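(* Let $n\ge1$, let $k\in\mathbb Z^+$, and let $\lambda$ be a partition (with $\lambda_1\le n$ in (2) and (4)). The Olshanski decompositions and the images under the projection $\boldsymbol\pi_{n,n+1}:\boldsymbol\zeta(n+1)\to\boldsymbol\zeta(n)$ of the following elements are: (1) $\mathbf{I}_k(n+1)=\mathbf{I}_k(n)\dotplus\mathbf{I}_k(n+1)^0$, where $\mathbf{I}_k(n+1)^0=\mathbf{I}_k(n+1)-\mathbf{I}_k(n)\in\mathbf{I}(n+1)^0$ and $\mathbf{I}_k(n)\in\boldsymbol\zeta(n)$; then $\boldsymbol\pi_{n,n+1}(\mathbf{I}_k(n+1))=\mathbf{I}_k(n)$. (2) $\mathbf{K}_\lambda(n+1)=\mathbf{K}_\lambda(n)\dotplus\mathbf{K}_\lambda(n+1)^0$, where $\mathbf{K}_\lambda(n+1)^0=\mathbf{K}_\lambda(n+1)-\mathbf{K}_\lambda(n)\in\mathbf{I}(n+1)^0$ and $\mathbf{K}_\lambda(n)\in\boldsymbol\zeta(n)$; then $\boldsymbol\pi_{n,n+1}(\mathbf{K}_\lambda(n+1))=\mathbf{K}_\lambda(n)$. (3) $\mathbf{J}_\lambda(n+1)=\mathbf{J}_\lambda(n)\dotplus\mathbf{J}_\lambda(n+1)^0$, where $\mathbf{J}_\lambda(n+1)^0=\mathbf{J}_\lambda(n+1)-\mathbf{J}_\lambda(n)\in\mathbf{I}(n+1)^0$ and $\mathbf{J}_\lambda(n)\in\boldsymbol\zeta(n)$; then $\boldsymbol\pi_{n,n+1}(\mathbf{J}_\lambda(n+1))=\mathbf{J}_\lambda(n)$.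 (4) $\mathbf{S}_\lambda(n+1)=\mathbf{S}_\lambda(n)\dotplus\mathbf{S}_\lambda(n+1)^0$, where $\mathbf{S}_\lambda(n+1)^0=\mathbf{S}_\lambda(n+1)-\mathbf{S}_\lambda(n)\in\mathbf{I}(n+1)^0$ and $\mathbf{S}_\lambda(n)\in\boldsymbol\zeta(n)$; then $\boldsymbol\pi_{n,n+1}(\mathbf{S}_\lambda(n+1))=\mathbf{S}_\lambda(n)$.
   Context: $\boldsymbol\zeta(n)$ is the center of $\mathbf{U}(gl(n))$, $gl(n)=gl(n,\mathbb C)$ with standard basis $e_{i,j}$; $\mathbf{U}(gl(n))\subset\mathbf{U}(gl(n+1))$ via $e_{i,j}\mapsto e_{i,j}$. Olshanski decomposition. Let $\mathbf{U}(gl(n+1))^0$ be the centralizer of $e_{n+1,n+1}$ in $\mathbf{U}(gl(n+1))$, $\mathbf{I}(n+1)$ the left ideal of $\mathbf{U}(gl(n+1))$ generated by $e_{i,n+1}$, $i=1,\dots,n+1$, and $\mathbf{I}(n+1)^0=\mathbf{I}(n+1)\cap\mathbf{U}(gl(n+1))^0$, a two-sided ideal of $\mathbf{U}(gl(n+1))^0$ (the ideal $\mathbf I(n+1)^0$, with no subscript, is not to be confused with the element $\mathbf{I}_k(n+1)^0$). One has $\mathbf{U}(gl(n+1))^0=\mathbf{U}(gl(n))\oplus\mathbf{I}(n+1)^0$, and every $\boldsymbol\varrho\in\boldsymbol\zeta(n+1)$ has a unique (Olshanski) decomposition $\boldsymbol\varrho=\boldsymbol\varrho'\dotplus\boldsymbol\varrho^0$,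 $\boldsymbol\varrho'\in\boldsymbol\zeta(n)$, $\boldsymbol\varrho^0\in\mathbf{I}(n+1)^0$. Projection $\boldsymbol\pi_{n,n+1}$. With $\mathbf{cdet}(A)=\sum_\sigma(-1)^{|\sigma|}a_{\sigma(1),1}\cdots a_{\sigma(k),k}$, put $\mathbf{H}_k(n)=\sum_{1\le i_1<\cdots<i_k\le n}\mathbf{cdet}[e_{i_a,i_b}+\delta_{ab}(k-a)]_{a,b=1,\dots,k}$; $\mathbf{H}_1(n),\dots,\mathbf{H}_n(n)$ are algebraically independent generators of $\boldsymbol\zeta(n)$ (Capelli). $\boldsymbol\pi_{n,n+1}$ is the algebra map with $\mathbf{H}_k(n+1)\mapsto\mathbf{H}_k(n)$ ($k\le n$), $\mathbf{H}_{n+1}(n+1)\mapsto0$. Virtual method (for each $n$). $gl(m_0|m_1+n)$ ($m_0,m_1$ sufficiently large) is the complex general linear Lie superalgebra with basis $e_{a,b}$, $a,b\in A_0\cup A_1\cup L$, $A_0=\{\alpha_1,\dots,\alpha_{m_0}\}$ (parity $0$), $A_1=\{\beta_1,\dots,\beta_{m_1}\}$ (parity $1$), $L=\{1,\dots,n\}$ (parity $1$), $|e_{a,b}|=|a|+|b|$, and $[e_{a,b},e_{c,d}]=\delta_{bc}e_{a,d}-(-1)^{(|a|+|b|)(|c|+|d|)}\delta_{ad}e_{c,b}$. Symbols in $A_0\cup A_1$ are virtual. $gl(n)$ is the subalgebra spanned by $e_{i,j}$, $i,j\in L$. A product $e_{a_M,b_M}\cdots e_{a_1,b_1}$ is irregular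 if there are $i\le M$ and a virtual symbol $\gamma$ with $\#\{j\le i: b_j=\gamma\}>\#\{j<i: a_j=\gamma\}$. Let $\mathbf{Irr}$ be the left ideal generated by irregular products. $Virt(m_0+m_1,n)=\mathbf{U}(gl(n))\oplus\mathbf{Irr}$ is a direct sum and a subalgebra of $\mathbf{U}(gl(m_0|m_1+n))$ in which $\mathbf{Irr}$ is a two-sided ideal; $\mathfrak p:Virt(m_0+m_1,n)\to\mathbf{U}(gl(n))$ is the projection with kernel $\mathbf{Irr}$. All monomials below lie in $Virt(m_0+m_1,n)$. For tableaux $S,T$ of the same shape, $e_{S,T}$ is the product of the $e_{s,t}$ with $s,t$ the entries of $S,T$ in the same cell, cells being read row by row, top to bottom and left to right. $C^*_\lambda$ (shape $\lambda$) has all entries of row $i$ equal to $\alpha_i$; $D^*_\lambda$ has all entries of column $j$ equal to $\beta_j$. $\widetilde\lambda$ is the conjugate partition and $H(\lambda)$ the product of the hook lengths of $\lambda$. Define the following elements (all central in $\mathbf{U}(gl(n))$), all equal to $1$ for $\lambda=\emptyset$ in the last three cases: - $\mathbf{I}_k(n)=\sum_{h_1+\cdots+h_n=k}\frac1{h_1!\cdots h_n!}\mathfrak p(e_{n,\beta}^{h_n}\cdots e_{1,\beta}^{h_1}e_{\beta,1}^{h_1}\cdots e_{\beta,n}^{h_n})$, any $\beta\in A_1$; - $\mathbf{K}_\lambda(n)=\sum_S\mathfrak p(e_{S,C^*_\lambda}e_{C^*_\lambda,S})$ ($\lambda_1\le n$), over tableaux $S$ of shape $\lambda$ on $\{1,\dots,n\}$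 with strictly increasing rows; - $\mathbf{J}_\lambda(n)=\sum_S\frac1{o_S}\mathfrak p(e_{S,D^*_{\widetilde\lambda}}e_{D^*_{\widetilde\lambda},S})$, over tableaux $S$ of shape $\widetilde\lambda$ on $\{1,\dots,n\}$ with weakly increasing columns, $o_S$ being the product over columns and symbols of the factorials of the multiplicities of the symbol in the column; - $\mathbf{S}_\lambda(n)=\frac1{H(\lambda)}\sum_S\mathfrak p(e_{S,C^*_\lambda}e_{C^*_\lambda,D^*_\lambda}e_{D^*_\lambda,C^*_\lambda}e_{C^*_\lambda,S})$ ($\lambda_1\le n$), over tableaux $S$ of shape $\lambda$ on $\{1,\dots,n\}$ with strictly increasing rows. *)

theory Defs
  imports
    Complex_Main
    "HOL-Library.Poly_Mapping"
    "HOL-Library.FuncSet"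
    "HOL-Combinatorics.Permutations"
    "HOL-Algebra.QuotRing"
begin

section \<open>Enveloping algebras of general linear Lie superalgebras\<close>

datatype gsym = Alpha nat | Beta nat | Proper nat

fun parity :: "gsym \<Rightarrow> nat" where
  "parity (Alpha _) = 0"
| "parity (Beta _) = 1"
| "parity (Proper _) = 1"

fun virtual :: "gsym \<Rightarrow> bool" where
  "virtual (Alpha _) = True"
| "virtual (Beta _) = True"
| "virtual (Proper _) = False"

definition proper_syms :: "nat \<Rightarrow> gsym set" where
  "proper_syms n = Proper ` {1..n}"

definition syms :: "nat \<Rightarrow> nat \<Rightarrow> nat \<Rightarrow> gsym set" where
  "syms m0 m1 n = Alpha ` {1..m0} \<union> Beta ` {1..m1} \<union> proper_syms n"

text \<open>
  The free associative algebra on letters \<open>(a, b)\<close>, which stand for \<open>e\<^bsub>a,b\<^esub>\<close>, is the monoid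
  algebra over \<open>\<complex>\<close> of the monoid of words, the latter written additively (with \<open>+\<close> for
  concatenation) as required by the product on finitely supported functions.
\<close>

datatype word = Word (letters: "(gsym \<times> gsym) list")

instantiation word :: monoid_add
begin

definition zero_word :: word where "0 = Word []"

definition plus_word :: "word \<Rightarrow> word \<Rightarrow> word" where
  "v + w = Word (letters v @ letters w)"

instance
  by standard (simp_all add: zero_word_def plus_word_def)

end

type_synonym falg = "word \<Rightarrow>\<^sub>0 complex"

definition monomial :: "(gsym \<times> gsym) list \<Rightarrow> falg" where
  "monomial ws = Poly_Mapping.single (Word ws) 1"

definition scalar :: "complex \<Rightarrow> falg" where
  "scalar c = Poly_Mapping.single (Word []) c"

abbreviation letter :: "gsym \<Rightarrow> gsym \<Rightarrow> falg" where
  "letter a b \<equiv> monomial [(a, b)]"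

definition free_alg :: "gsym set \<Rightarrow> falg ring" where
  "free_alg A =
     \<lparr>carrier = {x. \<forall>w \<in> Poly_Mapping.keys x. set (letters w) \<subseteq> A \<times> A},
      mult = (*), one = 1, zero = 0, add = (+)\<rparr>"

definition super_sign :: "gsym \<Rightarrow> gsym \<Rightarrow> gsym \<Rightarrow> gsym \<Rightarrow> falg" where
  "super_sign a b c d = (- 1) ^ ((parity a + parity b) * (parity c + parity d))"

text \<open>The superbracket of \<open>e\<^bsub>a,b\<^esub>\<close> and \<open>e\<^bsub>c,d\<^esub>\<close>.\<close>

definition gl_bracket :: "gsym \<Rightarrow> gsym \<Rightarrow> gsym \<Rightarrow> gsym \<Rightarrow> falg" where
  "gl_bracket a b c d =
     (if b = c then letter a d else 0)
     - super_sign a b c d * (if a = d then letter c b else 0)"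

definition relators :: "gsym set \<Rightarrow> falg set" where
  "relators A =
     {letter a b * letter c d - super_sign a b c d * (letter c d * letter a b) - gl_bracket a b c d
      | a b c d. a \<in> A \<and> b \<in> A \<and> c \<in> A \<and> d \<in> A}"

definition rel_ideal :: "gsym set \<Rightarrow> falg set" where
  "rel_ideal A = genideal (free_alg A) (relators A)"

text \<open>
  The enveloping algebra of the general linear Lie superalgebra with basis \<open>e\<^bsub>a,b\<^esub>\<close>,
  \<open>a, b \<in> A\<close>. Its elements are cosets; \<open>cls A x\<close> is the coset of \<open>x\<close>, so that
  \<open>cls A (monomial [(a1, b1), \<dots>, (ak, bk)])\<close> is the product \<open>e\<^bsub>a1,b1\<^esub> \<cdots> e\<^bsub>ak,bk\<^esub>\<close>.
\<close>

definition UE :: "gsym set \<Rightarrow> falg set ring" where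
  "UE A = free_alg A Quot rel_ideal A"

definition cls :: "gsym set \<Rightarrow> falg \<Rightarrow> falg set" where
  "cls A x = rel_ideal A +>\<^bsub>free_alg A\<^esub> x"

text \<open>
  For \<open>A \<subseteq> B\<close> the map \<open>UE A \<rightarrow> UE B\<close> induced by \<open>e\<^bsub>a,b\<^esub> \<mapsto> e\<^bsub>a,b\<^esub>\<close>: the classes in \<open>UE B\<close> of
  the representatives of a coset all coincide, hence their union is that class.
\<close>

definition incl :: "gsym set \<Rightarrow> falg set \<Rightarrow> falg set" where
  "incl B X = (\<Union>x\<in>X. cls B x)"

abbreviation Ugl :: "nat \<Rightarrow> falg set ring" where
  "Ugl n \<equiv> UE (proper_syms n)"

abbreviation Usuper :: "nat \<Rightarrow> nat \<Rightarrow> nat \<Rightarrow> falg set ring" where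
  "Usuper m0 m1 n \<equiv> UE (syms m0 m1 n)"

definition left_ideal :: "'a set \<Rightarrow> ('a, 'b) ring_scheme \<Rightarrow> bool" where
  "left_ideal I R \<longleftrightarrow>
     additive_subgroup I R \<and> (\<forall>x\<in>carrier R. \<forall>a\<in>I. x \<otimes>\<^bsub>R\<^esub> a \<in> I)"

definition gen_left_ideal :: "('a, 'b) ring_scheme \<Rightarrow> 'a set \<Rightarrow> 'a set" where
  "gen_left_ideal R S = \<Inter>{I. left_ideal I R \<and> S \<subseteq> I}"

definition centralizer :: "('a, 'b) ring_scheme \<Rightarrow> 'a set \<Rightarrow> 'a set" where
  "centralizer R S = {x \<in> carrier R. \<forall>y\<in>S. x \<otimes>\<^bsub>R\<^esub> y = y \<otimes>\<^bsub>R\<^esub> x}"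


section \<open>The center, the Olshanski decomposition and the Capelli projection\<close>

definition zeta :: "nat \<Rightarrow> falg set set" where
  "zeta n = centralizer (Ugl n) (carrier (Ugl n))"

definition zeta_ring :: "nat \<Rightarrow> falg set ring" where
  "zeta_ring n = (Ugl n)\<lparr>carrier := zeta n\<rparr>"

definition U0 :: "nat \<Rightarrow> falg set set" where
  "U0 n = centralizer (Ugl n) {cls (proper_syms n) (letter (Proper n) (Proper n))}"

definition I_ideal :: "nat \<Rightarrow> falg set set" where
  "I_ideal n = gen_left_ideal (Ugl n)
     ((\<lambda>i. cls (proper_syms n) (letter (Proper i) (Proper n))) ` {1..n})"

definition I0_ideal :: "nat \<Rightarrow> falg set set" where
  "I0_ideal n = I_ideal n \<inter> U0 n"

text \<open>\<open>\<rho> = \<rho>' \<dotplus> \<rho>0\<close> for \<open>\<rho>\<close> in the center of \<open>Ugl (n + 1)\<close>.\<close>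

definition olshanski :: "nat \<Rightarrow> falg set \<Rightarrow> falg set \<Rightarrow> falg set \<Rightarrow> bool" where
  "olshanski n \<rho> \<rho>' \<rho>0 \<longleftrightarrow>
     \<rho> \<in> zeta (n + 1) \<and> \<rho>' \<in> zeta n \<and> \<rho>0 \<in> I0_ideal (n + 1) \<and>
     \<rho> = incl (proper_syms (n + 1)) \<rho>' \<oplus>\<^bsub>Ugl (n + 1)\<^esub> \<rho>0"

definition cdet :: "nat \<Rightarrow> (nat \<Rightarrow> nat \<Rightarrow> 'a::ring_1) \<Rightarrow> 'a" where
  "cdet k a = (\<Sum>\<sigma> | \<sigma> permutes {1..k}.
     of_int (sign \<sigma>) * prod_list (map (\<lambda>j. a (\<sigma> j) j) [1..<k+1]))"

text \<open>
  \<open>i\<^sub>1 < \<dots> < i\<^sub>k\<close> are the elements of \<open>J\<close>; list positions start at 0.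
\<close>

definition H_gen :: "nat \<Rightarrow> nat \<Rightarrow> falg set" where
  "H_gen n k = cls (proper_syms n)
     (\<Sum>J | J \<subseteq> {1..n} \<and> card J = k.
        cdet k (\<lambda>a b. letter (Proper (sorted_list_of_set J ! (a - 1)))
                              (Proper (sorted_list_of_set J ! (b - 1)))
                       + (if a = b then of_nat (k - a) else 0)))"

definition capelli_proj :: "nat \<Rightarrow> falg set \<Rightarrow> falg set" where
  "capelli_proj n = (THE f.
     f \<in> extensional (zeta (n + 1)) \<and>
     f \<in> ring_hom (zeta_ring (n + 1)) (zeta_ring n) \<and>
     (\<forall>c. f (cls (proper_syms (n + 1)) (scalar c)) = cls (proper_syms n) (scalar c)) \<and>
     (\<forall>k\<in>{1..n}. f (H_gen (n + 1) k) = H_gen n k) \<and>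
     f (H_gen (n + 1) (n + 1)) = \<zero>\<^bsub>Ugl n\<^esub>)"


section \<open>The virtual method\<close>

text \<open>
  In \<open>e\<^bsub>aM,bM\<^esub> \<cdots> e\<^bsub>a1,b1\<^esub>\<close> the letters are numbered from the right, hence the reversal.
\<close>

definition irregular :: "(gsym \<times> gsym) list \<Rightarrow> bool" where
  "irregular ws \<longleftrightarrow>
     (\<exists>\<gamma>. virtual \<gamma> \<and>
       (\<exists>i\<in>{1..length ws}.
          count_list (map snd (take i (rev ws))) \<gamma>
          > count_list (map fst (take (i - 1) (rev ws))) \<gamma>))"

definition Irr :: "nat \<Rightarrow> nat \<Rightarrow> nat \<Rightarrow> falg set set" where
  "Irr m0 m1 n = gen_left_ideal (Usuper m0 m1 n)
     {cls (syms m0 m1 n) (monomial ws) | ws.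
        set ws \<subseteq> syms m0 m1 n \<times> syms m0 m1 n \<and> irregular ws}"

text \<open>
  The projection onto \<open>Ugl n\<close> along \<open>Irr\<close>, meaningful on the sum of \<open>Ugl n\<close> and \<open>Irr\<close>.
\<close>

definition devirt :: "nat \<Rightarrow> nat \<Rightarrow> nat \<Rightarrow> falg set \<Rightarrow> falg set" where
  "devirt m0 m1 n X = (THE u. u \<in> carrier (Ugl n) \<and>
     X \<ominus>\<^bsub>Usuper m0 m1 n\<^esub> incl (syms m0 m1 n) u \<in> Irr m0 m1 n)"

definition devirt_mon :: "nat \<Rightarrow> nat \<Rightarrow> nat \<Rightarrow> (gsym \<times> gsym) list \<Rightarrow> falg set" where
  "devirt_mon m0 m1 n ws = devirt m0 m1 n (cls (syms m0 m1 n) (monomial ws))"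

definition smult_gl :: "nat \<Rightarrow> complex \<Rightarrow> falg set \<Rightarrow> falg set" where
  "smult_gl n c u = cls (proper_syms n) (scalar c) \<otimes>\<^bsub>Ugl n\<^esub> u"


section \<open>Partitions and tableaux\<close>

text \<open>
  A partition is the list of its nonzero parts; a tableau is the list of its rows.
\<close>

definition is_partition :: "nat list \<Rightarrow> bool" where
  "is_partition lam \<longleftrightarrow> sorted_wrt (\<ge>) lam \<and> 0 \<notin> set lam"

definition first_part :: "nat list \<Rightarrow> nat" where
  "first_part lam = (if lam = [] then 0 else hd lam)"

definition conj_part :: "nat list \<Rightarrow> nat list" where
  "conj_part lam = map (\<lambda>j. length (filter (\<lambda>l. j < l) lam)) [0..<first_part lam]"

text \<open>
  With indices from 0, the cell \<open>(i, j)\<close> has arm \<open>lam ! i - Suc j\<close> and leg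
  \<open>conj_part lam ! j - Suc i\<close>.
\<close>

definition hook_prod :: "nat list \<Rightarrow> nat" where
  "hook_prod lam = (\<Prod>i<length lam. \<Prod>j<lam ! i.
     (lam ! i - Suc j) + (conj_part lam ! j - Suc i) + 1)"

definition shape :: "'a list list \<Rightarrow> nat list" where
  "shape S = map length S"

definition column :: "'a list list \<Rightarrow> nat \<Rightarrow> 'a list" where
  "column S j = map (\<lambda>r. r ! j) (filter (\<lambda>r. j < length r) S)"

definition row_strict_tableaux :: "nat \<Rightarrow> nat list \<Rightarrow> nat list list set" where
  "row_strict_tableaux n lam =
     {S. shape S = lam \<and> (\<forall>r\<in>set S. set r \<subseteq> {1..n} \<and> sorted_wrt (<) r)}"

definition col_weak_tableaux :: "nat \<Rightarrow> nat list \<Rightarrow> nat list list set" where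
  "col_weak_tableaux n lam =
     {S. shape S = lam \<and> (\<forall>r\<in>set S. set r \<subseteq> {1..n}) \<and>
         (\<forall>j<first_part lam. sorted_wrt (\<le>) (column S j))}"

definition col_mult_fact :: "nat \<Rightarrow> nat list list \<Rightarrow> nat" where
  "col_mult_fact n S =
     (\<Prod>j<first_part (shape S). \<Prod>s=1..n. fact (count_list (column S j) s))"

definition proper_tab :: "nat list list \<Rightarrow> gsym list list" where
  "proper_tab S = map (map Proper) S"

definition C_star :: "nat list \<Rightarrow> gsym list list" where
  "C_star lam = map (\<lambda>i. replicate (lam ! i) (Alpha (Suc i))) [0..<length lam]"

definition D_star :: "nat list \<Rightarrow> gsym list list" where
  "D_star lam = map (\<lambda>l. map Beta [1..<l+1]) lam"

definition tab_word :: "gsym list list \<Rightarrow> gsym list list \<Rightarrow> (gsym \<times> gsym) list" where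
  "tab_word S T = zip (concat S) (concat T)"


section \<open>The central elements\<close>

text \<open>
  In each case \<open>m0\<close> and \<open>m1\<close> are the numbers of even and odd virtual symbols available.
\<close>

definition I_elem :: "nat \<Rightarrow> nat \<Rightarrow> nat \<Rightarrow> nat \<Rightarrow> nat \<Rightarrow> falg set" where
  "I_elem m0 m1 b n k =
     (\<Oplus>\<^bsub>Ugl n\<^esub> h \<in> {h \<in> {1..n} \<rightarrow>\<^sub>E UNIV. (\<Sum>i=1..n. h i) = k}.
        smult_gl n (1 / (\<Prod>i=1..n. fact (h i)))
          (devirt_mon m0 m1 n
             (concat (map (\<lambda>i. replicate (h i) (Proper i, Beta b)) (rev [1..<n+1])) @
              concat (map (\<lambda>i. replicate (h i) (Beta b, Proper i)) [1..<n+1]))))"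

definition K_elem :: "nat \<Rightarrow> nat \<Rightarrow> nat \<Rightarrow> nat list \<Rightarrow> falg set" where
  "K_elem m0 m1 n lam =
     (\<Oplus>\<^bsub>Ugl n\<^esub> S \<in> row_strict_tableaux n lam.
        devirt_mon m0 m1 n
          (tab_word (proper_tab S) (C_star lam) @ tab_word (C_star lam) (proper_tab S)))"

definition J_elem :: "nat \<Rightarrow> nat \<Rightarrow> nat \<Rightarrow> nat list \<Rightarrow> falg set" where
  "J_elem m0 m1 n lam =
     (\<Oplus>\<^bsub>Ugl n\<^esub> S \<in> col_weak_tableaux n (conj_part lam).
        smult_gl n (1 / of_nat (col_mult_fact n S))
          (devirt_mon m0 m1 n
             (tab_word (proper_tab S) (D_star (conj_part lam)) @
              tab_word (D_star (conj_part lam)) (proper_tab S))))"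

definition S_elem :: "nat \<Rightarrow> nat \<Rightarrow> nat \<Rightarrow> nat list \<Rightarrow> falg set" where
  "S_elem m0 m1 n lam =
     smult_gl n (1 / of_nat (hook_prod lam))
       (\<Oplus>\<^bsub>Ugl n\<^esub> S \<in> row_strict_tableaux n lam.
          devirt_mon m0 m1 n
            (tab_word (proper_tab S) (C_star lam) @ tab_word (C_star lam) (D_star lam) @
             tab_word (D_star lam) (C_star lam) @ tab_word (C_star lam) (proper_tab S)))"

text \<open>The complement \<open>\<rho> - \<rho>'\<close> of \<open>\<rho>' \<in> Ugl n\<close> in \<open>\<rho> \<in> Ugl (n + 1)\<close>.\<close>

definition gl_diff :: "nat \<Rightarrow> falg set \<Rightarrow> falg set \<Rightarrow> falg set" where
  "gl_diff n \<rho> \<rho>' = \<rho> \<ominus>\<^bsub>Ugl (n + 1)\<^esub> incl (proper_syms (n + 1)) \<rho>'"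

end

theory Submission
  imports Defs "HOL-Combinatorics.Multiset_Permutations"
begin

text \<open>
  Up to a scalar, each of the four elements is the image of a sum, over all fillings of a sequence of
  virtual symbols by \<open>1, \<dots>, n\<close>, of words \<open>e\<^bsub>s1,v1\<^esub> \<cdots> e\<^bsub>sL,vL\<^esub> X e\<^bsub>v1,s1\<^esub> \<cdots> e\<^bsub>vL,sL\<^esub>\<close> in
  which only virtual symbols occur in \<open>X\<close>; restricting the fillings to tableaux merely collects equal
  terms. Such a sum commutes with \<open>gl(n)\<close>, so its image is central. The fillings for \<open>n + 1\<close> that
  use \<open>n + 1\<close> may be reordered so that \<open>n + 1\<close> comes last, and moving the letters with
  virtual second index to the right shows that they contribute to the left ideal generated by the
  \<open>e\<^bsub>i,n+1\<^esub>\<close>; this is the Olshanski decomposition.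

  The Capelli elements are themselves of this form, so the Olshanski projection maps
  \<open>H\<^sub>k(n+1)\<close> to \<open>H\<^sub>k(n)\<close>. It therefore coincides with the Capelli projection as soon as the center is
  generated by the Capelli elements. This holds because the principal symbol of a central element is
  an invariant polynomial, determined by its restriction to the slice of companion matrices, where
  the symbols of the Capelli elements are the coordinates. The facts that need linear
  independence in the enveloping algebra are derived from a faithful module, which avoids the
  Poincare-Birkhoff-Witt theorem.
\<close>

section \<open>Free algebras and their quotients\<close>

text \<open>Two definite descriptions shape the proof. \<open>devirt\<close> is meaningful only if
  the enveloping algebra of gl(n) meets \<open>Irr\<close> in zero, and \<open>capelli_proj\<close>
  only if its conditions determine exactly one map on the center. For the latter, the Olshanski
  projection supplies existence, and generation by the Capelli elements supplies uniqueness as well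
  as the decomposition of every central element.

  All directness statements come from one family of vectors of the module, the tensor powers of
  \<open>None\<close>. An element of U(gl(n)) that kills all of them is zero, because d letters
  applied to d copies of \<open>None\<close> can leave their commutative product behind as matrix
  units. Irregular words kill them, because they destroy virtual symbols that have not been created.
  The letters e_{i,n+1} kill them when column n+1 is left out of the module. Relabelling virtual
  symbols fixes them, so the elements for n and for n+1 may be computed with different virtual
  symbols.

  Congruences are handled on representatives in the free algebra, where degrees and coefficients of
  words are explicit.\<close>

lemma monomial_append: "monomial (u @ v) = monomial u * monomial v"
  by (simp add: monomial_def mult_single plus_word_def)

lemma monomial_Cons: "monomial (l # v) = monomial [l] * monomial v"
  using monomial_append[of "[l]" v] by simp

lemma monomial_Nil: "monomial [] = 1"
  by (simp add: monomial_def zero_word_def [symmetric])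

lemma scalar_mult: "scalar a * scalar b = scalar (a * b)"
  by (simp add: scalar_def mult_single plus_word_def)

lemma scalar_add: "scalar a + scalar b = scalar (a + b)"
  by (simp add: scalar_def single_add)

lemma scalar_0 [simp]: "scalar 0 = 0"
  by (simp add: scalar_def)

lemma scalar_1 [simp]: "scalar 1 = 1"
  by (simp add: scalar_def zero_word_def [symmetric])

lemma scalar_uminus: "scalar (- c) = - scalar c"
  by (simp add: scalar_def single_uminus)

lemma scalar_of_int: "scalar (of_int i) = of_int i"
  by (simp add: scalar_def zero_word_def [symmetric])

lemma scalar_of_nat: "scalar (of_nat i) = of_nat i"
  by (simp add: scalar_def zero_word_def [symmetric])

lemma scalar_times_monomial: "scalar c * monomial w = Poly_Mapping.single (Word w) c"
  by (simp add: scalar_def monomial_def mult_single plus_word_def)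

lemma falg_expand:
  fixes x :: falg
  shows "x = (\<Sum>w\<in>Poly_Mapping.keys x. scalar (Poly_Mapping.lookup x w) * monomial (letters w))"
proof (rule poly_mapping_eqI)
  fix k
  have "Poly_Mapping.lookup (\<Sum>w\<in>Poly_Mapping.keys x. scalar (Poly_Mapping.lookup x w) * monomial (letters w)) k
     = (\<Sum>w\<in>Poly_Mapping.keys x. if w = k then Poly_Mapping.lookup x w else 0)"
    by (simp add: lookup_sum scalar_times_monomial lookup_single when_def)
  also have "\<dots> = Poly_Mapping.lookup x k"
    by (simp add: in_keys_iff)
  finally show "Poly_Mapping.lookup x k = Poly_Mapping.lookup (\<Sum>w\<in>Poly_Mapping.keys x. scalar (Poly_Mapping.lookup x w) * monomial (letters w)) k"
    by simp
qed

lemma scalar_commute: "scalar c * x = x * scalar c"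
proof -
  have *: "scalar c * (scalar a * monomial w) = (scalar a * monomial w) * scalar c" for a w
    by (simp only: scalar_times_monomial) (simp add: scalar_def mult_single plus_word_def mult.commute)
  show ?thesis
    by (subst (1 2) falg_expand [of x]) (simp only: sum_distrib_left sum_distrib_right *)
qed

section \<open>Elements of the free algebra supported on a given alphabet\<close>

abbreviation fcar :: "gsym set \<Rightarrow> falg set" where
  "fcar A \<equiv> carrier (free_alg A)"

lemma fcar_iff: "x \<in> fcar A \<longleftrightarrow> (\<forall>w\<in>Poly_Mapping.keys x. set (letters w) \<subseteq> A \<times> A)"
  by (simp add: free_alg_def)

lemma fcar_0 [simp]: "0 \<in> fcar A"
  by (simp add: fcar_iff)

lemma fcar_add [intro]: "x \<in> fcar A \<Longrightarrow> y \<in> fcar A \<Longrightarrow> x + y \<in> fcar A"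
  using keys_add [of x y] by (fastforce simp: fcar_iff)

lemma fcar_mult [intro]:
  assumes "x \<in> fcar A" "y \<in> fcar A" shows "x * y \<in> fcar A"
  unfolding fcar_iff
proof
  fix w assume "w \<in> Poly_Mapping.keys (x * y)"
  then obtain u v where "w = u + v" "u \<in> Poly_Mapping.keys x" "v \<in> Poly_Mapping.keys y"
    using keys_mult [of x y] by blast
  with assms show "set (letters w) \<subseteq> A \<times> A"
    by (auto simp: fcar_iff plus_word_def)
qed

lemma fcar_scalar [simp]: "scalar c \<in> fcar A"
  by (simp add: fcar_iff scalar_def)

lemma fcar_1 [simp]: "1 \<in> fcar A"
  by (metis fcar_scalar scalar_1)

lemma fcar_monomial_iff [simp]: "monomial w \<in> fcar A \<longleftrightarrow> set w \<subseteq> A \<times> A"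
  by (simp add: fcar_iff monomial_def)

lemma fcar_uminus_iff [simp]: "- x \<in> fcar A \<longleftrightarrow> x \<in> fcar A"
  by (simp add: fcar_iff in_keys_iff)

lemma fcar_diff [intro]: "x \<in> fcar A \<Longrightarrow> y \<in> fcar A \<Longrightarrow> x - y \<in> fcar A"
  using fcar_add [of x A "- y"] by simp

lemma fcar_sum [intro]: "(\<And>i. i \<in> I \<Longrightarrow> f i \<in> fcar A) \<Longrightarrow> sum f I \<in> fcar A"
  by (induction I rule: infinite_finite_induct) auto

lemma fcar_of_int [simp]: "of_int i \<in> fcar A"
  by (metis fcar_scalar scalar_of_int)

lemma fcar_of_nat [simp]: "of_nat i \<in> fcar A"
  by (metis fcar_scalar scalar_of_nat)

lemma fcar_mono: "A \<subseteq> B \<Longrightarrow> x \<in> fcar A \<Longrightarrow> x \<in> fcar B"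
  by (fastforce simp: fcar_iff)

lemma fcar_prod_list [intro]: "(\<And>x. x \<in> set xs \<Longrightarrow> x \<in> fcar A) \<Longrightarrow> prod_list xs \<in> fcar A"
  by (induction xs) auto

lemma super_sign_scalar:
  "super_sign a b c d = scalar ((- 1) ^ ((parity a + parity b) * (parity c + parity d)))"
proof -
  have "scalar ((- 1) ^ k) = (- 1) ^ k" for k
    by (induction k) (simp_all add: scalar_uminus flip: scalar_mult)
  then show ?thesis by (simp add: super_sign_def)
qed

lemma fcar_super_sign [simp]: "super_sign a b c d \<in> fcar A"
  by (simp add: super_sign_scalar)

lemma fcar_gl_bracket [intro]: "{a,b,c,d} \<subseteq> A \<Longrightarrow> gl_bracket a b c d \<in> fcar A"
  unfolding gl_bracket_def by (intro fcar_diff fcar_mult fcar_super_sign) (auto)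

lemma fcar_induct [consumes 1, case_names zero add monomial]:
  assumes "x \<in> fcar A"
    and "P 0"
    and "\<And>x y. x \<in> fcar A \<Longrightarrow> y \<in> fcar A \<Longrightarrow> P x \<Longrightarrow> P y \<Longrightarrow> P (x + y)"
    and "\<And>c w. set w \<subseteq> A \<times> A \<Longrightarrow> P (scalar c * monomial w)"
  shows "P x"
proof -
  have "I \<subseteq> Poly_Mapping.keys x \<Longrightarrow>
    P (\<Sum>w\<in>I. scalar (Poly_Mapping.lookup x w) * monomial (letters w))" for I
  proof (induction I rule: infinite_finite_induct)
    case (insert w I)
    have "set (letters v) \<subseteq> A \<times> A" if "v \<in> insert w I" for v
      using insert.prems that assms(1) unfolding fcar_iff by blast
    with insert show ?case
      by (auto intro!: assms fcar_sum fcar_mult)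
  qed (use assms in auto)
  from this [OF subset_refl] show ?thesis
    by (simp add: falg_expand [symmetric])
qed

lemma free_alg_simps [simp]:
  "x \<otimes>\<^bsub>free_alg A\<^esub> y = x * y" "x \<oplus>\<^bsub>free_alg A\<^esub> y = x + y"
  "\<zero>\<^bsub>free_alg A\<^esub> = 0" "\<one>\<^bsub>free_alg A\<^esub> = 1"
  by (simp_all add: free_alg_def)

lemma ring_free_alg: "ring (free_alg A)"
proof (intro ringI abelian_groupI monoidI)
  fix x assume "x \<in> fcar A"
  then show "\<exists>y\<in>fcar A. y \<oplus>\<^bsub>free_alg A\<^esub> x = \<zero>\<^bsub>free_alg A\<^esub>"
    by (intro bexI [of _ "- x"]) simp_all
qed (simp_all add: fcar_add fcar_mult algebra_simps)

interpretation free_alg: ring "free_alg A" for A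
  by (rule ring_free_alg)

section \<open>The ideal of relations\<close>

abbreviation RI :: "gsym set \<Rightarrow> falg set" where
  "RI A \<equiv> rel_ideal A"

lemma relators_carrier: "relators A \<subseteq> fcar A"
  unfolding relators_def by (force intro!: fcar_diff fcar_mult fcar_gl_bracket)

lemma ideal_rel_ideal: "ideal (RI A) (free_alg A)"
  unfolding rel_ideal_def by (rule free_alg.genideal_ideal [OF relators_carrier])

lemma rel_ideal_carrier: "x \<in> RI A \<Longrightarrow> x \<in> fcar A"
  by (rule ideal.Icarr [OF ideal_rel_ideal])

lemma rel_ideal_lmult: "x \<in> fcar A \<Longrightarrow> r \<in> RI A \<Longrightarrow> x * r \<in> RI A"
  using ideal.I_l_closed [OF ideal_rel_ideal, of r A x] by simp

lemma rel_ideal_rmult: "x \<in> fcar A \<Longrightarrow> r \<in> RI A \<Longrightarrow> r * x \<in> RI A"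
  using ideal.I_r_closed [OF ideal_rel_ideal, of r A x] by simp

lemma rel_ideal_add: "x \<in> RI A \<Longrightarrow> y \<in> RI A \<Longrightarrow> x + y \<in> RI A"
  using additive_subgroup.a_closed [OF ideal.axioms(1) [OF ideal_rel_ideal], of x A y] by simp

lemma rel_ideal_0 [simp]: "0 \<in> RI A"
  using additive_subgroup.zero_closed [OF ideal.axioms(1) [OF ideal_rel_ideal], of A] by simp

lemma relator_in_rel_ideal:
  assumes "a \<in> A" "b \<in> A" "c \<in> A" "d \<in> A"
  shows "letter a b * letter c d - super_sign a b c d * (letter c d * letter a b)
           - gl_bracket a b c d \<in> RI A"
proof -
  have "letter a b * letter c d - super_sign a b c d * (letter c d * letter a b)
           - gl_bracket a b c d \<in> relators A"
    unfolding relators_def using assms by blast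
  then show ?thesis
    using free_alg.genideal_self [OF relators_carrier, of A] unfolding rel_ideal_def by blast
qed

text \<open>The elements with property \<open>P\<close> form a two-sided ideal containing the
  relators, hence containing the ideal they generate. Closure under negation is multiplication by
  the scalar -1.\<close>

lemma rel_ideal_induct [consumes 1, case_names zero relator add lmult rmult]:
  assumes "r \<in> RI A"
    and P0: "P 0"
    and "\<And>a b c d. {a,b,c,d} \<subseteq> A \<Longrightarrow>
      P (letter a b * letter c d - super_sign a b c d * (letter c d * letter a b) - gl_bracket a b c d)"
    and "\<And>x y. x \<in> fcar A \<Longrightarrow> y \<in> fcar A \<Longrightarrow> P x \<Longrightarrow> P y \<Longrightarrow> P (x + y)"
    and "\<And>x y. x \<in> fcar A \<Longrightarrow> y \<in> fcar A \<Longrightarrow> P y \<Longrightarrow> P (x * y)"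
    and "\<And>x y. x \<in> fcar A \<Longrightarrow> y \<in> fcar A \<Longrightarrow> P y \<Longrightarrow> P (y * x)"
  shows "P r"
proof -
  define K where "K = {x \<in> fcar A. P x}"
  have "ideal K (free_alg A)"
  proof (rule idealI)
    show "ring (free_alg A)" by (rule ring_free_alg)
    show "subgroup K (add_monoid (free_alg A))"
    proof (rule group.subgroupI)
      show "group (add_monoid (free_alg A))"
        by (rule free_alg.a_group)
      fix x assume "x \<in> K"
      then have x: "x \<in> fcar A" "P x" by (auto simp: K_def)
      have "P (- x)"
        using assms(5) [OF fcar_scalar [of "- 1"] x] by (simp add: scalar_uminus)
      moreover have "\<ominus>\<^bsub>free_alg A\<^esub> x = - x"
        using x by (intro free_alg.minus_equality) simp_all
      ultimately show "inv\<^bsub>add_monoid (free_alg A)\<^esub> x \<in> K"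
        using x unfolding a_inv_def by (simp add: K_def)
      fix y assume "y \<in> K"
      with x show "x \<otimes>\<^bsub>add_monoid (free_alg A)\<^esub> y \<in> K"
        using assms(4) [of x y] fcar_add [of x A y] by (simp add: K_def)
    next
      show "K \<noteq> {}" using P0 fcar_0 K_def by blast
    qed (simp add: K_def subsetI)
  next
    fix a x assume "a \<in> K" "x \<in> fcar A"
    then show "x \<otimes>\<^bsub>free_alg A\<^esub> a \<in> K" "a \<otimes>\<^bsub>free_alg A\<^esub> x \<in> K"
      using assms(5,6) [of x a] fcar_mult by (simp_all add: K_def)
  qed
  moreover have "relators A \<subseteq> K"
    proof
    fix x assume "x \<in> relators A"
    then obtain a b c d where "{a, b, c, d} \<subseteq> A"
      "x = letter a b * letter c d - super_sign a b c d * (letter c d * letter a b) - gl_bracket a b c d"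
      by (auto simp: relators_def)
    with \<open>x \<in> relators A\<close> show "x \<in> K"
      using relators_carrier [of A] assms(3) [of a b c d] by (auto simp: K_def)
  qed
  ultimately have "RI A \<subseteq> K"
    unfolding rel_ideal_def by (rule free_alg.genideal_minimal)
  with assms(1) show ?thesis by (auto simp: K_def)
qed

lemma rel_ideal_uminus: "x \<in> RI A \<Longrightarrow> - x \<in> RI A"
  using rel_ideal_lmult [OF fcar_scalar [of "- 1"]] by (simp add: scalar_uminus)

lemma rel_ideal_diff: "x \<in> RI A \<Longrightarrow> y \<in> RI A \<Longrightarrow> x - y \<in> RI A"
  using rel_ideal_add [OF _ rel_ideal_uminus, of x A y] by simp

lemma rel_ideal_sum: "(\<And>i. i \<in> I \<Longrightarrow> f i \<in> RI A) \<Longrightarrow> sum f I \<in> RI A"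
  by (induction I rule: infinite_finite_induct) (auto intro: rel_ideal_add)

lemma rel_ideal_mono:
  assumes "A \<subseteq> B" "x \<in> RI A" shows "x \<in> RI B"
  using assms(2)
proof (induction rule: rel_ideal_induct)
  case (relator a b c d)
  with assms(1) show ?case by (intro relator_in_rel_ideal) auto
qed (use assms(1) in \<open>auto intro: rel_ideal_add rel_ideal_lmult rel_ideal_rmult fcar_mono\<close>)

section \<open>Enveloping algebras through representatives\<close>

lemma cls_alt: "cls A x = (\<lambda>r. r + x) ` RI A"
  by (auto simp: cls_def a_r_coset_def')

lemma cls_eq_iff: "cls A x = cls A y \<longleftrightarrow> x - y \<in> RI A"
proof
  assume "cls A x = cls A y"
  moreover have "x \<in> cls A x" unfolding cls_alt by (auto intro!: image_eqI [of _ _ 0])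
  ultimately show "x - y \<in> RI A" by (auto simp: cls_alt)
next
  assume *: "x - y \<in> RI A"
  have "cls A x \<subseteq> cls A y" if "x - y \<in> RI A" for x y
  proof
    fix z assume "z \<in> cls A x"
    then obtain r where "r \<in> RI A" "z = r + x" by (auto simp: cls_alt)
    with that show "z \<in> cls A y"
      unfolding cls_alt by (intro image_eqI [of _ _ "r + (x - y)"]) (auto intro: rel_ideal_add)
  qed
  from this [OF *] this [of y x] show "cls A x = cls A y"
    using rel_ideal_uminus [OF *] by auto
qed

lemma UE_simps:
  "carrier (UE A) = cls A ` fcar A"
  "\<zero>\<^bsub>UE A\<^esub> = cls A 0"
  "\<one>\<^bsub>UE A\<^esub> = cls A 1"
  "x \<in> fcar A \<Longrightarrow> y \<in> fcar A \<Longrightarrow> cls A x \<oplus>\<^bsub>UE A\<^esub> cls A y = cls A (x + y)"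
  "x \<in> fcar A \<Longrightarrow> y \<in> fcar A \<Longrightarrow> cls A x \<otimes>\<^bsub>UE A\<^esub> cls A y = cls A (x * y)"
proof -
  show "carrier (UE A) = cls A ` fcar A"
    by (auto simp: UE_def FactRing_def A_RCOSETS_def' cls_def)
  show "\<zero>\<^bsub>UE A\<^esub> = cls A 0"
    by (simp add: UE_def FactRing_def cls_alt)
  show "\<one>\<^bsub>UE A\<^esub> = cls A 1"
    by (simp add: UE_def FactRing_def cls_def)
  assume *: "x \<in> fcar A" "y \<in> fcar A"
  show "cls A x \<oplus>\<^bsub>UE A\<^esub> cls A y = cls A (x + y)"
    using abelian_subgroup.a_rcos_sum [OF ideal.axioms(1) [OF ideal_rel_ideal, THEN abelian_subgroupI3] * ]
    by (simp add: UE_def FactRing_def cls_def free_alg.is_abelian_group)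
  show "cls A x \<otimes>\<^bsub>UE A\<^esub> cls A y = cls A (x * y)"
    using ideal.rcoset_mult_add [OF ideal_rel_ideal * ]
    by (simp add: UE_def FactRing_def cls_def)
qed

lemma ring_UE: "ring (UE A)"
  unfolding UE_def by (rule ideal.quotient_is_ring [OF ideal_rel_ideal])

interpretation UE: ring "UE A" for A
  by (rule ring_UE)

lemma UE_uminus: "x \<in> fcar A \<Longrightarrow> \<ominus>\<^bsub>UE A\<^esub> cls A x = cls A (- x)"
  by (intro UE.minus_equality) (auto simp: UE_simps)

lemma UE_minus: "x \<in> fcar A \<Longrightarrow> y \<in> fcar A \<Longrightarrow> cls A x \<ominus>\<^bsub>UE A\<^esub> cls A y = cls A (x - y)"
  by (simp add: a_minus_def UE_uminus UE_simps)

lemma UE_finsum: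
  assumes "finite S" "\<And>i. i \<in> S \<Longrightarrow> f i \<in> fcar A" "\<And>i. i \<in> S \<Longrightarrow> g i = cls A (f i)"
  shows "finsum (UE A) g S = cls A (sum f S)"
  using assms
proof (induction S rule: finite_induct)
  case (insert i S)
  have "finsum (UE A) g (insert i S) = g i \<oplus>\<^bsub>UE A\<^esub> finsum (UE A) g S"
    using insert by (intro UE.finsum_insert) (auto simp: UE_simps)
  with insert show ?case by (simp add: UE_simps fcar_sum)
qed (simp add: UE_simps)

lemma incl_cls:
  assumes "A \<subseteq> B" shows "incl B (cls A x) = cls B x"
proof -
  have "cls B y = cls B x" if "y \<in> cls A x" for y
    using that rel_ideal_mono [OF assms] unfolding cls_eq_iff by (auto simp: cls_alt)
  moreover have "x \<in> cls A x"
    unfolding cls_alt by (auto intro!: image_eqI [of _ _ 0])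
  ultimately show ?thesis unfolding incl_def by blast
qed

text \<open>The preimage in the free algebra of a left ideal of \<open>UE A\<close>.\<close>

inductive_set LG :: "gsym set \<Rightarrow> falg set \<Rightarrow> falg set" for A G where
  LG_rel: "x \<in> RI A \<Longrightarrow> x \<in> LG A G"
| LG_gen: "y \<in> fcar A \<Longrightarrow> g \<in> G \<Longrightarrow> g \<in> fcar A \<Longrightarrow> y * g \<in> LG A G"
| LG_add: "x \<in> LG A G \<Longrightarrow> y \<in> LG A G \<Longrightarrow> x + y \<in> LG A G"

lemma LG_carrier: "x \<in> LG A G \<Longrightarrow> x \<in> fcar A"
  by (induction rule: LG.induct) (auto intro: rel_ideal_carrier)

lemma LG_0 [simp]: "0 \<in> LG A G"
  by (simp add: LG_rel)

lemma LG_lmult: "x \<in> LG A G \<Longrightarrow> y \<in> fcar A \<Longrightarrow> y * x \<in> LG A G"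
proof (induction rule: LG.induct)
  case (LG_gen z g)
  then show ?case
    using LG.LG_gen [of "y * z" A g G] by (simp add: fcar_mult mult.assoc)
qed (auto simp: distrib_left intro: LG.intros rel_ideal_lmult)

lemma LG_uminus: "x \<in> LG A G \<Longrightarrow> - x \<in> LG A G"
  using LG_lmult [OF _ fcar_scalar [of "- 1"]] by (simp add: scalar_uminus)

lemma LG_diff: "x \<in> LG A G \<Longrightarrow> y \<in> LG A G \<Longrightarrow> x - y \<in> LG A G"
  using LG_add [OF _ LG_uminus, of x A G y] by simp

lemma LG_sum: "(\<And>i. i \<in> I \<Longrightarrow> f i \<in> LG A G) \<Longrightarrow> sum f I \<in> LG A G"
  by (induction I rule: infinite_finite_induct) (auto intro: LG_add)

lemma LG_mono:
  assumes "A \<subseteq> B" "G \<subseteq> H" "x \<in> LG A G" shows "x \<in> LG B H"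
  using assms(3)
  by (induction rule: LG.induct) (use assms(1,2) in \<open>auto intro: LG.intros rel_ideal_mono fcar_mono\<close>)

text \<open>The classes of \<open>LG A G\<close> form a left ideal containing the generators, and
  every such left ideal contains them. As \<open>LG A G\<close> includes the relations, membership
  depends on the class alone.\<close>

lemma gen_left_ideal_cls_iff:
  assumes "G \<subseteq> fcar A" "x \<in> fcar A"
  shows "cls A x \<in> gen_left_ideal (UE A) (cls A ` G) \<longleftrightarrow> x \<in> LG A G"
proof
  assume x: "x \<in> LG A G"
  have "cls A x \<in> I" if I: "left_ideal I (UE A)" "cls A ` G \<subseteq> I" for I
  proof -
    have sub: "additive_subgroup I (UE A)" using I by (simp add: left_ideal_def)
    from x show ?thesis
    proof (induction rule: LG.induct)
      case (LG_rel x)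
      then have "cls A x = cls A 0" by (simp add: cls_eq_iff)
      with additive_subgroup.zero_closed [OF sub] show ?case by (simp add: UE_simps)
    next
      case (LG_gen y g)
      then have "cls A (y * g) = cls A y \<otimes>\<^bsub>UE A\<^esub> cls A g" by (simp add: UE_simps)
      moreover have "cls A y \<in> carrier (UE A)" using LG_gen by (simp add: UE_simps)
      ultimately show ?case using I LG_gen(2) by (auto simp: left_ideal_def)
    next
      case (LG_add x y)
      then have "cls A (x + y) = cls A x \<oplus>\<^bsub>UE A\<^esub> cls A y"
        by (simp add: UE_simps LG_carrier)
      then show ?case
        using additive_subgroup.a_closed [OF sub] LG_add by simp
    qed
  qed
  then show "cls A x \<in> gen_left_ideal (UE A) (cls A ` G)"
    by (auto simp: gen_left_ideal_def)
next
  let ?I = "cls A ` LG A G"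
  assume "cls A x \<in> gen_left_ideal (UE A) (cls A ` G)"
  moreover have "left_ideal ?I (UE A)"
    unfolding left_ideal_def
  proof (intro conjI ballI additive_subgroup.intro group.subgroupI)
    show "group (add_monoid (UE A))" by (rule UE.a_group)
    show "?I \<noteq> {}" using LG_0 by blast
    show "?I \<subseteq> carrier (add_monoid (UE A))"
      using LG_carrier by (auto simp: UE_simps)
    fix X assume "X \<in> ?I"
    then obtain x where x: "X = cls A x" "x \<in> LG A G" by blast
    then show "inv\<^bsub>add_monoid (UE A)\<^esub> X \<in> ?I"
      using UE_uminus [of x A] LG_uminus [of x A G] LG_carrier [of x A G] by (simp add: a_inv_def)
    fix Y
    { assume "Y \<in> ?I"
      then obtain y where "Y = cls A y" "y \<in> LG A G" by blast
      with x show "X \<otimes>\<^bsub>add_monoid (UE A)\<^esub> Y \<in> ?I"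
        using UE_simps(4) [of x A y] LG_carrier LG_add [of x A G y] by auto }
    { assume "Y \<in> carrier (UE A)"
      then obtain y where "Y = cls A y" "y \<in> fcar A" by (auto simp: UE_simps)
      with x show "Y \<otimes>\<^bsub>UE A\<^esub> X \<in> ?I"
        using UE_simps(5) [of y A x] LG_carrier [of x A G] LG_lmult [of x A G y] by auto }
  qed
  moreover have "cls A ` G \<subseteq> ?I"
    using LG_gen [of 1 A _ G] assms(1) by fastforce
  ultimately have "cls A x \<in> ?I"
    unfolding gen_left_ideal_def by blast
  then obtain y where y: "y \<in> LG A G" "x - y \<in> RI A" by (auto simp: cls_eq_iff)
  then show "x \<in> LG A G"
    using LG_add [OF LG_rel [OF y(2)] y(1)] by simp
qed

section \<open>A faithful module\<close>

text \<open>The linear functional with prescribed values on words. Matrix coefficients of the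
  module, coefficients of symbols and restrictions of symbols to the slice all have this
  form.\<close>

definition lin :: "((gsym \<times> gsym) list \<Rightarrow> complex) \<Rightarrow> falg \<Rightarrow> complex" where
  "lin g x = (\<Sum>w\<in>Poly_Mapping.keys x. Poly_Mapping.lookup x w * g (letters w))"

lemma lin_superset:
  assumes "finite S" "Poly_Mapping.keys x \<subseteq> S"
  shows "lin g x = (\<Sum>w\<in>S. Poly_Mapping.lookup x w * g (letters w))"
  unfolding lin_def using assms by (intro sum.mono_neutral_left) (auto simp: in_keys_iff)

lemma lin_0 [simp]: "lin g 0 = 0"
  by (simp add: lin_def)

lemma lin_add: "lin g (x + y) = lin g x + lin g y"
proof -
  let ?S = "Poly_Mapping.keys x \<union> Poly_Mapping.keys y"
  have "lin g (x + y) = (\<Sum>w\<in>?S. Poly_Mapping.lookup (x + y) w * g (letters w))"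
    using keys_add [of x y] by (intro lin_superset) auto
  also have "\<dots> = lin g x + lin g y"
    using lin_superset [of ?S x g] lin_superset [of ?S y g]
    by (simp add: lookup_add distrib_right sum.distrib)
  finally show ?thesis .
qed

lemma lin_sum: "lin g (sum f I) = (\<Sum>i\<in>I. lin g (f i))"
  by (induction I rule: infinite_finite_induct) (auto simp: lin_add)

lemma lin_scalar_monomial [simp]: "lin g (scalar c * monomial w) = c * g w"
  by (simp add: scalar_times_monomial lin_def)

lemma lin_monomial [simp]: "lin g (monomial w) = g w"
  using lin_scalar_monomial [of g 1 w] by simp

lemma lin_scalar [simp]: "lin g (scalar c) = c * g []"
  using lin_scalar_monomial [of g c "[]"] by (simp add: monomial_Nil)

lemma lin_scalar_mult: "lin g (scalar c * x) = c * lin g x"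
proof -
  have "x \<in> fcar UNIV" by (simp add: fcar_iff)
  then show ?thesis
    by (induction rule: fcar_induct)
      (simp_all add: distrib_left lin_add scalar_mult flip: mult.assoc)
qed

lemma lin_uminus: "lin g (- x) = - lin g x"
  using lin_scalar_mult [of g "- 1" x] by (simp add: scalar_uminus)

lemma lin_diff: "lin g (x - y) = lin g x - lin g y"
  using lin_add [of g x "- y"] by (simp add: lin_uminus)

lemma lin_cong:
  "(\<And>w. w \<in> Poly_Mapping.keys x \<Longrightarrow> f (letters w) = g (letters w)) \<Longrightarrow> lin f x = lin g x"
  by (simp add: lin_def)

lemma lin_fun_add: "lin (\<lambda>w. f w + g w) x = lin f x + lin g x"
  by (simp add: lin_def distrib_left sum.distrib)

lemma lin_fun_cmult: "lin (\<lambda>w. c * f w) x = c * lin f x"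
  by (simp add: lin_def sum_distrib_left mult.left_commute)

lemma lin_fun_0 [simp]: "lin (\<lambda>w. 0) x = 0"
  by (simp add: lin_def)

lemma lin_fun_sum: "lin (\<lambda>w. \<Sum>i\<in>I. f i w) x = (\<Sum>i\<in>I. lin (f i) x)"
  by (induction I rule: infinite_finite_induct) (auto simp: lin_fun_add)

lemma falg_induct [case_names zero add monomial]:
  assumes "P 0" "\<And>x y. P x \<Longrightarrow> P y \<Longrightarrow> P (x + y)" "\<And>c w. P (scalar c * monomial w)"
  shows "P (x :: falg)"
proof -
  have "x \<in> fcar UNIV" by (simp add: fcar_iff)
  then show ?thesis by (induction rule: fcar_induct) (use assms in auto)
qed

lemma lin_mult: "lin g (x * y) = lin (\<lambda>u. lin (\<lambda>v. g (u @ v)) y) x"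
proof (induction x rule: falg_induct)
  case (monomial c u)
  show ?case
  proof (induction y rule: falg_induct)
    case (monomial d v)
    have "scalar c * monomial u * (scalar d * monomial v) = scalar (c * d) * monomial (u @ v)"
      by (metis (no_types, lifting) monomial_append mult.assoc scalar_commute scalar_mult)
    then show ?case by simp
  qed (simp_all add: distrib_left lin_add lin_fun_add)
qed (simp_all add: distrib_right lin_add lin_fun_add)

section \<open>The action on tensor powers\<close>

type_synonym slot = "(gsym \<times> gsym) option"

text \<open>\<open>None\<close> is the even extra vector. \<open>Some (a, c)\<close> is the matrix
  unit in row \<open>a\<close> and column \<open>c\<close>; the added 1 is the parity of its column,
  which is taken from odd symbols.\<close>

fun slot_parity :: "slot \<Rightarrow> nat" where
  "slot_parity None = 0"
| "slot_parity (Some (a, c)) = parity a + 1"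

text \<open>The Koszul sign for moving e_{a,b} past the tensor factor \<open>x\<close>.\<close>

definition slot_sign :: "gsym \<Rightarrow> gsym \<Rightarrow> slot \<Rightarrow> complex" where
  "slot_sign a b x = (- 1) ^ ((parity a + parity b) * slot_parity x)"

fun slot_act :: "gsym set \<Rightarrow> gsym \<Rightarrow> gsym \<Rightarrow> slot \<Rightarrow> (slot \<Rightarrow> complex) \<Rightarrow> complex" where
  "slot_act P a b None f = (if b \<in> P then f (Some (a, b)) else 0)"
| "slot_act P a b (Some (c, d)) f = (if c = b then f (Some (a, d)) else 0)"

text \<open>
  Let \<open>\<V>\<close> be the space of matrices with columns indexed by the set \<open>P\<close> of odd symbols, on which
  the matrix units act by left multiplication. Extended by a vector \<open>None\<close> that \<open>e\<^bsub>a,b\<^esub>\<close> maps to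
  the matrix unit \<open>(a, b)\<close> (to \<open>0\<close> if \<open>b \<notin> P\<close>), this remains a module, and
  \<open>act\<close> is the transpose of the action on its tensor powers.
\<close>

fun act :: "gsym set \<Rightarrow> gsym \<Rightarrow> gsym \<Rightarrow> (slot list \<Rightarrow> complex) \<Rightarrow> slot list \<Rightarrow> complex" where
  "act P a b \<phi> [] = 0"
| "act P a b \<phi> (x # w) =
     slot_act P a b x (\<lambda>y. \<phi> (y # w)) + slot_sign a b x * act P a b (\<lambda>v. \<phi> (x # v)) w"

lemma act_add: "act P a b (\<lambda>v. \<phi> v + \<psi> v) w = act P a b \<phi> w + act P a b \<psi> w"
proof (induction w arbitrary: \<phi> \<psi>)
  case (Cons x w)
  then show ?case by (cases x) (auto simp: algebra_simps)
qed simp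

lemma act_cmult: "act P a b (\<lambda>v. c * \<phi> v) w = c * act P a b \<phi> w"
proof (induction w arbitrary: \<phi>)
  case (Cons x w)
  then show ?case by (cases x) (auto simp: algebra_simps)
qed simp

lemma act_zero [simp]: "act P a b (\<lambda>v. 0) w = 0"
  using act_cmult [of P a b 0 "\<lambda>v. 0" w] by simp

definition csign :: "gsym \<Rightarrow> gsym \<Rightarrow> gsym \<Rightarrow> gsym \<Rightarrow> complex" where
  "csign a b c d = (- 1) ^ ((parity a + parity b) * (parity c + parity d))"

lemma super_sign_csign: "super_sign a b c d = scalar (csign a b c d)"
  by (simp add: super_sign_scalar csign_def)

lemma parity_cases: "parity a = 0 \<or> parity a = 1"
  by (cases a) auto

lemma csign_square [simp]:
  "csign a b c d * csign a b c d = 1" "csign a b c d * (csign a b c d * y) = y"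
  by (simp_all add: csign_def flip: power_add mult.assoc)

lemma slot_sign_simps:
  "slot_sign a b None = 1"
  "slot_sign a b (Some (c, f)) = csign a b c d * slot_sign a b (Some (d, f))"
  "slot_sign c d (Some (a, f)) = csign a b c d * slot_sign c d (Some (b, f))"
  "parity d = 1 \<Longrightarrow> slot_sign a b (Some (c, f)) = csign a b c d"
  "parity b = 1 \<Longrightarrow> slot_sign c d (Some (a, f)) = csign a b c d"
  using parity_cases [of a] parity_cases [of b] parity_cases [of c] parity_cases [of d]
  by (auto simp: slot_sign_def csign_def)

lemma sign_diagonal [simp]: "slot_sign a a x = 1" "csign a a c d = 1" "csign c d a a = 1"
  by (simp_all add: slot_sign_def csign_def flip: mult_2)

text \<open>Transposition reverses the order: applying \<open>act P a b\<close> and then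
  \<open>act P c d\<close> to a functional corresponds to the product e_{a,b} e_{c,d}. Both
  operators on the first slot give the bracket there, both on the rest give the induction
  hypothesis, and the mixed terms cancel by the Koszul signs. On \<open>None\<close> this uses that
  the columns in \<open>P\<close> are odd.\<close>

lemma act_relation:
  assumes P: "\<And>p. p \<in> P \<Longrightarrow> parity p = 1"
  shows "act P c d (act P a b \<phi>) w - csign a b c d * act P a b (act P c d \<phi>) w
    = (if b = c then act P a d \<phi> w else 0) - csign a b c d * (if a = d then act P c b \<phi> w else 0)"
proof (induction w arbitrary: \<phi>)
  case (Cons x w)
  have IH: "act P c d (act P a b (\<lambda>v. \<phi> (x # v))) w =
     csign a b c d * act P a b (act P c d (\<lambda>v. \<phi> (x # v))) w
      + (if b = c then act P a d (\<lambda>v. \<phi> (x # v)) w else 0)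
      - csign a b c d * (if a = d then act P c b (\<lambda>v. \<phi> (x # v)) w else 0)"
    using Cons [of "\<lambda>v. \<phi> (x # v)"] by (simp add: algebra_simps)
  have s1: "slot_sign a d x = slot_sign c d x * slot_sign a b x" if "b = c"
    using parity_cases [of a] parity_cases [of b] parity_cases [of d]
    unfolding that slot_sign_def by (auto simp: that)
  have s2: "slot_sign c b x = slot_sign c d x * slot_sign a b x" if "a = d"
    using parity_cases [of a] parity_cases [of b] parity_cases [of c]
    unfolding that slot_sign_def by (auto simp: that)
  show ?case
  proof (cases x)
    case None
    have *: "act P c d (act P a b \<phi>) (x # w) =
        (if d \<in> P then slot_act P a b (Some (c, d)) (\<lambda>y. \<phi> (y # w))
           + slot_sign a b (Some (c, d)) * act P a b (\<lambda>v. \<phi> (Some (c, d) # v)) w else 0)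
        + ((if b \<in> P then act P c d (\<lambda>v. \<phi> (Some (a, b) # v)) w else 0)
           + act P c d (act P a b (\<lambda>v. \<phi> (x # v))) w)"
      by (simp add: None slot_sign_simps(1) act_add act_cmult)
    have **: "act P a b (act P c d \<phi>) (x # w) =
        (if b \<in> P then slot_act P c d (Some (a, b)) (\<lambda>y. \<phi> (y # w))
           + slot_sign c d (Some (a, b)) * act P c d (\<lambda>v. \<phi> (Some (a, b) # v)) w else 0)
        + ((if d \<in> P then act P a b (\<lambda>v. \<phi> (Some (c, d) # v)) w else 0)
           + act P a b (act P c d (\<lambda>v. \<phi> (x # v))) w)"
      by (simp add: None slot_sign_simps(1) act_add act_cmult)
    show ?thesis
      unfolding * ** IH
      by (cases "b \<in> P"; cases "d \<in> P"; cases "b = c"; cases "a = d")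
        (use slot_sign_simps(4) [of d a b c d] slot_sign_simps(5) [of b c d a b] P [of b] P [of d] in
          \<open>simp_all add: None slot_sign_simps(1) algebra_simps\<close>)
  next
    case (Some y)
    obtain e f where y: "y = (e, f)" by (cases y)
    have *: "act P c d (act P a b \<phi>) (x # w) =
        (if e = d then slot_act P a b (Some (c, f)) (\<lambda>y. \<phi> (y # w))
           + slot_sign a b (Some (c, f)) * act P a b (\<lambda>v. \<phi> (Some (c, f) # v)) w else 0)
        + slot_sign c d x * ((if e = b then act P c d (\<lambda>v. \<phi> (Some (a, f) # v)) w else 0)
           + slot_sign a b x * act P c d (act P a b (\<lambda>v. \<phi> (x # v))) w)"
      by (simp add: Some y act_add act_cmult)
    have **: "act P a b (act P c d \<phi>) (x # w) =
        (if e = b then slot_act P c d (Some (a, f)) (\<lambda>y. \<phi> (y # w))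
           + slot_sign c d (Some (a, f)) * act P c d (\<lambda>v. \<phi> (Some (a, f) # v)) w else 0)
        + slot_sign a b x * ((if e = d then act P a b (\<lambda>v. \<phi> (Some (c, f) # v)) w else 0)
           + slot_sign c d x * act P a b (act P c d (\<lambda>v. \<phi> (x # v))) w)"
      by (simp add: Some y act_add act_cmult)
    show ?thesis
    proof (cases "b = c \<and> a = d")
      \<comment> \<open>Only here are both terms of the bracket present. All four indices are then
        \<open>c\<close> and \<open>d\<close>, and a case distinction on their parities settles the
        signs.\<close>
      case True
      then show ?thesis
        unfolding * ** IH using parity_cases [of c] parity_cases [of d]
        by (cases "e = b"; cases "e = d")
          (auto simp: Some y slot_sign_def csign_def)
    next
      case False
      then show ?thesis
        unfolding * ** IH
        by (cases "e = b"; cases "e = d"; cases "b = c"; cases "a = d")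
          (use slot_sign_simps(2) [of a b c f d] slot_sign_simps(3) [of c d a f b] s1 s2 in
            \<open>simp_all add: Some y algebra_simps\<close>)
    qed
  qed
qed simp

text \<open>Functionals form a right module, so the leftmost letter is applied first. Dually, the
  rightmost letter is the first to meet the tensor.\<close>

fun acts :: "gsym set \<Rightarrow> (gsym \<times> gsym) list \<Rightarrow> (slot list \<Rightarrow> complex) \<Rightarrow> slot list \<Rightarrow> complex" where
  "acts P [] \<phi> = \<phi>"
| "acts P (l # u) \<phi> = acts P u (act P (fst l) (snd l) \<phi>)"

lemma acts_append: "acts P (u @ v) \<phi> = acts P v (acts P u \<phi>)"
  by (induction u arbitrary: \<phi>) auto

lemma acts_add: "acts P u (\<lambda>v. \<phi> v + \<psi> v) w = acts P u \<phi> w + acts P u \<psi> w"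
proof (induction u arbitrary: \<phi> \<psi>)
  case (Cons l u)
  have "act P a b (\<lambda>v. \<phi> v + \<psi> v) = (\<lambda>v. act P a b \<phi> v + act P a b \<psi> v)" for a b
    by (simp add: fun_eq_iff act_add)
  with Cons show ?case by simp
qed simp

lemma acts_cmult: "acts P u (\<lambda>v. c * \<phi> v) w = c * acts P u \<phi> w"
proof (induction u arbitrary: \<phi>)
  case (Cons l u)
  have "act P a b (\<lambda>v. c * \<phi> v) = (\<lambda>v. c * act P a b \<phi> v)" for a b
    by (simp add: fun_eq_iff act_cmult)
  with Cons show ?case by simp
qed simp

lemma acts_0 [simp]: "acts P u (\<lambda>v. 0) w = 0"
  using acts_cmult [of P u 0 "\<lambda>v. 0" w] by simp

lemma acts_sum: "acts P u (\<lambda>v. \<Sum>i\<in>I. \<phi> i v) w = (\<Sum>i\<in>I. acts P u (\<phi> i) w)"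
  by (induction I rule: infinite_finite_induct) (auto simp: acts_add)

definition Act :: "gsym set \<Rightarrow> falg \<Rightarrow> (slot list \<Rightarrow> complex) \<Rightarrow> slot list \<Rightarrow> complex" where
  "Act P x \<phi> w = lin (\<lambda>u. acts P u \<phi> w) x"

lemma Act_monomial [simp]: "Act P (monomial u) \<phi> w = acts P u \<phi> w"
  by (simp add: Act_def)

lemma Act_scalar_mult: "Act P (scalar c * x) \<phi> w = c * Act P x \<phi> w"
  by (simp add: Act_def lin_scalar_mult)

lemma Act_0 [simp]: "Act P 0 \<phi> w = 0"
  by (simp add: Act_def)

lemma Act_add: "Act P (x + y) \<phi> w = Act P x \<phi> w + Act P y \<phi> w"
  by (simp add: Act_def lin_add)

lemma Act_diff: "Act P (x - y) \<phi> w = Act P x \<phi> w - Act P y \<phi> w"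
  by (simp add: Act_def lin_diff)

lemma Act_sum: "Act P (sum f I) \<phi> w = (\<Sum>i\<in>I. Act P (f i) \<phi> w)"
  by (simp add: Act_def lin_sum)

lemma acts_lin: "acts P v (\<lambda>w. lin (\<lambda>u. f u w) x) w = lin (\<lambda>u. acts P v (f u) w) x"
  by (simp add: lin_def acts_sum acts_cmult)

lemma Act_fun_0 [simp]: "Act P x (\<lambda>w. 0) w = 0"
  by (simp add: Act_def)

lemma Act_mult: "Act P (x * y) \<phi> w = Act P y (Act P x \<phi>) w"
proof -
  have "Act P (x * y) \<phi> w = lin (\<lambda>u. lin (\<lambda>v. acts P v (acts P u \<phi>) w) y) x"
    by (simp add: Act_def lin_mult acts_append)
  also have "\<dots> = lin (\<lambda>v. lin (\<lambda>u. acts P v (acts P u \<phi>) w) x) y"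
    by (simp add: lin_def sum_distrib_left mult_ac) (rule sum.swap)
  also have "\<dots> = Act P y (Act P x \<phi>) w"
  proof -
    have "Act P x \<phi> = (\<lambda>w. lin (\<lambda>u. acts P u \<phi> w) x)"
      by (simp add: Act_def fun_eq_iff)
    then show ?thesis by (simp add: Act_def [of P y] acts_lin)
  qed
  finally show ?thesis .
qed

definition odd_syms :: "gsym set" where
  "odd_syms = {a. parity a = 1}"

lemma Act_rel_ideal:
  assumes "x \<in> RI A" "P \<subseteq> odd_syms" shows "Act P x \<phi> w = 0"
  using assms(1)
proof (induction arbitrary: \<phi> w rule: rel_ideal_induct)
  case (relator a b c d)
  have "Act P (gl_bracket a b c d) \<phi> w
    = (if b = c then act P a d \<phi> w else 0) - csign a b c d * (if a = d then act P c b \<phi> w else 0)"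
    by (simp add: gl_bracket_def Act_diff Act_scalar_mult super_sign_csign)
  moreover have "Act P (letter a b * letter c d) \<phi> w = act P c d (act P a b \<phi>) w" for a b c d
    by (simp flip: monomial_append)
  ultimately show ?case
    using act_relation [of P c d a b \<phi> w] assms(2)
    by (simp add: Act_diff Act_scalar_mult super_sign_csign odd_syms_def subset_iff)
next
  case (rmult x y)
  then have "Act P y \<phi> = (\<lambda>w. 0)" by (simp add: fun_eq_iff)
  then show ?case by (simp add: Act_mult)
qed (auto simp: Act_add Act_mult)

section \<open>Test functionals and leading symbols\<close>

definition fill :: "slot list \<Rightarrow> (gsym \<times> gsym) multiset" where
  "fill w = image_mset the (filter_mset (\<lambda>x. x \<noteq> None) (mset w))"

text \<open>The value depends on the multiset of matrix units only, so the functional sees a word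
  through its commutative image.\<close>

definition test_fun :: "(gsym \<times> gsym) multiset \<Rightarrow> slot list \<Rightarrow> complex" where
  "test_fun M w = (if None \<notin> set w \<and> fill w = M then 1 else 0)"

lemma act_even:
  assumes "even (parity a + parity b)"
  shows "act P a b \<phi> w = (\<Sum>i<length w. slot_act P a b (w ! i) (\<lambda>y. \<phi> (w[i := y])))"
proof (induction w arbitrary: \<phi>)
  case (Cons x w)
  have "slot_sign a b x = 1" using assms by (simp add: slot_sign_def)
  with Cons show ?case
    by (simp add: sum.lessThan_Suc_shift del: sum.lessThan_Suc)
qed simp

text \<open>There are at least as many empty slots as letters. A letter that acts on a filled slot
  leaves one empty slot too many, so each letter has to fill a slot of its own; the factorial counts
  the ways to distribute the letters. All letters are even, so no signs arise.\<close>

lemma acts_test_fun: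
  assumes "set u \<subseteq> odd_syms \<times> (P \<inter> odd_syms)" "length u \<le> count (mset w) None"
  shows "acts P u (test_fun M) w =
    (if length u = count (mset w) None \<and> mset u + fill w = M then fact (length u) else 0)"
  using assms
proof (induction u arbitrary: w rule: rev_induct)
  case Nil
  have "count (mset w) None = 0 \<longleftrightarrow> None \<notin> set w" by simp
  then show ?case by (auto simp: test_fun_def)
next
  case (snoc l u)
  obtain a b where l: "l = (a, b)" by (cases l)
  have ab: "parity a = 1" "parity b = 1" "b \<in> P"
    using snoc.prems by (auto simp: l odd_syms_def)
  let ?k = "count (mset w) None"
  let ?v = "if length u + 1 = ?k \<and> mset (u @ [l]) + fill w = M then fact (length u) else (0::complex)"
  have "slot_act P a b (w ! i) (\<lambda>y. acts P u (test_fun M) (w[i := y]))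
      = (if w ! i = None then ?v else 0)" if i: "i < length w" for i
  proof (cases "w ! i")
    case None
    then obtain N where N: "mset w = add_mset None N"
      using i by (metis insert_DiffM nth_mem_mset)
    have "mset (w[i := Some l]) = add_mset (Some l) N"
      using i None N by (simp add: mset_update)
    then have "count (mset (w[i := Some l])) None = ?k - 1" "fill (w[i := Some l]) = add_mset l (fill w)"
      using N by (simp_all add: fill_def)
    moreover have "?k \<ge> 1" using N by simp
    ultimately show ?thesis
      using snoc.IH [of "w[i := Some l]"] snoc.prems None ab by (auto simp: l)
  next
    case (Some y)
    obtain c d where y: "y = (c, d)" by (cases y)
    have "mset (w[i := Some (a, d)]) = add_mset (Some (a, d)) (mset w - {#Some y#})"
      using i Some by (simp add: mset_update)
    then have "count (mset (w[i := Some (a, d)])) None = ?k" by simp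
    then show ?thesis
      using snoc.IH [of "w[i := Some (a, d)]"] snoc.prems Some by (simp add: y)
  qed
  then have "acts P (u @ [l]) (test_fun M) w = (\<Sum>i<length w. if w ! i = None then ?v else 0)"
    using ab by (simp add: acts_append l act_even)
  also have "\<dots> = of_nat (card {i \<in> {..<length w}. w ! i = None}) * ?v"
    by (subst sum.inter_filter [symmetric]) simp_all
  also have "card {i \<in> {..<length w}. w ! i = None} = ?k"
    by (simp add: count_mset length_filter_conv_card count_list_eq_length_filter eq_commute [of None])
  also have "of_nat ?k * ?v = (if length (u @ [l]) = ?k \<and> mset (u @ [l]) + fill w = M then fact (length (u @ [l])) else 0)"
  proof (cases "length u + 1 = ?k")
    case True
    then have "(fact (length (u @ [l])) :: complex) = of_nat ?k * fact (length u)"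
      by (simp flip: True)
    with True show ?thesis by simp
  qed simp
  finally show ?case .
qed

text \<open>The coefficient of the commutative monomial \<open>M\<close> in the image of the
  argument in the symmetric algebra.\<close>

definition sym_coef :: "(gsym \<times> gsym) multiset \<Rightarrow> falg \<Rightarrow> complex" where
  "sym_coef M = lin (\<lambda>w. if mset w = M then 1 else 0)"

definition Fil :: "gsym set \<Rightarrow> nat \<Rightarrow> falg set" where
  "Fil A d = {x \<in> fcar A. \<forall>w\<in>Poly_Mapping.keys x. length (letters w) \<le> d}"

lemma fill_replicate_None [simp]: "fill (replicate d None) = {#}"
  by (induction d) (simp_all add: fill_def)

lemma Act_test_fun:
  assumes "x \<in> Fil A (size M)" "A \<subseteq> P" "P \<subseteq> odd_syms"
  shows "Act P x (test_fun M) (replicate (size M) None) = fact (size M) * sym_coef M x"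
proof -
  let ?w = "replicate (size M) None"
  have "Act P x (test_fun M) ?w = lin (\<lambda>u. fact (size M) * (if mset u = M then 1 else 0)) x"
    unfolding Act_def
  proof (rule lin_cong)
    fix u assume u: "u \<in> Poly_Mapping.keys x"
    have "set (letters u) \<subseteq> odd_syms \<times> (P \<inter> odd_syms)" "length (letters u) \<le> count (mset ?w) None"
      using assms u by (auto simp: Fil_def fcar_iff)
    then show "acts P (letters u) (test_fun M) ?w = fact (size M) * (if mset (letters u) = M then 1 else 0)"
      by (subst acts_test_fun) auto
  qed
  then show ?thesis by (simp add: sym_coef_def lin_fun_cmult)
qed

text \<open>On empty slots the module gives zero for a relation, but also a nonzero multiple of the
  top coefficient. Hence an element of the ideal of relations has no leading symbol of the degree in
  which it is presented.\<close>

lemma sym_coef_rel_ideal: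
  assumes "x \<in> RI A" "A \<subseteq> odd_syms" "x \<in> Fil A (size M)"
  shows "sym_coef M x = 0"
  using Act_test_fun [OF assms(3) assms(2) order_refl] Act_rel_ideal [OF assms(1), of odd_syms]
  by simp

lemma Fil_carrier: "x \<in> Fil A d \<Longrightarrow> x \<in> fcar A"
  by (simp add: Fil_def)

lemma Fil_mono: "x \<in> Fil A d \<Longrightarrow> d \<le> e \<Longrightarrow> x \<in> Fil A e"
  by (auto simp: Fil_def)

lemma Fil_0 [simp]: "0 \<in> Fil A d"
  by (simp add: Fil_def)

lemma Fil_monomial: "set w \<subseteq> A \<times> A \<Longrightarrow> length w \<le> d \<Longrightarrow> monomial w \<in> Fil A d"
  by (simp add: Fil_def) (simp add: monomial_def)

lemma Fil_scalar [simp]: "scalar c \<in> Fil A d"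
  by (simp add: Fil_def) (simp add: scalar_def)

lemma Fil_add: "x \<in> Fil A d \<Longrightarrow> y \<in> Fil A d \<Longrightarrow> x + y \<in> Fil A d"
  using keys_add [of x y] by (auto simp: Fil_def)

lemma Fil_mult:
  assumes "x \<in> Fil A d" "y \<in> Fil A e" shows "x * y \<in> Fil A (d + e)"
proof -
  have "length (letters w) \<le> d + e" if w: "w \<in> Poly_Mapping.keys (x * y)" for w
  proof -
    obtain u v where "w = u + v" "u \<in> Poly_Mapping.keys x" "v \<in> Poly_Mapping.keys y"
      using w keys_mult [of x y] by blast
    with assms show ?thesis by (auto simp: Fil_def plus_word_def intro: add_mono)
  qed
  with assms show ?thesis by (auto simp: Fil_def)
qed

lemma Fil_scalar_mult: "x \<in> Fil A d \<Longrightarrow> scalar c * x \<in> Fil A d"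
  using Fil_mult [OF Fil_scalar [of c A 0]] by simp

lemma Fil_uminus: "x \<in> Fil A d \<Longrightarrow> - x \<in> Fil A d"
  using Fil_scalar_mult [of x A d "- 1"] by (simp add: scalar_uminus)

lemma Fil_diff: "x \<in> Fil A d \<Longrightarrow> y \<in> Fil A d \<Longrightarrow> x - y \<in> Fil A d"
  using Fil_add [OF _ Fil_uminus, of x A d y] by simp

lemma Fil_sum: "(\<And>i. i \<in> I \<Longrightarrow> f i \<in> Fil A d) \<Longrightarrow> sum f I \<in> Fil A d"
  by (induction I rule: infinite_finite_induct) (auto intro: Fil_add)

lemma Fil_exists:
  assumes "x \<in> fcar A" obtains d where "x \<in> Fil A d"
proof
  show "x \<in> Fil A (Max ((\<lambda>w. length (letters w)) ` Poly_Mapping.keys x))"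
    using assms by (auto simp: Fil_def)
qed

section \<open>The degree filtration modulo relations\<close>

text \<open>The degree filtration of the enveloping algebra, pulled back to the free
  algebra.\<close>

definition FR :: "gsym set \<Rightarrow> nat \<Rightarrow> falg set" where
  "FR A d = {x. \<exists>z\<in>Fil A d. x - z \<in> RI A}"

lemma FR_I: "z \<in> Fil A d \<Longrightarrow> x - z \<in> RI A \<Longrightarrow> x \<in> FR A d"
  by (auto simp: FR_def)

lemma Fil_FR: "x \<in> Fil A d \<Longrightarrow> x \<in> FR A d"
  by (auto intro: FR_I)

lemma FR_add:
  assumes "x \<in> FR A d" "y \<in> FR A d" shows "x + y \<in> FR A d"
proof -
  obtain u v where "u \<in> Fil A d" "v \<in> Fil A d" "x - u \<in> RI A" "y - v \<in> RI A"
    using assms by (auto simp: FR_def)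
  then show ?thesis
    using rel_ideal_add [of "x - u" A "y - v"] by (intro FR_I [of "u + v"]) (auto simp: Fil_add algebra_simps)
qed

lemma FR_lmult:
  assumes "x \<in> FR A d" "y \<in> Fil A e" shows "y * x \<in> FR A (e + d)"
proof -
  obtain u where "u \<in> Fil A d" "x - u \<in> RI A"
    using assms by (auto simp: FR_def)
  then show ?thesis
    using rel_ideal_lmult [of y A "x - u"] assms(2)
      Fil_mult [of y A e u d]
    by (intro FR_I [of "y * u"]) (auto simp: Fil_carrier right_diff_distrib)
qed

lemma FR_scalar_mult: "x \<in> FR A d \<Longrightarrow> scalar c * x \<in> FR A d"
  using FR_lmult [OF _ Fil_scalar [of c A 0]] by simp

lemma FR_sum: "(\<And>i. i \<in> I \<Longrightarrow> f i \<in> FR A d) \<Longrightarrow> sum f I \<in> FR A d"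
  by (induction I rule: infinite_finite_induct) (auto intro: FR_add Fil_FR)

lemma FR_rel_ideal: "x \<in> RI A \<Longrightarrow> x \<in> FR A d"
  by (intro FR_I [of 0]) auto

lemma swap_even:
  assumes "{a,b,c,d} \<subseteq> A" "A \<subseteq> odd_syms"
  shows "letter a b * letter c d - letter c d * letter a b
    - ((if b = c then letter a d else 0) - (if a = d then letter c b else 0)) \<in> RI A"
proof -
  have "parity a = 1" "parity b = 1" "parity c = 1" "parity d = 1"
    using assms by (auto simp: odd_syms_def)
  then show ?thesis
    using relator_in_rel_ideal [of a A b c d] assms(1) by (simp add: gl_bracket_def super_sign_def)
qed

lemma move_front_FR:
  assumes "set (l # u @ v) \<subseteq> A \<times> A" "A \<subseteq> odd_syms"
  shows "monomial (l # u @ v) - monomial (u @ l # v) \<in> FR A (length (u @ v))"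
  using assms(1)
proof (induction u)
  case (Cons m u)
  obtain a b c d where lm: "l = (a, b)" "m = (c, d)" by (metis surj_pair)
  let ?r = "(if b = c then letter a d else 0) - (if a = d then letter c b else 0)"
  have "letter a b * letter c d - letter c d * letter a b - ?r \<in> RI A"
    using Cons.prems by (intro swap_even assms(2)) (auto simp: lm)
  then have "(letter a b * letter c d - letter c d * letter a b - ?r) * monomial (u @ v) \<in> RI A"
    using Cons.prems by (intro rel_ideal_rmult) auto
  moreover have "?r \<in> Fil A 1"
    using Cons.prems by (auto simp: lm intro!: Fil_diff Fil_uminus Fil_monomial)
  then have "?r * monomial (u @ v) \<in> Fil A (length ((m # u) @ v))"
  proof -
    have "monomial (u @ v) \<in> Fil A (length (u @ v))"
      using Cons.prems by (intro Fil_monomial) auto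
    from Fil_mult [OF \<open>?r \<in> Fil A 1\<close> this] show ?thesis by simp
  qed
  ultimately have 1: "monomial (l # m # u @ v) - monomial (m # l # u @ v) \<in> FR A (length ((m # u) @ v))"
    using monomial_append [of "[l, m]" "u @ v"] monomial_append [of "[m, l]" "u @ v"]
      monomial_append [of "[l]" "[m]"] monomial_append [of "[m]" "[l]"]
    by (intro FR_I [of "?r * monomial (u @ v)"]) (auto simp: lm algebra_simps)
  have "monomial [m] * (monomial (l # u @ v) - monomial (u @ l # v)) \<in> FR A (1 + length (u @ v))"
    using Cons by (intro FR_lmult Fil_monomial) auto
  then have 2: "monomial (m # l # u @ v) - monomial (m # u @ l # v) \<in> FR A (length ((m # u) @ v))"
    by (simp add: right_diff_distrib flip: monomial_Cons)
  show ?case using FR_add [OF 1 2] by simp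
qed (simp add: Fil_FR)

lemma permute_FR:
  assumes "mset u = mset v" "set u \<subseteq> A \<times> A" "A \<subseteq> odd_syms" "length u \<le> Suc d"
  shows "monomial u - monomial v \<in> FR A d"
  using assms(1,2,4)
proof (induction u arbitrary: v d)
  case (Cons l u)
  obtain v1 v2 where v: "v = v1 @ l # v2"
    using Cons.prems(1) by (metis in_set_conv_decomp list.set_intros(1) mset_eq_setD)
  have m: "mset u = mset (v1 @ v2)" using Cons.prems by (simp add: v)
  have set: "set (l # v1 @ v2) \<subseteq> A \<times> A"
    using Cons.prems m mset_eq_setD [OF m] by auto
  have len: "length (v1 @ v2) \<le> d" using Cons.prems(3) mset_eq_length [OF m] by simp
  have 2: "monomial (l # v1 @ v2) - monomial v \<in> FR A d"
    using move_front_FR [OF set assms(3)] len Fil_mono unfolding v FR_def by blast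
  have 1: "monomial (l # u) - monomial (l # v1 @ v2) \<in> FR A d"
  proof (cases d)
    case 0
    then have "u = []" "v1 @ v2 = []" using len m by auto
    then show ?thesis by (simp add: Fil_FR)
  next
    case (Suc e)
    have "monomial [l] * (monomial u - monomial (v1 @ v2)) \<in> FR A (1 + e)"
      using Cons.prems(2,3) Suc m by (intro FR_lmult Fil_monomial Cons.IH) auto
    then show ?thesis by (simp add: right_diff_distrib Suc flip: monomial_Cons)
  qed
  show ?case using FR_add [OF 1 2] by simp
qed (simp add: Fil_FR)

text \<open>Each word of top degree is replaced, at the cost of lower terms, by one fixed ordering
  \<open>r M\<close> of its letters. The words with multiset \<open>M\<close> then collect into one
  monomial with coefficient \<open>sym_coef M x\<close>, which is zero.\<close>

lemma FR_lower:
  assumes x: "x \<in> Fil A (Suc d)" and A: "A \<subseteq> odd_syms"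
    and sym: "\<And>M. size M = Suc d \<Longrightarrow> sym_coef M x = 0"
  shows "x \<in> FR A d"
proof -
  obtain r :: "(gsym \<times> gsym) multiset \<Rightarrow> (gsym \<times> gsym) list" where r: "\<And>M. mset (r M) = M"
    using ex_mset by metis
  let ?c = "\<lambda>w. scalar (Poly_Mapping.lookup x w)"
  define K where "K = {w \<in> Poly_Mapping.keys x. length (letters w) = Suc d}"
  define L where "L = {w \<in> Poly_Mapping.keys x. length (letters w) \<le> d}"
  have fin: "finite K" "finite L" by (auto simp: K_def L_def)
  have "Poly_Mapping.keys x = K \<union> L" "K \<inter> L = {}"
    using x by (auto simp: Fil_def K_def L_def)
  then have "x = (\<Sum>w\<in>K. ?c w * monomial (letters w)) + (\<Sum>w\<in>L. ?c w * monomial (letters w))"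
    using falg_expand [of x] fin by (simp add: sum.union_disjoint)
  also have "(\<Sum>w\<in>K. ?c w * monomial (letters w)) =
     (\<Sum>w\<in>K. ?c w * (monomial (letters w) - monomial (r (mset (letters w)))))
      + (\<Sum>w\<in>K. ?c w * monomial (r (mset (letters w))))"
    by (simp add: sum_subtractf right_diff_distrib)
  also have "(\<Sum>w\<in>K. ?c w * monomial (r (mset (letters w)))) =
     (\<Sum>M\<in>(\<lambda>w. mset (letters w)) ` K. \<Sum>w | w \<in> K \<and> mset (letters w) = M. ?c w * monomial (r M))"
    using fin by (subst sum.image_gen [where g = "\<lambda>w. mset (letters w)"]) auto
  also have "\<dots> = (\<Sum>M\<in>(\<lambda>w. mset (letters w)) ` K. scalar (sym_coef M x) * monomial (r M))"
  proof (rule sum.cong)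
    fix M assume "M \<in> (\<lambda>w. mset (letters w)) ` K"
    then have size: "size M = Suc d" by (auto simp: K_def)
    have scalar_sum: "scalar (sum f I) = (\<Sum>i\<in>I. scalar (f i))" for f :: "word \<Rightarrow> complex" and I
      by (induction I rule: infinite_finite_induct) (auto simp flip: scalar_add)
    have "sym_coef M x = (\<Sum>w\<in>Poly_Mapping.keys x. if mset (letters w) = M then Poly_Mapping.lookup x w else 0)"
      by (simp add: sym_coef_def lin_def if_distrib cong: if_cong)
    also have "\<dots> = (\<Sum>w | w \<in> K \<and> mset (letters w) = M. Poly_Mapping.lookup x w)"
      using size by (subst sum.inter_filter [symmetric]) (auto simp: K_def intro!: sum.cong)
    finally show "(\<Sum>w | w \<in> K \<and> mset (letters w) = M. ?c w * monomial (r M))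
      = scalar (sym_coef M x) * monomial (r M)"
      by (simp add: scalar_sum sum_distrib_right)
  qed simp
  also have "\<dots> = 0"
    using sym by (intro sum.neutral) (auto simp: K_def)
  finally have eq: "x = (\<Sum>w\<in>K. ?c w * (monomial (letters w) - monomial (r (mset (letters w)))))
      + (\<Sum>w\<in>L. ?c w * monomial (letters w))" by simp
  have "(\<Sum>w\<in>K. ?c w * (monomial (letters w) - monomial (r (mset (letters w))))) \<in> FR A d"
  proof (intro FR_sum FR_scalar_mult permute_FR A)
    fix w assume "w \<in> K"
    then show "set (letters w) \<subseteq> A \<times> A"
      using x unfolding Fil_def fcar_iff K_def by blast
  qed (auto simp: r K_def)
  moreover have "(\<Sum>w\<in>L. ?c w * monomial (letters w)) \<in> FR A d"
  proof (intro FR_sum FR_scalar_mult Fil_FR Fil_monomial)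
    fix w assume "w \<in> L"
    then show "set (letters w) \<subseteq> A \<times> A"
      using x unfolding Fil_def fcar_iff L_def by blast
  qed (auto simp: L_def)
  ultimately show ?thesis by (subst eq) (rule FR_add)
qed

lemma Fil_zero_scalar:
  assumes "x \<in> Fil A 0" shows "x = scalar (sym_coef {#} x)"
proof -
  have "Poly_Mapping.keys x \<subseteq> {Word []}"
  proof
    fix w assume "w \<in> Poly_Mapping.keys x"
    with assms show "w \<in> {Word []}" by (cases w) (auto simp: Fil_def)
  qed
  then have "x = scalar (Poly_Mapping.lookup x (Word []))"
    by (intro poly_mapping_eqI) (auto simp: scalar_def lookup_single when_def in_keys_iff)
  then obtain c where "x = scalar c" by blast
  then show ?thesis by (simp add: sym_coef_def)
qed

text \<open>Induction on the degree of a representative: the test functionals of size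
  \<open>Suc d\<close> read off its leading symbol, which vanishes, so the degree drops by
  \<open>FR_lower\<close>. In degree 0 the representative is a scalar, and
  \<open>test_fun {#}\<close> shows it to be zero.\<close>

theorem faithful:
  assumes "x \<in> fcar A" and A: "A \<subseteq> P" "P \<subseteq> odd_syms"
    and 0: "\<And>M. set_mset M \<subseteq> A \<times> A \<Longrightarrow> Act P x (test_fun M) (replicate (size M) None) = 0"
  shows "x \<in> RI A"
proof -
  obtain d where "x \<in> FR A d"
    using Fil_exists [OF assms(1)] Fil_FR by metis
  then show ?thesis
  proof (induction d)
    case (0)
    then obtain z where z: "z \<in> Fil A 0" "x - z \<in> RI A" by (auto simp: FR_def)
    have "Act P z (test_fun {#}) (replicate (size {#}) None) = 0"
      using assms(4) [of "{#}"] Act_rel_ideal [OF z(2) A(2)] by (simp add: Act_diff)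
    then have "sym_coef {#} z = 0"
      using Act_test_fun [of z A "{#}" P] z A by simp
    then have "z = 0" using Fil_zero_scalar [OF z(1)] by simp
    with z show ?case by simp
  next
    case (Suc d)
    then obtain z where z: "z \<in> Fil A (Suc d)" "x - z \<in> RI A" by (auto simp: FR_def)
    have "sym_coef M z = 0" if "size M = Suc d" for M
    proof (cases "set_mset M \<subseteq> A \<times> A")
      case False
      have "sym_coef M z = lin (\<lambda>w. 0) z"
        unfolding sym_coef_def
      proof (rule lin_cong)
        fix w assume "w \<in> Poly_Mapping.keys z"
        then have "set (letters w) \<subseteq> A \<times> A"
          using z(1) unfolding Fil_def fcar_iff by blast
        with False show "(if mset (letters w) = M then 1 else 0) = (0 :: complex)" by auto
      qed
      then show ?thesis by simp
    next
      case True
      then have "Act P z (test_fun M) (replicate (size M) None) = 0"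
        using 0 [of M] Act_rel_ideal [OF z(2) A(2)] by (simp add: Act_diff)
      then have "fact (size M) * sym_coef M z = 0"
        using Act_test_fun [of z A M P] z A by (simp only: that)
      then show ?thesis unfolding mult_eq_0_iff by simp
    qed
    then have "z \<in> FR A d" using z A by (intro FR_lower) auto
    then have "x \<in> FR A d" using FR_add [OF FR_rel_ideal [OF z(2)] \<open>z \<in> FR A d\<close>] by simp
    then show ?case by (rule Suc.IH)
  qed
qed

section \<open>The virtual method\<close>

definition irregular_words :: "gsym set \<Rightarrow> falg set" where
  "irregular_words A = {monomial ws | ws. set ws \<subseteq> A \<times> A \<and> irregular ws}"

abbreviation JI :: "gsym set \<Rightarrow> falg set" where
  "JI A \<equiv> LG A (irregular_words A)"

lemma irregular_words_mono: "A \<subseteq> B \<Longrightarrow> irregular_words A \<subseteq> irregular_words B"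
  unfolding irregular_words_def by blast

lemma JI_mono: "A \<subseteq> B \<Longrightarrow> x \<in> JI A \<Longrightarrow> x \<in> JI B"
  by (rule LG_mono) (auto intro: irregular_words_mono [THEN subsetD])

lemma irregular_words_carrier: "irregular_words A \<subseteq> fcar A"
  by (auto simp: irregular_words_def)

lemma JI_irregular:
  assumes "set ws \<subseteq> A \<times> A" "irregular ws" shows "monomial ws \<in> JI A"
  using LG_gen [of 1 A "monomial ws" "irregular_words A"] assms
  by (auto simp: irregular_words_def)

lemma Irr_cls_iff:
  assumes "x \<in> fcar (syms m0 m1 n)"
  shows "cls (syms m0 m1 n) x \<in> Irr m0 m1 n \<longleftrightarrow> x \<in> JI (syms m0 m1 n)"
proof -
  let ?A = "syms m0 m1 n"
  have "Irr m0 m1 n = gen_left_ideal (UE ?A) (cls ?A ` irregular_words ?A)"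
    unfolding Irr_def irregular_words_def by (rule arg_cong [of _ _ "gen_left_ideal _"]) auto
  then show ?thesis
    using gen_left_ideal_cls_iff [OF irregular_words_carrier assms] by simp
qed

section \<open>Irregular words annihilate tensors without virtual symbols\<close>

definition virtual_count :: "gsym \<Rightarrow> slot list \<Rightarrow> nat" where
  "virtual_count \<gamma> w = length (filter (\<lambda>x. \<exists>c. x = Some (\<gamma>, c)) w)"

lemma virtual_count_simps [simp]:
  "virtual_count \<gamma> [] = 0"
  "virtual_count \<gamma> (None # w) = virtual_count \<gamma> w"
  "virtual_count \<gamma> (Some (a, c) # w) = of_bool (a = \<gamma>) + virtual_count \<gamma> w"
  by (auto simp: virtual_count_def)

text \<open>e_{a,b} creates a row labelled \<gamma> if \<open>a = \<gamma>\<close> and destroys one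
  if \<open>b = \<gamma>\<close>, so only tensors with the resulting count are reached. An empty
  slot obeys the same rule: it is filled only when \<open>b \<in> P\<close>, and then
  \<open>b\<close> is not virtual.\<close>

lemma act_support:
  assumes "virtual \<gamma>" "\<And>p. p \<in> P \<Longrightarrow> \<not> virtual p"
    and "\<And>v. virtual_count \<gamma> v + of_bool (b = \<gamma>) = virtual_count \<gamma> w + of_bool (a = \<gamma>) \<Longrightarrow> \<phi> v = 0"
  shows "act P a b \<phi> w = 0"
  using assms(3)
proof (induction w arbitrary: \<phi>)
  case (Cons x w)
  have "slot_act P a b x (\<lambda>y. \<phi> (y # w)) = 0"
  proof (cases x)
    case None
    then show ?thesis using Cons.prems [of "Some (a, b) # w"] assms by auto
  next
    case (Some y)
    then show ?thesis using Cons.prems [of "Some (a, snd y) # w"] by (cases y) auto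
  qed
  moreover have "act P a b (\<lambda>v. \<phi> (x # v)) w = 0"
  proof (rule Cons.IH)
    fix v assume "virtual_count \<gamma> v + of_bool (b = \<gamma>) = virtual_count \<gamma> w + of_bool (a = \<gamma>)"
    then show "\<phi> (x # v) = 0" by (intro Cons.prems) (cases x; auto)
  qed
  ultimately show ?case by simp
qed simp

lemma act_annihilate:
  assumes "virtual b" "\<And>p. p \<in> P \<Longrightarrow> \<not> virtual p" "virtual_count b w = 0"
  shows "act P a b \<phi> w = 0"
  using assms(3)
proof (induction w arbitrary: \<phi>)
  case (Cons x w)
  have "slot_act P a b x (\<lambda>y. \<phi> (y # w)) = 0"
    using Cons.prems assms by (cases x) (auto split: if_splits)
  moreover have "virtual_count b w = 0" using Cons.prems by (cases x) auto
  ultimately show ?case using Cons.IH by simp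
qed simp

text \<open>The letters meet the tensor from right to left. By the time of the \<open>i\<close>-th
  one, more rows \<gamma> would have been destroyed than were present at the start or created by the
  \<open>i - 1\<close> letters before it.\<close>

lemma acts_irregular:
  assumes "virtual \<gamma>" "\<And>p. p \<in> P \<Longrightarrow> \<not> virtual p"
    and "i \<in> {1..length ws}"
    and "count_list (map snd (take i (rev ws))) \<gamma>
           > virtual_count \<gamma> w + count_list (map fst (take (i - 1) (rev ws))) \<gamma>"
  shows "acts P ws \<phi> w = 0"
  using assms(3,4)
proof (induction ws arbitrary: i w rule: rev_induct)
  case (snoc l u)
  obtain a b where l: "l = (a, b)" by (cases l)
  have "act P a b (acts P u \<phi>) w = 0"
  proof (cases "i = 1")
    case True
    then have "b = \<gamma>" "virtual_count \<gamma> w = 0"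
      using snoc.prems by (auto simp: l split: if_splits)
    then show ?thesis using act_annihilate assms(1,2) by blast
  next
    case False
    then obtain j where j: "i = Suc (Suc j)" using snoc.prems by (cases i; cases "i - 1") auto
    show ?thesis
    proof (rule act_support [OF assms(1,2)])
      fix v assume "virtual_count \<gamma> v + of_bool (b = \<gamma>) = virtual_count \<gamma> w + of_bool (a = \<gamma>)"
      then show "acts P u \<phi> v = 0"
        using snoc.prems by (intro snoc.IH [of "Suc j"]) (auto simp: j l split: if_splits)
    qed
  qed
  then show ?case by (simp add: acts_append l)
qed simp

text \<open>In \<open>y * g\<close> the factor \<open>g\<close> meets the tensor before
  \<open>y\<close> does, which is why the whole left ideal, and not just its generators, acts as
  zero.\<close>

lemma Act_JI:
  assumes "x \<in> JI A" "\<And>p. p \<in> P \<Longrightarrow> \<not> virtual p" "P \<subseteq> odd_syms"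
    and "\<And>\<gamma>. virtual \<gamma> \<Longrightarrow> virtual_count \<gamma> w = 0"
  shows "Act P x \<phi> w = 0"
  using assms(1)
proof (induction rule: LG.induct)
  case (LG_gen y g)
  then obtain ws \<gamma> i where "g = monomial ws" "virtual \<gamma>" "i \<in> {1..length ws}"
    "count_list (map snd (take i (rev ws))) \<gamma> > count_list (map fst (take (i - 1) (rev ws))) \<gamma>"
    by (auto simp: irregular_words_def irregular_def)
  then show ?case
    using acts_irregular [of \<gamma> P i ws w] assms(2,4) by (simp add: Act_mult)
qed (simp_all add: Act_rel_ideal assms(3) Act_add)

lemma virtual_count_None [simp]: "virtual_count \<gamma> (replicate d None) = 0"
  by (induction d) auto

lemma proper_syms_odd: "proper_syms n \<subseteq> odd_syms"
  by (auto simp: proper_syms_def odd_syms_def)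

lemma proper_syms_not_virtual: "p \<in> proper_syms n \<Longrightarrow> \<not> virtual p"
  by (auto simp: proper_syms_def)

text \<open>Directness of the sum of U(gl(n)) and \<open>Irr\<close>: elements of the left ideal
  kill the empty slots, and on proper letters this is detected by \<open>faithful\<close>.\<close>

lemma JI_proper:
  assumes "x \<in> JI A" "x \<in> fcar (proper_syms n)" shows "x \<in> RI (proper_syms n)"
  using assms(2)
  by (rule faithful [OF _ order_refl proper_syms_odd])
    (simp add: Act_JI [OF assms(1) proper_syms_not_virtual proper_syms_odd])

lemma irregular_snoc_proper:
  assumes "irregular ws" "\<not> virtual b" "\<not> virtual a" shows "irregular (ws @ [(a, b)])"
proof -
  obtain \<gamma> i where "virtual \<gamma>" "i \<in> {1..length ws}"
    "count_list (map snd (take i (rev ws))) \<gamma> > count_list (map fst (take (i - 1) (rev ws))) \<gamma>"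
    using assms(1) by (auto simp: irregular_def)
  then show ?thesis
    unfolding irregular_def using assms(2,3)
    by (intro exI [of _ \<gamma>] conjI bexI [of _ "Suc i"]) (cases i; auto)+
qed

text \<open>A proper letter appended on the right shifts the positions but changes no count of a
  virtual symbol, so irregular words stay irregular. This lets commutation with gl(n) pass from a
  virtual sum to its projection.\<close>

lemma JI_rmult_proper:
  assumes "x \<in> JI A" "{a, b} \<subseteq> A" "\<not> virtual a" "\<not> virtual b"
  shows "x * letter a b \<in> JI A"
  using assms(1)
proof (induction rule: LG.induct)
  case (LG_rel x)
  then show ?case using assms(2) by (intro LG.LG_rel rel_ideal_rmult) auto
next
  case (LG_gen y g)
  then obtain ws where "g = monomial ws" "irregular ws" "set ws \<subseteq> A \<times> A"
    by (auto simp: irregular_words_def)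
  then have "g * letter a b \<in> JI A"
    using JI_irregular [of "ws @ [(a, b)]" A] irregular_snoc_proper assms
    by (auto simp: monomial_append)
  then show ?case using LG_lmult [OF _ LG_gen(1)] by (simp add: mult.assoc)
qed (simp add: distrib_right LG_add)

section \<open>Straightening of words\<close>

text \<open>Weight zero for every e_{\<gamma>,\<gamma>} with \<gamma> virtual. Exchanging letters
  and replacing two letters by a term of their bracket preserve it.\<close>

definition balanced :: "(gsym \<times> gsym) list \<Rightarrow> bool" where
  "balanced w \<longleftrightarrow> (\<forall>\<gamma>. virtual \<gamma> \<longrightarrow> count_list (map fst w) \<gamma> = count_list (map snd w) \<gamma>)"

lemma balanced_iff:
  "balanced w \<longleftrightarrow> (\<forall>\<gamma>. virtual \<gamma> \<longrightarrow>
     (\<Sum>l\<leftarrow>w. of_bool (fst l = \<gamma>)) = (\<Sum>l\<leftarrow>w. of_bool (snd l = \<gamma>) :: int))"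
proof -
  have "int (count_list (map f w) \<gamma>) = (\<Sum>l\<leftarrow>w. of_bool (f l = \<gamma>))" for f :: "gsym \<times> gsym \<Rightarrow> gsym" and \<gamma>
    by (induction w) auto
  from this [of fst] this [of snd] show ?thesis
    unfolding balanced_def by (metis of_nat_eq_iff)
qed

abbreviation LI :: "nat \<Rightarrow> falg set" where
  "LI N \<equiv> LG (proper_syms N) ((\<lambda>i. letter (Proper i) (Proper N)) ` {1..N})"

lemma irregular_snoc_virtual: "virtual \<gamma> \<Longrightarrow> irregular (w @ [(a, \<gamma>)])"
  unfolding irregular_def by (intro exI [of _ \<gamma>] conjI bexI [of _ 1]) auto

text \<open>
  Letters with virtual second index are moved to the right, where they make a word irregular;
  the letters they produce on the way shorten the word. If the last letter is \<open>e\<^bsub>x,N\<^esub>\<close>, every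
  word obtained ends in some \<open>e\<^bsub>y,N\<^esub>\<close> or is irregular.
\<close>

lemma straighten:
  assumes A: "\<And>a. a \<in> A \<Longrightarrow> \<not> virtual a \<Longrightarrow> a \<in> proper_syms N"
    and "set w \<subseteq> A \<times> A" "balanced w"
  obtains u where "u \<in> fcar (proper_syms N)" "monomial w - u \<in> JI A"
    "w \<noteq> [] \<Longrightarrow> snd (last w) = Proper N \<or> virtual (snd (last w)) \<Longrightarrow> u \<in> LI N"
proof -
  define ok where "ok w u \<longleftrightarrow> u \<in> fcar (proper_syms N) \<and> monomial w - u \<in> JI A \<and>
     (w \<noteq> [] \<longrightarrow> snd (last w) = Proper N \<or> virtual (snd (last w)) \<longrightarrow> u \<in> LI N)" for w u
  have sub: "x \<in> fcar (proper_syms N)" if "x \<in> LI N" for x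
    using that by (rule LG_carrier)
  have "\<exists>u. ok w u"
    using assms(2,3)
  proof (induction "length w" arbitrary: w rule: less_induct)
    case less
    show ?case
    proof (cases "\<forall>l\<in>set w. \<not> virtual (snd l)")
      case True
      \<comment> \<open>By balance, a virtual first index would also have to occur as a second
        index.\<close>
      have "\<not> virtual (fst l)" if "l \<in> set w" for l
      proof
        assume v: "virtual (fst l)"
        have "count_list (map fst w) (fst l) = count_list (map snd w) (fst l)"
          using less.prems v by (auto simp: balanced_def)
        moreover have "count_list (map snd w) (fst l) = 0"
          using True v by (auto simp: count_list_0_iff)
        ultimately show False using that by (auto simp: count_list_0_iff)
      qed
      then have ws: "set w \<subseteq> proper_syms N \<times> proper_syms N"
        using True less.prems A by fastforce
      have "monomial w \<in> LI N" if w: "w \<noteq> []" and ends: "snd (last w) = Proper N"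
      proof -
        obtain x where x: "last w = (x, Proper N)" using ends by (metis prod.collapse)
        then obtain i where i: "x = Proper i" "i \<in> {1..N}"
          using ws last_in_set [OF w] by (auto simp: proper_syms_def)
        have eq: "monomial w = monomial (butlast w) * letter x (Proper N)"
          using w x by (metis append_butlast_last_id monomial_append)
        have "set (butlast w) \<subseteq> proper_syms N \<times> proper_syms N"
          using ws by (meson in_set_butlastD subset_iff)
        moreover have "(x, Proper N) \<in> proper_syms N \<times> proper_syms N"
          using ws last_in_set [OF w] x by auto
        ultimately show ?thesis
          unfolding eq using i by (intro LG_gen) auto
      qed
      then have "ok w (monomial w)"
        using ws True by (auto simp: ok_def)
      then show ?thesis by blast
    next
      case False
      then obtain l where "l \<in> set w" "virtual (snd l)" by blast
      then obtain w1 a \<gamma> w2 where w: "w = w1 @ (a, \<gamma>) # w2" and \<gamma>: "virtual \<gamma>"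
        by (metis split_list prod.collapse)
      have IH: "\<exists>u. ok v u" if "length v < length w" "set v \<subseteq> A \<times> A" "balanced v" for v
        using that by (intro less.hyps) auto
      \<comment> \<open>Inner induction on what stands to the right of the virtual letter;
        \<open>w1\<close> varies, since each exchange moves a letter over to it. The bracket terms
        are shorter and fall under the outer induction.\<close>
      have "\<exists>u. ok v u" if "v = w1 @ (a, \<gamma>) # w2" "set v \<subseteq> A \<times> A" "balanced v" "length v = length w" for v w1
        using that
      proof (induction w2 arbitrary: v w1)
        case Nil
        then have "monomial v \<in> JI A"
          using \<gamma> by (auto intro!: JI_irregular irregular_snoc_virtual)
        then have "ok v 0" by (simp add: ok_def)
        then show ?case by blast
      next
        case (Cons l w3)
        obtain c d where l: "l = (c, d)" by (cases l)
        define v1 where "v1 = w1 @ (c, d) # (a, \<gamma>) # w3"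
        define v2 where "v2 = w1 @ (a, d) # w3"
        define v3 where "v3 = w1 @ (c, \<gamma>) # w3"
        let ?s = "super_sign a \<gamma> c d"
        have sets: "set v1 \<subseteq> A \<times> A" "set v2 \<subseteq> A \<times> A" "set v3 \<subseteq> A \<times> A" "{a,\<gamma>,c,d} \<subseteq> A"
          and sets': "set w1 \<subseteq> A \<times> A" "set w3 \<subseteq> A \<times> A"
          using Cons.prems(1,2) by (auto simp: v1_def v2_def v3_def l)
        have bal: "balanced v1" "\<gamma> = c \<Longrightarrow> balanced v2" "a = d \<Longrightarrow> balanced v3"
          using Cons.prems(1,3)
          by (simp_all add: v1_def v2_def v3_def l balanced_iff algebra_simps)
        have len: "length v1 = length w" "length v2 < length w" "length v3 < length w"
          using Cons.prems(1,4) by (auto simp: v1_def v2_def v3_def)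
        have "v1 = (w1 @ [(c, d)]) @ (a, \<gamma>) # w3" by (simp add: v1_def)
        then obtain u1 where u1: "ok v1 u1"
          using Cons.IH [of v1] sets bal len by blast
        obtain u2 where u2: "\<gamma> = c \<Longrightarrow> ok v2 u2"
          using IH [of v2] sets bal len by blast
        obtain u3 where u3: "a = d \<Longrightarrow> ok v3 u3"
          using IH [of v3] sets bal len by blast
        define u where "u = ?s * u1 + (if \<gamma> = c then u2 else 0) - ?s * (if a = d then u3 else 0)"
        have u_car: "u \<in> fcar (proper_syms N)"
          unfolding u_def using u1 u2 u3 by (intro fcar_diff fcar_add fcar_mult fcar_super_sign) (auto simp: ok_def)
        \<comment> \<open>If \<open>w3\<close> is empty, the new last letter has second index
          \<gamma> or \<open>d\<close>, where \<open>d\<close> is the one of the old last letter;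
          otherwise the last letter is unchanged. So the condition on the end of the word is
          inherited.\<close>
        have last: "(v1 \<noteq> [] \<and> (snd (last v1) = Proper N \<or> virtual (snd (last v1))))"
            "v2 \<noteq> [] \<and> (snd (last v2) = Proper N \<or> virtual (snd (last v2)))"
            "v3 \<noteq> [] \<and> (snd (last v3) = Proper N \<or> virtual (snd (last v3)))"
          if "snd (last v) = Proper N \<or> virtual (snd (last v))"
          using that \<gamma> Cons.prems(1) by (auto simp: v1_def v2_def v3_def l)
        have u_LI: "u \<in> LI N" if "snd (last v) = Proper N \<or> virtual (snd (last v))"
          unfolding u_def using last [OF that] u1 u2 u3
          by (intro LG_diff LG_add LG_lmult fcar_super_sign) (auto simp: ok_def)
        have "monomial w1 * (letter a \<gamma> * letter c d - ?s * (letter c d * letter a \<gamma>) - gl_bracket a \<gamma> c d)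
             * monomial w3 \<in> RI A"
          using sets sets' by (intro rel_ideal_rmult rel_ideal_lmult relator_in_rel_ideal) auto
        also have "monomial w1 * (letter a \<gamma> * letter c d - ?s * (letter c d * letter a \<gamma>) - gl_bracket a \<gamma> c d)
             * monomial w3 = monomial v - ?s * monomial v1 - (if \<gamma> = c then monomial v2 else 0)
               + ?s * (if a = d then monomial v3 else 0)"
        proof -
          have s: "x * (?s * y) = ?s * (x * y)" for x y
            unfolding super_sign_scalar by (metis mult.assoc scalar_commute)
          have "monomial v = monomial w1 * (letter a \<gamma> * (letter c d * monomial w3))"
            "monomial v1 = monomial w1 * (letter c d * (letter a \<gamma> * monomial w3))"
            "monomial v2 = monomial w1 * (letter a d * monomial w3)"
            "monomial v3 = monomial w1 * (letter c \<gamma> * monomial w3)"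
            by (simp_all add: Cons.prems(1) l v1_def v2_def v3_def flip: monomial_append)
          then show ?thesis
            by (simp add: gl_bracket_def algebra_simps s)
        qed
        finally have 0: "monomial v - ?s * monomial v1 - (if \<gamma> = c then monomial v2 else 0)
               + ?s * (if a = d then monomial v3 else 0) \<in> JI A"
          by (rule LG_rel)
        have 1: "?s * (monomial v1 - u1) \<in> JI A"
          using u1 by (intro LG_lmult) (auto simp: ok_def)
        have 2: "(if \<gamma> = c then monomial v2 - u2 else 0) \<in> JI A"
          using u2 by (auto simp: ok_def)
        have 3: "?s * (if a = d then monomial v3 - u3 else 0) \<in> JI A"
          using u3 by (intro LG_lmult) (auto simp: ok_def)
        have "monomial v - u = (monomial v - ?s * monomial v1 - (if \<gamma> = c then monomial v2 else 0)
               + ?s * (if a = d then monomial v3 else 0)) + ?s * (monomial v1 - u1)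
             + (if \<gamma> = c then monomial v2 - u2 else 0) - ?s * (if a = d then monomial v3 - u3 else 0)"
          by (auto simp: u_def algebra_simps)
        also have "\<dots> \<in> JI A"
          by (intro LG_diff [OF LG_add [OF LG_add [OF 0 1] 2] 3])
        finally have "ok v u"
          using u_car u_LI by (simp add: ok_def)
        then show ?case by blast
      qed
      from this [OF w less.prems refl] show ?thesis .
    qed
  qed
  then show ?thesis using that by (auto simp: ok_def)
qed

lemma syms_cases: "a \<in> syms m0 m1 n \<Longrightarrow> \<not> virtual a \<Longrightarrow> a \<in> proper_syms n"
  by (auto simp: syms_def)

lemma proper_syms_subset_syms: "proper_syms n \<subseteq> syms m0 m1 n"
  by (auto simp: syms_def)

text \<open>Two representatives congruent to the word differ by an element of \<open>JI\<close> in
  proper letters, which is a relation by \<open>JI_proper\<close>. This resolves the definite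
  description in \<open>devirt\<close>.\<close>

lemma devirt_mon_eq:
  assumes w: "set w \<subseteq> syms m0 m1 n \<times> syms m0 m1 n"
    and u: "u \<in> fcar (proper_syms n)" "monomial w - u \<in> JI (syms m0 m1 n)"
  shows "devirt_mon m0 m1 n w = cls (proper_syms n) u"
  unfolding devirt_mon_def devirt_def
proof (rule the_equality)
  let ?A = "syms m0 m1 n"
  have w': "monomial w \<in> fcar ?A" using w by simp
  have *: "cls ?A (monomial w) \<ominus>\<^bsub>UE ?A\<^esub> incl ?A (cls (proper_syms n) v) \<in> Irr m0 m1 n
     \<longleftrightarrow> monomial w - v \<in> JI ?A" if "v \<in> fcar (proper_syms n)" for v
  proof -
    have v: "v \<in> fcar ?A" using that proper_syms_subset_syms by (rule fcar_mono [rotated])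
    then show ?thesis
      using Irr_cls_iff [of "monomial w - v"] w'
      by (simp add: incl_cls [OF proper_syms_subset_syms] UE_minus fcar_diff)
  qed
  show "cls (proper_syms n) u \<in> carrier (Ugl n) \<and>
    cls ?A (monomial w) \<ominus>\<^bsub>UE ?A\<^esub> incl ?A (cls (proper_syms n) u) \<in> Irr m0 m1 n"
    using u * by (auto simp: UE_simps)
  fix U assume U: "U \<in> carrier (Ugl n) \<and>
    cls ?A (monomial w) \<ominus>\<^bsub>UE ?A\<^esub> incl ?A U \<in> Irr m0 m1 n"
  then obtain v where v: "U = cls (proper_syms n) v" "v \<in> fcar (proper_syms n)"
    by (auto simp: UE_simps)
  then have "monomial w - v \<in> JI ?A" using U * by simp
  from LG_diff [OF u(2) this] have "v - u \<in> JI ?A" by simp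
  then have "v - u \<in> RI (proper_syms n)"
    by (rule JI_proper) (use u v in auto)
  then show "U = cls (proper_syms n) u" by (simp add: v cls_eq_iff)
qed

section \<open>Central elements and the Olshanski decomposition\<close>

text \<open>The bracket with an even e_{a,b}, where every sign is 1; \<open>ad_word\<close> extends
  it to words as a derivation.\<close>

fun bracket_letter :: "gsym \<Rightarrow> gsym \<Rightarrow> gsym \<times> gsym \<Rightarrow> falg" where
  "bracket_letter a b (c, d) = (if b = c then letter a d else 0) - (if a = d then letter c b else 0)"

fun ad_word :: "gsym \<Rightarrow> gsym \<Rightarrow> (gsym \<times> gsym) list \<Rightarrow> falg" where
  "ad_word a b [] = 0"
| "ad_word a b (l # w) = bracket_letter a b l * monomial w + monomial [l] * ad_word a b w"

lemma ad_word_append: "ad_word a b (u @ v) = ad_word a b u * monomial v + monomial u * ad_word a b v"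
proof (induction u)
  case (Cons l u)
  then show ?case
    by (simp add: monomial_Cons [of l u] monomial_append algebra_simps)
qed (simp add: monomial_Nil)

lemma commutator_monomial:
  assumes "{a, b} \<subseteq> A" "even (parity a + parity b)" "set w \<subseteq> A \<times> A"
  shows "letter a b * monomial w - monomial w * letter a b - ad_word a b w \<in> RI A"
  using assms(3)
proof (induction w)
  case (Cons l w)
  obtain c d where l: "l = (c, d)" by (cases l)
  have "letter a b * letter c d - letter c d * letter a b - bracket_letter a b l \<in> RI A"
    using relator_in_rel_ideal [of a A b c d] assms Cons.prems
    by (simp add: l gl_bracket_def super_sign_def)
  then have "(letter a b * letter c d - letter c d * letter a b - bracket_letter a b l) * monomial w \<in> RI A"
    using Cons.prems by (intro rel_ideal_rmult) auto
  moreover have "letter c d * (letter a b * monomial w - monomial w * letter a b - ad_word a b w) \<in> RI A"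
    using Cons by (intro rel_ideal_lmult) (auto simp: l)
  ultimately have "(letter a b * letter c d - letter c d * letter a b - bracket_letter a b l) * monomial w
    + letter c d * (letter a b * monomial w - monomial w * letter a b - ad_word a b w) \<in> RI A"
    by (rule rel_ideal_add)
  then show ?case
    by (simp add: l monomial_Cons [of _ w] algebra_simps)
qed (simp add: monomial_Nil)

section \<open>Representatives of central elements\<close>

definition central :: "nat \<Rightarrow> falg \<Rightarrow> bool" where
  "central n z \<longleftrightarrow> z \<in> fcar (proper_syms n) \<and>
     (\<forall>i\<in>{1..n}. \<forall>j\<in>{1..n}. letter (Proper i) (Proper j) * z - z * letter (Proper i) (Proper j)
        \<in> RI (proper_syms n))"

lemma centralD:
  assumes "central n z" "x \<in> fcar (proper_syms n)"
  shows "x * z - z * x \<in> RI (proper_syms n)"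
  using assms(2)
proof (induction rule: fcar_induct)
  case (add x y)
  then show ?case
    using rel_ideal_add [of "x * z - z * x" _ "y * z - z * y"] by (simp add: algebra_simps)
next
  case (monomial c w)
  have "monomial w * z - z * monomial w \<in> RI (proper_syms n)"
    using monomial
  proof (induction w)
    case (Cons l w)
    then obtain i j where l: "l = (Proper i, Proper j)" "i \<in> {1..n}" "j \<in> {1..n}"
      by (auto simp: proper_syms_def)
    have "monomial [l] * (monomial w * z - z * monomial w) \<in> RI (proper_syms n)"
      using Cons by (intro rel_ideal_lmult) auto
    moreover have "(monomial [l] * z - z * monomial [l]) * monomial w \<in> RI (proper_syms n)"
      using Cons.prems assms(1) l by (intro rel_ideal_rmult) (auto simp: central_def)
    ultimately have "monomial [l] * (monomial w * z - z * monomial w)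
      + (monomial [l] * z - z * monomial [l]) * monomial w \<in> RI (proper_syms n)"
      by (rule rel_ideal_add)
    then show ?case by (simp add: monomial_Cons [of l w] algebra_simps)
  qed (simp add: monomial_Nil)
  then have "scalar c * (monomial w * z - z * monomial w) \<in> RI (proper_syms n)"
    by (rule rel_ideal_lmult [rotated]) simp
  moreover have "z * (scalar c * monomial w) = scalar c * (z * monomial w)"
    by (metis mult.assoc scalar_commute)
  ultimately show ?case by (simp add: right_diff_distrib mult.assoc)
qed simp

lemma central_carrier: "central n z \<Longrightarrow> z \<in> fcar (proper_syms n)"
  by (simp add: central_def)

lemma zeta_cls_iff:
  assumes "z \<in> fcar (proper_syms n)"
  shows "cls (proper_syms n) z \<in> zeta n \<longleftrightarrow> central n z"
proof
  assume "central n z"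
  then show "cls (proper_syms n) z \<in> zeta n"
    using centralD [of n z] rel_ideal_uminus
    by (fastforce simp: zeta_def centralizer_def UE_simps assms cls_eq_iff)
next
  assume z: "cls (proper_syms n) z \<in> zeta n"
  have "letter (Proper i) (Proper j) * z - z * letter (Proper i) (Proper j) \<in> RI (proper_syms n)"
    if "i \<in> {1..n}" "j \<in> {1..n}" for i j
  proof -
    have ij: "letter (Proper i) (Proper j) \<in> fcar (proper_syms n)"
      using that by (auto simp: proper_syms_def)
    then have "cls (proper_syms n) (letter (Proper i) (Proper j)) \<in> carrier (Ugl n)"
      by (simp add: UE_simps)
    with z have "cls (proper_syms n) z \<otimes>\<^bsub>Ugl n\<^esub> cls (proper_syms n) (letter (Proper i) (Proper j))
       = cls (proper_syms n) (letter (Proper i) (Proper j)) \<otimes>\<^bsub>Ugl n\<^esub> cls (proper_syms n) z"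
      by (simp add: zeta_def centralizer_def)
    then have "z * letter (Proper i) (Proper j) - letter (Proper i) (Proper j) * z \<in> RI (proper_syms n)"
      using ij assms by (simp add: UE_simps cls_eq_iff)
    then show ?thesis using rel_ideal_uminus by fastforce
  qed
  with assms show "central n z" by (simp add: central_def)
qed

lemma zeta_cases:
  assumes "\<rho> \<in> zeta n" obtains z where "central n z" "\<rho> = cls (proper_syms n) z"
proof -
  obtain z where "z \<in> fcar (proper_syms n)" "\<rho> = cls (proper_syms n) z"
    using assms by (auto simp: zeta_def centralizer_def UE_simps)
  with assms zeta_cls_iff that show ?thesis by blast
qed

lemma central_cong:
  assumes "central n z" "y \<in> fcar (proper_syms n)" "z - y \<in> RI (proper_syms n)"
  shows "central n y"
  using assms zeta_cls_iff [of z n] zeta_cls_iff [of y n] central_carrier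
  by (metis cls_eq_iff)

lemma central_add:
  assumes "central n x" "central n y" shows "central n (x + y)"
proof -
  have "a * (x + y) - (x + y) * a = (a * x - x * a) + (a * y - y * a)" for a
    by (simp add: algebra_simps)
  with assms show ?thesis by (auto simp: central_def rel_ideal_add)
qed

lemma central_mult:
  assumes "central n x" "central n y" shows "central n (x * y)"
  unfolding central_def
proof (intro conjI ballI)
  fix i j assume "i \<in> {1..n}" "j \<in> {1..n}"
  let ?a = "letter (Proper i) (Proper j)"
  have "(?a * x - x * ?a) * y + x * (?a * y - y * ?a) \<in> RI (proper_syms n)"
    using assms \<open>i \<in> {1..n}\<close> \<open>j \<in> {1..n}\<close>
    by (intro rel_ideal_add rel_ideal_lmult rel_ideal_rmult) (auto simp: central_def)
  then show "?a * (x * y) - x * y * ?a \<in> RI (proper_syms n)"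
    by (simp add: algebra_simps)
qed (use assms central_carrier in auto)

lemma central_scalar: "central n (scalar c)"
  using scalar_commute by (simp add: central_def)

lemma central_uminus: "central n x \<Longrightarrow> central n (- x)"
  using central_mult [OF central_scalar [of n "- 1"]] by (simp add: scalar_uminus)

lemma central_diff: "central n x \<Longrightarrow> central n y \<Longrightarrow> central n (x - y)"
  using central_add [OF _ central_uminus, of n x y] by simp

text \<open>For e_{i,j} in gl(n), both products with \<open>x - u\<close> stay in the ideal, so the
  commutator with \<open>u\<close> lies in \<open>JI\<close>. It involves proper letters only and is
  therefore a relation.\<close>

lemma central_devirtualized:
  assumes u: "u \<in> fcar (proper_syms n)" "x - u \<in> JI A" and A: "proper_syms n \<subseteq> A"
    and x: "\<And>i j. i \<in> {1..n} \<Longrightarrow> j \<in> {1..n} \<Longrightarrow>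
      letter (Proper i) (Proper j) * x - x * letter (Proper i) (Proper j) \<in> RI A"
  shows "central n u"
  unfolding central_def
proof (intro conjI ballI)
  fix i j assume ij: "i \<in> {1..n}" "j \<in> {1..n}"
  let ?a = "letter (Proper i) (Proper j)"
  have s: "Proper i \<in> proper_syms n" "Proper j \<in> proper_syms n"
    using ij by (auto simp: proper_syms_def)
  have "?a * (x - u) \<in> JI A" "(x - u) * ?a \<in> JI A"
    using s A by (intro LG_lmult [OF u(2)] JI_rmult_proper [OF u(2)]; auto)+
  from LG_diff [OF LG_rel [OF x [OF ij]] LG_diff [OF this]]
  have "?a * u - u * ?a \<in> JI A" by (simp add: algebra_simps)
  then show "?a * u - u * ?a \<in> RI (proper_syms n)"
    using s by (intro JI_proper fcar_diff fcar_mult u) auto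
qed (rule u)

lemma proper_syms_mono: "n \<le> m \<Longrightarrow> proper_syms n \<subseteq> proper_syms m"
  by (auto simp: proper_syms_def)

section \<open>The left ideal generated by the last column\<close>

lemma act_None:
  assumes "b \<notin> P" shows "act P a b \<phi> (replicate d None) = 0"
  by (induction d arbitrary: \<phi>) (simp_all add: assms)

text \<open>In the module whose columns are \<open>1, ..., n\<close>, the letters e_{i,N} cannot
  fill an empty slot, so the left ideal kills the empty slots. Thus U(gl(n)) meets it in zero
  only.\<close>

lemma LI_proper:
  assumes "x \<in> LI N" "n < N" "x \<in> fcar (proper_syms n)" shows "x \<in> RI (proper_syms n)"
proof (rule faithful [OF assms(3) order_refl proper_syms_odd])
  fix M
  have "Act (proper_syms n) x \<phi> (replicate d None) = 0" for d \<phi>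
    using assms(1)
  proof (induction rule: LG.induct)
    case (LG_gen y g)
    have "Proper N \<notin> proper_syms n" using assms(2) by (auto simp: proper_syms_def)
    with LG_gen show ?case by (auto simp: Act_mult act_None)
  qed (simp_all add: Act_rel_ideal proper_syms_odd Act_add)
  then show "Act (proper_syms n) x (test_fun M) (replicate (size M) None) = 0" .
qed

text \<open>For \<open>i, j < N\<close>, the product e_{k,N} e_{i,j} equals e_{i,j} e_{k,N} minus
  e_{i,N} if \<open>k = j\<close>. So the left ideal is stable under right multiplication by
  U(gl(n)).\<close>

lemma LI_rmult:
  assumes "x \<in> LI N" "n < N" "y \<in> fcar (proper_syms n)" shows "x * y \<in> LI N"
proof -
  let ?A = "proper_syms N"
  have 1: "x * letter (Proper i) (Proper j) \<in> LI N" if ij: "i \<in> {1..n}" "j \<in> {1..n}" and "x \<in> LI N" for x i j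
    using that(3)
  proof (induction rule: LG.induct)
    case (LG_rel x)
    then show ?case using ij assms(2) by (intro LG.LG_rel rel_ideal_rmult) (auto simp: proper_syms_def)
  next
    case (LG_gen y g)
    then obtain k where k: "g = letter (Proper k) (Proper N)" "k \<in> {1..N}" by blast
    let ?x = "letter (Proper i) (Proper j)" and ?c = "if k = j then letter (Proper i) (Proper N) else 0"
    have 1: "g * ?x - ?x * g + ?c \<in> RI ?A"
      using swap_even [of "Proper k" "Proper N" "Proper i" "Proper j" ?A] k ij assms(2) proper_syms_odd [of N]
      by (auto simp: proper_syms_def)
    have 2: "?x * g \<in> LI N"
      using LG_gen ij assms(2) by (intro LG.LG_gen) (auto simp: proper_syms_def)
    have 3: "?c \<in> LI N"
      using LG.LG_gen [of 1 ?A "letter (Proper i) (Proper N)"] ij assms(2)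
      by (auto simp: proper_syms_def)
    have "g * ?x \<in> LI N"
      using LG_diff [OF LG_add [OF LG.LG_rel [OF 1] 2] 3] by simp
    then show ?case using LG_lmult [OF _ LG_gen(1)] by (simp add: mult.assoc)
  qed (simp add: distrib_right LG_add)
  from assms(3,1) show ?thesis
  proof (induction arbitrary: x rule: fcar_induct)
    case (monomial c w)
    have "x * scalar c \<in> LI N"
      using LG_lmult [OF monomial.prems, of "scalar c"] by (simp add: scalar_commute)
    then have "x * scalar c * monomial w \<in> LI N"
      using monomial(1)
    proof (induction w rule: rev_induct)
      case (snoc l w)
      then obtain i j where "l = (Proper i, Proper j)" "i \<in> {1..n}" "j \<in> {1..n}"
        by (auto simp: proper_syms_def)
      with snoc 1 show ?case by (simp add: monomial_append flip: mult.assoc)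
    qed (simp add: monomial_Nil)
    then show ?case by (simp add: mult.assoc)
  qed (auto simp: distrib_left LG_add)
qed

lemma I_ideal_cls_iff:
  assumes "x \<in> fcar (proper_syms N)"
  shows "cls (proper_syms N) x \<in> I_ideal N \<longleftrightarrow> x \<in> LI N"
proof -
  let ?G = "(\<lambda>i. letter (Proper i) (Proper N)) ` {1..N}"
  have "?G \<subseteq> fcar (proper_syms N)" by (auto simp: proper_syms_def)
  from gen_left_ideal_cls_iff [OF this assms] show ?thesis
    by (simp add: I_ideal_def image_image)
qed

text \<open>\<open>z'\<close> represents the component in \<open>U(gl(n))\<close> of the element represented by \<open>z\<close>.\<close>

definition olsh :: "nat \<Rightarrow> falg \<Rightarrow> falg \<Rightarrow> bool" where
  "olsh n z z' \<longleftrightarrow> z \<in> fcar (proper_syms (n + 1)) \<and> z' \<in> fcar (proper_syms n) \<and> z - z' \<in> LI (n + 1)"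

text \<open>Makes the passage from \<open>z\<close> to \<open>z'\<close> a well-defined map on
  classes.\<close>

lemma olsh_unique:
  assumes "olsh n x x'" "olsh n y y'" "x - y \<in> RI (proper_syms (n + 1))"
  shows "x' - y' \<in> RI (proper_syms n)"
proof (rule LI_proper [of _ "n + 1"])
  have "x - x' \<in> LI (n + 1)" "y - y' \<in> LI (n + 1)"
    using assms by (auto simp: olsh_def)
  from LG_add [OF LG_diff [OF LG_rel [OF assms(3)] this(1)] this(2)]
  have "(x - y) - (x - x') + (y - y') \<in> LI (n + 1)" .
  then show "x' - y' \<in> LI (n + 1)" by simp
qed (use assms in \<open>auto simp: olsh_def\<close>)

lemma olsh_add:
  assumes "olsh n x x'" "olsh n y y'" shows "olsh n (x + y) (x' + y')"
  using assms LG_add [of "x - x'" _ _ "y - y'"] by (auto simp: olsh_def algebra_simps)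

text \<open>Since \<open>x * y - x' * y' = (x - x') * y' + x * (y - y')\<close>, multiplicativity
  rests on \<open>LI_rmult\<close> for the first summand and on the left ideal property for the
  second.\<close>

lemma olsh_mult:
  assumes "olsh n x x'" "olsh n y y'" shows "olsh n (x * y) (x' * y')"
proof -
  have "(x - x') * y' + x * (y - y') \<in> LI (n + 1)"
    using assms by (intro LG_add LG_lmult LI_rmult [of _ _ n]) (auto simp: olsh_def)
  then show ?thesis using assms by (auto simp: olsh_def algebra_simps)
qed

lemma olsh_scalar: "olsh n (scalar c) (scalar c)"
  by (simp add: olsh_def)

text \<open>Commutators of gl(n) with \<open>z\<close> are relations and those with
  \<open>z - z'\<close> lie in the left ideal; so the commutators with \<open>z'\<close> lie there
  too, and being in U(gl(n)) they vanish by \<open>LI_proper\<close>.\<close>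

lemma olsh_central:
  assumes "olsh n z z'" "central (n + 1) z" shows "central n z'"
  unfolding central_def
proof (intro conjI ballI)
  fix i j assume ij: "i \<in> {1..n}" "j \<in> {1..n}"
  let ?a = "letter (Proper i) (Proper j)"
  have a: "?a \<in> fcar (proper_syms n)" "?a \<in> fcar (proper_syms (n + 1))"
    using ij by (auto simp: proper_syms_def)
  have "?a * z - z * ?a \<in> LI (n + 1)"
    using centralD [OF assms(2) a(2)] by (rule LG_rel)
  moreover have d: "z - z' \<in> LI (n + 1)"
    using assms(1) by (simp add: olsh_def)
  ultimately have "(?a * z - z * ?a) - (?a * (z - z') - (z - z') * ?a) \<in> LI (n + 1)"
    using LG_lmult [OF d a(2)] LI_rmult [OF d _ a(1)] by (intro LG_diff [of "_ - _" _ _ "_ - _"] LG_diff [of "_ * (_ - _)"]) simp_all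
  then have "?a * z' - z' * ?a \<in> LI (n + 1)" by (simp add: algebra_simps)
  then show "?a * z' - z' * ?a \<in> RI (proper_syms n)"
    using assms(1) a(1) by (intro LI_proper [of _ "n + 1"] fcar_diff fcar_mult) (simp_all add: olsh_def)
qed (use assms in \<open>simp add: olsh_def\<close>)

text \<open>What remains is that \<open>z - z'\<close> centralizes e_{n+1,n+1}: \<open>z\<close>
  does because it is central, and \<open>z'\<close> because it is written in letters that do not
  involve the index n+1.\<close>

lemma olshanski_cls:
  assumes "olsh n z z'" "central (n + 1) z"
  shows "olshanski n (cls (proper_syms (n + 1)) z) (cls (proper_syms n) z')
    (gl_diff n (cls (proper_syms (n + 1)) z) (cls (proper_syms n) z'))"
proof -
  let ?A = "proper_syms (n + 1)"
  have sub: "proper_syms n \<subseteq> ?A" by (simp add: proper_syms_mono)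
  have z: "z \<in> fcar ?A" "z' \<in> fcar ?A" "z' \<in> fcar (proper_syms n)" "z - z' \<in> LI (n + 1)"
    using assms fcar_mono [OF sub] by (auto simp: olsh_def)
  have diff: "gl_diff n (cls ?A z) (cls (proper_syms n) z') = cls ?A (z - z')"
    unfolding gl_diff_def incl_cls [OF sub] using z by (simp add: UE_minus)
  let ?e = "letter (Proper (n + 1)) (Proper (n + 1))"
  have e: "?e \<in> fcar ?A" by (auto simp: proper_syms_def)
  have "?e * z' - z' * ?e \<in> RI ?A"
    using z(3)
  proof (induction rule: fcar_induct)
    case (add x y)
    then show ?case
      using rel_ideal_add [of "?e * x - x * ?e" _ "?e * y - y * ?e"] by (simp add: algebra_simps)
  next
    case (monomial c w)
    have "set w \<subseteq> ?A \<times> ?A" using monomial sub by auto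
    then have "?e * monomial w - monomial w * ?e - ad_word (Proper (n + 1)) (Proper (n + 1)) w \<in> RI ?A"
      by (intro commutator_monomial) (auto simp: proper_syms_def)
    moreover have "ad_word (Proper (n + 1)) (Proper (n + 1)) w = 0"
      using monomial by (induction w) (auto simp: proper_syms_def)
    ultimately have "scalar c * (?e * monomial w - monomial w * ?e) \<in> RI ?A"
      by (intro rel_ideal_lmult) auto
    moreover have "?e * (scalar c * monomial w) = scalar c * (?e * monomial w)"
      by (metis mult.assoc scalar_commute)
    ultimately show ?case by (simp add: right_diff_distrib mult.assoc)
  qed simp
  moreover have "?e * z - z * ?e \<in> RI ?A"
    using centralD [OF assms(2) e] .
  ultimately have "(?e * z' - z' * ?e) - (?e * z - z * ?e) \<in> RI ?A"
    by (rule rel_ideal_diff)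
  then have "(z - z') * ?e - ?e * (z - z') \<in> RI ?A"
    by (simp add: algebra_simps)
  then have "cls ?A (z - z') \<in> U0 (n + 1)"
    using z e imageI [OF fcar_diff [OF z(1,2)], of "cls ?A"]
    by (simp add: U0_def centralizer_def UE_simps fcar_diff cls_eq_iff)
  then have "cls ?A (z - z') \<in> I0_ideal (n + 1)"
    using I_ideal_cls_iff [of "z - z'" "n + 1"] z by (simp add: I0_ideal_def fcar_diff)
  moreover have "cls ?A z \<in> zeta (n + 1)" "cls (proper_syms n) z' \<in> zeta n"
    using zeta_cls_iff assms olsh_central [OF assms] z by auto
  ultimately show ?thesis
    unfolding olshanski_def diff incl_cls [OF sub] using z by (simp add: UE_simps fcar_diff)
qed

section \<open>Invariant sums of virtual words\<close>

text \<open>A tableau entry paired with the virtual symbol in the same cell; it is read as e_{s,v}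
  on the left and as e_{v,s} on the right.\<close>

type_synonym cells = "(nat \<times> gsym) list"

definition left_word :: "cells \<Rightarrow> (gsym \<times> gsym) list" where
  "left_word z = map (\<lambda>(s, v). (Proper s, v)) z"

definition right_word :: "cells \<Rightarrow> (gsym \<times> gsym) list" where
  "right_word z = map (\<lambda>(s, v). (v, Proper s)) z"

lemma left_word_simps [simp]:
  "left_word [] = []" "left_word ((s, v) # z) = (Proper s, v) # left_word z"
  "left_word (y @ z) = left_word y @ left_word z"
  by (simp_all add: left_word_def)

lemma right_word_simps [simp]:
  "right_word [] = []" "right_word ((s, v) # z) = (v, Proper s) # right_word z"
  "right_word (y @ z) = right_word y @ right_word z"
  by (simp_all add: right_word_def)

definition virtual_word :: "(gsym \<times> gsym) list \<Rightarrow> cells \<Rightarrow> (gsym \<times> gsym) list" where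
  "virtual_word X z = left_word z @ X @ right_word z"

definition virtual_cells :: "gsym set \<Rightarrow> cells set" where
  "virtual_cells A = {z. \<forall>(s, v)\<in>set z. Proper s \<in> A \<and> v \<in> A \<and> virtual v}"

lemma virtual_cells_simps [simp]:
  "[] \<in> virtual_cells A"
  "(s, v) # z \<in> virtual_cells A \<longleftrightarrow> Proper s \<in> A \<and> v \<in> A \<and> virtual v \<and> z \<in> virtual_cells A"
  "y @ z \<in> virtual_cells A \<longleftrightarrow> y \<in> virtual_cells A \<and> z \<in> virtual_cells A"
  by (auto simp: virtual_cells_def)

lemma virtual_cells_words:
  assumes "z \<in> virtual_cells A"
  shows "set (left_word z) \<subseteq> A \<times> A" "set (right_word z) \<subseteq> A \<times> A"
  using assms by (induction z) auto

lemma swap_super: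
  assumes "{a, b, c, d} \<subseteq> A" "b \<noteq> c" "a \<noteq> d"
  shows "letter a b * letter c d - scalar (csign a b c d) * (letter c d * letter a b) \<in> RI A"
  using relator_in_rel_ideal [of a A b c d] assms by (simp add: gl_bracket_def super_sign_csign)

text \<open>
  Permuting the factors of \<open>e\<^bsub>s,v\<^esub> \<cdots>\<close> and those of \<open>e\<^bsub>v,s\<^esub> \<cdots>\<close> in the same way produces the
  same sign twice.
\<close>

definition sign_related :: "gsym set \<Rightarrow> cells \<Rightarrow> cells \<Rightarrow> bool" where
  "sign_related A y z \<longleftrightarrow> (\<exists>\<epsilon>. \<epsilon> * \<epsilon> = 1 \<and> (A \<subseteq> odd_syms \<longrightarrow> \<epsilon> = 1) \<and>
     monomial (left_word y) - scalar \<epsilon> * monomial (left_word z) \<in> RI A \<and>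
     monomial (right_word y) - scalar \<epsilon> * monomial (right_word z) \<in> RI A)"

lemma sign_related_refl: "sign_related A z z"
  unfolding sign_related_def by (intro exI [of _ 1]) simp

lemma sign_related_trans:
  assumes "sign_related A x y" "sign_related A y z" shows "sign_related A x z"
proof -
  obtain \<epsilon> \<delta> where *: "\<epsilon> * \<epsilon> = 1" "\<delta> * \<delta> = 1" "A \<subseteq> odd_syms \<longrightarrow> \<epsilon> = 1" "A \<subseteq> odd_syms \<longrightarrow> \<delta> = 1"
    "monomial (left_word x) - scalar \<epsilon> * monomial (left_word y) \<in> RI A"
    "monomial (right_word x) - scalar \<epsilon> * monomial (right_word y) \<in> RI A"
    "monomial (left_word y) - scalar \<delta> * monomial (left_word z) \<in> RI A"
    "monomial (right_word y) - scalar \<delta> * monomial (right_word z) \<in> RI A"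
    using assms by (auto simp: sign_related_def)
  have "p - scalar (\<epsilon> * \<delta>) * r \<in> RI A"
    if "p - scalar \<epsilon> * q \<in> RI A" "q - scalar \<delta> * r \<in> RI A" for p q r
    using rel_ideal_add [OF that(1) rel_ideal_lmult [OF fcar_scalar [of \<epsilon>] that(2)]]
    by (simp add: right_diff_distrib flip: scalar_mult mult.assoc)
  with * show ?thesis
    unfolding sign_related_def by (intro exI [of _ "\<epsilon> * \<delta>"]) (auto simp: algebra_simps)
qed

lemma sign_related_Cons:
  assumes "sign_related A y z" "[c] \<in> virtual_cells A" shows "sign_related A (c # y) (c # z)"
proof -
  obtain s v where c: "c = (s, v)" by (cases c)
  obtain \<epsilon> where *: "\<epsilon> * \<epsilon> = 1" "A \<subseteq> odd_syms \<longrightarrow> \<epsilon> = 1"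
    "monomial (left_word y) - scalar \<epsilon> * monomial (left_word z) \<in> RI A"
    "monomial (right_word y) - scalar \<epsilon> * monomial (right_word z) \<in> RI A"
    using assms by (auto simp: sign_related_def)
  have "monomial (l # p) - scalar \<epsilon> * monomial (l # q) \<in> RI A"
    if "monomial p - scalar \<epsilon> * monomial q \<in> RI A" "l \<in> A \<times> A" for p q l
  proof -
    have "monomial [l] * (scalar \<epsilon> * monomial q) = scalar \<epsilon> * (monomial [l] * monomial q)"
      by (metis mult.assoc scalar_commute)
    then show ?thesis
      using rel_ideal_lmult [of "monomial [l]" A, OF _ that(1)] that(2)
      by (simp add: right_diff_distrib flip: monomial_Cons)
  qed
  with * assms(2) show ?thesis
    unfolding sign_related_def by (intro exI [of _ \<epsilon>]) (auto simp: c)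
qed

lemma sign_related_swap:
  assumes "c # d # z \<in> virtual_cells A" shows "sign_related A (c # d # z) (d # c # z)"
proof -
  obtain s v t w where cd: "c = (s, v)" "d = (t, w)" by (metis surj_pair)
  have ne: "v \<noteq> Proper t" "Proper s \<noteq> w" using assms by (auto simp: cd)
  have L: "letter (Proper s) v * letter (Proper t) w
       - scalar (csign (Proper s) v (Proper t) w) * (letter (Proper t) w * letter (Proper s) v) \<in> RI A"
    using assms ne by (intro swap_super) (auto simp: cd)
  have R: "letter v (Proper s) * letter w (Proper t)
       - scalar (csign v (Proper s) w (Proper t)) * (letter w (Proper t) * letter v (Proper s)) \<in> RI A"
    using assms ne by (intro swap_super) (auto simp: cd)
  have z: "monomial (left_word z) \<in> fcar A" "monomial (right_word z) \<in> fcar A"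
    using virtual_cells_words [of z A] assms by (auto simp: cd)
  have sg: "csign v (Proper s) w (Proper t) = csign (Proper s) v (Proper t) w"
    by (simp add: csign_def add.commute)
  have "csign (Proper s) v (Proper t) w = 1" if "A \<subseteq> odd_syms"
    using that assms by (auto simp: cd csign_def odd_syms_def)
  then show ?thesis
    unfolding sign_related_def
    using rel_ideal_rmult [OF z(1) L] rel_ideal_rmult [OF z(2) R]
    by (intro exI [of _ "csign (Proper s) v (Proper t) w"])
      (simp add: cd sg left_diff_distrib mult.assoc flip: monomial_append)
qed

lemma sign_related_mset:
  assumes "mset y = mset z" "y \<in> virtual_cells A" shows "sign_related A y z"
  using assms
proof (induction y arbitrary: z)
  case (Cons c y)
  obtain z1 z2 where z: "z = z1 @ c # z2"
    using Cons.prems(1) by (metis in_set_conv_decomp list.set_intros(1) mset_eq_setD)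
  have "mset y = mset (z1 @ z2)" using Cons.prems by (simp add: z)
  moreover have c: "[c] \<in> virtual_cells A" "y \<in> virtual_cells A"
    using Cons.prems(2) by (cases c; simp)+
  ultimately have "sign_related A (c # y) (c # z1 @ z2)"
    by (intro sign_related_Cons Cons.IH) auto
  moreover have "z1 @ z2 \<in> virtual_cells A"
    using c(2) mset_eq_setD [OF \<open>mset y = mset (z1 @ z2)\<close>] by (simp only: virtual_cells_def mem_Collect_eq)
  then have "sign_related A (c # z1 @ z2) (z1 @ c # z2)"
  proof (induction z1)
    case (Cons d z1)
    then have d: "[d] \<in> virtual_cells A" "z1 @ z2 \<in> virtual_cells A" by (cases d; simp)+
    have "sign_related A (c # d # z1 @ z2) (d # c # z1 @ z2)"
      using c d by (intro sign_related_swap) (cases c; cases d; simp)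
    moreover have "sign_related A (d # c # z1 @ z2) (d # z1 @ c # z2)"
      using Cons d by (intro sign_related_Cons) auto
    ultimately show ?case using sign_related_trans by simp
  qed (simp add: sign_related_refl)
  ultimately show ?case using sign_related_trans z by blast
qed (simp add: sign_related_refl)

text \<open>When all symbols are odd the letters e_{s,v} are even and commute, so one side may be
  permuted alone. This serves for \<open>I_elem\<close>, whose left factor runs through
  \<open>1, ..., n\<close> in the opposite order.\<close>

lemma left_word_mset_odd:
  assumes "mset y = mset z" "y \<in> virtual_cells A" "A \<subseteq> odd_syms"
  shows "monomial (left_word y) - monomial (left_word z) \<in> RI A"
  using sign_related_mset [OF assms(1,2)] assms(3) by (auto simp: sign_related_def)

lemma virtual_word_mset:
  assumes "mset y = mset z" "y \<in> virtual_cells A" "set X \<subseteq> A \<times> A"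
  shows "monomial (virtual_word X y) - monomial (virtual_word X z) \<in> RI A"
proof -
  obtain \<epsilon> where e: "\<epsilon> * \<epsilon> = 1"
    and L: "monomial (left_word y) - scalar \<epsilon> * monomial (left_word z) \<in> RI A" (is "?l - _ * ?l' \<in> _")
    and R: "monomial (right_word y) - scalar \<epsilon> * monomial (right_word z) \<in> RI A" (is "?r - _ * ?r' \<in> _")
    using sign_related_mset [OF assms(1,2)] by (auto simp: sign_related_def)
  have z: "z \<in> virtual_cells A"
    using assms(2) mset_eq_setD [OF assms(1)] by (simp only: virtual_cells_def mem_Collect_eq)
  have "(?l - scalar \<epsilon> * ?l') * (monomial X * ?r) + (scalar \<epsilon> * ?l' * monomial X) * (?r - scalar \<epsilon> * ?r') \<in> RI A"
    using virtual_cells_words [OF assms(2)] virtual_cells_words [OF z] assms(3)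
    by (intro rel_ideal_add rel_ideal_lmult [OF _ R] rel_ideal_rmult [OF _ L] fcar_mult) auto
  moreover have "(scalar \<epsilon> * ?l' * monomial X) * (scalar \<epsilon> * ?r') = ?l' * (monomial X * ?r')"
    using e by (metis (no_types, opaque_lifting) mult.assoc mult_1 scalar_1 scalar_commute scalar_mult)
  ultimately show ?thesis
    by (simp add: virtual_word_def monomial_append right_diff_distrib left_diff_distrib mult.assoc)
qed

text \<open>For even \<open>v\<close> the letter e_{s,v} is odd, and its superbracket with itself
  says that twice its square is zero. Permuting brings the two equal cells together.\<close>

lemma virtual_word_repeat:
  assumes "count (mset z) (s, v) \<ge> 2" "parity v = 0" "z \<in> virtual_cells A" "set X \<subseteq> A \<times> A"
  shows "monomial (virtual_word X z) \<in> RI A"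
proof -
  have "{#(s, v), (s, v)#} \<subseteq># mset z"
    using assms(1) count_le_replicate_mset_subset_eq [of 2 "mset z" "(s, v)"]
    by (simp add: numeral_2_eq_2)
  then obtain M where M: "mset z = {#(s, v), (s, v)#} + M"
    using subset_mset.le_iff_add by blast
  obtain y where "mset y = M" using ex_mset by blast
  with M have mz: "mset z = mset ((s, v) # (s, v) # y)" by simp
  then have y: "(s, v) # (s, v) # y \<in> virtual_cells A"
    using assms(3) mset_eq_setD [OF mz] by (simp only: virtual_cells_def mem_Collect_eq)
  let ?x = "letter (Proper s) v"
  have "?x * ?x - scalar (csign (Proper s) v (Proper s) v) * (?x * ?x) \<in> RI A"
    using y by (intro swap_super) auto
  then have "scalar (1 / 2) * (?x * ?x + ?x * ?x) \<in> RI A"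
    using assms(2) by (intro rel_ideal_lmult) (auto simp: csign_def scalar_uminus)
  moreover have "scalar (1 / 2) * (p + p) = p" for p
  proof -
    have "scalar (1 / 2) * (p + p) = scalar (1 / 2 + 1 / 2) * p"
      by (simp only: distrib_left distrib_right flip: scalar_add)
    then show ?thesis by simp
  qed
  ultimately have "?x * ?x \<in> RI A" by simp
  then have "?x * ?x * monomial (left_word y @ X @ right_word ((s, v) # (s, v) # y)) \<in> RI A"
    using y virtual_cells_words [of y A] assms(4)
    by (intro rel_ideal_rmult [OF _ \<open>?x * ?x \<in> RI A\<close>]) auto
  then have "monomial (virtual_word X ((s, v) # (s, v) # y)) \<in> RI A"
    by (simp add: virtual_word_def flip: monomial_append)
  from rel_ideal_add [OF virtual_word_mset [OF mz assms(3,4)] this] show ?thesis by simp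
qed

section \<open>Sums over all fillings\<close>

definition fillings :: "nat \<Rightarrow> nat \<Rightarrow> nat list set" where
  "fillings n L = {s. set s \<subseteq> {1..n} \<and> length s = L}"

lemma finite_fillings [simp]: "finite (fillings n L)"
  unfolding fillings_def using finite_lists_length_eq [of "{1..n}" L] by simp

definition virtual_sum :: "nat \<Rightarrow> (gsym \<times> gsym) list \<Rightarrow> gsym list \<Rightarrow> falg" where
  "virtual_sum n X vs = (\<Sum>s\<in>fillings n (length vs). monomial (virtual_word X (zip s vs)))"

lemma zip_virtual_cells:
  assumes "set s \<subseteq> {1..n}" "set vs \<subseteq> A \<inter> Collect virtual" "proper_syms n \<subseteq> A"
  shows "zip s vs \<in> virtual_cells A"
proof -
  have "Proper t \<in> A \<and> v \<in> A \<and> virtual v" if "(t, v) \<in> set (zip s vs)" for t v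
  proof -
    have "t \<in> {1..n}" "v \<in> set vs"
      using assms(1) set_zip_leftD [OF that] set_zip_rightD [OF that] by auto
    then have "Proper t \<in> proper_syms n" "v \<in> A \<and> virtual v"
      using assms(2) by (auto simp: proper_syms_def)
    then show ?thesis using assms(3) by blast
  qed
  then show ?thesis by (auto simp: virtual_cells_def)
qed

lemma ad_word_left:
  assumes "length s = length vs" "\<forall>v\<in>set vs. virtual v"
  shows "ad_word (Proper i) (Proper j) (left_word (zip s vs))
    = (\<Sum>p<length s. if s ! p = j then monomial (left_word (zip (s[p := i]) vs)) else 0)"
  using assms
proof (induction s vs rule: list_induct2)
  case (Cons t s v vs)
  have "v \<noteq> Proper i" using Cons.prems by auto
  with Cons show ?case
    by (simp add: sum.lessThan_Suc_shift sum_distrib_left if_distrib cong: if_cong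
        del: sum.lessThan_Suc flip: monomial_append)
qed simp

lemma ad_word_right:
  assumes "length s = length vs" "\<forall>v\<in>set vs. virtual v"
  shows "ad_word (Proper i) (Proper j) (right_word (zip s vs))
    = - (\<Sum>p<length s. if s ! p = i then monomial (right_word (zip (s[p := j]) vs)) else 0)"
  using assms
proof (induction s vs rule: list_induct2)
  case (Cons t s v vs)
  have "Proper j \<noteq> v" using Cons.prems by auto
  with Cons show ?case
    by (simp add: sum.lessThan_Suc_shift sum_distrib_left if_distrib cong: if_cong
        del: sum.lessThan_Suc flip: monomial_append)
qed simp

lemma ad_word_virtual:
  assumes "\<forall>l\<in>set X. virtual (fst l) \<and> virtual (snd l)"
  shows "ad_word (Proper i) (Proper j) X = 0"
  using assms
proof (induction X)
  case (Cons l X)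
  then show ?case by (cases l) auto
qed simp

text \<open>Bracketing with e_{i,j} replaces an entry \<open>j\<close> by \<open>i\<close> in the
  left half, or, with a minus sign, an entry \<open>i\<close> by \<open>j\<close> in the right half;
  virtual letters in \<open>X\<close> contribute nothing. Summed over all fillings, the two kinds of
  terms cancel position by position.\<close>

lemma virtual_sum_commutes:
  assumes vs: "set vs \<subseteq> A \<inter> Collect virtual" and A: "proper_syms n \<subseteq> A"
    and X: "set X \<subseteq> A \<times> A" "\<forall>l\<in>set X. virtual (fst l) \<and> virtual (snd l)"
    and ij: "i \<in> {1..n}" "j \<in> {1..n}"
  shows "letter (Proper i) (Proper j) * virtual_sum n X vs
    - virtual_sum n X vs * letter (Proper i) (Proper j) \<in> RI A"
proof -
  let ?S = "fillings n (length vs)" and ?a = "letter (Proper i) (Proper j)"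
  let ?w = "\<lambda>s. virtual_word X (zip s vs)"
  define W where "W s t = monomial (left_word (zip s vs)) * (monomial X * monomial (right_word (zip t vs)))" for s t
  have "(\<Sum>s\<in>?S. ad_word (Proper i) (Proper j) (?w s)) = 0"
  proof -
    have "ad_word (Proper i) (Proper j) (?w s) = (\<Sum>p<length vs. if s ! p = j then W (s[p := i]) s else 0)
       - (\<Sum>p<length vs. if s ! p = i then W s (s[p := j]) else 0)" if "s \<in> ?S" for s
    proof -
      have s: "length s = length vs" using that by (simp add: fillings_def)
      show ?thesis
        using vs
        by (simp add: virtual_word_def ad_word_append monomial_append ad_word_left ad_word_right s subset_iff
            ad_word_virtual [OF X(2)] sum_distrib_left sum_distrib_right if_distrib [of "\<lambda>x. x * _"]
            if_distrib [of "\<lambda>x. _ * x"] W_def sum_negf cong: if_cong)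
    qed
    then have "(\<Sum>s\<in>?S. ad_word (Proper i) (Proper j) (?w s)) =
       (\<Sum>p<length vs. \<Sum>s\<in>?S. if s ! p = j then W (s[p := i]) s else 0)
       - (\<Sum>p<length vs. \<Sum>s\<in>?S. if s ! p = i then W s (s[p := j]) else 0)"
      by (simp add: sum_subtractf sum.swap [of _ "{..<length vs}"])
    also have "(\<Sum>s\<in>?S. if s ! p = j then W (s[p := i]) s else 0)
      = (\<Sum>s\<in>?S. if s ! p = i then W s (s[p := j]) else 0)" if "p < length vs" for p
    proof -
      \<comment> \<open>Changing position \<open>p\<close> from \<open>j\<close> to \<open>i\<close>
        carries the first index set to the second and turns the pair of fillings of a left term into
        that of a right term.\<close>
      have "(\<Sum>s | s \<in> ?S \<and> s ! p = j. W (s[p := i]) s) = (\<Sum>s | s \<in> ?S \<and> s ! p = i. W s (s[p := j]))"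
        using that ij
        by (intro sum.reindex_bij_witness [where i = "\<lambda>s. s[p := j]" and j = "\<lambda>s. s[p := i]"])
          (auto simp: fillings_def list_update_same_conv dest!: subsetD [OF set_update_subset_insert])
      then show ?thesis by (simp add: sum.inter_filter)
    qed
    then have "(\<Sum>p<length vs. \<Sum>s\<in>?S. if s ! p = j then W (s[p := i]) s else 0)
       = (\<Sum>p<length vs. \<Sum>s\<in>?S. if s ! p = i then W s (s[p := j]) else 0)"
      by (rule sum.cong [OF refl]) simp
    finally show ?thesis by simp
  qed
  moreover have "(\<Sum>s\<in>?S. ?a * monomial (?w s) - monomial (?w s) * ?a - ad_word (Proper i) (Proper j) (?w s)) \<in> RI A"
  proof (intro rel_ideal_sum commutator_monomial)
    fix s assume "s \<in> ?S"
    then have "zip s vs \<in> virtual_cells A"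
      using vs A by (intro zip_virtual_cells) (auto simp: fillings_def)
    from virtual_cells_words [OF this] X(1) show "set (?w s) \<subseteq> A \<times> A"
      by (simp add: virtual_word_def)
  qed (use A ij in \<open>auto simp: proper_syms_def\<close>)
  ultimately show ?thesis
    by (simp add: virtual_sum_def sum_subtractf sum_distrib_left sum_distrib_right)
qed

lemma balanced_virtual_word:
  assumes "balanced X" shows "balanced (virtual_word X z)"
proof -
  have "(\<Sum>l\<leftarrow>left_word z. of_bool (fst l = \<gamma>)) = (\<Sum>l\<leftarrow>right_word z. of_bool (snd l = \<gamma>) :: int)"
    "(\<Sum>l\<leftarrow>left_word z. of_bool (snd l = \<gamma>)) = (\<Sum>l\<leftarrow>right_word z. of_bool (fst l = \<gamma>) :: int)" for \<gamma>
    by (induction z) auto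
  with assms show ?thesis by (simp add: balanced_iff virtual_word_def)
qed

text \<open>If \<open>N\<close> occurs as an entry, its cell is moved to the end, so that the word
  ends in a letter e_{v,N}, which is the case of \<open>straighten\<close> that lands in the left
  ideal.\<close>

lemma straighten_virtual_word:
  assumes A: "\<And>a. a \<in> A \<Longrightarrow> \<not> virtual a \<Longrightarrow> a \<in> proper_syms N"
    and z: "z \<in> virtual_cells A" and X: "set X \<subseteq> A \<times> A" "balanced X"
  obtains u where "u \<in> fcar (proper_syms N)" "monomial (virtual_word X z) - u \<in> JI A"
    "N \<in> fst ` set z \<Longrightarrow> u \<in> LI N"
proof (cases "N \<in> fst ` set z")
  case False
  have "set (virtual_word X z) \<subseteq> A \<times> A"
    using virtual_cells_words [OF z] X by (simp add: virtual_word_def)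
  from straighten [OF A this balanced_virtual_word [OF X(2)]] False that show ?thesis by metis
next
  case True
  then obtain z1 v z2 where split: "z = z1 @ (N, v) # z2"
    by (metis (no_types, lifting) imageE prod.collapse split_list)
  define y where "y = (z1 @ z2) @ [(N, v)]"
  have y: "mset z = mset y" "y \<in> virtual_cells A"
    using z by (auto simp: y_def split)
  have "set (virtual_word X y) \<subseteq> A \<times> A"
    using virtual_cells_words [OF y(2)] X by (simp add: virtual_word_def)
  from straighten [OF A this balanced_virtual_word [OF X(2)]]
  obtain u where u: "u \<in> fcar (proper_syms N)" "monomial (virtual_word X y) - u \<in> JI A"
    "virtual_word X y \<noteq> [] \<Longrightarrow> snd (last (virtual_word X y)) = Proper N \<or> virtual (snd (last (virtual_word X y)))
      \<Longrightarrow> u \<in> LI N"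
    by metis
  have "u \<in> LI N" by (rule u(3)) (auto simp: virtual_word_def y_def)
  moreover have "monomial (virtual_word X z) - u \<in> JI A"
    using LG_add [OF LG_rel [OF virtual_word_mset [OF y(1) z X(1)]] u(2)] by simp
  ultimately show ?thesis using that u(1) by blast
qed

section \<open>Independence of the choice of virtual symbols\<close>

definition renaming :: "(gsym \<Rightarrow> gsym) \<Rightarrow> bool" where
  "renaming \<sigma> \<longleftrightarrow> inj \<sigma> \<and> (\<forall>a. parity (\<sigma> a) = parity a) \<and> (\<forall>i. \<sigma> (Proper i) = Proper i)"

text \<open>Only rows are relabelled: the columns that can be filled in are proper symbols, which a
  renaming fixes.\<close>

fun rename_slot :: "(gsym \<Rightarrow> gsym) \<Rightarrow> slot \<Rightarrow> slot" where
  "rename_slot \<sigma> None = None"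
| "rename_slot \<sigma> (Some (a, c)) = Some (\<sigma> a, c)"

lemma act_rename:
  assumes "renaming \<sigma>"
  shows "act (proper_syms n) (\<sigma> a) (\<sigma> b) \<phi> (map (rename_slot \<sigma>) w)
    = act (proper_syms n) a b (\<lambda>v. \<phi> (map (rename_slot \<sigma>) v)) w"
proof (induction w arbitrary: \<phi>)
  case (Cons x w)
  have eq: "\<sigma> c = \<sigma> d \<longleftrightarrow> c = d" for c d
    using assms by (auto simp: renaming_def inj_eq)
  have "b \<in> proper_syms n \<Longrightarrow> \<sigma> b = b"
    using assms by (auto simp: proper_syms_def renaming_def)
  moreover have "\<sigma> b \<in> proper_syms n \<longleftrightarrow> b \<in> proper_syms n"
  proof -
    have "\<sigma> b = Proper i \<longleftrightarrow> b = Proper i" for i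
      using eq [of b "Proper i"] assms by (simp add: renaming_def)
    then show ?thesis by (auto simp: proper_syms_def)
  qed
  ultimately have "slot_act (proper_syms n) (\<sigma> a) (\<sigma> b) (rename_slot \<sigma> x) (\<lambda>y. \<phi> (y # map (rename_slot \<sigma>) w))
    = slot_act (proper_syms n) a b x (\<lambda>y. \<phi> (rename_slot \<sigma> y # map (rename_slot \<sigma>) w))"
    by (cases x) (auto simp: eq)
  moreover have "slot_sign (\<sigma> a) (\<sigma> b) (rename_slot \<sigma> x) = slot_sign a b x"
    using assms by (cases x) (auto simp: slot_sign_def renaming_def)
  ultimately show ?case using Cons [of "\<lambda>v. \<phi> (rename_slot \<sigma> x # v)"] by simp
qed simp

lemma acts_rename:
  assumes "renaming \<sigma>"
  shows "acts (proper_syms n) (map (map_prod \<sigma> \<sigma>) u) \<phi> (map (rename_slot \<sigma>) w)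
    = acts (proper_syms n) u (\<lambda>v. \<phi> (map (rename_slot \<sigma>) v)) w"
proof (induction u arbitrary: \<phi>)
  case (Cons l u)
  have "(\<lambda>v. act (proper_syms n) (\<sigma> (fst l)) (\<sigma> (snd l)) \<phi> (map (rename_slot \<sigma>) v))
    = act (proper_syms n) (fst l) (snd l) (\<lambda>v. \<phi> (map (rename_slot \<sigma>) v))"
    by (simp add: fun_eq_iff act_rename [OF assms])
  then show ?case
    using Cons [of "act (proper_syms n) (\<sigma> (fst l)) (\<sigma> (snd l)) \<phi>"] by simp
qed simp

lemma test_fun_rename:
  assumes "renaming \<sigma>" "set_mset M \<subseteq> proper_syms n \<times> proper_syms n"
  shows "test_fun M (map (rename_slot \<sigma>) v) = test_fun M v"
proof -
  let ?f = "image_mset (map_prod \<sigma> id)"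
  have fill: "fill (map (rename_slot \<sigma>) v) = ?f (fill v)"
    unfolding fill_def
  proof (induction v)
    case (Cons x v)
    then show ?case by (cases x) auto
  qed simp
  have fixed: "?f N = N" if "set_mset N \<subseteq> proper_syms n \<times> proper_syms n" for N :: "(gsym \<times> gsym) multiset"
  proof -
    have "?f N = image_mset id N"
      using that assms(1) by (intro image_mset_cong) (auto simp: proper_syms_def renaming_def)
    then show ?thesis by simp
  qed
  have "?f N = M \<longleftrightarrow> N = M" for N
  proof
    assume M: "?f N = M"
    have "set_mset N \<subseteq> proper_syms n \<times> proper_syms n"
    proof
      fix l assume "l \<in> set_mset N"
      then have "map_prod \<sigma> id l \<in> set_mset M" by (simp flip: M)
      then have "map_prod \<sigma> id l \<in> proper_syms n \<times> proper_syms n" using assms(2) by blast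
      then obtain i where i: "\<sigma> (fst l) = Proper i" "Proper i \<in> proper_syms n" "snd l \<in> proper_syms n"
        by (cases l) (auto simp: proper_syms_def)
      then have "\<sigma> (fst l) = \<sigma> (Proper i)" using assms(1) by (simp add: renaming_def)
      then have "fst l = Proper i" using assms(1) unfolding renaming_def by (meson injD)
      with i show "l \<in> proper_syms n \<times> proper_syms n" by (cases l) auto
    qed
    with fixed M show "N = M" by simp
  qed (use fixed assms(2) in simp)
  moreover have "None = rename_slot \<sigma> x \<longleftrightarrow> x = None" for x by (cases x) auto
  then have "None \<notin> set (map (rename_slot \<sigma>) v) \<longleftrightarrow> None \<notin> set v" by auto
  ultimately show ?thesis unfolding test_fun_def fill by simp
qed

lemma virtual_word_rename:
  assumes "renaming \<sigma>"
  shows "virtual_word (map (map_prod \<sigma> \<sigma>) X) (zip s (map \<sigma> vs)) = map (map_prod \<sigma> \<sigma>) (virtual_word X (zip s vs))"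
  using assms
  by (auto simp: virtual_word_def left_word_def right_word_def zip_map2 renaming_def)

text \<open>Empty slots contain no symbols, and for proper \<open>M\<close> the functional
  \<open>test_fun M\<close> does not notice a relabelling. So the two sums have equal matrix
  coefficients, hence so do \<open>u\<close> and \<open>u'\<close>, and \<open>faithful\<close>
  applies.\<close>

lemma virtual_sum_rename:
  assumes \<sigma>: "renaming \<sigma>"
    and u: "u \<in> fcar (proper_syms n)" "virtual_sum n X vs - u \<in> JI A"
    and u': "u' \<in> fcar (proper_syms n)"
      "virtual_sum n (map (map_prod \<sigma> \<sigma>) X) (map \<sigma> vs) - u' \<in> JI A'"
  shows "u - u' \<in> RI (proper_syms n)"
proof (rule faithful [OF fcar_diff [OF u(1) u'(1)] order_refl proper_syms_odd])
  fix M :: "(gsym \<times> gsym) multiset"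
  assume M: "set_mset M \<subseteq> proper_syms n \<times> proper_syms n"
  let ?N = "replicate (size M) None :: slot list"
  have test: "(\<lambda>v. test_fun M (map (rename_slot \<sigma>) v)) = test_fun M"
    using test_fun_rename [OF \<sigma> M] by auto
  have "map (rename_slot \<sigma>) ?N = ?N" by simp
  then have "acts (proper_syms n) (map (map_prod \<sigma> \<sigma>) w) (test_fun M) ?N = acts (proper_syms n) w (test_fun M) ?N" for w
    using acts_rename [OF \<sigma>, of n w "test_fun M" ?N] test by simp
  then have "Act (proper_syms n) (virtual_sum n (map (map_prod \<sigma> \<sigma>) X) (map \<sigma> vs)) (test_fun M) ?N
    = Act (proper_syms n) (virtual_sum n X vs) (test_fun M) ?N"
    by (simp add: virtual_sum_def Act_sum virtual_word_rename [OF \<sigma>])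
  moreover have "Act (proper_syms n) (virtual_sum n X vs - u) (test_fun M) ?N = 0"
    "Act (proper_syms n) (virtual_sum n (map (map_prod \<sigma> \<sigma>) X) (map \<sigma> vs) - u') (test_fun M) ?N = 0"
    using Act_JI [OF u(2) proper_syms_not_virtual proper_syms_odd] Act_JI [OF u'(2) proper_syms_not_virtual proper_syms_odd]
    by auto
  ultimately show "Act (proper_syms n) (u - u') (test_fun M) ?N = 0"
    by (simp add: Act_diff)
qed

text \<open>The fillings for n+1 split into those that use n+1, which give the part in the left
  ideal, and the sum for n over the renamed symbols. The parameters with a prime belong to n+1, so
  the two supplies of virtual symbols are unrelated except through \<sigma>.\<close>

theorem virtual_sum_olsh:
  fixes n m0 m1 m0' m1' :: nat and c :: complex
  defines "A \<equiv> syms m0 m1 n" and "A' \<equiv> syms m0' m1' (n + 1)"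
  assumes \<sigma>: "renaming \<sigma>"
    and vs: "set vs \<subseteq> A \<inter> Collect virtual" and X: "set X \<subseteq> A \<times> A" "\<forall>l\<in>set X. virtual (fst l) \<and> virtual (snd l)"
      "balanced X"
    and vs': "set (map \<sigma> vs) \<subseteq> A' \<inter> Collect virtual"
    and X': "set (map (map_prod \<sigma> \<sigma>) X) \<subseteq> A' \<times> A'"
      "\<forall>l\<in>set (map (map_prod \<sigma> \<sigma>) X). virtual (fst l) \<and> virtual (snd l)" "balanced (map (map_prod \<sigma> \<sigma>) X)"
    and u: "u \<in> fcar (proper_syms n)" "scalar c * virtual_sum n X vs - u \<in> JI A"
    and u': "u' \<in> fcar (proper_syms (n + 1))"
      "scalar c * virtual_sum (n + 1) (map (map_prod \<sigma> \<sigma>) X) (map \<sigma> vs) - u' \<in> JI A'"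
  shows "olsh n u' u" "central (n + 1) u'"
proof -
  let ?X = "map (map_prod \<sigma> \<sigma>) X" and ?vs = "map \<sigma> vs" and ?L = "length vs"
  have sub: "proper_syms n \<subseteq> A" "proper_syms (n + 1) \<subseteq> A'" "proper_syms n \<subseteq> proper_syms (n + 1)"
    by (auto simp: A_def A'_def syms_def proper_syms_def)
  show "central (n + 1) u'"
  proof (rule central_devirtualized [OF u' sub(2)])
    fix i j assume ij: "i \<in> {1..n + 1}" "j \<in> {1..n + 1}"
    let ?a = "letter (Proper i) (Proper j)" and ?s = "virtual_sum (n + 1) ?X ?vs"
    have "scalar c * (?a * ?s - ?s * ?a) \<in> RI A'"
      by (intro rel_ideal_lmult fcar_scalar virtual_sum_commutes vs' X' sub ij)
    moreover have "?a * (scalar c * ?s) = scalar c * (?a * ?s)"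
      by (metis mult.assoc scalar_commute)
    ultimately show "?a * (scalar c * ?s) - scalar c * ?s * ?a \<in> RI A'"
      by (simp add: right_diff_distrib mult.assoc)
  qed
  have cells: "zip s ?vs \<in> virtual_cells A'" if "s \<in> fillings (n + 1) ?L" for s
    using that by (intro zip_virtual_cells [OF _ vs' sub(2)]) (auto simp: fillings_def)
  have A': "a \<in> proper_syms (n + 1)" if "a \<in> A'" "\<not> virtual a" for a
    using that syms_cases unfolding A'_def by blast
  have "\<exists>v. v \<in> fcar (proper_syms (n + 1)) \<and> monomial (virtual_word ?X (zip s ?vs)) - v \<in> JI A'
      \<and> (n + 1 \<in> set s \<longrightarrow> v \<in> LI (n + 1))" if s: "s \<in> fillings (n + 1) ?L" for s
  proof -
    have "fst ` set (zip s ?vs) = set s"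
      using s by (simp add: fillings_def set_map [symmetric] del: set_map)
    then show ?thesis
      using straighten_virtual_word [OF A' cells [OF s] X'(1,3)] by metis
  qed
  then obtain v where v: "\<And>s. s \<in> fillings (n + 1) ?L \<Longrightarrow> v s \<in> fcar (proper_syms (n + 1))"
    "\<And>s. s \<in> fillings (n + 1) ?L \<Longrightarrow> monomial (virtual_word ?X (zip s ?vs)) - v s \<in> JI A'"
    "\<And>s. s \<in> fillings (n + 1) ?L \<Longrightarrow> n + 1 \<in> set s \<Longrightarrow> v s \<in> LI (n + 1)"
    by metis
  define T where "T = {s \<in> fillings (n + 1) ?L. n + 1 \<in> set s}"
  have "fillings (n + 1) ?L = T \<union> fillings n ?L" "T \<inter> fillings n ?L = {}"
    by (auto simp: T_def fillings_def subset_iff le_Suc_eq)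
  then have split: "virtual_sum (n + 1) ?X ?vs
      = (\<Sum>s\<in>T. monomial (virtual_word ?X (zip s ?vs))) + virtual_sum n ?X ?vs"
    using sum.union_disjoint [of T "fillings n ?L" "\<lambda>s. monomial (virtual_word ?X (zip s ?vs))"]
    by (simp add: virtual_sum_def T_def)
  have T: "(\<Sum>s\<in>T. monomial (virtual_word ?X (zip s ?vs))) - sum v T \<in> JI A'" "sum v T \<in> LI (n + 1)"
    using v by (auto simp: T_def simp flip: sum_subtractf intro!: LG_sum)
  \<comment> \<open>The virtual symbols available for n+1, but only the proper ones up to n: the
    fillings that avoid n+1 are straightened inside this alphabet, so that the result stays in
    U(gl(n)).\<close>
  define A'' where "A'' = syms m0' m1' n"
  have "A'' \<subseteq> A'" by (auto simp: A''_def A'_def syms_def proper_syms_def)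
  have vs'': "set ?vs \<subseteq> A'' \<inter> Collect virtual" and X'': "set ?X \<subseteq> A'' \<times> A''"
  proof -
    have *: "a \<in> A''" if "a \<in> A'" "virtual a" for a
      using that by (auto simp: A''_def A'_def syms_def proper_syms_def)
    show "set ?vs \<subseteq> A'' \<inter> Collect virtual"
      using vs' * by blast
    show "set ?X \<subseteq> A'' \<times> A''"
    proof
      fix l assume l: "l \<in> set ?X"
      then have "fst l \<in> A'" "snd l \<in> A'" "virtual (fst l)" "virtual (snd l)"
        using X'(1,2) by (auto simp: mem_Times_iff simp del: set_map)
      then show "l \<in> A'' \<times> A''" using * by (simp add: mem_Times_iff)
    qed
  qed
  have A'': "a \<in> proper_syms n" if "a \<in> A''" "\<not> virtual a" for a
    using that syms_cases unfolding A''_def by blast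
  have "\<exists>v. v \<in> fcar (proper_syms n) \<and> monomial (virtual_word ?X (zip s ?vs)) - v \<in> JI A''"
    if "s \<in> fillings n ?L" for s
  proof -
    have "zip s ?vs \<in> virtual_cells A''"
      using that by (intro zip_virtual_cells [OF _ vs'']) (auto simp: fillings_def A''_def syms_def)
    then show ?thesis
      using straighten_virtual_word [OF A'' _ X'' X'(3)] by metis
  qed
  then obtain v' where v': "\<And>s. s \<in> fillings n ?L \<Longrightarrow> v' s \<in> fcar (proper_syms n)"
    "\<And>s. s \<in> fillings n ?L \<Longrightarrow> monomial (virtual_word ?X (zip s ?vs)) - v' s \<in> JI A''"
    by metis
  define V where "V = sum v' (fillings n ?L)"
  have V: "V \<in> fcar (proper_syms n)" "virtual_sum n ?X ?vs - V \<in> JI A''"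
    using v' by (auto simp: V_def virtual_sum_def simp flip: sum_subtractf intro!: LG_sum)
  note V' = JI_mono [OF \<open>A'' \<subseteq> A'\<close> V(2)]
  have "scalar c * ((\<Sum>s\<in>T. monomial (virtual_word ?X (zip s ?vs))) - sum v T)
      + scalar c * (virtual_sum n ?X ?vs - V) \<in> JI A'"
    by (intro LG_add LG_lmult T V' fcar_scalar)
  from LG_diff [OF this u'(2)]
  have "u' - scalar c * sum v T - scalar c * V \<in> JI A'"
    unfolding split by (simp add: algebra_simps)
  moreover have car: "sum v T \<in> fcar (proper_syms (n + 1))" "V \<in> fcar (proper_syms (n + 1))" "u \<in> fcar (proper_syms (n + 1))"
    using v(1) V(1) u(1) fcar_mono [OF sub(3)] by (auto simp: T_def)
  ultimately have 1: "u' - scalar c * sum v T - scalar c * V \<in> RI (proper_syms (n + 1))"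
    using u'(1) by (intro JI_proper fcar_diff fcar_mult fcar_scalar) simp_all
  \<comment> \<open>\<open>virtual_sum_rename\<close> compares the sums without the factor
    \<open>c\<close>, so \<open>c\<close> is divided out. For \<open>c = 0\<close> the element
    \<open>u\<close> itself lies in the ideal.\<close>
  have 2: "scalar c * V - u \<in> RI (proper_syms n)"
  proof (cases "c = 0")
    case True
    then have "u \<in> JI A" using LG_uminus [OF u(2)] by simp
    then have "u \<in> RI (proper_syms n)" using u(1) by (rule JI_proper)
    with True show ?thesis using rel_ideal_uminus by simp
  next
    case False
    let ?w = "scalar (1 / c) * u"
    have "?w \<in> fcar (proper_syms n)" using u(1) by auto
    moreover have "scalar (1 / c) * (scalar c * virtual_sum n X vs - u) \<in> JI A"
      using u(2) by (rule LG_lmult) simp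
    then have "virtual_sum n X vs - ?w \<in> JI A"
      using False by (simp add: right_diff_distrib scalar_mult flip: mult.assoc)
    ultimately have "?w - V \<in> RI (proper_syms n)"
      using virtual_sum_rename [OF \<sigma> _ _ V] by blast
    from rel_ideal_lmult [OF fcar_scalar [of "- c"] this]
    show ?thesis
      using False by (simp add: right_diff_distrib scalar_mult scalar_uminus flip: mult.assoc)
  qed
  have "scalar c * sum v T \<in> LI (n + 1)"
    using T(2) by (rule LG_lmult) simp
  from LG_add [OF LG_add [OF LG_rel [OF 1] this] LG_rel [OF rel_ideal_mono [OF sub(3) 2]]]
  have "u' - u \<in> LI (n + 1)" by simp
  then show "olsh n u' u"
    using u(1) u'(1) by (simp add: olsh_def)
qed

section \<open>Sums over tableaux\<close>

definition tableaux :: "nat \<Rightarrow> nat list \<Rightarrow> nat list list set" where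
  "tableaux n lam = {S. map length S = lam \<and> (\<forall>r\<in>set S. set r \<subseteq> {1..n})}"

definition row_weak_tableaux :: "nat \<Rightarrow> nat list \<Rightarrow> nat list list set" where
  "row_weak_tableaux n lam = {S \<in> tableaux n lam. \<forall>r\<in>set S. sorted r}"

definition tab_cells :: "nat list list \<Rightarrow> gsym list \<Rightarrow> cells" where
  "tab_cells S vs = concat (map2 (\<lambda>r v. map (\<lambda>s. (s, v)) r) S vs)"

text \<open>Each symbol is repeated along its row, so fillings of this list are tableaux of shape
  \<open>lam\<close> read row by row.\<close>

definition row_syms :: "nat list \<Rightarrow> gsym list \<Rightarrow> gsym list" where
  "row_syms lam vs = concat (map2 replicate lam vs)"

definition row_mult_fact :: "nat \<Rightarrow> nat list list \<Rightarrow> nat" where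
  "row_mult_fact n S = (\<Prod>r\<leftarrow>S. \<Prod>x=1..n. fact (count_list r x))"

lemma tableaux_Nil [simp]: "tableaux n [] = {[]}"
  by (auto simp: tableaux_def)

lemma zip_append_replicate: "zip (r @ s) (replicate (length r) v @ vs) = map (\<lambda>s. (s, v)) r @ zip s vs"
  by (induction r) auto

lemma zip_concat_row_syms:
  assumes "map length S = lam" "length vs = length lam"
  shows "zip (concat S) (row_syms lam vs) = tab_cells S vs"
  using assms
proof (induction S arbitrary: lam vs)
  case (Cons r S)
  then obtain v vs' where "vs = v # vs'" by (cases vs) auto
  with Cons show ?case
    by (auto simp: tab_cells_def row_syms_def zip_append_replicate)
qed (simp add: tab_cells_def)

lemma length_row_syms: "length vs = length lam \<Longrightarrow> length (row_syms lam vs) = sum_list lam"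
proof (induction lam arbitrary: vs)
  case (Cons l lam)
  then show ?case by (cases vs) (auto simp: row_syms_def)
qed (simp add: row_syms_def)

lemma set_row_syms: "set (row_syms lam vs) \<subseteq> set vs"
  by (auto simp: row_syms_def dest: set_zip_rightD)

lemma mset_tab_cells_sort: "mset (tab_cells (map sort S) vs) = mset (tab_cells S vs)"
proof (induction S arbitrary: vs)
  case (Cons r S)
  show ?case
  proof (cases vs)
    case (Cons v vs')
    have "mset (map (\<lambda>s. (s, v)) (sort r)) = mset (map (\<lambda>s. (s, v)) r)"
      by simp
    then show ?thesis using Cons.IH by (simp add: tab_cells_def Cons)
  qed (simp add: tab_cells_def)
qed (simp add: tab_cells_def)

lemma bij_betw_concat: "bij_betw concat (tableaux n lam) (fillings n (sum_list lam))"
  unfolding bij_betw_def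
proof
  show "inj_on concat (tableaux n lam)"
  proof (rule inj_onI)
    fix S T assume *: "S \<in> tableaux n lam" "T \<in> tableaux n lam" "concat S = concat T"
    then have l: "map length S = map length T" by (simp add: tableaux_def)
    then have "length S = length T" by (rule map_eq_imp_length_eq)
    moreover have "length x = length y" if "(x, y) \<in> set (zip S T)" for x y
      using that l \<open>length S = length T\<close>
      by (metis (no_types, lifting) in_set_zip nth_map fst_conv snd_conv)
    ultimately show "S = T" using * by (intro concat_injective) auto
  qed
  show "concat ` tableaux n lam = fillings n (sum_list lam)"
  proof (intro equalityI subsetI)
    fix s assume "s \<in> concat ` tableaux n lam"
    then obtain S where "s = concat S" "map length S = lam" "\<And>r. r \<in> set S \<Longrightarrow> set r \<subseteq> {1..n}"
      by (auto simp: tableaux_def)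
    then show "s \<in> fillings n (sum_list lam)"
      by (fastforce simp: fillings_def length_concat)
  next
    fix s assume "s \<in> fillings n (sum_list lam)"
    then show "s \<in> concat ` tableaux n lam"
    proof (induction lam arbitrary: s)
      case Nil
      then show ?case by (auto simp: fillings_def)
    next
      case (Cons l lam)
      then have s: "set s \<subseteq> {1..n}" "length s = l + sum_list lam" by (auto simp: fillings_def)
      then have "drop l s \<in> fillings n (sum_list lam)"
        using set_drop_subset [of l s] by (auto simp: fillings_def)
      then obtain S where S: "S \<in> tableaux n lam" "drop l s = concat S"
        using Cons.IH by blast
      have "take l s # S \<in> tableaux n (l # lam)"
        using S(1) s set_take_subset [of l s] by (auto simp: tableaux_def)
      moreover have "concat (take l s # S) = s"
        using S(2) by (metis append_take_drop_id concat.simps(2))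
      ultimately show ?case by (metis image_eqI)
    qed
  qed
qed

lemma finite_tableaux [simp]: "finite (tableaux n lam)"
  using bij_betw_finite [OF bij_betw_concat] by simp

text \<open>The arrangements of each row are counted by a multinomial coefficient, and the rows are
  rearranged independently.\<close>

lemma card_sort_fibre:
  "finite {S. list_all2 (\<lambda>s r. mset s = mset r) S T} \<and>
   ((\<forall>r\<in>set T. set r \<subseteq> {1..n}) \<longrightarrow>
     card {S. list_all2 (\<lambda>s r. mset s = mset r) S T} * row_mult_fact n T = (\<Prod>r\<leftarrow>T. fact (length r)))"
proof (induction T)
  case Nil
  then show ?case by (simp add: row_mult_fact_def)
next
  case (Cons r T)
  let ?F = "{S. list_all2 (\<lambda>s r. mset s = mset r) S T}"
  have eq: "{S. list_all2 (\<lambda>s r. mset s = mset r) S (r # T)}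
    = (\<lambda>(s, S). s # S) ` (permutations_of_multiset (mset r) \<times> ?F)"
    by (auto simp: permutations_of_multiset_def list_all2_Cons2)
  have "inj_on (\<lambda>(s, S). s # S) (permutations_of_multiset (mset r) \<times> ?F)"
    by (auto simp: inj_on_def)
  then have card: "card {S. list_all2 (\<lambda>s r. mset s = mset r) S (r # T)}
    = card (permutations_of_multiset (mset r)) * card ?F"
    unfolding eq by (simp add: card_image card_cartesian_product)
  have "(\<Prod>x=1..n. fact (count_list r x)) * card (permutations_of_multiset (mset r)) = fact (length r)"
    if "set r \<subseteq> {1..n}"
  proof -
    have "(\<Prod>x=1..n. fact (count_list r x)) = (\<Prod>x\<in>set r. fact (count (mset r) x) :: nat)"
      using that by (intro prod.mono_neutral_cong_right) (auto simp: count_list_0_iff count_mset)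
    then show ?thesis
      using card_permutations_of_multiset_aux [of "mset r"] by (simp add: mult.commute)
  qed
  then show ?case
    using Cons card unfolding eq
    by (auto simp: row_mult_fact_def mult_ac)
qed

lemma row_mult_fact_pos: "row_mult_fact n T > 0"
  unfolding row_mult_fact_def by (induction T) (auto intro!: prod_pos)

lemma sum_scalar_const: "(\<Sum>i\<in>I. x) = scalar (of_nat (card I)) * x"
  by (simp add: scalar_of_nat)

text \<open>Tableaux that agree after sorting their rows give congruent words, and a sorted tableau
  arises from as many of them as the product of the factorials of the row lengths divided by
  \<open>row_mult_fact\<close>. This is where the factorial denominators of \<open>I_elem\<close>
  and \<open>J_elem\<close> come from.\<close>

lemma virtual_sum_weak:
  assumes vs: "length vs = length lam" "set vs \<subseteq> A \<inter> Collect virtual" "proper_syms n \<subseteq> A"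
    and X: "set X \<subseteq> A \<times> A"
  shows "scalar (1 / (\<Prod>l\<leftarrow>lam. fact l)) * virtual_sum n X (row_syms lam vs)
    - (\<Sum>T\<in>row_weak_tableaux n lam. scalar (1 / of_nat (row_mult_fact n T))
        * monomial (virtual_word X (tab_cells T vs))) \<in> RI A"
proof -
  let ?m = "\<lambda>S. monomial (virtual_word X (tab_cells S vs))"
  let ?c = "\<Prod>l\<leftarrow>lam. fact l :: complex"
  have c: "?c \<noteq> 0" by (induction lam) auto
  have rs: "set (row_syms lam vs) \<subseteq> A \<inter> Collect virtual"
    using set_row_syms vs(2) by blast
  have "virtual_sum n X (row_syms lam vs)
      = (\<Sum>S\<in>tableaux n lam. monomial (virtual_word X (zip (concat S) (row_syms lam vs))))"
    unfolding virtual_sum_def length_row_syms [OF vs(1)]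
    by (rule sum.reindex_bij_betw [OF bij_betw_concat, symmetric])
  also have "\<dots> = (\<Sum>S\<in>tableaux n lam. ?m S)"
    by (intro sum.cong refl) (simp add: tableaux_def zip_concat_row_syms vs(1))
  finally have 1: "virtual_sum n X (row_syms lam vs) = (\<Sum>S\<in>tableaux n lam. ?m S)" .
  have "(\<Sum>S\<in>tableaux n lam. ?m S - ?m (map sort S)) \<in> RI A"
  proof (intro rel_ideal_sum virtual_word_mset X)
    fix S assume S: "S \<in> tableaux n lam"
    then have "concat S \<in> fillings n (sum_list lam)"
      using bij_betw_concat [of n lam] by (auto simp: bij_betw_def)
    then have "zip (concat S) (row_syms lam vs) \<in> virtual_cells A"
      using rs vs(3) by (intro zip_virtual_cells) (auto simp: fillings_def)
    then show "tab_cells S vs \<in> virtual_cells A"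
      using S vs(1) by (simp add: tableaux_def zip_concat_row_syms)
  qed (simp add: mset_tab_cells_sort)
  moreover have "(\<Sum>S\<in>tableaux n lam. ?m (map sort S))
      = (\<Sum>T\<in>row_weak_tableaux n lam. scalar (?c / of_nat (row_mult_fact n T)) * ?m T)"
  proof -
    have fin: "finite (row_weak_tableaux n lam)"
      unfolding row_weak_tableaux_def by simp
    have "(\<Sum>S\<in>tableaux n lam. ?m (map sort S))
      = (\<Sum>T\<in>row_weak_tableaux n lam. \<Sum>S | S \<in> tableaux n lam \<and> map sort S = T. ?m (map sort S))"
    proof (rule sum.group [symmetric, OF finite_tableaux fin])
      show "map sort ` tableaux n lam \<subseteq> row_weak_tableaux n lam"
        by (fastforce simp: tableaux_def row_weak_tableaux_def comp_def)
    qed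
    also have "\<dots> = (\<Sum>T\<in>row_weak_tableaux n lam. scalar (?c / of_nat (row_mult_fact n T)) * ?m T)"
    proof (rule sum.cong [OF refl])
      fix T assume T: "T \<in> row_weak_tableaux n lam"
      let ?F = "{S. list_all2 (\<lambda>s r. mset s = mset r) S T}"
      have "{S. S \<in> tableaux n lam \<and> map sort S = T} = ?F"
      proof (intro equalityI subsetI)
        fix S assume "S \<in> {S. S \<in> tableaux n lam \<and> map sort S = T}"
        then show "S \<in> ?F" by (auto simp: list_all2_conv_all_nth)
      next
        fix S assume "S \<in> ?F"
        then have S: "length S = length T" "\<And>i. i < length T \<Longrightarrow> mset (S ! i) = mset (T ! i)"
          by (auto simp: list_all2_conv_all_nth)
        have "map length S = lam"
          using T S(1) mset_eq_length [OF S(2)]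
          by (intro nth_equalityI) (auto simp: row_weak_tableaux_def tableaux_def)
        moreover have "set r \<subseteq> {1..n}" if "r \<in> set S" for r
        proof -
          obtain i where "i < length T" "r = S ! i" using \<open>r \<in> set S\<close> S(1) by (metis in_set_conv_nth)
          then have "set r = set (T ! i)" "T ! i \<in> set T" using S(2) mset_eq_setD by auto
          then show ?thesis using T by (auto simp: row_weak_tableaux_def tableaux_def)
        qed
        moreover have "map sort S = T"
        proof (rule nth_equalityI)
          fix i assume "i < length (map sort S)"
          then show "map sort S ! i = T ! i"
            using S T by (auto simp: row_weak_tableaux_def intro!: properties_for_sort)
        qed (use S in simp)
        ultimately show "S \<in> {S. S \<in> tableaux n lam \<and> map sort S = T}"
          by (auto simp: tableaux_def)
      qed
      then have "(\<Sum>S | S \<in> tableaux n lam \<and> map sort S = T. ?m (map sort S)) = (\<Sum>S\<in>?F. ?m T)"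
        by (intro sum.cong) auto
      also have "\<dots> = scalar (of_nat (card ?F)) * ?m T" by (rule sum_scalar_const)
      also have "of_nat (card ?F) = ?c / of_nat (row_mult_fact n T)"
      proof -
        have lam: "lam = map length T" using T by (simp add: row_weak_tableaux_def tableaux_def)
        have "card ?F * row_mult_fact n T = (\<Prod>r\<leftarrow>T. fact (length r))"
          using card_sort_fibre [of T n] T by (auto simp: row_weak_tableaux_def tableaux_def)
        then have "complex_of_nat (card ?F) * of_nat (row_mult_fact n T) = of_nat (\<Prod>r\<leftarrow>T. fact (length r))"
          by (metis of_nat_mult)
        also have "of_nat (\<Prod>r\<leftarrow>T. fact (length r)) = ?c"
          unfolding lam by (induction T) auto
        finally show ?thesis using row_mult_fact_pos [of n T] by (simp add: field_simps)
      qed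
      finally show "(\<Sum>S | S \<in> tableaux n lam \<and> map sort S = T. ?m (map sort S))
        = scalar (?c / of_nat (row_mult_fact n T)) * ?m T" .
    qed
    finally show ?thesis .
  qed
  ultimately have "virtual_sum n X (row_syms lam vs)
    - (\<Sum>T\<in>row_weak_tableaux n lam. scalar (?c / of_nat (row_mult_fact n T)) * ?m T) \<in> RI A"
    unfolding 1 by (simp add: sum_subtractf)
  from rel_ideal_lmult [OF fcar_scalar [of "1 / ?c"] this] show ?thesis
    using c by (simp add: right_diff_distrib sum_distrib_left scalar_mult flip: mult.assoc)
qed

text \<open>With even symbols, a row with a repeated entry gives a word that vanishes by
  \<open>virtual_word_repeat\<close>; what is left are the strict tableaux, whose multiplicities are
  all at most 1.\<close>

lemma virtual_sum_strict:
  assumes vs: "length vs = length lam" "set vs \<subseteq> A \<inter> Collect virtual" "proper_syms n \<subseteq> A"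
    and X: "set X \<subseteq> A \<times> A" and even: "\<And>v. v \<in> set vs \<Longrightarrow> parity v = 0"
  shows "scalar (1 / (\<Prod>l\<leftarrow>lam. fact l)) * virtual_sum n X (row_syms lam vs)
    - (\<Sum>T\<in>row_strict_tableaux n lam. monomial (virtual_word X (tab_cells T vs))) \<in> RI A"
proof -
  let ?m = "\<lambda>S. monomial (virtual_word X (tab_cells S vs))"
  let ?f = "\<lambda>T. scalar (1 / of_nat (row_mult_fact n T)) * ?m T"
  have sub: "row_strict_tableaux n lam \<subseteq> row_weak_tableaux n lam"
    by (auto simp: row_strict_tableaux_def row_weak_tableaux_def tableaux_def shape_def
        intro: strict_sorted_imp_sorted)
  have fin: "finite (row_weak_tableaux n lam)"
    unfolding row_weak_tableaux_def by simp
  have "row_mult_fact n T = 1" if "T \<in> row_strict_tableaux n lam" for T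
  proof -
    have "(\<Prod>x=1..n. fact (count_list r x)) = (1 :: nat)" if "r \<in> set T" for r
    proof (intro prod.neutral ballI)
      fix x
      have "distinct r"
        using \<open>T \<in> _\<close> \<open>r \<in> set T\<close> by (auto simp: row_strict_tableaux_def strict_sorted_iff)
      then have "count_list r x \<le> 1" by (simp add: distinct_count_atmost_1 flip: count_mset)
      then show "fact (count_list r x) = (1 :: nat)"
        by (cases "count_list r x") auto
    qed
    then show ?thesis
      unfolding row_mult_fact_def by (induction T) auto
  qed
  then have "(\<Sum>T\<in>row_strict_tableaux n lam. ?f T) = (\<Sum>T\<in>row_strict_tableaux n lam. ?m T)"
    by (intro sum.cong) auto
  then have "(\<Sum>T\<in>row_weak_tableaux n lam. ?f T)
      = (\<Sum>T\<in>row_weak_tableaux n lam - row_strict_tableaux n lam. ?f T) + (\<Sum>T\<in>row_strict_tableaux n lam. ?m T)"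
    using sum.subset_diff [OF sub fin, of ?f] by simp
  moreover have "(\<Sum>T\<in>row_weak_tableaux n lam - row_strict_tableaux n lam. ?f T) \<in> RI A"
  proof (intro rel_ideal_sum rel_ideal_lmult fcar_scalar)
    fix T assume T: "T \<in> row_weak_tableaux n lam - row_strict_tableaux n lam"
    then have lam: "lam = map length T" and T': "\<forall>r\<in>set T. set r \<subseteq> {1..n} \<and> sorted r"
      by (auto simp: row_weak_tableaux_def tableaux_def)
    obtain r where r: "r \<in> set T" "\<not> sorted_wrt (<) r"
      using T by (auto simp: row_weak_tableaux_def row_strict_tableaux_def tableaux_def shape_def)
    then have "\<not> distinct r" using T' by (auto simp: strict_sorted_iff)
    then obtain x where x: "count (mset r) x \<ge> 2"
      using distinct_count_atmost_1 [of r] by (metis One_nat_def Suc_1 count_eq_zero_iff not_less_eq_eq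
          le_Suc_eq le_zero_eq set_mset_mset)
    obtain i where i: "i < length T" "r = T ! i" using r by (metis in_set_conv_nth)
    let ?v = "vs ! i"
    have i': "i < length vs" using i vs(1) lam by simp
    have "(r, ?v) \<in> set (zip T vs)" using i i' by (auto simp: set_zip)
    then obtain L1 L2 where "zip T vs = L1 @ (r, ?v) # L2" by (metis split_list)
    then have "mset (map (\<lambda>s. (s, ?v)) r) \<subseteq># mset (tab_cells T vs)"
      by (simp add: tab_cells_def)
    moreover have "count (mset (map (\<lambda>s. (s, ?v)) r)) (x, ?v) = count (mset r) x"
      by (induction r) auto
    ultimately have "count (mset (tab_cells T vs)) (x, ?v) \<ge> 2"
      using x by (metis dual_order.trans mset_subset_eq_count)
    moreover have "tab_cells T vs \<in> virtual_cells A"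
    proof -
      have "zip (concat T) (row_syms lam vs) \<in> virtual_cells A"
        using T' set_row_syms [of lam vs] vs(2,3) by (intro zip_virtual_cells) auto
      then show ?thesis using zip_concat_row_syms [of T lam vs] vs(1) lam by simp
    qed
    ultimately show "?m T \<in> RI A"
      using virtual_word_repeat [of "tab_cells T vs" x ?v A X] X even [of ?v] i' by auto
  qed
  ultimately show ?thesis
    using rel_ideal_add [OF virtual_sum_weak [OF vs X]] by (fastforce simp: algebra_simps)
qed

section \<open>Capelli elements\<close>

definition cdet_from :: "nat \<Rightarrow> nat \<Rightarrow> (nat \<Rightarrow> nat \<Rightarrow> falg) \<Rightarrow> falg" where
  "cdet_from m k a = (\<Sum>\<sigma> | \<sigma> permutes {m..k}.
     of_int (sign \<sigma>) * prod_list (map (\<lambda>j. a (\<sigma> j) j) [m..<k+1]))"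

lemma cdet_from_1: "cdet k a = cdet_from 1 k a"
  by (simp add: cdet_def cdet_from_def)

lemma cdet_from_empty: "k < m \<Longrightarrow> cdet_from m k a = 1"
  by (simp add: cdet_from_def)

text \<open>A permutation of \<open>{m..k}\<close> is a transposition of \<open>m\<close> with some
  \<open>s\<close> after a permutation fixing \<open>m\<close>. In each product the factor of column
  \<open>m\<close> stands first, so it can be taken out on the left without commuting
  anything.\<close>

lemma cdet_from_expand:
  assumes "m \<le> k"
  shows "cdet_from m k a = (\<Sum>s\<in>{m..k}. (if s = m then 1 else - 1) *
    (a s m * cdet_from (Suc m) k (\<lambda>i j. a (transpose m s i) j)))"
proof -
  let ?T = "{Suc m..k}"
  have ins: "{m..k} = insert m ?T" using assms by auto
  have "cdet_from m k a = (\<Sum>s\<in>{m..k}. \<Sum>q | q permutes ?T.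
      of_int (sign (transpose m s \<circ> q)) * prod_list (map (\<lambda>j. a ((transpose m s \<circ> q) j) j) [m..<k+1]))"
    unfolding cdet_from_def ins by (rule sum_over_permutations_insert) auto
  also have "\<dots> = (\<Sum>s\<in>{m..k}. \<Sum>q | q permutes ?T.
     (if s = m then 1 else - 1) * (a s m * (of_int (sign q) * prod_list (map (\<lambda>j. a (transpose m s (q j)) j) [Suc m..<k+1]))))"
  proof (intro sum.cong refl)
    fix s q assume q: "q \<in> {q. q permutes ?T}"
    then have "permutation q" by (auto intro: permutes_imp_permutation [of ?T])
    then have "sign (transpose m s \<circ> q) = (if s = m then 1 else - 1) * sign q"
      by (simp add: sign_compose permutation_swap_id sign_swap_id)
    moreover have "q m = m" using q permutes_not_in [of q ?T m] by auto
    moreover have "[m..<k+1] = m # [Suc m..<k+1]"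
      using assms by (simp add: upt_conv_Cons)
    moreover have "of_int (sign q) * x = x * of_int (sign q)" for x :: falg
      by (simp add: sign_def)
    ultimately show "of_int (sign (transpose m s \<circ> q)) * prod_list (map (\<lambda>j. a ((transpose m s \<circ> q) j) j) [m..<k+1])
      = (if s = m then 1 else - 1) * (a s m * (of_int (sign q) * prod_list (map (\<lambda>j. a (transpose m s (q j)) j) [Suc m..<k+1])))"
      by (simp add: sign_def)
  qed
  also have "\<dots> = (\<Sum>s\<in>{m..k}. (if s = m then 1 else - 1) *
    (a s m * cdet_from (Suc m) k (\<lambda>i j. a (transpose m s i) j)))"
    by (simp add: cdet_from_def sum_distrib_left)
  finally show ?thesis .
qed

section \<open>Determinants as products of annihilations and creations\<close>

definition creations :: "gsym \<Rightarrow> nat list \<Rightarrow> (gsym \<times> gsym) list" where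
  "creations \<alpha> js = map (\<lambda>j. (\<alpha>, Proper j)) js"

definition annihilations :: "gsym \<Rightarrow> nat list \<Rightarrow> (gsym \<times> gsym) list" where
  "annihilations \<alpha> is = map (\<lambda>i. (Proper i, \<alpha>)) is"

lemma annihilations_simps [simp]:
  "annihilations \<alpha> [] = []" "annihilations \<alpha> (i # is) = (Proper i, \<alpha>) # annihilations \<alpha> is"
  "annihilations \<alpha> (is @ js) = annihilations \<alpha> is @ annihilations \<alpha> js"
  "length (annihilations \<alpha> is) = length is"
  by (simp_all add: annihilations_def)

lemma fcar_minus_one_power [simp]: "(- 1) ^ k \<in> fcar A"
  by (simp add: minus_one_power_iff)

lemma set_annihilations:
  "proper_syms n \<subseteq> A \<Longrightarrow> \<alpha> \<in> A \<Longrightarrow> set is \<subseteq> {1..n} \<Longrightarrow> set (annihilations \<alpha> is) \<subseteq> A \<times> A"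
  by (auto simp: annihilations_def proper_syms_def)

lemma set_creations:
  "proper_syms n \<subseteq> A \<Longrightarrow> \<alpha> \<in> A \<Longrightarrow> set is \<subseteq> {1..n} \<Longrightarrow> set (creations \<alpha> is) \<subseteq> A \<times> A"
  by (auto simp: creations_def proper_syms_def)

text \<open>Expansion permutes the rows, so row and column labels \<open>r\<close> and
  \<open>c\<close> are kept separate. The shift appears where the labels agree, and its size depends
  on the column only.\<close>

definition capelli_entry :: "nat \<Rightarrow> (nat \<Rightarrow> nat) \<Rightarrow> (nat \<Rightarrow> nat) \<Rightarrow> nat \<Rightarrow> nat \<Rightarrow> falg" where
  "capelli_entry k r c a b = letter (Proper (r a)) (Proper (c b)) + (if r a = c b then of_nat (k - b) else 0)"

lemma upt_split: "m \<le> a \<Longrightarrow> a \<le> k \<Longrightarrow> [m..<Suc k] = [m..<a] @ a # [Suc a..<Suc k]"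
  using upt_add_eq_append [of m a "Suc k - a"] by (simp add: upt_conv_Cons)

context
  fixes A :: "gsym set" and n :: nat and \<alpha> :: gsym
  assumes A: "proper_syms n \<subseteq> A" and \<alpha>: "\<alpha> \<in> A" "virtual \<alpha>" "parity \<alpha> = 0"
begin

lemma proper_in_A: "i \<in> {1..n} \<Longrightarrow> Proper i \<in> A"
  using A by (auto simp: proper_syms_def)

lemma alpha_not_Proper: "\<alpha> \<noteq> Proper i" "Proper i \<noteq> \<alpha>"
  using \<alpha> by auto

lemma annihilations_move:
  assumes "i \<in> {1..n}" "set is \<subseteq> {1..n}"
  shows "monomial (annihilations \<alpha> (i # is)) - (- 1) ^ length is * monomial (annihilations \<alpha> (is @ [i])) \<in> RI A"
  using assms(2)
proof (induction "is")
  case (Cons j js)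
  have ij: "{Proper i, \<alpha>, Proper j, \<alpha>} \<subseteq> A" using assms(1) Cons.prems proper_in_A \<alpha> by auto
  have "letter (Proper i) \<alpha> * letter (Proper j) \<alpha>
      - scalar (csign (Proper i) \<alpha> (Proper j) \<alpha>) * (letter (Proper j) \<alpha> * letter (Proper i) \<alpha>) \<in> RI A"
    using ij by (intro swap_super) (auto simp: alpha_not_Proper)
  then have 1: "(letter (Proper i) \<alpha> * letter (Proper j) \<alpha> + letter (Proper j) \<alpha> * letter (Proper i) \<alpha>)
      * monomial (annihilations \<alpha> js) \<in> RI A"
    using Cons.prems \<alpha> set_annihilations [OF A \<alpha>(1), of js]
    by (intro rel_ideal_rmult) (auto simp: csign_def scalar_uminus)
  have "letter (Proper j) \<alpha> * (monomial (annihilations \<alpha> (i # js))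
      - (- 1) ^ length js * monomial (annihilations \<alpha> (js @ [i]))) \<in> RI A"
    using Cons ij by (intro rel_ideal_lmult) auto
  from rel_ideal_diff [OF 1 this] show ?case
    by (simp add: minus_one_power_iff monomial_Cons [of _ "_ # _"] monomial_Cons [of _ "annihilations _ _"]
        monomial_Cons [of _ "annihilations _ _ @ _"] algebra_simps split: if_splits)
qed simp

text \<open>The eigenvalue of the adjoint action of e_{\<alpha>,\<alpha>} on the word.\<close>

definition weight :: "(gsym \<times> gsym) list \<Rightarrow> int" where
  "weight w = (\<Sum>l\<leftarrow>w. of_bool (fst l = \<alpha>) - of_bool (snd l = \<alpha>))"

lemma weight_simps [simp]:
  "weight [] = 0" "weight (l # w) = of_bool (fst l = \<alpha>) - of_bool (snd l = \<alpha>) + weight w"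
  "weight (u @ v) = weight u + weight v"
  by (simp_all add: weight_def)

text \<open>Moving e_{\<alpha>,\<alpha>} to the right through \<open>w\<close> produces the weight,
  and at the right end it makes the word irregular.\<close>

lemma weight_operator:
  assumes "set w \<subseteq> A \<times> A"
  shows "letter \<alpha> \<alpha> * monomial w - of_int (weight w) * monomial w \<in> JI A"
proof -
  have "letter \<alpha> \<alpha> * monomial w - monomial w * letter \<alpha> \<alpha> - ad_word \<alpha> \<alpha> w \<in> JI A"
    using \<alpha> by (intro LG_rel commutator_monomial assms) auto
  moreover have "ad_word \<alpha> \<alpha> w = of_int (weight w) * monomial w"
  proof (induction w)
    case (Cons l w)
    have "monomial [l] * (of_int i * x) = of_int i * (monomial [l] * x)" for i x
      unfolding scalar_of_int [symmetric] by (metis mult.assoc scalar_commute)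
    moreover obtain c d where l: "l = (c, d)" by (cases l)
    ultimately show ?case
      using Cons by (auto simp: l monomial_Cons [of "(_, _)" w] algebra_simps)
  qed simp
  moreover have "monomial w * letter \<alpha> \<alpha> \<in> JI A"
    using assms \<alpha> irregular_snoc_virtual [of \<alpha> w \<alpha>]
    by (simp add: JI_irregular flip: monomial_append)
  ultimately show ?thesis
    using LG_add [of "letter \<alpha> \<alpha> * monomial w - monomial w * letter \<alpha> \<alpha> - ad_word \<alpha> \<alpha> w" A _ "monomial w * letter \<alpha> \<alpha>"]
    by simp
qed

text \<open>
  Moving \<open>e\<^bsub>\<alpha>,j\<^esub>\<close> to the left through a product of letters \<open>e\<^bsub>i,\<alpha>\<^esub>\<close>: the terms produced by moving the
  letters \<open>e\<^bsub>i,j\<^esub>\<close> to the left afterwards make the scalar next to \<open>e\<^bsub>i,j\<^esub>\<close> independent of \<open>i\<close>.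
\<close>

lemma creation_move_left:
  assumes "set is \<subseteq> {1..n}" "j \<in> {1..n}" "set w \<subseteq> A \<times> A"
  shows "monomial (annihilations \<alpha> is @ (\<alpha>, Proper j) # w)
    - (\<Sum>t<length is. (- 1) ^ (length is - 1 - t) *
        ((letter (Proper (is ! t)) (Proper j) + (if is ! t = j then of_int (weight w) else 0))
          * monomial (annihilations \<alpha> (take t is @ drop (Suc t) is) @ w)))
    - (- 1) ^ length is * monomial ((\<alpha>, Proper j) # annihilations \<alpha> is @ w) \<in> JI A"
  using assms(1)
proof (induction "is")
  case Nil
  then show ?case by simp
next
  case (Cons i js)
  let ?e = "\<lambda>i. letter (Proper i) (Proper j)" and ?q = "of_int (weight w) :: falg"
  let ?x = "letter (Proper i) \<alpha>" and ?c = "letter \<alpha> (Proper j)"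
  let ?om = "\<lambda>t. monomial (annihilations \<alpha> (take t js @ drop (Suc t) js) @ w)"
  let ?L = "length js" and ?\<delta> = "if i = j then 1 else 0 :: falg"
  let ?k = "\<lambda>t. if js ! t = j then ?q else 0"
  let ?P = "monomial (annihilations \<alpha> js @ w)"
  have ij: "Proper i \<in> A" "Proper j \<in> A" "\<alpha> \<in> A" and js: "set js \<subseteq> {1..n}" and i: "i \<in> {1..n}"
    using Cons.prems assms(2) proper_in_A \<alpha> by auto
  have wA: "set (annihilations \<alpha> js @ w) \<subseteq> A \<times> A"
    using set_annihilations [OF A \<alpha>(1) js] assms(3) by auto
  define sg where "sg t = (- 1 :: falg) ^ (?L - 1 - t)" for t
  have sgc: "x * (sg t * y) = sg t * (x * y)" "x * ((- 1) ^ L * y) = (- 1) ^ L * (x * y)" for x y :: falg and t L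
    by (simp_all add: sg_def minus_one_power_iff)
  have qc: "x * (?q * y) = ?q * (x * y)" for x y
    unfolding scalar_of_int [symmetric] by (metis mult.assoc scalar_commute)
  have IH: "?x * (monomial (annihilations \<alpha> js @ (\<alpha>, Proper j) # w)
      - (\<Sum>t<?L. sg t * ((?e (js ! t) + ?k t) * ?om t))
      - (- 1) ^ ?L * (?c * ?P)) \<in> JI A"
    using Cons ij unfolding sg_def by (intro LG_lmult) (auto simp: monomial_Cons [of "(\<alpha>, Proper j)"  "_ @ _"])
  have om: "?om t \<in> fcar A" for t
  proof -
    have sub: "set (take t js @ drop (Suc t) js) \<subseteq> {1..n}"
      using js by (auto dest: in_set_takeD in_set_dropD)
    show ?thesis using set_annihilations [OF A \<alpha>(1) sub] assms(3) by simp
  qed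
  \<comment> \<open>Passing the new letter e_{i,\<alpha>} through e_{s,j}, where \<open>s\<close> is
    entry \<open>t\<close> of \<open>js\<close>, leaves a bracket term e_{s,\<alpha>} exactly when
    \<open>i = j\<close>.\<close>
  have "(?x * ?e (js ! t) - ?e (js ! t) * ?x + ?\<delta> * letter (Proper (js ! t)) \<alpha>) * ?om t \<in> RI A" if "t < ?L" for t
  proof (rule rel_ideal_rmult [OF om])
    have t: "js ! t \<in> {1..n}" using js that by (simp add: subset_iff)
    have "?x * ?e (js ! t) - super_sign (Proper i) \<alpha> (Proper (js ! t)) (Proper j) * (?e (js ! t) * ?x)
        - gl_bracket (Proper i) \<alpha> (Proper (js ! t)) (Proper j) \<in> RI A"
      using ij t proper_in_A by (intro relator_in_rel_ideal) auto
    then show "?x * ?e (js ! t) - ?e (js ! t) * ?x + ?\<delta> * letter (Proper (js ! t)) \<alpha> \<in> RI A"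
      using \<alpha> by (auto simp: gl_bracket_def super_sign_def alpha_not_Proper split: if_splits)
  qed
  then have 2: "(\<Sum>t<?L. sg t * ((?x * ?e (js ! t) - ?e (js ! t) * ?x + ?\<delta> * letter (Proper (js ! t)) \<alpha>) * ?om t)) \<in> JI A"
    by (intro LG_sum LG_lmult [OF LG_rel]) (auto simp: sg_def)
  \<comment> \<open>That bracket term is the letter that had been omitted; returning it to position
    \<open>t\<close> passes \<open>t\<close> anticommuting letters.\<close>
  have "letter (Proper (js ! t)) \<alpha> * ?om t - (- 1) ^ t * ?P \<in> RI A" if t: "t < ?L" for t
  proof -
    have jt: "js ! t \<in> {1..n}" using js t by (simp add: subset_iff)
    have sub: "set (take t js) \<subseteq> {1..n}" "set (drop (Suc t) js) \<subseteq> {1..n}"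
      using js by (auto dest: in_set_takeD in_set_dropD)
    have "(monomial (annihilations \<alpha> (js ! t # take t js))
        - (- 1) ^ t * monomial (annihilations \<alpha> (take t js @ [js ! t])))
        * monomial (annihilations \<alpha> (drop (Suc t) js) @ w) \<in> RI A"
      using annihilations_move [OF jt sub(1)] t set_annihilations [OF A \<alpha>(1) sub(2)] assms(3)
      by (intro rel_ideal_rmult) auto
    moreover have "take t js @ [js ! t] @ drop (Suc t) js = js"
      using t by (simp add: Cons_nth_drop_Suc)
    then have "annihilations \<alpha> js = annihilations \<alpha> (take t js @ [js ! t]) @ annihilations \<alpha> (drop (Suc t) js)"
      by (metis annihilations_simps(3) append.assoc)
    ultimately show ?thesis
      by (simp add: left_diff_distrib mult.assoc flip: monomial_append)
  qed
  then have 3: "(\<Sum>t<?L. sg t * (?\<delta> * (letter (Proper (js ! t)) \<alpha> * ?om t - (- 1) ^ t * ?P))) \<in> JI A"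
    by (intro LG_sum LG_lmult [OF LG_lmult [OF LG_rel]]) (auto simp: sg_def)
  have "(?x * ?c + ?c * ?x - ?e i - ?\<delta> * letter \<alpha> \<alpha>) * ?P \<in> RI A"
  proof (rule rel_ideal_rmult)
    have "?x * ?c - super_sign (Proper i) \<alpha> \<alpha> (Proper j) * (?c * ?x)
        - gl_bracket (Proper i) \<alpha> \<alpha> (Proper j) \<in> RI A"
      using ij by (intro relator_in_rel_ideal) auto
    then show "?x * ?c + ?c * ?x - ?e i - ?\<delta> * letter \<alpha> \<alpha> \<in> RI A"
      using \<alpha> by (auto simp: gl_bracket_def super_sign_def algebra_simps split: if_splits)
    show "?P \<in> fcar A" using wA by simp
  qed
  then have 4: "(- 1) ^ ?L * ((?x * ?c + ?c * ?x - ?e i - ?\<delta> * letter \<alpha> \<alpha>) * ?P) \<in> JI A"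
    by (intro LG_lmult [OF LG_rel]) auto
  have wt: "weight (annihilations \<alpha> js @ w) = weight w - int ?L"
    by (induction js) (simp_all add: alpha_not_Proper)
  have 5: "(- 1) ^ ?L * (?\<delta> * (letter \<alpha> \<alpha> * ?P - (?q - of_nat ?L) * ?P)) \<in> JI A"
    using weight_operator [OF wA] unfolding wt
    by (intro LG_lmult [OF LG_lmult]) (auto simp: algebra_simps)
  \<comment> \<open>The sign of the \<open>t\<close>-th summand times the sign of reinsertion is the
    same for all \<open>t\<close>. The total is a multiple of the length of \<open>js\<close>, and
    it cancels the contribution of the annihilations to the weight in \<open>wt\<close>, leaving
    just \<open>weight w\<close>.\<close>
  have sum: "(\<Sum>t<?L. sg t * (?\<delta> * ((- 1) ^ t * ?P))) = - ((- 1) ^ ?L * (?\<delta> * (of_nat ?L * ?P)))"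
  proof -
    have "sg t * (?\<delta> * ((- 1) ^ t * ?P)) = - ((- 1) ^ ?L * (?\<delta> * ?P))" if "t < ?L" for t
    proof -
      have "(- 1 :: falg) ^ (?L - 1 - t) * (- 1) ^ t = (- 1) ^ (?L - 1)"
        using that by (simp flip: power_add)
      moreover have "(- 1 :: falg) ^ (?L - 1) = - ((- 1) ^ ?L)"
        using that by (cases ?L) auto
      ultimately show ?thesis
        by (auto simp: sg_def simp flip: mult.assoc)
    qed
    then show ?thesis by (simp add: sgc(2) [of "of_nat ?L" ?L])
  qed
  define SA where "SA = (\<Sum>t<?L. sg t * (?x * (?e (js ! t) * ?om t)))"
  define SB where "SB = (\<Sum>t<?L. sg t * (?e (js ! t) * (?x * ?om t)))"
  define SC where "SC = (\<Sum>t<?L. sg t * (?k t * (?x * ?om t)))"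
  define SD where "SD = (\<Sum>t<?L. sg t * (?\<delta> * (letter (Proper (js ! t)) \<alpha> * ?om t)))"
  let ?M = "monomial (annihilations \<alpha> js @ (\<alpha>, Proper j) # w)"
  have x_in: "?x * (sg t * ((?e (js ! t) + ?k t) * ?om t)) = sg t * (?x * (?e (js ! t) * ?om t)) + sg t * (?k t * (?x * ?om t))" for t
    using qc [of ?x "?om t"] by (simp add: sgc(1) [of ?x] distrib_left distrib_right mult.assoc)
  have "?x * (\<Sum>t<?L. sg t * ((?e (js ! t) + ?k t) * ?om t)) = SA + SC"
    by (simp only: sum_distrib_left x_in sum.distrib SA_def SC_def)
  then have IH': "?x * ?M - SA - SC - (- 1) ^ ?L * (?x * (?c * ?P)) \<in> JI A"
    using IH unfolding right_diff_distrib by (simp add: sgc(2) [of ?x] algebra_simps)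
  have 2: "SA - SB + SD \<in> JI A"
    using 2 by (simp add: SA_def SB_def SD_def algebra_simps sum.distrib sum_subtractf)
  have 3: "SD + (- 1) ^ ?L * (?\<delta> * (of_nat ?L * ?P)) \<in> JI A"
    using 3 unfolding right_diff_distrib sum_subtractf sum SD_def by simp
  have lhs: "monomial (annihilations \<alpha> (i # js) @ (\<alpha>, Proper j) # w)
    - (\<Sum>t<length (i # js). (- 1) ^ (length (i # js) - 1 - t) *
        ((?e ((i # js) ! t) + (if (i # js) ! t = j then ?q else 0))
          * monomial (annihilations \<alpha> (take t (i # js) @ drop (Suc t) (i # js)) @ w)))
    - (- 1) ^ length (i # js) * monomial ((\<alpha>, Proper j) # annihilations \<alpha> (i # js) @ w)
    = ?x * ?M - ((- 1) ^ ?L * ((?e i + ?\<delta> * ?q) * ?P) + (SB + SC)) + (- 1) ^ ?L * (?c * (?x * ?P))"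
    by (simp add: sum.lessThan_Suc_shift SB_def SC_def sg_def distrib_right distrib_left sum.distrib mult.assoc
        del: sum.lessThan_Suc flip: monomial_append)
  show ?case
    unfolding lhs
    using LG_add [OF LG_add [OF LG_add [OF LG_add [OF IH' 2] LG_uminus [OF 3]] 4] 5]
    by (cases "i = j") (simp_all add: algebra_simps)
qed

text \<open>The list is reversed, so row \<open>a\<close> sits at position \<open>k - a\<close>.
  Deleting row \<open>a\<close> and exchanging rows \<open>m\<close> and \<open>a\<close> differ by
  moving the letter of row \<open>m\<close> past the \<open>a - m - 1\<close> rows strictly between;
  the remaining sign is that of the transposition.\<close>

lemma omit_row:
  assumes a: "a \<in> {m..k}" and r: "r ` {m..k} \<subseteq> {1..n}" and w: "set w \<subseteq> A \<times> A"
  defines "is \<equiv> rev (map r [m..<k+1])"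
  shows "(- 1) ^ (a - m) * monomial (annihilations \<alpha> (take (k - a) is @ drop (Suc (k - a)) is) @ w)
    - (if a = m then 1 else - 1) * monomial (annihilations \<alpha> (rev (map (r \<circ> transpose m a) [Suc m..<k+1])) @ w) \<in> RI A"
proof -
  define U where "U = rev (map r [Suc a..<k+1])"
  define V where "V = rev (map r [Suc m..<a])"
  have split: "[m..<k+1] = [m..<a] @ a # [Suc a..<k+1]"
    using upt_split [of m a k] a by (simp del: upt_Suc)
  have is_eq: "is = U @ r a # rev (map r [m..<a])"
    unfolding is_def split by (simp add: U_def)
  have "length U = k - a" using a by (simp add: U_def del: upt_Suc)
  then have omit: "take (k - a) is @ drop (Suc (k - a)) is = U @ rev (map r [m..<a])"
    unfolding is_eq by simp
  show ?thesis
  proof (cases "a = m")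
    case True
    then show ?thesis unfolding omit by (simp add: U_def)
  next
    case False
    then have am: "m < a" using a by simp
    have r': "map (r \<circ> transpose m a) [Suc m..<k+1] = map r [Suc m..<a] @ r m # map r [Suc a..<k+1]"
    proof -
      have eq: "[Suc m..<k+1] = [Suc m..<a] @ a # [Suc a..<k+1]"
        using upt_split [of "Suc m" a k] a am by (simp del: upt_Suc)
      show ?thesis
        unfolding eq using am by (auto simp: transpose_def simp del: upt_Suc)
    qed
    have V: "rev (map r [m..<a]) = V @ [r m]"
      using am by (simp add: V_def upt_conv_Cons)
    have lV: "a - m = Suc (length V)" using am by (simp add: V_def)
    have sets: "set V \<subseteq> {1..n}" "set U \<subseteq> {1..n}" "r m \<in> {1..n}"
      using r a by (auto simp: U_def V_def image_subset_iff)
    have "monomial (annihilations \<alpha> U) * ((monomial (annihilations \<alpha> (r m # V))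
        - (- 1) ^ length V * monomial (annihilations \<alpha> (V @ [r m]))) * monomial w) \<in> RI A"
      using annihilations_move [OF sets(3,1)] set_annihilations [OF A \<alpha>(1) sets(2)] w
      by (intro rel_ideal_lmult rel_ideal_rmult) auto
    moreover have "x * ((- 1) ^ L * y) = (- 1) ^ L * (x * y)" for x y :: falg and L
      by (simp add: minus_one_power_iff)
    then have "monomial (annihilations \<alpha> U) * ((monomial (annihilations \<alpha> (r m # V))
        - (- 1) ^ length V * monomial (annihilations \<alpha> (V @ [r m]))) * monomial w)
      = monomial (annihilations \<alpha> (U @ r m # V) @ w) - (- 1) ^ length V * monomial (annihilations \<alpha> (U @ V @ [r m]) @ w)"
      by (simp add: left_diff_distrib right_diff_distrib mult.assoc monomial_append)
        (simp add: monomial_append [symmetric])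
    ultimately have "monomial (annihilations \<alpha> (U @ r m # V) @ w)
        - (- 1) ^ length V * monomial (annihilations \<alpha> (U @ V @ [r m]) @ w) \<in> RI A"
      by simp
    moreover have "rev (map (r \<circ> transpose m a) [Suc m..<k+1]) = U @ r m # V"
      unfolding r' by (simp add: U_def V_def del: upt_Suc)
    ultimately show ?thesis
      unfolding omit V lV using False by simp
  qed
qed

text \<open>Induction on the number of columns: moving the creation letter of column
  \<open>m\<close> to the left by \<open>creation_move_left\<close> gives one term for each row, and
  by \<open>omit_row\<close> these are the terms of the expansion along column
  \<open>m\<close>.\<close>

lemma cdet_virtual:
  assumes "r ` {m..k} \<subseteq> {1..n}" "c ` {m..k} \<subseteq> {1..n}"
  shows "cdet_from m k (capelli_entry k r c)
    - monomial (annihilations \<alpha> (rev (map r [m..<k+1])) @ creations \<alpha> (map c [m..<k+1])) \<in> JI A"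
  using assms
proof (induction "k + 1 - m" arbitrary: m r)
  case 0
  then show ?case by (simp add: cdet_from_empty creations_def monomial_Nil)
next
  case (Suc d)
  then have mk: "m \<le> k" by simp
  let ?is = "rev (map r [m..<k+1])" and ?L = "Suc k - m"
  define w where "w = creations \<alpha> (map c [Suc m..<k+1])"
  have "set (map c [Suc m..<k+1]) \<subseteq> {1..n}" using Suc.prems(2) by auto
  then have w: "set w \<subseteq> A \<times> A" unfolding w_def by (rule set_creations [OF A \<alpha>(1)])
  have is1: "set ?is \<subseteq> {1..n}" using Suc.prems(1) by auto
  have cm: "c m \<in> {1..n}" using Suc.prems(2) mk by (meson atLeastAtMost_iff image_subset_iff order_refl)
  have "weight (creations \<alpha> js) = int (length js)" for js
    by (induction js) (auto simp: creations_def alpha_not_Proper)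
  \<comment> \<open>The \<open>k - m\<close> creations still to the right produce the diagonal shift
    of column \<open>m\<close>.\<close>
  then have wt: "weight w = int (k - m)" using mk by (simp add: w_def)
  have len: "length ?is = ?L" using mk by simp
  let ?E = "capelli_entry k r c"
  let ?om = "\<lambda>t. monomial (annihilations \<alpha> (take t ?is @ drop (Suc t) ?is) @ w)"
  let ?G = "\<lambda>a. monomial (annihilations \<alpha> (rev (map (r \<circ> transpose m a) [Suc m..<k+1])) @ w)"
  let ?s = "\<lambda>a. if a = m then 1 else - 1 :: falg"
  have entry: "?E a m \<in> fcar A" if "a \<in> {m..k}" for a
    using that Suc.prems(1) cm proper_in_A unfolding capelli_entry_def
    by (intro fcar_add) (auto simp: image_subset_iff)
  have "monomial (annihilations \<alpha> ?is @ (\<alpha>, Proper (c m)) # w)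
    - (\<Sum>t<?L. (- 1) ^ (?L - 1 - t) * ((letter (Proper (?is ! t)) (Proper (c m)) + (if ?is ! t = c m then of_int (weight w) else 0)) * ?om t))
    - (- 1) ^ ?L * monomial ((\<alpha>, Proper (c m)) # annihilations \<alpha> ?is @ w) \<in> JI A"
    using creation_move_left [OF is1 cm w] unfolding len .
  moreover have "(\<Sum>t<?L. (- 1) ^ (?L - 1 - t) * ((letter (Proper (?is ! t)) (Proper (c m)) + (if ?is ! t = c m then of_int (weight w) else 0)) * ?om t))
    = (\<Sum>a\<in>{m..k}. ?E a m * ((- 1) ^ (a - m) * ?om (k - a)))"
  proof (rule sum.reindex_bij_witness [where i = "\<lambda>a. k - a" and j = "\<lambda>t. k - t"])
    fix t assume t: "t \<in> {..<?L}"
    have "?is ! t = r (k - t)"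
      using t mk by (simp add: rev_nth nth_append del: upt_Suc)
    moreover have "?L - 1 - t = k - t - m" "k - (k - t) = t" using t by auto
    moreover have "x * ((- 1) ^ L * y) = (- 1) ^ L * (x * y)" for x y :: falg and L
      by (simp add: minus_one_power_iff)
    ultimately show "?E (k - t) m * ((- 1) ^ (k - t - m) * ?om (k - (k - t)))
      = (- 1) ^ (?L - 1 - t) * ((letter (Proper (?is ! t)) (Proper (c m)) + (if ?is ! t = c m then of_int (weight w) else 0)) * ?om t)"
      by (simp add: capelli_entry_def wt)
  qed (use mk in auto)
  \<comment> \<open>Once the creation letter has reached the front, behind it stand
    \<open>k - m + 1\<close> annihilations of \<alpha> and only \<open>k - m\<close> creations, so
    that word is irregular.\<close>
  moreover have "(- 1) ^ ?L * monomial ((\<alpha>, Proper (c m)) # annihilations \<alpha> ?is @ w) \<in> JI A"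
  proof -
    let ?w = "annihilations \<alpha> ?is @ w"
    have "count_list (map snd (annihilations \<alpha> js)) \<alpha> = length js" for js
      by (induction js) auto
    moreover have "count_list (map fst (annihilations \<alpha> js)) \<alpha> = 0" for js
      by (induction js) (auto simp: alpha_not_Proper)
    moreover have "count_list (map fst w) \<alpha> = k - m"
    proof -
      have "count_list (map fst (creations \<alpha> js)) \<alpha> = length js" for js
        by (induction js) (auto simp: creations_def)
      then show ?thesis using mk by (simp add: w_def del: upt_Suc)
    qed
    ultimately have "count_list (map snd ?w) \<alpha> \<ge> Suc (k - m)" "count_list (map fst ?w) \<alpha> = k - m"
      using mk len by (simp_all add: alpha_not_Proper)
    moreover have "count_list (map fst (take i (rev ?w))) \<alpha> \<le> count_list (map fst ?w) \<alpha>" for i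
    proof -
      have "count_list (map fst ?w) \<alpha> = count_list (map fst (rev ?w)) \<alpha>"
        by (simp add: count_list_rev rev_map [symmetric] del: rev_append rev_rev_ident)
      also have "map fst (rev ?w) = map fst (take i (rev ?w)) @ map fst (drop i (rev ?w))"
        by (metis append_take_drop_id map_append)
      finally show ?thesis by simp
    qed
    moreover have "count_list (map snd (take (length ?w) (rev ?w))) \<alpha> = count_list (map snd ?w) \<alpha>"
      by (simp add: count_list_rev rev_map [symmetric] del: rev_append rev_rev_ident length_append)
    ultimately have "count_list (map snd (take (length ?w) (rev ?w))) \<alpha>
        > count_list (map fst (take (length ?w - 1) (rev ?w))) \<alpha>"
      by (metis le_imp_less_Suc less_le_trans)
    moreover have "length ?w \<ge> 1" using mk by simp
    ultimately have "irregular ?w"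
      unfolding irregular_def using \<alpha>(2) by (intro exI [of _ \<alpha>] conjI bexI [of _ "length ?w"]) auto
    then have "monomial ?w \<in> JI A"
      using set_annihilations [OF A \<alpha>(1) is1] w by (intro JI_irregular) auto
    then have "(- 1) ^ ?L * (letter \<alpha> (Proper (c m)) * monomial ?w) \<in> JI A"
      using proper_in_A [OF cm] \<alpha> by (intro LG_lmult [OF LG_lmult]) auto
    then show ?thesis by (simp only: monomial_Cons [of "(\<alpha>, Proper (c m))" "_ @ _"])
  qed
  ultimately have 1: "monomial (annihilations \<alpha> ?is @ (\<alpha>, Proper (c m)) # w)
    - (\<Sum>a\<in>{m..k}. ?E a m * ((- 1) ^ (a - m) * ?om (k - a))) \<in> JI A"
    using LG_add by fastforce
  have 2: "(\<Sum>a\<in>{m..k}. ?E a m * ((- 1) ^ (a - m) * ?om (k - a) - ?s a * ?G a)) \<in> JI A"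
    using omit_row [OF _ Suc.prems(1) w] entry by (intro LG_sum LG_lmult [OF LG_rel]) auto
  have 3: "(\<Sum>a\<in>{m..k}. ?s a * (?E a m * (cdet_from (Suc m) k (\<lambda>i j. ?E (transpose m a i) j) - ?G a))) \<in> JI A"
  proof (intro LG_sum LG_lmult [OF LG_lmult])
    fix a assume a: "a \<in> {m..k}"
    have "(\<lambda>i j. ?E (transpose m a i) j) = capelli_entry k (r \<circ> transpose m a) c"
      by (simp add: capelli_entry_def fun_eq_iff)
    moreover have "cdet_from (Suc m) k (capelli_entry k (r \<circ> transpose m a) c) - ?G a \<in> JI A"
      unfolding w_def
    proof (rule Suc.hyps(1))
      show "d = k + 1 - Suc m" using Suc.hyps(2) by simp
      have "transpose m a ` {Suc m..k} \<subseteq> {m..k}"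
        using a by (auto simp: transpose_def)
      then show "(r \<circ> transpose m a) ` {Suc m..k} \<subseteq> {1..n}"
        using Suc.prems(1) by fastforce
      show "c ` {Suc m..k} \<subseteq> {1..n}" using Suc.prems(2) by auto
    qed
    ultimately show "cdet_from (Suc m) k (\<lambda>i j. ?E (transpose m a i) j) - ?G a \<in> JI A" by simp
  qed (use entry in auto)
  have sE: "?E a m * (?s a * y) = ?s a * (?E a m * y)" for a y by simp
  have "cdet_from m k ?E = (\<Sum>a\<in>{m..k}. ?s a * (?E a m * cdet_from (Suc m) k (\<lambda>i j. ?E (transpose m a i) j)))"
    by (rule cdet_from_expand [OF mk])
  moreover have "annihilations \<alpha> ?is @ creations \<alpha> (map c [m..<k+1]) = annihilations \<alpha> ?is @ (\<alpha>, Proper (c m)) # w"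
    using mk by (simp add: w_def creations_def upt_conv_Cons del: upt_Suc)
  ultimately show ?case
    using LG_diff [OF LG_diff [OF 3 2] 1]
    by (simp add: right_diff_distrib sum_subtractf sE del: upt_Suc)
qed

end

section \<open>Capelli elements as virtual sums\<close>

definition capelli :: "nat \<Rightarrow> nat \<Rightarrow> falg" where
  "capelli n k = (\<Sum>J | J \<subseteq> {1..n} \<and> card J = k.
     cdet k (\<lambda>a b. letter (Proper (sorted_list_of_set J ! (a - 1)))
                           (Proper (sorted_list_of_set J ! (b - 1)))
                    + (if a = b then of_nat (k - a) else 0)))"

lemma H_gen_capelli: "H_gen n k = cls (proper_syms n) (capelli n k)"
  by (simp add: H_gen_def capelli_def)

lemma cdet_cong:
  assumes "\<And>i j. i \<in> {1..k} \<Longrightarrow> j \<in> {1..k} \<Longrightarrow> a i j = b i j"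
  shows "cdet k a = cdet k b"
  unfolding cdet_def
proof (intro sum.cong refl arg_cong2 [where f = "(*)"] arg_cong [where f = prod_list] map_cong)
  fix \<sigma> j assume "\<sigma> \<in> {\<sigma>. \<sigma> permutes {1..k}}" "j \<in> set [1..<k+1]"
  then have "\<sigma> j \<in> {1..k}" "j \<in> {1..k}"
    using permutes_in_image [of \<sigma> "{1..k}" j] by auto
  then show "a (\<sigma> j) j = b (\<sigma> j) j" using assms by blast
qed

lemma fcar_cdet:
  assumes "\<And>i j. i \<in> {1..k} \<Longrightarrow> j \<in> {1..k} \<Longrightarrow> a i j \<in> fcar A"
  shows "cdet k a \<in> fcar A"
  unfolding cdet_def
proof (intro fcar_sum fcar_mult fcar_of_int fcar_prod_list)
  fix \<sigma> x assume \<sigma>: "\<sigma> \<in> {\<sigma>. \<sigma> permutes {1..k}}" and "x \<in> set (map (\<lambda>j. a (\<sigma> j) j) [1..<k+1])"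
  then obtain j where "x = a (\<sigma> j) j" "j \<in> {1..k}" by auto
  moreover from \<sigma> this have "\<sigma> j \<in> {1..k}"
    using permutes_in_image [of \<sigma> "{1..k}" j] by auto
  ultimately show "x \<in> fcar A" using assms by blast
qed

lemma subset_row:
  fixes n :: nat
  assumes "J \<subseteq> {1..n}" "card J = k"
  defines "xs \<equiv> sorted_list_of_set J"
  shows "length xs = k" "set xs \<subseteq> {1..n}" "distinct xs" "sorted_wrt (<) xs"
    "map (\<lambda>a. xs ! (a - 1)) [1..<k+1] = xs"
    "a \<in> {1..k} \<Longrightarrow> xs ! (a - 1) \<in> J"
    "a \<in> {1..k} \<Longrightarrow> b \<in> {1..k} \<Longrightarrow> xs ! (a - 1) = xs ! (b - 1) \<longleftrightarrow> a = b"
proof -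
  have fin: "finite J" using finite_subset [OF assms(1)] by simp
  then show len: "length xs = k" and set: "set xs \<subseteq> {1..n}" and dist: "distinct xs" and "sorted_wrt (<) xs"
    using assms(1,2) by (simp_all add: xs_def)
  show "map (\<lambda>a. xs ! (a - 1)) [1..<k+1] = xs"
    by (intro nth_equalityI) (simp_all add: len nth_append del: upt_Suc)
  show "xs ! (a - 1) \<in> J" if "a \<in> {1..k}"
  proof -
    have "xs ! (a - 1) \<in> set xs" using that len by (intro nth_mem) auto
    then show ?thesis using fin by (simp add: xs_def)
  qed
  show "xs ! (a - 1) = xs ! (b - 1) \<longleftrightarrow> a = b" if "a \<in> {1..k}" "b \<in> {1..k}"
    using that len by (subst nth_eq_iff_index_eq [OF dist]) auto
qed

lemma capelli_carrier: "capelli n k \<in> fcar (proper_syms n)"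
  unfolding capelli_def
proof (intro fcar_sum fcar_cdet fcar_add)
  fix J i j assume J: "J \<in> {J. J \<subseteq> {1..n} \<and> card J = k}" and "i \<in> {1..k}" "j \<in> {1..k}"
  then have "sorted_list_of_set J ! (i - 1) \<in> {1..n}" "sorted_list_of_set J ! (j - 1) \<in> {1..n}"
    using subset_row(6) [of J n k] by blast+
  then show "letter (Proper (sorted_list_of_set J ! (i - 1))) (Proper (sorted_list_of_set J ! (j - 1))) \<in> fcar (proper_syms n)"
    by (auto simp: proper_syms_def)
  show "(if i = j then of_nat (k - i) else 0) \<in> fcar (proper_syms n)" by simp
qed

text \<open>The sign of the reversal of \<open>k\<close> anticommuting letters,
  \<open>(- 1) ^ (k * (k - 1) div 2)\<close>.\<close>

definition rev_sign :: "nat \<Rightarrow> complex" where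
  "rev_sign k = (\<Prod>i<k. (- 1) ^ i)"

lemma rev_sign_square: "rev_sign k * rev_sign k = 1"
  by (simp add: rev_sign_def flip: prod.distrib power_add mult_2)

lemma annihilations_rev:
  assumes A: "proper_syms n \<subseteq> A" and \<alpha>: "\<alpha> \<in> A" "virtual \<alpha>" "parity \<alpha> = 0"
    and "set xs \<subseteq> {1..n}"
  shows "monomial (annihilations \<alpha> xs) - scalar (rev_sign (length xs)) * monomial (annihilations \<alpha> (rev xs)) \<in> RI A"
  using assms(5)
proof (induction xs)
  case Nil
  then show ?case by (simp add: rev_sign_def)
next
  case (Cons x xs)
  let ?s = "scalar (rev_sign (length xs))"
  have x: "x \<in> {1..n}" "set (rev xs) \<subseteq> {1..n}" using Cons.prems by auto
  have "letter (Proper x) \<alpha> * (monomial (annihilations \<alpha> xs) - ?s * monomial (annihilations \<alpha> (rev xs))) \<in> RI A"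
    using Cons A \<alpha> by (intro rel_ideal_lmult) (auto simp: proper_syms_def)
  moreover have "letter (Proper x) \<alpha> * (?s * y) = ?s * (letter (Proper x) \<alpha> * y)" for y
    by (metis mult.assoc scalar_commute)
  ultimately have "monomial (annihilations \<alpha> (x # xs)) - ?s * monomial (annihilations \<alpha> (x # rev xs)) \<in> RI A"
    by (simp add: right_diff_distrib flip: monomial_Cons)
  moreover have "?s * (monomial (annihilations \<alpha> (x # rev xs))
      - (- 1) ^ length (rev xs) * monomial (annihilations \<alpha> (rev xs @ [x]))) \<in> RI A"
    by (intro rel_ideal_lmult fcar_scalar annihilations_move [OF A \<alpha>] x)
  ultimately have "(monomial (annihilations \<alpha> (x # xs)) - ?s * monomial (annihilations \<alpha> (x # rev xs)))
      + ?s * (monomial (annihilations \<alpha> (x # rev xs))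
      - (- 1) ^ length (rev xs) * monomial (annihilations \<alpha> (rev xs @ [x]))) \<in> RI A"
    by (rule rel_ideal_add)
  moreover have "?s * (- 1) ^ length xs = scalar (rev_sign (length (x # xs)))"
  proof -
    have "(- 1) ^ length xs = scalar ((- 1) ^ length xs)"
      by (simp add: minus_one_power_iff scalar_uminus)
    then show ?thesis by (simp add: scalar_mult rev_sign_def)
  qed
  ultimately show ?case by (simp add: right_diff_distrib flip: mult.assoc)
qed

text \<open>Strict tableaux with one row of length \<open>k\<close> are \<open>k\<close>-subsets, so
  the \<open>k\<close>-th Capelli element is \<open>K_elem\<close> of the partition
  \<open>[k]\<close> up to a sign. The sign arises because \<open>cdet_virtual\<close> lists the
  annihilations in reversed order.\<close>

lemma capelli_virtual:
  assumes A: "proper_syms n \<subseteq> A" and \<alpha>: "\<alpha> \<in> A" "virtual \<alpha>" "parity \<alpha> = 0"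
  shows "scalar (rev_sign k / fact k) * virtual_sum n [] (replicate k \<alpha>) - capelli n k \<in> JI A"
proof -
  let ?S = "{J. J \<subseteq> {1..n} \<and> card J = k}" and ?e = "scalar (rev_sign k)"
  let ?w = "\<lambda>J. monomial (virtual_word [] (tab_cells [sorted_list_of_set J] [\<alpha>]))"
  have fin: "finite ?S" by simp
  have "scalar (1 / fact k) * virtual_sum n [] (row_syms [k] [\<alpha>])
    - (\<Sum>T\<in>row_strict_tableaux n [k]. monomial (virtual_word [] (tab_cells T [\<alpha>]))) \<in> RI A"
    using virtual_sum_strict [of "[\<alpha>]" "[k]" A n "[]"] A \<alpha> by simp
  moreover have "(\<Sum>T\<in>row_strict_tableaux n [k]. monomial (virtual_word [] (tab_cells T [\<alpha>]))) = (\<Sum>J\<in>?S. ?w J)"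
  proof (rule sum.reindex_bij_witness [where i = "\<lambda>J. [sorted_list_of_set J]" and j = "\<lambda>T. set (hd T)"])
    fix T assume "T \<in> row_strict_tableaux n [k]"
    then obtain r where "T = [r]" "length r = k" "set r \<subseteq> {1..n}" "sorted_wrt (<) r"
      by (auto simp: row_strict_tableaux_def shape_def)
    then show "[sorted_list_of_set (set (hd T))] = T" "set (hd T) \<in> ?S"
      "?w (set (hd T)) = monomial (virtual_word [] (tab_cells T [\<alpha>]))"
      by (auto simp: strict_sorted_equal sorted_list_of_set.idem_if_sorted_distinct strict_sorted_iff distinct_card)
  next
    fix J assume "J \<in> ?S"
    then show "set (hd [sorted_list_of_set J]) = J" "[sorted_list_of_set J] \<in> row_strict_tableaux n [k]"
      using subset_row [of J n k] finite_subset [of J "{1..n}"]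
      by (auto simp: row_strict_tableaux_def shape_def)
  qed
  moreover have "row_syms [k] [\<alpha>] = replicate k \<alpha>" by (simp add: row_syms_def)
  ultimately have 1: "?e * (scalar (1 / fact k) * virtual_sum n [] (replicate k \<alpha>) - (\<Sum>J\<in>?S. ?w J)) \<in> JI A"
    by (intro LG_lmult [OF LG_rel]) simp_all
  have "?e * ?w J - cdet k (\<lambda>a b. letter (Proper (sorted_list_of_set J ! (a - 1)))
                           (Proper (sorted_list_of_set J ! (b - 1)))
                    + (if a = b then of_nat (k - a) else 0)) \<in> JI A" (is "_ - ?c \<in> _") if J: "J \<in> ?S" for J
  proof -
    define xs where "xs = sorted_list_of_set J"
    note xs = subset_row [of J n k, folded xs_def]
    let ?r = "\<lambda>a. xs ! (a - 1)"
    have len: "length xs = k" and set: "set xs \<subseteq> {1..n}" using xs J by auto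
    have c: "?c = cdet_from 1 k (capelli_entry k ?r ?r)"
      unfolding cdet_from_1 [symmetric] xs_def [symmetric]
      by (intro cdet_cong) (use xs(7) J in \<open>auto simp: capelli_entry_def\<close>)
    have r: "?r ` {1..k} \<subseteq> {1..n}" using xs(6) J by auto
    have m: "map ?r [1..<k+1] = xs" using xs J by blast
    have "cdet_from 1 k (capelli_entry k ?r ?r)
        - monomial (annihilations \<alpha> (rev xs) @ creations \<alpha> xs) \<in> JI A"
      using cdet_virtual [OF A \<alpha> r r] unfolding m .
    moreover have "?e * ((monomial (annihilations \<alpha> xs) - ?e * monomial (annihilations \<alpha> (rev xs)))
        * monomial (creations \<alpha> xs)) \<in> JI A"
      using annihilations_rev [OF A \<alpha> set] set_creations [OF A \<alpha>(1) set] unfolding len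
      by (intro LG_rel rel_ideal_lmult [OF _ rel_ideal_rmult]) auto
    moreover have "?w J = monomial (annihilations \<alpha> xs) * monomial (creations \<alpha> xs)"
      by (simp add: virtual_word_def tab_cells_def left_word_def right_word_def annihilations_def
          creations_def comp_def flip: xs_def monomial_append)
    moreover have "?e * (?e * y) = y" for y
      by (simp add: scalar_mult rev_sign_square flip: mult.assoc)
    ultimately have "?e * ?w J - monomial (annihilations \<alpha> (rev xs) @ creations \<alpha> xs) \<in> JI A"
      "?c - monomial (annihilations \<alpha> (rev xs) @ creations \<alpha> xs) \<in> JI A"
      unfolding c by (simp_all add: left_diff_distrib right_diff_distrib monomial_append mult.assoc)
    from LG_diff [OF this] show ?thesis by simp
  qed
  then have "(\<Sum>J\<in>?S. ?e * ?w J) - capelli n k \<in> JI A"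
    unfolding capelli_def sum_subtractf [symmetric] by (intro LG_sum) blast
  from LG_add [OF 1 this] show ?thesis
    by (simp add: right_diff_distrib sum_distrib_left scalar_mult flip: mult.assoc)
qed

text \<open>A single even virtual symbol is enough on both sides, with the identity as
  renaming.\<close>

lemma capelli_olsh: "olsh n (capelli (n + 1) k) (capelli n k)" and
  capelli_central_Suc: "central (n + 1) (capelli (n + 1) k)"
proof -
  have id: "map id xs = xs" "map (map_prod id id) ys = ys" for xs :: "gsym list" and ys :: "(gsym \<times> gsym) list"
    by (simp_all add: map_prod.id)
  have v: "set (replicate k (Alpha 1)) \<subseteq> syms 1 0 m \<inter> Collect virtual" for m
    by (auto simp: syms_def)
  have c: "scalar (rev_sign k / fact k) * virtual_sum m [] (replicate k (Alpha 1)) - capelli m k \<in> JI (syms 1 0 m)" for m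
    by (rule capelli_virtual) (auto simp: syms_def)
  have r: "renaming id" by (simp add: renaming_def)
  show "olsh n (capelli (n + 1) k) (capelli n k)" "central (n + 1) (capelli (n + 1) k)"
    using virtual_sum_olsh [OF r, of "replicate k (Alpha 1)" 1 0 n "[]" 1 0 "capelli n k" "rev_sign k / fact k" "capelli (n + 1) k",
        unfolded id] v c capelli_carrier
    by (simp_all add: balanced_def)
qed

lemma capelli_central:
  assumes "n \<ge> 1" shows "central n (capelli n k)"
  using capelli_central_Suc [of "n - 1" k] assms by simp

section \<open>The center is generated by the Capelli elements\<close>

type_synonym letter_fun = "gsym \<times> gsym \<Rightarrow> complex"

text \<open>
  \<open>polar [X1, \<dots>, Xd] M\<close> is the value at \<open>X1, \<dots>, Xd\<close> of the symmetric multilinear form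
  obtained by polarizing the commutative monomial \<open>M\<close>.
\<close>

fun polar :: "letter_fun list \<Rightarrow> (gsym \<times> gsym) multiset \<Rightarrow> complex" where
  "polar [] M = (if M = {#} then 1 else 0)"
| "polar (X # Xs) M = (\<Sum>l\<in>#M. X l * polar Xs (M - {#l#}))"

section \<open>Polarized forms\<close>

lemma sum_mset_subtract:
  fixes f g :: "'a \<Rightarrow> complex"
  shows "(\<Sum>l\<in>#M. f l - g l) = (\<Sum>l\<in>#M. f l) - (\<Sum>l\<in>#M. g l)"
  by (induction M) auto

lemma sum_mset_sum_swap:
  fixes f :: "'a \<Rightarrow> 'b \<Rightarrow> complex"
  shows "(\<Sum>l\<in>#M. \<Sum>q\<in>S. f l q) = (\<Sum>q\<in>S. \<Sum>l\<in>#M. f l q)"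
  by (induction M) (auto simp: sum.distrib)

lemma sum_mset_remove:
  fixes f :: "'a \<Rightarrow> complex"
  assumes "l \<in># M" shows "(\<Sum>k\<in>#M - {#l#}. f k) = (\<Sum>k\<in>#M. f k) - f l"
proof -
  have "(\<Sum>k\<in>#M. f k) = (\<Sum>k\<in>#add_mset l (M - {#l#}). f k)" using assms by simp
  then show ?thesis by simp
qed

text \<open>Both sides run over ordered pairs of distinct occurrences in \<open>M\<close>.\<close>

lemma sum_mset_swap_diff:
  fixes f :: "'a \<Rightarrow> 'a \<Rightarrow> complex"
  shows "(\<Sum>l\<in>#M. \<Sum>k\<in>#M - {#l#}. f l k) = (\<Sum>k\<in>#M. \<Sum>l\<in>#M - {#k#}. f l k)"
proof -
  have "(\<Sum>l\<in>#M. \<Sum>k\<in>#M - {#l#}. f l k) = (\<Sum>l\<in>#M. (\<Sum>k\<in>#M. f l k) - f l l)"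
    by (intro arg_cong [where f = sum_mset] image_mset_cong) (simp add: sum_mset_remove)
  also have "\<dots> = (\<Sum>k\<in>#M. (\<Sum>l\<in>#M. f l k) - f k k)"
    using sum_mset.swap [of f M M] by (simp add: sum_mset_subtract)
  also have "\<dots> = (\<Sum>k\<in>#M. \<Sum>l\<in>#M - {#k#}. f l k)"
    by (intro arg_cong [where f = sum_mset] image_mset_cong) (simp add: sum_mset_remove)
  finally show ?thesis .
qed

lemma polar_swap: "polar (X # Y # Xs) M = polar (Y # X # Xs) M"
proof -
  have "polar (X # Y # Xs) M = (\<Sum>l\<in>#M. \<Sum>k\<in>#M - {#l#}. X l * (Y k * polar Xs (M - {#l#} - {#k#})))"
    by (simp add: sum_mset_distrib_left)
  also have "\<dots> = (\<Sum>k\<in>#M. \<Sum>l\<in>#M - {#k#}. X l * (Y k * polar Xs (M - {#l#} - {#k#})))"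
    by (rule sum_mset_swap_diff)
  also have "\<dots> = polar (Y # X # Xs) M"
    by (simp add: sum_mset_distrib_left mult.left_commute add_mset_commute)
  finally show ?thesis .
qed

lemma polar_mset:
  assumes "mset Xs = mset Ys" shows "polar Xs M = polar Ys M"
  using assms
proof (induction Xs arbitrary: Ys M)
  case (Cons X Xs)
  have move: "polar (X # Us @ Vs) M = polar (Us @ X # Vs) M" for Us Vs M
  proof (induction Us arbitrary: M)
    case (Cons U Us)
    have "polar (X # U # Us @ Vs) M = polar (U # X # Us @ Vs) M" by (rule polar_swap)
    then show ?case using Cons by (simp del: polar.simps add: polar.simps(2) [of U])
  qed simp
  obtain Us Vs where Ys: "Ys = Us @ X # Vs"
    using Cons.prems by (metis in_set_conv_decomp list.set_intros(1) mset_eq_setD)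
  then have "polar Xs = polar (Us @ Vs)"
    using Cons.prems by (intro ext Cons.IH) simp
  then show ?case using move [of Us Vs M] by (simp add: Ys)
qed simp

lemma polar_size: "polar Xs M \<noteq> 0 \<Longrightarrow> size M = length Xs"
proof (induction Xs arbitrary: M)
  case (Cons X Xs)
  then obtain l where "l \<in># M" "polar Xs (M - {#l#}) \<noteq> 0"
  proof -
    have "\<exists>l\<in>#M. polar Xs (M - {#l#}) \<noteq> 0"
    proof (rule ccontr)
      assume "\<not> ?thesis"
      then have "polar (X # Xs) M = (\<Sum>l\<in>#M. 0)"
        unfolding polar.simps by (intro arg_cong [where f = sum_mset] image_mset_cong) auto
      with Cons.prems show False by simp
    qed
    with that show ?thesis by blast
  qed
  from \<open>l \<in># M\<close> have "M = add_mset l (M - {#l#})" by simp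
  then have "size M = Suc (size (M - {#l#}))" by (metis size_add_mset)
  with Cons.IH [of "M - {#l#}"] \<open>polar Xs (M - {#l#}) \<noteq> 0\<close> show ?case by simp
qed (simp split: if_splits)

definition unit :: "gsym \<times> gsym \<Rightarrow> letter_fun" where
  "unit k l = (if l = k then 1 else 0)"

lemma polar_unit: "polar (unit k # Xs) M = of_nat (count M k) * polar Xs (M - {#k#})"
proof -
  have "(\<Sum>l\<in>#M. unit k l * g l) = of_nat (count M k) * g k" for g :: letter_fun
    by (induction M) (auto simp: unit_def algebra_simps)
  then show ?thesis by simp
qed

text \<open>Arguments that are unit vectors single out one monomial; \<open>K\<close> is the product
  of the factorials of its multiplicities.\<close>

lemma polar_units:
  "\<exists>K. K \<noteq> 0 \<and> (\<forall>M. polar (map unit ls) M = (if M = mset ls then K else 0))"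
proof (induction ls)
  case Nil
  then show ?case by (intro exI [of _ 1]) auto
next
  case (Cons l ls)
  then obtain K where K: "K \<noteq> 0" "\<And>M. polar (map unit ls) M = (if M = mset ls then K else 0)" by blast
  have "polar (map unit (l # ls)) M = (if M = mset (l # ls) then of_nat (count (mset (l # ls)) l) * K else 0)" for M
  proof (cases "l \<in># M")
    case True
    then obtain N where "M = add_mset l N" by (metis insert_DiffM)
    then show ?thesis by (simp add: polar_unit K del: polar.simps)
  next
    case False
    then have "count M l = 0" by (simp add: not_in_iff)
    moreover have "M \<noteq> mset (l # ls)" using False by auto
    ultimately show ?thesis by (simp add: polar_unit del: polar.simps)
  qed
  moreover have "complex_of_nat (count (mset (l # ls)) l) * K \<noteq> 0" using K by (simp del: of_nat_Suc)
  ultimately show ?case by blast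
qed

section \<open>Invariance of the symbol of a central element\<close>

text \<open>The linear extension of \<open>g\<close> evaluated at the bracket of e_{a,b} with
  e_{c,d}, that is, the transpose of the adjoint action.\<close>

fun bracket_fun :: "gsym \<Rightarrow> gsym \<Rightarrow> letter_fun \<Rightarrow> letter_fun" where
  "bracket_fun a b g (c, d) = (if b = c then g (a, d) else 0) - (if a = d then g (c, b) else 0)"

lemma bracket_fun_sum:
  "bracket_fun a b (\<lambda>l. (\<Sum>i\<in>#M. f i l)) l = (\<Sum>i\<in>#M. bracket_fun a b (f i) l)"
  by (cases l) (auto simp: sum_mset_subtract)

lemma bracket_fun_add:
  "bracket_fun a b (\<lambda>l. f l + g l) l = bracket_fun a b f l + bracket_fun a b g l"
  by (cases l) auto

lemma bracket_fun_cmult: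
  "bracket_fun a b (\<lambda>l. c * f l) l = c * bracket_fun a b f l"
  by (cases l) (auto simp: algebra_simps)

lemma bracket_fun_multc:
  "bracket_fun a b (\<lambda>l. f l * c) l = bracket_fun a b f l * c"
  by (cases l) (auto simp: algebra_simps)

lemma lin_bracket_letter:
  "lin g (bracket_letter a b l * x) = bracket_fun a b (\<lambda>l'. lin (\<lambda>v. g (l' # v)) x) l"
proof (cases l)
  case (Pair c d)
  have "lin g (letter p q * x) = lin (\<lambda>v. g ((p, q) # v)) x" for p q
    by (simp add: lin_mult)
  then show ?thesis by (simp add: Pair left_diff_distrib lin_diff)
qed

lemma lin_ad_word:
  "lin (\<lambda>v. g (mset v)) (ad_word a b w)
    = (\<Sum>l\<in>#mset w. bracket_fun a b (\<lambda>l'. g (add_mset l' (mset w - {#l#}))) l)"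
proof (induction w arbitrary: g)
  case (Cons k w)
  have "lin (\<lambda>v. g (mset v)) (monomial [k] * ad_word a b w)
    = (\<Sum>l\<in>#mset w. bracket_fun a b (\<lambda>l'. g (add_mset k (add_mset l' (mset w - {#l#})))) l)"
    using Cons [of "\<lambda>M. g (add_mset k M)"] by (simp add: lin_mult)
  also have "\<dots> = (\<Sum>l\<in>#mset w. bracket_fun a b (\<lambda>l'. g (add_mset l' (add_mset k (mset w) - {#l#}))) l)"
    by (intro arg_cong [where f = sum_mset] image_mset_cong) (simp add: add_mset_commute)
  finally show ?case by (simp add: lin_add lin_bracket_letter)
qed simp

lemma lin_mset_eq_0:
  assumes "\<And>M. size M = d \<Longrightarrow> sym_coef M y = 0" "\<And>M. size M \<noteq> d \<Longrightarrow> g M = 0"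
  shows "lin (\<lambda>w. g (mset w)) y = 0"
proof -
  let ?K = "(\<lambda>w. mset (letters w)) ` Poly_Mapping.keys y"
  have "lin (\<lambda>w. g (mset w)) y = lin (\<lambda>w. \<Sum>M\<in>?K. g M * (if mset w = M then 1 else 0)) y"
  proof (rule lin_cong)
    fix w assume "w \<in> Poly_Mapping.keys y"
    then show "g (mset (letters w)) = (\<Sum>M\<in>?K. g M * (if mset (letters w) = M then 1 else 0))"
      by (simp add: if_distrib cong: if_cong)
  qed
  also have "\<dots> = (\<Sum>M\<in>?K. g M * sym_coef M y)"
    by (simp add: lin_fun_sum lin_fun_cmult sym_coef_def)
  also have "\<dots> = 0"
    using assms by (intro sum.neutral) (metis mult_eq_0_iff)
  finally show ?thesis .
qed

lemma Fil_ad_word: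
  assumes "{a, b} \<subseteq> A" "set w \<subseteq> A \<times> A" shows "ad_word a b w \<in> Fil A (length w)"
  using assms(2)
proof (induction w)
  case (Cons l w)
  obtain c d where l: "l = (c, d)" by (cases l)
  have "bracket_letter a b l \<in> Fil A 1"
    using assms(1) Cons.prems by (auto simp: l intro!: Fil_diff Fil_uminus Fil_monomial)
  moreover have "monomial w \<in> Fil A (length w)" "monomial [l] \<in> Fil A 1"
    using Cons.prems by (auto intro: Fil_monomial)
  ultimately show ?case
    using Cons Fil_mult [of _ A 1 _ "length w"] by (auto intro!: Fil_add)
qed simp

text \<open>The commutator of e_{i,j} with \<open>x\<close> is congruent to the derivation applied
  to the words of \<open>x\<close>, which has degree at most \<open>d\<close> again. It is a
  relation, so by \<open>sym_coef_rel_ideal\<close> its symbol in degree \<open>d\<close> vanishes,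
  and with it every functional \<open>g\<close> of monomials of that degree.\<close>

lemma central_invariant:
  assumes x: "central n x" "x \<in> Fil (proper_syms n) d"
    and ij: "i \<in> {1..n}" "j \<in> {1..n}" and g: "\<And>M. size M \<noteq> d \<Longrightarrow> g M = 0"
  shows "lin (\<lambda>w. \<Sum>l\<in>#mset w. bracket_fun (Proper i) (Proper j) (\<lambda>l'. g (add_mset l' (mset w - {#l#}))) l) x = 0"
proof -
  let ?A = "proper_syms n" and ?a = "letter (Proper i) (Proper j)"
  let ?K = "Poly_Mapping.keys x" and ?c = "\<lambda>w. scalar (Poly_Mapping.lookup x w)"
  define y where "y = (\<Sum>w\<in>?K. ?c w * ad_word (Proper i) (Proper j) (letters w))"
  have s: "{Proper i, Proper j} \<subseteq> ?A" using ij by (auto simp: proper_syms_def)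
  have w: "set (letters w) \<subseteq> ?A \<times> ?A" "length (letters w) \<le> d" if "w \<in> ?K" for w
    using x(2) that unfolding Fil_def fcar_iff by blast+
  have "(\<Sum>w\<in>?K. ?c w * (?a * monomial (letters w) - monomial (letters w) * ?a - ad_word (Proper i) (Proper j) (letters w))) \<in> RI ?A"
    using w s by (intro rel_ideal_sum rel_ideal_lmult commutator_monomial) auto
  also have "(\<Sum>w\<in>?K. ?c w * (?a * monomial (letters w) - monomial (letters w) * ?a - ad_word (Proper i) (Proper j) (letters w)))
    = ?a * x - x * ?a - y"
  proof -
    have c: "?a * (scalar c * y) = scalar c * (?a * y)" for c y
      by (metis mult.assoc scalar_commute)
    have "?a * (\<Sum>w\<in>?K. ?c w * monomial (letters w)) = (\<Sum>w\<in>?K. ?c w * (?a * monomial (letters w)))"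
      by (simp add: sum_distrib_left c)
    moreover have "(\<Sum>w\<in>?K. ?c w * monomial (letters w)) * ?a = (\<Sum>w\<in>?K. ?c w * (monomial (letters w) * ?a))"
      by (simp add: sum_distrib_right mult.assoc)
    ultimately show ?thesis
      by (simp add: y_def right_diff_distrib sum_subtractf flip: falg_expand)
  qed
  finally have "?a * x - x * ?a - y \<in> RI ?A" .
  moreover have "?a * x - x * ?a \<in> RI ?A" using x(1) ij by (simp add: central_def)
  ultimately have "y \<in> RI ?A" using rel_ideal_diff by fastforce
  moreover have "y \<in> Fil ?A d"
    unfolding y_def using w by (intro Fil_sum Fil_scalar_mult Fil_mono [OF Fil_ad_word [OF s]])
  ultimately have "sym_coef M y = 0" if "size M = d" for M
    using sym_coef_rel_ideal [OF _ proper_syms_odd] that by blast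
  then have "lin (\<lambda>w. g (mset w)) y = 0"
    using g by (rule lin_mset_eq_0)
  moreover have "lin (\<lambda>w. g (mset w)) y
    = lin (\<lambda>w. \<Sum>l\<in>#mset w. bracket_fun (Proper i) (Proper j) (\<lambda>l'. g (add_mset l' (mset w - {#l#}))) l) x"
    by (simp add: y_def lin_sum lin_scalar_mult lin_ad_word lin_def [of _ x])
  ultimately show ?thesis by simp
qed

lemma polar_add_mset:
  "polar (X # Xs) (add_mset k M) = X k * polar Xs M + (\<Sum>l\<in>#M. X l * polar Xs (add_mset k (M - {#l#})))"
proof -
  have "(\<Sum>l\<in>#M. X l * polar Xs (add_mset k M - {#l#})) = (\<Sum>l\<in>#M. X l * polar Xs (add_mset k (M - {#l#})))"
    by (intro arg_cong [where f = sum_mset] image_mset_cong) simp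
  then show ?thesis by simp
qed

text \<open>Moves the derivation from the letters of the monomial to the arguments of the form, one
  argument at a time.\<close>

lemma polar_bracket:
  "(\<Sum>l\<in>#M. bracket_fun a b (\<lambda>k. polar Xs (add_mset k (M - {#l#}))) l)
    = (\<Sum>q<length Xs. polar (Xs[q := bracket_fun a b (Xs ! q)]) M)"
proof (induction Xs arbitrary: M)
  case Nil
  have "bracket_fun a b (\<lambda>k. polar [] (add_mset k N)) l = 0" for N l by (cases l) simp
  then show ?case by simp
next
  case (Cons X Xs)
  have "(\<Sum>l\<in>#M. bracket_fun a b (\<lambda>k. polar (X # Xs) (add_mset k (M - {#l#}))) l)
    = (\<Sum>l\<in>#M. bracket_fun a b X l * polar Xs (M - {#l#}))
      + (\<Sum>l\<in>#M. \<Sum>k\<in>#M - {#l#}. X k * bracket_fun a b (\<lambda>k'. polar Xs (add_mset k' (M - {#l#} - {#k#}))) l)"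
    by (simp add: polar_add_mset bracket_fun_add bracket_fun_multc bracket_fun_sum bracket_fun_cmult sum_mset.distrib
        del: polar.simps)
  also have "(\<Sum>l\<in>#M. \<Sum>k\<in>#M - {#l#}. X k * bracket_fun a b (\<lambda>k'. polar Xs (add_mset k' (M - {#l#} - {#k#}))) l)
    = (\<Sum>k\<in>#M. \<Sum>l\<in>#M - {#k#}. X k * bracket_fun a b (\<lambda>k'. polar Xs (add_mset k' (M - {#l#} - {#k#}))) l)"
    by (rule sum_mset_swap_diff)
  also have "\<dots> = (\<Sum>k\<in>#M. X k * (\<Sum>q<length Xs. polar (Xs[q := bracket_fun a b (Xs ! q)]) (M - {#k#})))"
  proof (intro arg_cong [where f = sum_mset] image_mset_cong)
    fix k
    show "(\<Sum>l\<in>#M - {#k#}. X k * bracket_fun a b (\<lambda>k'. polar Xs (add_mset k' (M - {#l#} - {#k#}))) l)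
      = X k * (\<Sum>q<length Xs. polar (Xs[q := bracket_fun a b (Xs ! q)]) (M - {#k#}))"
      using Cons.IH [of "M - {#k#}"] by (simp add: sum_mset_distrib_left [symmetric] add_mset_commute)
  qed
  also have "\<dots> = (\<Sum>q<length Xs. polar (X # Xs[q := bracket_fun a b (Xs ! q)]) M)"
    by (simp add: sum_distrib_left sum_mset_sum_swap)
  finally show ?case
    by (simp add: sum.lessThan_Suc_shift del: sum.lessThan_Suc)
qed

definition polar_at :: "letter_fun list \<Rightarrow> falg \<Rightarrow> complex" where
  "polar_at Xs x = lin (\<lambda>w. polar Xs (mset w)) x"

lemma polar_at_mset: "mset Xs = mset Ys \<Longrightarrow> polar_at Xs x = polar_at Ys x"
  unfolding polar_at_def by (intro lin_cong polar_mset)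

lemma polar_at_scale_add:
  "polar_at ((\<lambda>l. c * X l + Y l) # Xs) x = c * polar_at (X # Xs) x + polar_at (Y # Xs) x"
  unfolding polar_at_def
  by (simp add: algebra_simps sum_mset.distrib sum_mset_distrib_left flip: lin_fun_cmult lin_fun_add)

lemma polar_at_zero: "polar_at ((\<lambda>l. 0) # Xs) x = 0"
  by (simp add: polar_at_def)

lemma polar_at_sum:
  "polar_at ((\<lambda>l. \<Sum>i\<in>I. c i * X i l) # Xs) x = (\<Sum>i\<in>I. c i * polar_at (X i # Xs) x)"
proof (induction I rule: infinite_finite_induct)
  case (insert i I)
  then show ?case using polar_at_scale_add [of "c i" "X i" "\<lambda>l. \<Sum>i\<in>I. c i * X i l" Xs x] by simp
qed (simp_all add: polar_at_zero)

lemma polar_at_cong: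
  assumes "x \<in> fcar A" "\<And>l. l \<in> A \<times> A \<Longrightarrow> X l = Y l"
  shows "polar_at (X # Xs) x = polar_at (Y # Xs) x"
  unfolding polar_at_def
proof (rule lin_cong)
  fix w assume "w \<in> Poly_Mapping.keys x"
  then have "set (letters w) \<subseteq> A \<times> A" using assms(1) unfolding fcar_iff by blast
  then have "X l = Y l" if "l \<in># mset (letters w)" for l using that assms(2) by auto
  then show "polar (X # Xs) (mset (letters w)) = polar (Y # Xs) (mset (letters w))"
    unfolding polar.simps by (intro arg_cong [where f = sum_mset] image_mset_cong) simp
qed

lemma polar_at_invariant:
  assumes "central n x" "x \<in> Fil (proper_syms n) (length Xs)" "i \<in> {1..n}" "j \<in> {1..n}"
  shows "(\<Sum>q<length Xs. polar_at (Xs[q := bracket_fun (Proper i) (Proper j) (Xs ! q)]) x) = 0"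
proof -
  have "lin (\<lambda>w. \<Sum>l\<in>#mset w. bracket_fun (Proper i) (Proper j) (\<lambda>k. polar Xs (add_mset k (mset w - {#l#}))) l) x = 0"
    by (rule central_invariant [OF assms]) (metis polar_size)
  then show ?thesis by (simp add: polar_bracket polar_at_def lin_fun_sum)
qed

text \<open>A vanishing polarized form has vanishing values on unit vectors, and these are nonzero
  multiples of the coefficients.\<close>

lemma sym_coef_polar:
  assumes "\<And>Xs. length Xs = d \<Longrightarrow> polar_at Xs x = 0" "size M = d"
  shows "sym_coef M x = 0"
proof -
  obtain ls where ls: "mset ls = M" using ex_mset by blast
  obtain K where K: "K \<noteq> 0" "\<And>M. polar (map unit ls) M = (if M = mset ls then K else 0)"
    using polar_units by blast
  have "polar_at (map unit ls) x = lin (\<lambda>w. K * (if mset w = M then 1 else 0)) x"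
    unfolding polar_at_def by (intro lin_cong) (simp add: K(2) ls)
  also have "\<dots> = K * sym_coef M x"
    by (simp add: sym_coef_def lin_fun_cmult)
  finally show ?thesis
    using assms(1) [of "map unit ls"] K(1) assms(2) ls by (metis length_map mult_eq_0_iff size_mset)
qed

abbreviation unit_at :: "nat \<Rightarrow> nat \<Rightarrow> letter_fun" where
  "unit_at c d \<equiv> unit (Proper c, Proper d)"

text \<open>
  The matrices \<open>subdiag N + Y\<close> with \<open>Y\<close> concentrated in the last column are, up to conventions, the
  companion matrices. They form a slice to the adjoint orbits: modulo brackets with \<open>subdiag N\<close>,
  every matrix is congruent to one concentrated in the last column. Hence an invariant form that
  vanishes on the slice vanishes, by induction on the number of arguments other than \<open>subdiag N\<close>.
\<close>

definition subdiag_letters :: "nat \<Rightarrow> (gsym \<times> gsym) set" where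
  "subdiag_letters N = (\<lambda>c. (Proper (Suc c), Proper c)) ` {1..<N}"

definition subdiag :: "nat \<Rightarrow> letter_fun" where
  "subdiag N l = (if l \<in> subdiag_letters N then 1 else 0)"

text \<open>Modulo these brackets the matrix units in positions \<open>(c, d)\<close> and
  \<open>(c + 1, d + 1)\<close> are identified, and those in the last row left of the last column
  are zero. Hence every matrix unit slides along its diagonal to the last column or to zero.\<close>

lemma bracket_subdiag:
  assumes "d \<in> {1..<N}" "c \<in> {1..N}"
  shows "bracket_fun (Proper (Suc d)) (Proper c) (subdiag N)
    = (\<lambda>l. (if c < N then - 1 else 0) * unit_at (Suc c) (Suc d) l + unit_at c d l)"
proof
  fix l :: "gsym \<times> gsym"
  obtain p q where l: "l = (p, q)" by (cases l)
  have "subdiag N (Proper (Suc d), q) = (if q = Proper d then 1 else 0)"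
    using assms by (cases q) (auto simp: subdiag_def subdiag_letters_def)
  moreover have "subdiag N (p, Proper c) = (if p = Proper (Suc c) \<and> c < N then 1 else 0)"
    using assms by (cases p) (auto simp: subdiag_def subdiag_letters_def)
  ultimately show "bracket_fun (Proper (Suc d)) (Proper c) (subdiag N) l
    = (if c < N then - 1 else 0) * unit_at (Suc c) (Suc d) l + unit_at c d l"
    by (auto simp: l unit_def)
qed

lemma polar_at_slice:
  assumes x: "central N x" "x \<in> Fil (proper_syms N) d"
    and slice: "\<And>is. set is \<subseteq> {1..N} \<Longrightarrow> length is \<le> d \<Longrightarrow>
      polar_at (replicate (d - length is) (subdiag N) @ map (\<lambda>i. unit_at i N) is) x = 0"
  shows "length Ys \<le> d \<Longrightarrow> polar_at (replicate (d - length Ys) (subdiag N) @ Ys) x = 0"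
proof (induction "length Ys" arbitrary: Ys)
  case 0
  then show ?case using slice [of "[]"] by simp
next
  case (Suc m)
  let ?f = "subdiag N" and ?r = "d - Suc m"
  let ?s = "\<lambda>is. map (\<lambda>i. unit_at i N) is"
  have IH: "polar_at (replicate (Suc ?r) ?f @ Zs) x = 0" if "length Zs = m" for Zs
  proof -
    have "Suc ?r = d - length Zs" using that Suc by simp
    then show ?thesis using Suc.hyps(1) [of Zs] that Suc by simp
  qed
  \<comment> \<open>Brackets that fall on the arguments \<open>Zs\<close> keep all
    \<open>Suc ?r\<close> copies of the subdiagonal matrix and vanish by induction. Those on its
    copies are all equal by symmetry, and a nonzero multiple of one of them is left.\<close>
  have rel: "(if c < N then - 1 else 0) * polar_at (unit_at (Suc c) (Suc e) # replicate ?r ?f @ Zs) x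
      + polar_at (unit_at c e # replicate ?r ?f @ Zs) x = 0"
    if "length Zs = m" "e \<in> {1..<N}" "c \<in> {1..N}" for Zs c e
  proof -
    let ?Xs = "replicate (Suc ?r) ?f @ Zs" and ?D = "bracket_fun (Proper (Suc e)) (Proper c)"
    have len: "length ?Xs = d" using that Suc by simp
    have "(\<Sum>q<length ?Xs. polar_at (?Xs[q := ?D (?Xs ! q)]) x) = 0"
      using x that by (intro polar_at_invariant) (simp_all only: len, auto)
    also have "(\<Sum>q<length ?Xs. polar_at (?Xs[q := ?D (?Xs ! q)]) x)
      = (\<Sum>q<length ?Xs. if q < Suc ?r then polar_at (?D ?f # replicate ?r ?f @ Zs) x else 0)"
    proof (rule sum.cong [OF refl])
      fix q assume q: "q \<in> {..<length ?Xs}"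
      show "polar_at (?Xs[q := ?D (?Xs ! q)]) x
        = (if q < Suc ?r then polar_at (?D ?f # replicate ?r ?f @ Zs) x else 0)"
      proof (cases "q < Suc ?r")
        case True
        then have "?Xs ! q = ?f" by (simp add: nth_append del: replicate.simps)
        moreover have "mset (?Xs[q := ?D ?f]) = mset (?D ?f # replicate ?r ?f @ Zs)"
          using q \<open>?Xs ! q = ?f\<close> by (subst mset_update) (auto simp del: length_append)
        ultimately show ?thesis using True polar_at_mset by simp
      next
        case False
        then have "?Xs[q := ?D (?Xs ! q)] = replicate (Suc ?r) ?f @ Zs[q - Suc ?r := ?D (?Xs ! q)]"
          by (simp add: list_update_append del: replicate.simps)
        then show ?thesis using False IH [of "Zs[q - Suc ?r := ?D (?Xs ! q)]"] that
          by (simp del: replicate.simps)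
      qed
    qed
    also have "\<dots> = of_nat (Suc ?r) * polar_at (?D ?f # replicate ?r ?f @ Zs) x"
    proof -
      have "{..<length ?Xs} \<inter> {q. q < Suc ?r} = {..<Suc ?r}" by auto
      then show ?thesis by (simp add: sum.If_cases del: sum.lessThan_Suc of_nat_Suc replicate.simps)
    qed
    finally have "polar_at (?D ?f # replicate ?r ?f @ Zs) x = 0" by (simp del: of_nat_Suc)
    then show ?thesis
      unfolding bracket_subdiag [OF that(2,3)] polar_at_scale_add .
  qed
  \<comment> \<open>The arbitrary arguments are exchanged one after another for matrix units in the
    last column.\<close>
  have main: "polar_at (replicate ?r ?f @ Zs @ ?s is) x = 0"
    if "length Zs + length is = Suc m" "set is \<subseteq> {1..N}" for Zs "is"
    using that
  proof (induction Zs arbitrary: "is")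
    case Nil
    then show ?case using slice [of "is"] Suc by simp
  next
    case (Cons Z Zs)
    let ?Ws = "Zs @ ?s is"
    have lW: "length ?Ws = m" using Cons.prems by simp
    have last: "polar_at (unit_at c N # replicate ?r ?f @ ?Ws) x = 0" if "c \<in> {1..N}" for c
    proof -
      have "polar_at (replicate ?r ?f @ Zs @ ?s (c # is)) x = 0"
        using Cons.prems that by (intro Cons.IH) auto
      moreover have "mset (unit_at c N # replicate ?r ?f @ ?Ws) = mset (replicate ?r ?f @ Zs @ ?s (c # is))"
        by simp
      ultimately show ?thesis using polar_at_mset by metis
    qed
    \<comment> \<open>Descent from the last column: each step to the left moves one place along the
      diagonal, until row \<open>N\<close> is reached.\<close>
    have all: "polar_at (unit_at c (N - e) # replicate ?r ?f @ ?Ws) x = 0" if "c \<in> {1..N}" "e < N" for c e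
      using that
    proof (induction e arbitrary: c)
      case 0
      then show ?case using last by simp
    next
      case (Suc e)
      have e: "N - Suc e \<in> {1..<N}" "Suc (N - Suc e) = N - e" using Suc.prems by auto
      show ?case
      proof (cases "c < N")
        case True
        then have "polar_at (unit_at (Suc c) (N - e) # replicate ?r ?f @ ?Ws) x = 0"
          using Suc by (intro Suc.IH) auto
        then show ?thesis using rel [OF lW e(1) Suc.prems(1)] by (simp add: e(2))
      next
        case False
        then show ?thesis using rel [OF lW e(1) Suc.prems(1)] by simp
      qed
    qed
    let ?I = "{1..N} \<times> {1..N}"
    let ?Z = "\<lambda>l. \<Sum>(c, e)\<in>?I. Z (Proper c, Proper e) * unit_at c e l"
    have "polar_at (Z # replicate ?r ?f @ ?Ws) x = polar_at (?Z # replicate ?r ?f @ ?Ws) x"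
    proof (rule polar_at_cong [OF Fil_carrier [OF x(2)]])
      fix l assume "l \<in> proper_syms N \<times> proper_syms N"
      then obtain c e where l: "l = (Proper c, Proper e)" "(c, e) \<in> ?I"
        by (auto simp: proper_syms_def)
      have "?Z l = (\<Sum>p\<in>?I. if p = (c, e) then Z l else 0)"
        by (intro sum.cong) (auto simp: l unit_def split: if_splits)
      then show "Z l = ?Z l" using l by simp
    qed
    also have "\<dots> = (\<Sum>(c, e)\<in>?I. Z (Proper c, Proper e) * polar_at (unit_at c e # replicate ?r ?f @ ?Ws) x)"
      unfolding case_prod_beta' by (rule polar_at_sum)
    also have "\<dots> = 0"
    proof (intro sum.neutral ballI)
      fix p assume "p \<in> ?I"
      then obtain c e where p: "p = (c, e)" "c \<in> {1..N}" "e \<in> {1..N}" by auto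
      then show "(case p of (c, e) \<Rightarrow> Z (Proper c, Proper e) * polar_at (unit_at c e # replicate ?r ?f @ ?Ws) x) = 0"
        using all [of c "N - e"] by simp
    qed
    finally have "polar_at (Z # replicate ?r ?f @ ?Ws) x = 0" .
    moreover have "mset (Z # replicate ?r ?f @ ?Ws) = mset (replicate ?r ?f @ (Z # Zs) @ ?s is)" by simp
    ultimately show ?case using polar_at_mset by metis
  qed
  from main [of Ys "[]"] Suc show ?case by simp
qed

text \<open>The monomials that restrict to the monomial \<mu> on the slice: subdiagonal letters take
  the value 1 there and leave no trace, while \<mu> records the rows of the letters in the last
  column.\<close>

definition slice_mset :: "nat \<Rightarrow> nat multiset \<Rightarrow> (gsym \<times> gsym) multiset \<Rightarrow> bool" where
  "slice_mset N \<mu> M \<longleftrightarrow> (\<exists>F. set_mset F \<subseteq> subdiag_letters N \<and> M = image_mset (\<lambda>i. (Proper i, Proper N)) \<mu> + F)"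

lemma polar_subdiag:
  "polar (replicate r (subdiag N)) M = (if size M = r \<and> set_mset M \<subseteq> subdiag_letters N then fact r else 0)"
proof (induction r arbitrary: M)
  case 0
  then show ?case by auto
next
  case (Suc r)
  have "subdiag N l * polar (replicate r (subdiag N)) (M - {#l#})
    = (if size M = Suc r \<and> set_mset M \<subseteq> subdiag_letters N then fact r else 0)" if l: "l \<in># M" for l
  proof -
    obtain N' where "M = add_mset l N'" using l by (metis insert_DiffM)
    then show ?thesis by (auto simp: Suc subdiag_def)
  qed
  then have "polar (replicate (Suc r) (subdiag N)) M
    = (\<Sum>l\<in>#M. if size M = Suc r \<and> set_mset M \<subseteq> subdiag_letters N then fact r else 0)"
    unfolding replicate.simps polar.simps by (intro arg_cong [where f = sum_mset] image_mset_cong)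
  then show ?case by simp
qed

lemma column_not_subdiag: "(Proper i, Proper N) \<notin> subdiag_letters N"
  by (auto simp: subdiag_letters_def)

lemma slice_count: "slice_mset N \<mu> M \<Longrightarrow> count M (Proper i, Proper N) = count \<mu> i"
proof -
  assume "slice_mset N \<mu> M"
  then obtain F where F: "set_mset F \<subseteq> subdiag_letters N" "M = image_mset (\<lambda>i. (Proper i, Proper N)) \<mu> + F"
    by (auto simp: slice_mset_def)
  have "count F (Proper i, Proper N) = 0"
    using F(1) column_not_subdiag by (meson not_in_iff subsetD)
  moreover have "count (image_mset (\<lambda>i. (Proper i, Proper N)) \<mu>) (Proper i, Proper N) = count \<mu> i"
    by (induction \<mu>) auto
  ultimately show ?thesis by (simp add: F(2))
qed

lemma slice_add: "slice_mset N (add_mset i \<mu>) (add_mset (Proper i, Proper N) M) \<longleftrightarrow> slice_mset N \<mu> M"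
  by (auto simp: slice_mset_def)

lemma polar_slice:
  "\<exists>K. K \<noteq> 0 \<and> (\<forall>M. polar (map (\<lambda>i. unit_at i N) is @ replicate r (subdiag N)) M
    = (if size M = length is + r \<and> slice_mset N (mset is) M then K else 0))"
proof (induction "is")
  case Nil
  have "slice_mset N {#} M \<longleftrightarrow> set_mset M \<subseteq> subdiag_letters N" for M
    by (auto simp: slice_mset_def)
  then show ?case
    by (intro exI [of _ "fact r"]) (auto simp: polar_subdiag)
next
  case (Cons i "is")
  then obtain K where K: "K \<noteq> 0" "\<And>M. polar (map (\<lambda>i. unit_at i N) is @ replicate r (subdiag N)) M
    = (if size M = length is + r \<and> slice_mset N (mset is) M then K else 0)" by blast
  let ?K = "of_nat (count (mset (i # is)) i) * K"
  have "polar (map (\<lambda>i. unit_at i N) (i # is) @ replicate r (subdiag N)) M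
    = (if size M = length (i # is) + r \<and> slice_mset N (mset (i # is)) M then ?K else 0)" for M
  proof (cases "(Proper i, Proper N) \<in># M")
    case True
    then obtain M' where M: "M = add_mset (Proper i, Proper N) M'" by (metis insert_DiffM)
    have "count M (Proper i, Proper N) = count (mset (i # is)) i" if "slice_mset N (mset (i # is)) M"
      using slice_count [OF that] .
    then show ?thesis
      by (auto simp: polar_unit K M slice_add simp del: polar.simps)
  next
    case False
    then have "count M (Proper i, Proper N) = 0" by (simp add: not_in_iff)
    moreover from this have "\<not> slice_mset N (mset (i # is)) M"
      using slice_count [of N "mset (i # is)" M i] by auto
    ultimately show ?thesis by (simp add: polar_unit del: polar.simps)
  qed
  moreover have "?K \<noteq> 0" using K(1) by (simp del: of_nat_Suc)
  ultimately show ?case by blast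
qed

text \<open>The coefficient of the monomial \<mu> in the restriction to the slice of the degree
  \<open>d\<close> part of the symbol.\<close>

definition slice_coef :: "nat \<Rightarrow> nat \<Rightarrow> nat multiset \<Rightarrow> falg \<Rightarrow> complex" where
  "slice_coef N d \<mu> = lin (\<lambda>w. if length w = d \<and> slice_mset N \<mu> (mset w) then 1 else 0)"

text \<open>A zero restriction makes the polarized form vanish on the slice, hence everywhere by
  \<open>polar_at_slice\<close>; then the leading symbol is zero.\<close>

lemma lower_degree:
  assumes x: "central N x" "x \<in> Fil (proper_syms N) (Suc d)"
    and slice: "\<And>\<mu>. slice_coef N (Suc d) \<mu> x = 0"
  shows "x \<in> FR (proper_syms N) d"
proof (rule FR_lower [OF x(2) proper_syms_odd])
  have "polar_at (replicate (Suc d - length is) (subdiag N) @ map (\<lambda>i. unit_at i N) is) x = 0"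
    if "length is \<le> Suc d" for "is"
  proof -
    let ?r = "Suc d - length is"
    obtain K where K: "K \<noteq> 0" "\<And>M. polar (map (\<lambda>i. unit_at i N) is @ replicate ?r (subdiag N)) M
      = (if size M = length is + ?r \<and> slice_mset N (mset is) M then K else 0)"
      using polar_slice by blast
    have "polar_at (replicate ?r (subdiag N) @ map (\<lambda>i. unit_at i N) is) x
        = polar_at (map (\<lambda>i. unit_at i N) is @ replicate ?r (subdiag N)) x"
      by (intro polar_at_mset) simp
    also have "\<dots> = lin (\<lambda>w. K * (if length w = Suc d \<and> slice_mset N (mset is) (mset w) then 1 else 0)) x"
      unfolding polar_at_def K(2) using that by (intro lin_cong) simp
    also have "\<dots> = K * slice_coef N (Suc d) (mset is) x"
      by (simp add: slice_coef_def lin_fun_cmult)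
    finally show ?thesis using slice by simp
  qed
  then have "polar_at Xs x = 0" if "length Xs = Suc d" for Xs
    using polar_at_slice [OF x, of Xs] that by simp
  then show "sym_coef M x = 0" if "size M = Suc d" for M
    using sym_coef_polar that by blast
qed

section \<open>Capelli elements restricted to the slice\<close>

lemma lin_Fil_0:
  assumes "y \<in> Fil A d" "\<And>u. length u \<le> d \<Longrightarrow> g u = 0" shows "lin g y = 0"
proof -
  have "lin g y = lin (\<lambda>u. 0) y"
    using assms by (intro lin_cong) (auto simp: Fil_def)
  then show ?thesis by simp
qed

lemma lin_nonzero:
  assumes "lin g x \<noteq> 0" obtains w where "w \<in> Poly_Mapping.keys x" "g (letters w) \<noteq> 0"
proof -
  have "\<exists>w\<in>Poly_Mapping.keys x. g (letters w) \<noteq> 0"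
  proof (rule ccontr)
    assume "\<not> ?thesis"
    then have "lin g x = 0" by (simp add: lin_def)
    with assms show False ..
  qed
  with that show ?thesis by blast
qed

lemma Fil_prod_list:
  assumes "\<And>x. x \<in> set xs \<Longrightarrow> x \<in> Fil A 1" shows "prod_list xs \<in> Fil A (length xs)"
  using assms
proof (induction xs)
  case Nil
  then show ?case using Fil_scalar [of 1 A 0] by simp
next
  case (Cons x xs)
  then show ?case using Fil_mult [of x A 1 "prod_list xs" "length xs"] by simp
qed

text \<open>Choosing a shift in some factor shortens the word, and \<open>g\<close> vanishes on
  shorter words; so the Capelli shifts are invisible in the top degree.\<close>

lemma lin_prod_shift:
  assumes "\<And>u. length u < length js \<Longrightarrow> g u = 0"
  shows "lin g (prod_list (map (\<lambda>j. letter (a j) (b j) + scalar (s j)) js)) = g (map (\<lambda>j. (a j, b j)) js)"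
  using assms
proof (induction js arbitrary: g)
  case Nil
  then show ?case using lin_scalar [of g 1] by simp
next
  case (Cons j js)
  let ?p = "prod_list (map (\<lambda>j. letter (a j) (b j) + scalar (s j)) js)"
  have "?p \<in> Fil UNIV (length (map (\<lambda>j. letter (a j) (b j) + scalar (s j)) js))"
    by (intro Fil_prod_list) (auto intro!: Fil_add Fil_monomial)
  then have "lin g ?p = 0"
    using Cons.prems by (intro lin_Fil_0) auto
  moreover have "lin (\<lambda>v. g ((a j, b j) # v)) ?p = g ((a j, b j) # map (\<lambda>j. (a j, b j)) js)"
    using Cons.prems by (intro Cons.IH) auto
  ultimately show ?case
    by (simp add: distrib_right lin_add lin_scalar_mult lin_mult [of g "letter _ _"])
qed

definition cyc :: "nat \<Rightarrow> nat \<Rightarrow> nat" where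
  "cyc k j = (if 1 \<le> j \<and> j < k then Suc j else if j = k then 1 else j)"

lemma cyc_permutes_sign:
  assumes "k \<ge> 1" shows "cyc k permutes {1..k} \<and> sign (cyc k) = (- 1) ^ (k - 1)"
  using assms
proof (induction k rule: dec_induct)
  case base
  have "cyc 1 = id" by (auto simp: cyc_def fun_eq_iff)
  show ?case unfolding \<open>cyc 1 = id\<close> by (simp add: id_def)
next
  case (step k)
  have eq: "cyc (Suc k) = cyc k \<circ> transpose k (Suc k)"
    using step.hyps by (auto simp: cyc_def fun_eq_iff transpose_def)
  have "cyc k permutes {1..Suc k}"
    by (rule permutes_subset [of "cyc k" "{1..k}"]) (use step.IH in auto)
  moreover have "transpose k (Suc k) permutes {1..Suc k}"
    using step.hyps by (intro permutes_swap_id) auto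
  moreover have "permutation (cyc k)"
    using step.IH permutes_imp_permutation [of "{1..k}"] by blast
  moreover have "(- 1 :: int) ^ (k - 1) * - 1 = (- 1) ^ k"
    using step.hyps by (cases k) auto
  ultimately have "cyc k \<circ> transpose k (Suc k) permutes {1..Suc k}"
    "sign (cyc k \<circ> transpose k (Suc k)) = (- 1) ^ k"
    using step.IH permutes_compose [of "transpose k (Suc k)" "{1..Suc k}" "cyc k"]
    by (simp_all only: sign_compose permutation_swap_id sign_swap_id) simp
  then show ?case unfolding eq by (simp only: diff_Suc_1 simp_thms)
qed

text \<open>The one term of the \<open>k\<close>-th Capelli element that survives on the slice: the
  last \<open>k\<close> indices permuted cyclically. It consists of \<open>k - 1\<close> subdiagonal
  letters and one letter in column \<open>N\<close>.\<close>

definition cycle_word :: "nat \<Rightarrow> nat \<Rightarrow> (gsym \<times> gsym) list" where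
  "cycle_word N k = map (\<lambda>j. (Proper (N - k + cyc k j), Proper (N - k + j))) [1..<k+1]"

text \<open>The letters of a surviving term are subdiagonal or in the last column, so a column index
  other than \<open>N\<close> is sent to its successor. This forces the index set to be a final
  segment and the permutation to be the cycle, of sign \<open>(- 1) ^ (k - 1)\<close>.\<close>

lemma lin_capelli:
  assumes k: "1 \<le> k" "k \<le> N"
    and g: "\<And>u. g u \<noteq> 0 \<Longrightarrow> length u = k \<and> set u \<subseteq> subdiag_letters N \<union> range (\<lambda>i. (Proper i, Proper N))"
  shows "lin g (capelli N k) = (- 1) ^ (k - 1) * g (cycle_word N k)"
proof -
  let ?S = "{J. J \<subseteq> {1..N} \<and> card J = k}" and ?P = "{\<sigma>. \<sigma> permutes {1..k}}"
  let ?x = "\<lambda>J j. sorted_list_of_set J ! (j - 1)"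
  let ?u = "\<lambda>J \<sigma>. map (\<lambda>j. (Proper (?x J (\<sigma> j)), Proper (?x J j))) [1..<k+1]"
  let ?J = "{N - k + 1..N}"
  have x0: "?x ?J j = N - k + j" if "j \<in> {1..k}" for j
  proof -
    have "sorted_list_of_set ?J = [N - k + 1..<Suc N]"
      by (metis atLeastLessThanSuc_atLeastAtMost sorted_list_of_set_range)
    moreover have "N - k + 1 + (j - 1) < Suc N" using that k by auto
    ultimately show ?thesis using that by (simp add: nth_upt del: upt_Suc)
  qed
  have "lin g (capelli N k) = (\<Sum>J\<in>?S. \<Sum>\<sigma>\<in>?P. of_int (sign \<sigma>) * g (?u J \<sigma>))"
    unfolding capelli_def cdet_def lin_sum
  proof (intro sum.cong refl)
    fix J \<sigma>
    have "(if a = b then of_nat (k - a) else 0) = scalar (if a = b then of_nat (k - a) else 0)" for a b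
      by (simp add: scalar_of_nat)
    moreover have "lin g (prod_list (map (\<lambda>j. letter (Proper (?x J (\<sigma> j))) (Proper (?x J j))
        + scalar (if \<sigma> j = j then of_nat (k - \<sigma> j) else 0)) [1..<k+1])) = g (?u J \<sigma>)"
    proof (rule lin_prod_shift)
      fix u :: "(gsym \<times> gsym) list" assume "length u < length [1..<k+1]"
      then have "length u \<noteq> k" by (simp del: upt_Suc)
      then show "g u = 0" using g [of u] by blast
    qed
    ultimately show "lin g (of_int (sign \<sigma>) * prod_list (map (\<lambda>j. letter (Proper (?x J (\<sigma> j))) (Proper (?x J j))
        + (if \<sigma> j = j then of_nat (k - \<sigma> j) else 0)) [1..<k+1])) = of_int (sign \<sigma>) * g (?u J \<sigma>)"
      by (simp add: lin_scalar_mult flip: scalar_of_int)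
  qed
  also have "\<dots> = (\<Sum>(J, \<sigma>)\<in>?S \<times> ?P. of_int (sign \<sigma>) * g (?u J \<sigma>))"
    by (rule sum.cartesian_product)
  also have "\<dots> = (\<Sum>(J, \<sigma>)\<in>{(?J, cyc k)}. of_int (sign \<sigma>) * g (?u J \<sigma>))"
  proof (rule sum.mono_neutral_right)
    show "finite (?S \<times> ?P)" using finite_permutations [of "{1..k}"] by simp
    show "{(?J, cyc k)} \<subseteq> ?S \<times> ?P"
      using k cyc_permutes_sign by auto
    show "\<forall>p\<in>?S \<times> ?P - {(?J, cyc k)}. (case p of (J, \<sigma>) \<Rightarrow> of_int (sign \<sigma>) * g (?u J \<sigma>)) = 0"
    proof
      fix p assume p: "p \<in> ?S \<times> ?P - {(?J, cyc k)}"
      obtain J \<sigma> where pJ: "p = (J, \<sigma>)" by (cases p)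
      have J: "J \<subseteq> {1..N}" "card J = k" and \<sigma>: "\<sigma> permutes {1..k}"
        using p unfolding pJ by blast+
      have ne: "(J, \<sigma>) \<noteq> (?J, cyc k)" using p unfolding pJ by blast
      have "g (?u J \<sigma>) = 0"
      proof (rule ccontr)
      assume gu: "g (?u J \<sigma>) \<noteq> 0"
      note row = subset_row [OF J]
      have step: "?x J j = N \<or> ?x J j < N \<and> ?x J (\<sigma> j) = Suc (?x J j)" if "j \<in> {1..k}" for j
      proof -
        have "(Proper (?x J (\<sigma> j)), Proper (?x J j)) \<in> set (?u J \<sigma>)"
          using that by (auto simp del: upt_Suc)
        then show ?thesis using g [OF gu] by (auto simp: subdiag_letters_def)
      qed
      have \<sigma>in: "\<sigma> j \<in> {1..k}" if "j \<in> {1..k}" for j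
        using that \<sigma> permutes_in_image by fastforce
      have fin: "finite J" "J \<noteq> {}" using J k finite_subset [OF J(1)] by auto
      \<comment> \<open>A set closed under successor below \<open>N\<close> is an interval ending at
        \<open>N\<close>, and its size determines it.\<close>
      have up: "Suc y \<in> J" if "y \<in> J" "y < N" for y
      proof -
        have "y \<in> set (sorted_list_of_set J)" using that fin by simp
        then obtain p where "p < k" "y = sorted_list_of_set J ! p"
          using row(1) by (metis in_set_conv_nth)
        then have j: "y = ?x J (Suc p)" "Suc p \<in> {1..k}" by auto
        then have "Suc y = ?x J (\<sigma> (Suc p))" using step [OF j(2)] that by auto
        then show ?thesis using row(6) [OF \<sigma>in [OF j(2)]] by simp
      qed
      have "Min J + e \<in> J" if "Min J + e \<le> N" for e
        using that
      proof (induction e)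
        case 0
        then show ?case using fin by simp
      next
        case (Suc e)
        then show ?case using up [of "Min J + e"] by simp
      qed
      then have "{Min J..N} \<subseteq> J" by (auto simp: le_iff_add)
      moreover have "J \<subseteq> {Min J..N}" using J fin by auto
      ultimately have JM: "J = {Min J..N}" by blast
      then have "k = Suc N - Min J" using J(2) by (metis card_atLeastAtMost)
      then have "Min J = N - k + 1" using k by simp
      with JM have J0: "J = ?J" by simp
      have lt: "\<sigma> j = Suc j" if "1 \<le> j" "j < k" for j
      proof -
        have "j \<in> {1..k}" using that by simp
        then have "N - k + \<sigma> j = Suc (N - k + j)"
          using step [of j] x0 [of j] x0 [OF \<sigma>in [of j]] that k unfolding J0 by auto
        then show ?thesis by simp
      qed
      have inj: "inj \<sigma>" using \<sigma> by (rule permutes_inj)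
      \<comment> \<open>Every other value up to \<open>k\<close> is already the image of its
        predecessor.\<close>
      have "\<sigma> k = 1"
      proof (rule ccontr)
        assume "\<sigma> k \<noteq> 1"
        then have "1 \<le> \<sigma> k - 1" "\<sigma> k - 1 < k" "Suc (\<sigma> k - 1) = \<sigma> k" using \<sigma>in [of k] k by auto
        then have "\<sigma> (\<sigma> k - 1) = \<sigma> k" using lt [of "\<sigma> k - 1"] by simp
        then have "\<sigma> k - 1 = k" by (rule injD [OF inj])
        then show False using \<open>\<sigma> k - 1 < k\<close> by simp
      qed
      moreover have "\<sigma> j = j" if "j \<notin> {1..k}" for j using \<sigma> that by (rule permutes_not_in)
      ultimately have "\<sigma> = cyc k" using lt by (fastforce simp: cyc_def fun_eq_iff)
      with J0 ne show False by simp
      qed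
      then show "(case p of (J, \<sigma>) \<Rightarrow> of_int (sign \<sigma>) * g (?u J \<sigma>)) = 0"
        unfolding pJ prod.case by simp
    qed
  qed
  also have "\<dots> = (- 1) ^ (k - 1) * g (?u ?J (cyc k))"
    using cyc_permutes_sign [OF k(1)] by simp
  also have "?u ?J (cyc k) = cycle_word N k"
    unfolding cycle_word_def
  proof (intro map_cong refl)
    fix j assume "j \<in> set [1..<k+1]"
    then have j: "j \<in> {1..k}" by auto
    then have "cyc k j \<in> {1..k}"
      by (auto simp: cyc_def)
    with j show "(Proper (?x ?J (cyc k j)), Proper (?x ?J j)) = (Proper (N - k + cyc k j), Proper (N - k + j))"
      using x0 [of j] x0 [of "cyc k j"] by simp
  qed
  finally show ?thesis .
qed

lemma mset_cycle_word:
  assumes "i \<in> {1..N}"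
  obtains F where "set_mset F \<subseteq> subdiag_letters N" "mset (cycle_word N (N + 1 - i)) = add_mset (Proper i, Proper N) F"
proof
  let ?k = "N + 1 - i"
  let ?F = "mset (map (\<lambda>j. (Proper (N - ?k + cyc ?k j), Proper (N - ?k + j))) [1..<?k])"
  show "set_mset ?F \<subseteq> subdiag_letters N"
  proof
    fix l assume "l \<in> set_mset ?F"
    then obtain j where j: "1 \<le> j" "j < ?k" "l = (Proper (N - ?k + cyc ?k j), Proper (N - ?k + j))"
      by auto
    then have "l = (Proper (Suc (N - ?k + j)), Proper (N - ?k + j))" "N - ?k + j \<in> {1..<N}"
      using assms by (auto simp: cyc_def)
    then show "l \<in> subdiag_letters N"
      unfolding subdiag_letters_def by (rule image_eqI)
  qed
  have "1 \<le> ?k" using assms by auto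
  then have "[1..<?k+1] = [1..<?k] @ [?k]" by simp
  moreover have "N - ?k + cyc ?k ?k = i" "N - ?k + ?k = N"
    using assms by (auto simp: cyc_def)
  ultimately show "mset (cycle_word N ?k) = add_mset (Proper i, Proper N) ?F"
    unfolding cycle_word_def by (simp del: upt_Suc)
qed

lemma slice_mset_add_subdiag:
  assumes "set_mset F \<subseteq> subdiag_letters N"
  shows "slice_mset N \<mu> (F + M) \<longleftrightarrow> slice_mset N \<mu> M"
proof
  assume "slice_mset N \<mu> M"
  then obtain G where "set_mset G \<subseteq> subdiag_letters N" "M = image_mset (\<lambda>i. (Proper i, Proper N)) \<mu> + G"
    by (auto simp: slice_mset_def)
  with assms show "slice_mset N \<mu> (F + M)"
    unfolding slice_mset_def by (intro exI [of _ "F + G"]) auto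
next
  assume "slice_mset N \<mu> (F + M)"
  then obtain G where G: "set_mset G \<subseteq> subdiag_letters N" "F + M = image_mset (\<lambda>i. (Proper i, Proper N)) \<mu> + G"
    by (auto simp: slice_mset_def)
  let ?I = "image_mset (\<lambda>i. (Proper i, Proper N)) \<mu>"
  have "count F l \<le> count G l" for l
  proof (cases "l \<in># F")
    case True
    then have "l \<in> subdiag_letters N" using assms by auto
    then have "l \<notin># ?I" using column_not_subdiag by auto
    then have "count ?I l = 0" by (rule count_eq_zero_iff [THEN iffD2])
    moreover have "count F l + count M l = count ?I l + count G l"
      using G(2) by (metis count_union)
    ultimately show ?thesis by simp
  qed (simp add: not_in_iff)
  then have "F \<subseteq># G" by (simp add: subseteq_mset_def)
  then obtain H where H: "G = F + H" using subset_mset.le_iff_add by blast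
  then have "M = ?I + H" using G(2) by simp
  then show "slice_mset N \<mu> M"
    unfolding slice_mset_def using G(1) H by (intro exI [of _ H]) auto
qed

lemma capelli_Fil: "capelli N k \<in> Fil (proper_syms N) k"
  unfolding capelli_def
proof (rule Fil_sum)
  fix J assume J: "J \<in> {J. J \<subseteq> {1..N} \<and> card J = k}"
  let ?a = "\<lambda>a b. letter (Proper (sorted_list_of_set J ! (a - 1))) (Proper (sorted_list_of_set J ! (b - 1)))
                    + (if a = b then of_nat (k - a) else 0)"
  have entry: "?a i j \<in> Fil (proper_syms N) 1" if "i \<in> {1..k}" "j \<in> {1..k}" for i j
  proof -
    have "sorted_list_of_set J ! (i - 1) \<in> {1..N}" "sorted_list_of_set J ! (j - 1) \<in> {1..N}"
      using subset_row(6) [of J N k] that J by blast+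
    then show ?thesis
      by (intro Fil_add Fil_monomial) (auto simp: proper_syms_def simp flip: scalar_of_nat)
  qed
  show "cdet k ?a \<in> Fil (proper_syms N) k"
    unfolding cdet_def
  proof (rule Fil_sum)
    fix \<sigma> assume \<sigma>: "\<sigma> \<in> {\<sigma>. \<sigma> permutes {1..k}}"
    have "prod_list (map (\<lambda>j. ?a (\<sigma> j) j) [1..<k+1]) \<in> Fil (proper_syms N) (length (map (\<lambda>j. ?a (\<sigma> j) j) [1..<k+1]))"
    proof (rule Fil_prod_list)
      fix x assume "x \<in> set (map (\<lambda>j. ?a (\<sigma> j) j) [1..<k+1])"
      then obtain j where j: "x = ?a (\<sigma> j) j" "j \<in> {1..k}" by auto
      then have "\<sigma> j \<in> {1..k}" using \<sigma> permutes_in_image by fastforce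
      with j entry show "x \<in> Fil (proper_syms N) 1" by blast
    qed
    then show "of_int (sign \<sigma>) * prod_list (map (\<lambda>j. ?a (\<sigma> j) j) [1..<k+1]) \<in> Fil (proper_syms N) k"
      by (simp add: Fil_scalar_mult del: upt_Suc flip: scalar_of_int)
  qed
qed

text \<open>On the slice, the Capelli element of index \<open>N + 1 - i\<close> is, up to sign, the
  coordinate in row \<open>i\<close> of the last column; so multiplying by it adds one
  \<open>i\<close> to the monomial.\<close>

lemma slice_coef_capelli_mult:
  assumes i: "i \<in> {1..N}" and y: "y \<in> Fil A q"
  shows "slice_coef N (N + 1 - i + q) \<mu> (capelli N (N + 1 - i) * y)
    = (- 1) ^ (N - i) * (if i \<in># \<mu> then slice_coef N q (\<mu> - {#i#}) y else 0)"
proof -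
  define k where "k = N + 1 - i"
  define F :: "(gsym \<times> gsym) list \<Rightarrow> complex" where
    "F w = (if length w = k + q \<and> slice_mset N \<mu> (mset w) then 1 else 0)" for w
  define g where "g u = (if length u = k then lin (\<lambda>v. F (u @ v)) y else 0)" for u
  have "slice_coef N (k + q) \<mu> (capelli N k * y) = lin (\<lambda>u. lin (\<lambda>v. F (u @ v)) y) (capelli N k)"
    by (simp add: slice_coef_def lin_mult F_def)
  also have "\<dots> = lin g (capelli N k)"
  proof (rule lin_cong)
    fix w assume "w \<in> Poly_Mapping.keys (capelli N k)"
    then have "length (letters w) \<le> k" using capelli_Fil by (auto simp: Fil_def)
    moreover have "lin (\<lambda>v. F (letters w @ v)) y = 0" if "length (letters w) < k"
      using that by (intro lin_Fil_0 [OF y]) (auto simp: F_def)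
    ultimately show "lin (\<lambda>v. F (letters w @ v)) y = g (letters w)" by (auto simp: g_def)
  qed
  also have "\<dots> = (- 1) ^ (k - 1) * g (cycle_word N k)"
  proof (rule lin_capelli)
    fix u assume gu: "g u \<noteq> 0"
    then obtain v where "F (u @ v) \<noteq> 0"
      unfolding g_def by (metis lin_fun_0 lin_cong)
    then have "slice_mset N \<mu> (mset u + mset v)" by (auto simp: F_def split: if_splits)
    then obtain G where G: "set_mset G \<subseteq> subdiag_letters N" "mset u + mset v = image_mset (\<lambda>i. (Proper i, Proper N)) \<mu> + G"
      by (auto simp: slice_mset_def)
    have "set u \<subseteq> set_mset (mset u + mset v)" by simp
    also have "\<dots> \<subseteq> subdiag_letters N \<union> range (\<lambda>i. (Proper i, Proper N))"
      unfolding G(2) using G(1) by auto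
    finally show "length u = k \<and> set u \<subseteq> subdiag_letters N \<union> range (\<lambda>i. (Proper i, Proper N))"
      using gu by (auto simp: g_def split: if_splits)
  qed (use i in \<open>auto simp: k_def\<close>)
  also have "g (cycle_word N k) = (if i \<in># \<mu> then slice_coef N q (\<mu> - {#i#}) y else 0)"
  proof -
    obtain E where E: "set_mset E \<subseteq> subdiag_letters N" "mset (cycle_word N k) = add_mset (Proper i, Proper N) E"
      using mset_cycle_word [OF i] unfolding k_def .
    have len: "length (cycle_word N k) = k" by (simp add: cycle_word_def)
    have sl: "slice_mset N \<mu> (mset (cycle_word N k @ v)) \<longleftrightarrow> i \<in># \<mu> \<and> slice_mset N (\<mu> - {#i#}) (mset v)" for v
    proof (cases "i \<in># \<mu>")
      case True
      then have "\<mu> = add_mset i (\<mu> - {#i#})" by simp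
      then have "slice_mset N \<mu> (mset (cycle_word N k @ v)) \<longleftrightarrow> slice_mset N (\<mu> - {#i#}) (E + mset v)"
        using slice_add [of N i "\<mu> - {#i#}" "E + mset v"] E(2) by simp
      with True show ?thesis by (simp add: slice_mset_add_subdiag [OF E(1)])
    next
      case False
      then have "count \<mu> i = 0" by (simp add: not_in_iff)
      then have "\<not> slice_mset N \<mu> (mset (cycle_word N k @ v))"
        using slice_count [of N \<mu> "mset (cycle_word N k @ v)" i] E(2) by auto
      with False show ?thesis by simp
    qed
    show ?thesis
    proof (cases "i \<in># \<mu>")
      case True
      then show ?thesis by (simp add: g_def len F_def sl slice_coef_def del: mset_append)
    next
      case False
      then show ?thesis by (simp add: g_def len F_def sl del: mset_append)
    qed
  qed
  finally show ?thesis using i by (simp add: k_def)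
qed

text \<open>Products of Capelli elements therefore restrict to signed monomials in the coordinates
  of the slice.\<close>

lemma capelli_prod:
  assumes "set is \<subseteq> {1..N}"
  defines "p \<equiv> prod_list (map (\<lambda>i. capelli N (N + 1 - i)) is)"
  shows "p \<in> Fil (proper_syms N) (\<Sum>i\<leftarrow>is. N + 1 - i)"
    and "slice_coef N (\<Sum>i\<leftarrow>is. N + 1 - i) \<mu> p = (if \<mu> = mset is then (\<Prod>i\<leftarrow>is. (- 1) ^ (N - i)) else 0)"
proof -
  have "p \<in> Fil (proper_syms N) (\<Sum>i\<leftarrow>is. N + 1 - i) \<and> (\<forall>\<mu>.
      slice_coef N (\<Sum>i\<leftarrow>is. N + 1 - i) \<mu> p = (if \<mu> = mset is then (\<Prod>i\<leftarrow>is. (- 1) ^ (N - i)) else 0))"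
    using assms(1) unfolding p_def
  proof (induction "is")
    case Nil
    have "slice_mset N \<mu> {#} \<longleftrightarrow> \<mu> = {#}" for \<mu>
      by (auto simp: slice_mset_def)
    then show ?case
      using Fil_scalar [of 1] lin_scalar [of _ 1] by (auto simp: slice_coef_def)
  next
    case (Cons i "is")
    let ?p = "prod_list (map (\<lambda>i. capelli N (N + 1 - i)) is)" and ?d = "\<Sum>i\<leftarrow>is. N + 1 - i"
    have IH: "?p \<in> Fil (proper_syms N) ?d"
      "\<And>\<mu>. slice_coef N ?d \<mu> ?p = (if \<mu> = mset is then (\<Prod>i\<leftarrow>is. (- 1) ^ (N - i)) else 0)"
      using Cons by auto
    have "slice_coef N (N + 1 - i + ?d) \<mu> (capelli N (N + 1 - i) * ?p)
      = (if \<mu> = mset (i # is) then (\<Prod>i\<leftarrow>i # is. (- 1) ^ (N - i)) else 0)" for \<mu>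
    proof -
      have "i \<in> {1..N}" using Cons.prems by simp
      note mult = slice_coef_capelli_mult [OF this IH(1), of \<mu>]
      have "i \<in># \<mu> \<and> \<mu> - {#i#} = mset is \<longleftrightarrow> \<mu> = mset (i # is)"
        by (auto dest: insert_DiffM)
      then show ?thesis unfolding mult IH(2) by auto
    qed
    moreover have "capelli N (N + 1 - i) * ?p \<in> Fil (proper_syms N) (N + 1 - i + ?d)"
      by (rule Fil_mult [OF capelli_Fil IH(1)])
    ultimately show ?case by simp
  qed
  then show "p \<in> Fil (proper_syms N) (\<Sum>i\<leftarrow>is. N + 1 - i)"
    "slice_coef N (\<Sum>i\<leftarrow>is. N + 1 - i) \<mu> p = (if \<mu> = mset is then (\<Prod>i\<leftarrow>is. (- 1) ^ (N - i)) else 0)"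
    by blast+
qed

section \<open>Homogeneity on the slice and generation of the center\<close>

text \<open>Subdiagonal letters disappear on the slice, so \<mu> alone does not show the degree it
  came from. Invariance under the diagonal element with entries \<open>1, ..., N\<close> restores
  it: the Capelli product belonging to \<mu> has exactly degree \<open>d\<close>, so subtracting it
  does not raise the degree.\<close>

lemma slice_degree:
  assumes x: "central N x" "x \<in> Fil (proper_syms N) d" and ne: "slice_coef N d \<mu> x \<noteq> 0"
  shows "set_mset \<mu> \<subseteq> {1..N}" "(\<Sum>i\<in>#\<mu>. N + 1 - i) = d"
proof -
  define g :: "(gsym \<times> gsym) multiset \<Rightarrow> complex" where
    "g M = (if size M = d \<and> slice_mset N \<mu> M then 1 else 0)" for M
  \<comment> \<open>The entry of that diagonal element at the given index; a letter
    \<open>(a, b)\<close> has weight \<open>ind a - ind b\<close>.\<close>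
  define ind :: "gsym \<Rightarrow> complex" where "ind a = (\<Sum>i=1..N. of_nat i * of_bool (a = Proper i))" for a
  have ind: "ind (Proper i) = of_nat i" if "i \<in> {1..N}" for i
  proof -
    have "ind (Proper i) = (\<Sum>j=1..N. if i = j then of_nat j else 0)"
      unfolding ind_def by (intro sum.cong) auto
    then show ?thesis using that by simp
  qed
  have slice_coef: "slice_coef N d \<mu> x = lin (\<lambda>w. g (mset w)) x"
    by (simp add: slice_coef_def g_def)
  have wA: "set (letters w) \<subseteq> proper_syms N \<times> proper_syms N" if "w \<in> Poly_Mapping.keys x" for w
    using x(2) that unfolding Fil_def fcar_iff by blast
  have mu: "set_mset \<mu> \<subseteq> {1..N}" if w: "w \<in> Poly_Mapping.keys x" and sl: "slice_mset N \<mu> (mset (letters w))" for w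
  proof
    fix i assume "i \<in># \<mu>"
    then have "(Proper i, Proper N) \<in># mset (letters w)"
      using slice_count [OF sl, of i] by (metis count_eq_zero_iff)
    then have "Proper i \<in> proper_syms N" using wA [OF w] by auto
    then show "i \<in> {1..N}" by (auto simp: proper_syms_def)
  qed
  obtain w0 where w0: "w0 \<in> Poly_Mapping.keys x" "g (mset (letters w0)) \<noteq> 0"
    using ne unfolding slice_coef by (metis lin_cong lin_fun_0)
  then have "slice_mset N \<mu> (mset (letters w0))" by (auto simp: g_def split: if_splits)
  with w0 mu show mu': "set_mset \<mu> \<subseteq> {1..N}" by blast
  \<comment> \<open>The weight of every contributing monomial: a subdiagonal letter has weight 1,
    and \<open>(Proper i, Proper N)\<close> has weight \<open>i - N = 1 - (N + 1 - i)\<close>.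
    Invariance forces it to be zero.\<close>
  define \<omega> :: complex where "\<omega> = of_nat d - (\<Sum>i\<in>#\<mu>. of_nat (N + 1 - i))"
  have bracket: "(\<Sum>l\<in>#M. bracket_fun a a (\<lambda>l'. g (add_mset l' (M - {#l#}))) l)
      = (\<Sum>l\<in>#M. of_bool (fst l = a) - of_bool (snd l = a)) * g M" for M a
  proof -
    have "bracket_fun a a (\<lambda>l'. g (add_mset l' (M - {#l#}))) l = (of_bool (fst l = a) - of_bool (snd l = a)) * g M"
      if "l \<in># M" for l
      using that by (cases l) auto
    then show ?thesis
      by (simp add: sum_mset_distrib_right cong: image_mset_cong)
  qed
  have "(\<Sum>i=1..N. of_nat i * lin (\<lambda>w. (\<Sum>l\<in>#mset w. of_bool (fst l = Proper i) - of_bool (snd l = Proper i)) * g (mset w)) x) = 0"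
  proof (intro sum.neutral ballI)
    fix i assume i: "i \<in> {1..N}"
    have "lin (\<lambda>w. \<Sum>l\<in>#mset w. bracket_fun (Proper i) (Proper i) (\<lambda>l'. g (add_mset l' (mset w - {#l#}))) l) x = 0"
      by (rule central_invariant [OF x i i]) (simp add: g_def)
    then show "of_nat i * lin (\<lambda>w. (\<Sum>l\<in>#mset w. of_bool (fst l = Proper i) - of_bool (snd l = Proper i)) * g (mset w)) x = 0"
      by (simp only: bracket mult_zero_right)
  qed
  also have "(\<Sum>i=1..N. of_nat i * lin (\<lambda>w. (\<Sum>l\<in>#mset w. of_bool (fst l = Proper i) - of_bool (snd l = Proper i)) * g (mset w)) x)
    = lin (\<lambda>w. \<Sum>i=1..N. of_nat i * ((\<Sum>l\<in>#mset w. of_bool (fst l = Proper i) - of_bool (snd l = Proper i)) * g (mset w))) x"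
    by (simp add: lin_fun_sum lin_fun_cmult)
  also have "\<dots> = lin (\<lambda>w. \<omega> * g (mset w)) x"
  proof (rule lin_cong)
    fix w assume w: "w \<in> Poly_Mapping.keys x"
    let ?M = "mset (letters w)"
    show "(\<Sum>i=1..N. of_nat i * ((\<Sum>l\<in>#?M. of_bool (fst l = Proper i) - of_bool (snd l = Proper i)) * g ?M)) = \<omega> * g ?M"
    proof (cases "g ?M = 0")
      case False
      then have M: "size ?M = d" "slice_mset N \<mu> ?M" by (auto simp: g_def split: if_splits)
      then obtain F where F: "set_mset F \<subseteq> subdiag_letters N" "?M = image_mset (\<lambda>i. (Proper i, Proper N)) \<mu> + F"
        by (auto simp: slice_mset_def)
      have "(\<Sum>i=1..N. of_nat i * ((\<Sum>l\<in>#?M. of_bool (fst l = Proper i) - of_bool (snd l = Proper i)) * g ?M))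
        = (\<Sum>l\<in>#?M. ind (fst l) - ind (snd l)) * g ?M"
      proof -
        have "(\<Sum>l\<in>#?M. ind (fst l) - ind (snd l))
          = (\<Sum>l\<in>#?M. \<Sum>i=1..N. of_nat i * (of_bool (fst l = Proper i) - of_bool (snd l = Proper i)))"
          by (simp only: ind_def right_diff_distrib sum_subtractf)
        also have "\<dots> = (\<Sum>i=1..N. of_nat i * (\<Sum>l\<in>#?M. of_bool (fst l = Proper i) - of_bool (snd l = Proper i)))"
          by (simp only: sum_mset_sum_swap sum_mset_distrib_left)
        finally show ?thesis by (simp only: sum_distrib_right mult.assoc)
      qed
      also have "(\<Sum>l\<in>#?M. ind (fst l) - ind (snd l)) = (\<Sum>i\<in>#\<mu>. ind (Proper i) - ind (Proper N)) + (\<Sum>l\<in>#F. ind (fst l) - ind (snd l))"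
        by (simp add: F(2) image_mset.compositionality comp_def)
      also have "(\<Sum>l\<in>#F. ind (fst l) - ind (snd l)) = (\<Sum>l\<in>#F. 1)"
      proof (intro arg_cong [where f = sum_mset] image_mset_cong)
        fix l assume "l \<in># F"
        then obtain c where "l = (Proper (Suc c), Proper c)" "c \<in> {1..<N}"
          using F(1) by (auto simp: subdiag_letters_def)
        then show "ind (fst l) - ind (snd l) = 1" by (simp add: ind)
      qed
      also have "(\<Sum>i\<in>#\<mu>. ind (Proper i) - ind (Proper N)) = (\<Sum>i\<in>#\<mu>. 1 - of_nat (N + 1 - i))"
      proof (intro arg_cong [where f = sum_mset] image_mset_cong)
        fix i assume "i \<in># \<mu>"
        then have "i \<in> {1..N}" "N \<in> {1..N}" using mu' by auto
        then show "ind (Proper i) - ind (Proper N) = 1 - of_nat (N + 1 - i)"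
          by (simp only: ind) (simp add: of_nat_diff)
      qed
      also have "(\<Sum>i\<in>#\<mu>. 1 - of_nat (N + 1 - i)) + (\<Sum>l\<in>#F. 1) = \<omega>"
      proof -
        have "size \<mu> + size F = d" using M(1) F(2) by (metis size_image_mset size_union)
        then have "of_nat d = (of_nat (size \<mu>) + of_nat (size F) :: complex)" by (metis of_nat_add)
        then show ?thesis by (simp add: \<omega>_def sum_mset_subtract)
      qed
      finally show ?thesis .
    qed simp
  qed
  also have "\<dots> = \<omega> * slice_coef N d \<mu> x"
    by (simp add: slice_coef lin_fun_cmult)
  finally have "\<omega> = 0" using ne by simp
  then have "complex_of_nat d = of_nat (\<Sum>i\<in>#\<mu>. N + 1 - i)"
    by (simp add: \<omega>_def image_mset.compositionality comp_def del: of_nat_diff)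
  then show "(\<Sum>i\<in>#\<mu>. N + 1 - i) = d" by (metis of_nat_eq_iff)
qed

inductive_set capelli_alg :: "nat \<Rightarrow> falg set" for N where
  scalar: "scalar c \<in> capelli_alg N"
| capelli: "k \<in> {1..N} \<Longrightarrow> capelli N k \<in> capelli_alg N"
| add: "x \<in> capelli_alg N \<Longrightarrow> y \<in> capelli_alg N \<Longrightarrow> x + y \<in> capelli_alg N"
| mult: "x \<in> capelli_alg N \<Longrightarrow> y \<in> capelli_alg N \<Longrightarrow> x * y \<in> capelli_alg N"

lemma capelli_alg_central: "x \<in> capelli_alg N \<Longrightarrow> central N x"
  by (induction rule: capelli_alg.induct)
    (auto intro: central_scalar capelli_central central_add central_mult)

lemma capelli_alg_sum: "(\<And>i. i \<in> I \<Longrightarrow> f i \<in> capelli_alg N) \<Longrightarrow> sum f I \<in> capelli_alg N"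
  using capelli_alg.scalar [of 0 N]
  by (induction I rule: infinite_finite_induct) (auto intro: capelli_alg.add)

lemma capelli_alg_prod_list: "(\<And>x. x \<in> set xs \<Longrightarrow> x \<in> capelli_alg N) \<Longrightarrow> prod_list xs \<in> capelli_alg N"
  using capelli_alg.scalar [of 1 N] by (induction xs) (auto intro: capelli_alg.mult)

lemma slice_coef_diff: "slice_coef N d \<mu> (x - y) = slice_coef N d \<mu> x - slice_coef N d \<mu> y"
  by (simp add: slice_coef_def lin_diff)

text \<open>The restricted symbol is a finite combination of monomials, and each of them is realized
  in the right degree by a Capelli product. The signs of these products square to 1, so they serve
  as their own inverses in \<open>y\<close>.\<close>

lemma capelli_slice_surjective:
  assumes x: "central N x" "x \<in> Fil (proper_syms N) d"
  obtains y where "y \<in> capelli_alg N" "y \<in> Fil (proper_syms N) d" "\<And>\<mu>. slice_coef N d \<mu> (x - y) = 0"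
proof -
  \<comment> \<open>Recovers \<mu> from a word as the rows of its letters in column
    \<open>N\<close>, so that only finitely many \<mu> occur.\<close>
  let ?P = "\<lambda>w. image_mset (\<lambda>l. case fst l of Proper i \<Rightarrow> i | _ \<Rightarrow> 0) (filter_mset (\<lambda>l. snd l = Proper N) (mset (letters w)))"
  define \<Omega> where "\<Omega> = {\<mu>. slice_coef N d \<mu> x \<noteq> 0}"
  have "\<Omega> \<subseteq> ?P ` Poly_Mapping.keys x"
  proof
    fix \<mu> assume "\<mu> \<in> \<Omega>"
    then obtain w where w: "w \<in> Poly_Mapping.keys x" "slice_mset N \<mu> (mset (letters w))"
      by (auto simp: \<Omega>_def slice_coef_def split: if_splits elim!: lin_nonzero)
    then obtain F where F: "set_mset F \<subseteq> subdiag_letters N" "mset (letters w) = image_mset (\<lambda>i. (Proper i, Proper N)) \<mu> + F"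
      by (auto simp: slice_mset_def)
    have "filter_mset (\<lambda>l. snd l = Proper N) F = {#}"
      using F(1) by (auto simp: subdiag_letters_def)
    moreover have "filter_mset (\<lambda>l. snd l = Proper N) (image_mset (\<lambda>i. (Proper i, Proper N)) \<mu>)
        = image_mset (\<lambda>i. (Proper i, Proper N)) \<mu>"
      by (induction \<mu>) auto
    ultimately have "?P w = \<mu>"
      by (simp add: F(2) image_mset.compositionality comp_def)
    with w show "\<mu> \<in> ?P ` Poly_Mapping.keys x" by blast
  qed
  then have fin: "finite \<Omega>" by (rule finite_subset) simp
  obtain r :: "nat multiset \<Rightarrow> nat list" where r: "\<And>M. mset (r M) = M"
    using ex_mset by metis
  let ?p = "\<lambda>\<mu>. prod_list (map (\<lambda>i. capelli N (N + 1 - i)) (r \<mu>))"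
  let ?s = "\<lambda>\<mu>. \<Prod>i\<leftarrow>r \<mu>. (- 1 :: complex) ^ (N - i)"
  define y where "y = (\<Sum>\<mu>\<in>\<Omega>. scalar (slice_coef N d \<mu> x * ?s \<mu>) * ?p \<mu>)"
  have \<Omega>: "set (r \<mu>) \<subseteq> {1..N}" "(\<Sum>i\<leftarrow>r \<mu>. N + 1 - i) = d" if "\<mu> \<in> \<Omega>" for \<mu>
  proof -
    have ne: "slice_coef N d \<mu> x \<noteq> 0" using that by (simp add: \<Omega>_def)
    have "set (r \<mu>) = set_mset \<mu>" by (metis r set_mset_mset)
    then show "set (r \<mu>) \<subseteq> {1..N}" using slice_degree(1) [OF x ne] by simp
    have "(\<Sum>i\<leftarrow>r \<mu>. N + 1 - i) = (\<Sum>i\<in>#mset (r \<mu>). N + 1 - i)"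
      by (metis mset_map sum_mset_sum_list)
    then show "(\<Sum>i\<leftarrow>r \<mu>. N + 1 - i) = d" using slice_degree(2) [OF x ne] by (simp add: r)
  qed
  have "y \<in> capelli_alg N"
    unfolding y_def using \<Omega>(1)
    by (intro capelli_alg_sum capelli_alg.mult capelli_alg.scalar capelli_alg_prod_list)
      (fastforce intro: capelli_alg.capelli)
  moreover have "y \<in> Fil (proper_syms N) d"
    unfolding y_def using capelli_prod(1) [OF \<Omega>(1)] \<Omega>(2) by (intro Fil_sum Fil_scalar_mult) metis
  moreover have "slice_coef N d \<nu> (x - y) = 0" for \<nu>
  proof -
    have sq: "?s \<mu> * ?s \<mu> = 1" for \<mu>
    proof -
      have "(\<Prod>i\<leftarrow>is. (- 1 :: complex) ^ (N - i)) * (\<Prod>i\<leftarrow>is. (- 1) ^ (N - i)) = 1" for "is"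
        by (induction "is") (auto simp: minus_one_power_iff)
      then show ?thesis .
    qed
    have "slice_coef N d \<nu> y = (\<Sum>\<mu>\<in>\<Omega>. slice_coef N d \<mu> x * ?s \<mu> * slice_coef N d \<nu> (?p \<mu>))"
      by (simp add: y_def slice_coef_def lin_sum lin_scalar_mult)
    also have "\<dots> = (\<Sum>\<mu>\<in>\<Omega>. if \<mu> = \<nu> then slice_coef N d \<mu> x else 0)"
    proof (rule sum.cong [OF refl])
      fix \<mu> assume "\<mu> \<in> \<Omega>"
      then have "slice_coef N d \<nu> (?p \<mu>) = (if \<nu> = \<mu> then ?s \<mu> else 0)"
        using capelli_prod(2) [OF \<Omega>(1), of \<mu> \<nu>] \<Omega>(2) by (simp add: r)
      then show "slice_coef N d \<mu> x * ?s \<mu> * slice_coef N d \<nu> (?p \<mu>) = (if \<mu> = \<nu> then slice_coef N d \<mu> x else 0)"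
        using sq [of \<mu>] by (cases "\<mu> = \<nu>") (simp_all add: mult.assoc)
    qed
    also have "\<dots> = slice_coef N d \<nu> x"
      using fin by (simp add: \<Omega>_def)
    finally show ?thesis by (simp add: slice_coef_diff)
  qed
  ultimately show ?thesis using that by blast
qed

text \<open>Subtracting a Capelli polynomial with the same restricted symbol leaves a central
  element, which is congruent to one of smaller degree by \<open>lower_degree\<close>.\<close>

theorem center_generated:
  assumes "central N z" obtains y where "y \<in> capelli_alg N" "z - y \<in> RI (proper_syms N)"
proof -
  obtain d where "z \<in> FR (proper_syms N) d"
    using Fil_exists [OF central_carrier [OF assms]] Fil_FR by metis
  with assms have "\<exists>y\<in>capelli_alg N. z - y \<in> RI (proper_syms N)"
  proof (induction d arbitrary: z)
    case 0
    then obtain x where x: "x \<in> Fil (proper_syms N) 0" "z - x \<in> RI (proper_syms N)" by (auto simp: FR_def)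
    then have "x \<in> capelli_alg N" using Fil_zero_scalar capelli_alg.scalar by metis
    with x show ?case by blast
  next
    case (Suc d)
    then obtain x where x: "x \<in> Fil (proper_syms N) (Suc d)" "z - x \<in> RI (proper_syms N)" by (auto simp: FR_def)
    then have c: "central N x" using central_cong [OF Suc.prems(1) Fil_carrier] by blast
    obtain y where y: "y \<in> capelli_alg N" "y \<in> Fil (proper_syms N) (Suc d)" "\<And>\<mu>. slice_coef N (Suc d) \<mu> (x - y) = 0"
      using capelli_slice_surjective [OF c x(1)] by blast
    have c': "central N (x - y)" using c capelli_alg_central [OF y(1)] by (rule central_diff)
    then have "x - y \<in> FR (proper_syms N) d"
      using x(1) y by (intro lower_degree) (auto intro: Fil_diff)
    then obtain y' where y': "y' \<in> capelli_alg N" "x - y - y' \<in> RI (proper_syms N)"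
      using Suc.IH c' by blast
    then have "z - (y + y') \<in> RI (proper_syms N)"
      using rel_ideal_add [OF x(2) y'(2)] by (simp add: algebra_simps)
    then show ?case using y(1) y'(1) capelli_alg.add by blast
  qed
  then show ?thesis using that by blast
qed

section \<open>The Capelli projection\<close>

text \<open>Elements with a decomposition are closed under sums and products, and scalars and
  Capelli elements have one; generation of the center does the rest.\<close>

lemma olsh_exists:
  assumes "central (n + 1) z" obtains z' where "olsh n z z'"
proof -
  obtain y where y: "y \<in> capelli_alg (n + 1)" "z - y \<in> RI (proper_syms (n + 1))"
    using center_generated [OF assms] .
  from y(1) have "\<exists>y'. olsh n y y'"
  proof (induction rule: capelli_alg.induct)
    case (scalar c)
    then show ?case using olsh_scalar by blast
  next
    case (capelli k)
    then show ?case using capelli_olsh by blast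
  next
    case (add x y)
    then show ?case using olsh_add by blast
  next
    case (mult x y)
    then show ?case using olsh_mult by blast
  qed
  then obtain y' where "olsh n y y'" by blast
  then have "olsh n z y'"
    using LG_add [OF LG_rel [OF y(2)], of "y - y'"] central_carrier [OF assms] by (simp add: olsh_def)
  with that show ?thesis by blast
qed

lemma capelli_eq_0: "n < k \<Longrightarrow> capelli n k = 0"
proof -
  assume "n < k"
  have "{J. J \<subseteq> {1..n} \<and> card J = k} = {}"
  proof (rule ccontr)
    assume "\<not> ?thesis"
    then obtain J where "J \<subseteq> {1..n}" "card J = k" by blast
    then show False using card_mono [of "{1..n}" J] \<open>n < k\<close> by simp
  qed
  then show ?thesis unfolding capelli_def by (simp only: sum.empty)
qed

lemma zeta_ring_simps:
  "carrier (zeta_ring n) = zeta n"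
  "x \<otimes>\<^bsub>zeta_ring n\<^esub> y = x \<otimes>\<^bsub>Ugl n\<^esub> y"
  "x \<oplus>\<^bsub>zeta_ring n\<^esub> y = x \<oplus>\<^bsub>Ugl n\<^esub> y"
  "\<one>\<^bsub>zeta_ring n\<^esub> = \<one>\<^bsub>Ugl n\<^esub>"
  by (simp_all add: zeta_ring_def)

text \<open>The Olshanski projection is an algebra map with the prescribed values on the Capelli
  elements, and two such maps agree on everything these generate, hence on the center.\<close>

theorem capelli_proj_olsh:
  assumes "olsh n z z'" "central (n + 1) z"
  shows "capelli_proj n (cls (proper_syms (n + 1)) z) = cls (proper_syms n) z'"
proof -
  let ?B = "proper_syms (n + 1)" and ?A = "proper_syms n"
  \<comment> \<open>The Olshanski projection on classes; the value \<open>undefined\<close> outside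
    the center is the one that \<open>extensional\<close> prescribes.\<close>
  define f where "f \<rho> = (if \<rho> \<in> zeta (n + 1) then
      (THE \<rho>'. \<exists>z z'. \<rho> = cls ?B z \<and> olsh n z z' \<and> \<rho>' = cls ?A z') else undefined)" for \<rho>
  have f: "f (cls ?B z) = cls ?A z'" if "olsh n z z'" "central (n + 1) z" for z z'
  proof -
    have "cls ?B z \<in> zeta (n + 1)" using that zeta_cls_iff by (simp add: olsh_def)
    moreover have "(THE \<rho>'. \<exists>x x'. cls ?B z = cls ?B x \<and> olsh n x x' \<and> \<rho>' = cls ?A x') = cls ?A z'"
    proof (rule the_equality)
      show "\<exists>x x'. cls ?B z = cls ?B x \<and> olsh n x x' \<and> cls ?A z' = cls ?A x'"
        using that(1) by blast
    next
      fix \<rho>' assume "\<exists>x x'. cls ?B z = cls ?B x \<and> olsh n x x' \<and> \<rho>' = cls ?A x'"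
      then obtain x x' where "x - z \<in> RI ?B" "olsh n x x'" "\<rho>' = cls ?A x'"
        by (metis cls_eq_iff)
      then show "\<rho>' = cls ?A z'" using olsh_unique [OF _ that(1)] by (simp add: cls_eq_iff)
    qed
    ultimately show ?thesis by (simp add: f_def)
  qed
  have cases: "\<exists>z z'. \<rho> = cls ?B z \<and> olsh n z z' \<and> central (n + 1) z" if "\<rho> \<in> zeta (n + 1)" for \<rho>
    using zeta_cases [OF that] olsh_exists by metis
  have H: "f (H_gen (n + 1) k) = H_gen n k" for k
    unfolding H_gen_capelli by (rule f [OF capelli_olsh capelli_central_Suc])
  have scal: "f (cls ?B (scalar c)) = cls ?A (scalar c)" for c
    by (rule f [OF olsh_scalar central_scalar])
  have hom: "f \<in> ring_hom (zeta_ring (n + 1)) (zeta_ring n)"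
  proof (rule ring_hom_memI)
    fix x assume "x \<in> carrier (zeta_ring (n + 1))"
    then obtain u u' where u: "x = cls ?B u" "olsh n u u'" "central (n + 1) u"
      using cases [of x] unfolding zeta_ring_simps by blast
    have "u' \<in> fcar ?A" using u(2) by (simp add: olsh_def)
    then show "f x \<in> carrier (zeta_ring n)"
      using zeta_cls_iff [of u' n] olsh_central [OF u(2,3)]
      by (simp only: u(1) f [OF u(2,3)] zeta_ring_simps)
    fix y assume "y \<in> carrier (zeta_ring (n + 1))"
    then obtain v v' where v: "y = cls ?B v" "olsh n v v'" "central (n + 1) v"
      using cases [of y] unfolding zeta_ring_simps by blast
    have c: "u \<in> fcar ?B" "v \<in> fcar ?B" "u' \<in> fcar ?A" "v' \<in> fcar ?A"
      using u v by (auto simp: olsh_def)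
    show "f (x \<otimes>\<^bsub>zeta_ring (n + 1)\<^esub> y) = f x \<otimes>\<^bsub>zeta_ring n\<^esub> f y"
      using f [OF olsh_mult [OF u(2) v(2)] central_mult [OF u(3) v(3)]] f [OF u(2,3)] f [OF v(2,3)] c
      by (simp only: zeta_ring_simps u(1) v(1) UE_simps)
    show "f (x \<oplus>\<^bsub>zeta_ring (n + 1)\<^esub> y) = f x \<oplus>\<^bsub>zeta_ring n\<^esub> f y"
      using f [OF olsh_add [OF u(2) v(2)] central_add [OF u(3) v(3)]] f [OF u(2,3)] f [OF v(2,3)] c
      by (simp only: zeta_ring_simps u(1) v(1) UE_simps)
  next
    show "f \<one>\<^bsub>zeta_ring (n + 1)\<^esub> = \<one>\<^bsub>zeta_ring n\<^esub>"
      using scal [of 1] by (simp add: zeta_ring_simps UE_simps)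
  qed
  have "capelli_proj n = f"
    unfolding capelli_proj_def
  proof (rule the_equality)
    \<comment> \<open>There is no set of \<open>n + 1\<close> indices among
      \<open>1, ..., n\<close>, so the sum for gl(n) is empty.\<close>
    have "f (H_gen (n + 1) (n + 1)) = \<zero>\<^bsub>Ugl n\<^esub>"
      unfolding H by (simp add: H_gen_capelli capelli_eq_0 UE_simps)
    then show "f \<in> extensional (zeta (n + 1)) \<and> f \<in> ring_hom (zeta_ring (n + 1)) (zeta_ring n) \<and>
     (\<forall>c. f (cls ?B (scalar c)) = cls ?A (scalar c)) \<and>
     (\<forall>k\<in>{1..n}. f (H_gen (n + 1) k) = H_gen n k) \<and>
     f (H_gen (n + 1) (n + 1)) = \<zero>\<^bsub>Ugl n\<^esub>"
      using hom scal H by (simp add: extensional_def f_def)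
  next
    fix g assume g: "g \<in> extensional (zeta (n + 1)) \<and> g \<in> ring_hom (zeta_ring (n + 1)) (zeta_ring n) \<and>
     (\<forall>c. g (cls ?B (scalar c)) = cls ?A (scalar c)) \<and>
     (\<forall>k\<in>{1..n}. g (H_gen (n + 1) k) = H_gen n k) \<and>
     g (H_gen (n + 1) (n + 1)) = \<zero>\<^bsub>Ugl n\<^esub>"
    then have ghom: "g \<in> ring_hom (zeta_ring (n + 1)) (zeta_ring n)" by blast
    have "g (cls ?B y) = f (cls ?B y)" if "y \<in> capelli_alg (n + 1)" for y
      using that
    proof (induction rule: capelli_alg.induct)
      case (scalar c)
      then show ?case using g scal by simp
    next
      case (capelli k)
      have "g (H_gen (n + 1) k) = f (H_gen (n + 1) k)"
      proof (cases "k = n + 1")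
        case True
        then show ?thesis using g unfolding H by (simp add: H_gen_capelli capelli_eq_0 UE_simps)
      next
        case False
        then show ?thesis using g capelli unfolding H by simp
      qed
      then show ?case by (simp only: H_gen_capelli)
    next
      case (add x y)
      then have c: "central (n + 1) x" "central (n + 1) y" by (auto intro: capelli_alg_central)
      note car = central_carrier [OF c(1)] central_carrier [OF c(2)]
      have z: "cls ?B x \<in> carrier (zeta_ring (n + 1))" "cls ?B y \<in> carrier (zeta_ring (n + 1))"
        using c zeta_cls_iff car by (simp_all add: zeta_ring_simps)
      have "cls ?B (x + y) = cls ?B x \<oplus>\<^bsub>zeta_ring (n + 1)\<^esub> cls ?B y"
        using car by (simp only: zeta_ring_simps UE_simps)
      then show ?case
        using ring_hom_add [OF ghom z] ring_hom_add [OF hom z] add by simp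
    next
      case (mult x y)
      then have c: "central (n + 1) x" "central (n + 1) y" by (auto intro: capelli_alg_central)
      note car = central_carrier [OF c(1)] central_carrier [OF c(2)]
      have z: "cls ?B x \<in> carrier (zeta_ring (n + 1))" "cls ?B y \<in> carrier (zeta_ring (n + 1))"
        using c zeta_cls_iff car by (simp_all add: zeta_ring_simps)
      have "cls ?B (x * y) = cls ?B x \<otimes>\<^bsub>zeta_ring (n + 1)\<^esub> cls ?B y"
        using car by (simp only: zeta_ring_simps UE_simps)
      then show ?case
        using ring_hom_mult [OF ghom z] ring_hom_mult [OF hom z] mult by simp
    qed
    note agree = this
    show "g = f"
    proof
      fix \<rho>
      show "g \<rho> = f \<rho>"
      proof (cases "\<rho> \<in> zeta (n + 1)")
        case True
        then obtain z where z: "central (n + 1) z" "\<rho> = cls ?B z" using zeta_cases by blast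
        then obtain y where "y \<in> capelli_alg (n + 1)" "z - y \<in> RI ?B" using center_generated by blast
        then show ?thesis using agree z(2) by (metis cls_eq_iff)
      next
        case False
        then show ?thesis using g by (simp add: extensional_def f_def)
      qed
    qed
  qed
  then show ?thesis using f [OF assms] by simp
qed

section \<open>The four families of central elements\<close>

lemma devirt_representative:
  assumes "set w \<subseteq> syms m0 m1 n \<times> syms m0 m1 n" "balanced w"
  shows "\<exists>u. u \<in> fcar (proper_syms n) \<and> monomial w - u \<in> JI (syms m0 m1 n)"
proof (rule straighten [of "syms m0 m1 n" n w])
  show "a \<in> proper_syms n" if "a \<in> syms m0 m1 n" "\<not> virtual a" for a
    using that by (rule syms_cases)
  show "\<exists>u. u \<in> fcar (proper_syms n) \<and> monomial w - u \<in> JI (syms m0 m1 n)"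
    if "u \<in> fcar (proper_syms n)" "monomial w - u \<in> JI (syms m0 m1 n)" for u
    using that by blast
qed (rule assms)+

text \<open>Choosing a representative for each projected word turns the sum in the enveloping
  algebra into one congruence in the free algebra, to which the results on
  \<open>virtual_sum\<close> apply.\<close>

lemma weighted_devirt_sum:
  assumes "finite S"
    and "\<And>T. T \<in> S \<Longrightarrow> set (W T) \<subseteq> syms m0 m1 n \<times> syms m0 m1 n" "\<And>T. T \<in> S \<Longrightarrow> balanced (W T)"
  obtains u where "u \<in> fcar (proper_syms n)"
    "(\<Sum>T\<in>S. scalar (c T) * monomial (W T)) - u \<in> JI (syms m0 m1 n)"
    "finsum (Ugl n) (\<lambda>T. smult_gl n (c T) (devirt_mon m0 m1 n (W T))) S = cls (proper_syms n) u"
proof -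
  let ?A = "syms m0 m1 n"
  have "\<exists>u. u \<in> fcar (proper_syms n) \<and> monomial (W T) - u \<in> JI ?A" if "T \<in> S" for T
    using devirt_representative assms(2,3) [OF that] by blast
  then obtain v where v: "\<And>T. T \<in> S \<Longrightarrow> v T \<in> fcar (proper_syms n)"
    "\<And>T. T \<in> S \<Longrightarrow> monomial (W T) - v T \<in> JI ?A"
    by metis
  have "finsum (Ugl n) (\<lambda>T. smult_gl n (c T) (devirt_mon m0 m1 n (W T))) S
    = cls (proper_syms n) (\<Sum>T\<in>S. scalar (c T) * v T)"
  proof (rule UE_finsum [OF assms(1)])
    fix T assume T: "T \<in> S"
    show "scalar (c T) * v T \<in> fcar (proper_syms n)" using v(1) [OF T] by (intro fcar_mult) simp_all
    show "smult_gl n (c T) (devirt_mon m0 m1 n (W T)) = cls (proper_syms n) (scalar (c T) * v T)"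
      unfolding smult_gl_def devirt_mon_eq [OF assms(2) v, OF T T T]
      using v(1) [OF T] by (simp add: UE_simps)
  qed
  moreover have "(\<Sum>T\<in>S. scalar (c T) * v T) \<in> fcar (proper_syms n)"
    using v(1) by (intro fcar_sum fcar_mult) simp_all
  moreover have "(\<Sum>T\<in>S. scalar (c T) * (monomial (W T) - v T)) \<in> JI ?A"
    using v(2) by (intro LG_sum LG_lmult) simp_all
  then have "(\<Sum>T\<in>S. scalar (c T) * monomial (W T)) - (\<Sum>T\<in>S. scalar (c T) * v T) \<in> JI ?A"
    by (simp add: right_diff_distrib sum_subtractf)
  ultimately show ?thesis using that by blast
qed

lemma devirt_sum:
  assumes "finite S"
    and "\<And>T. T \<in> S \<Longrightarrow> set (W T) \<subseteq> syms m0 m1 n \<times> syms m0 m1 n" "\<And>T. T \<in> S \<Longrightarrow> balanced (W T)"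
  obtains u where "u \<in> fcar (proper_syms n)"
    "(\<Sum>T\<in>S. monomial (W T)) - u \<in> JI (syms m0 m1 n)"
    "finsum (Ugl n) (\<lambda>T. devirt_mon m0 m1 n (W T)) S = cls (proper_syms n) u"
proof -
  obtain u where u: "u \<in> fcar (proper_syms n)" "(\<Sum>T\<in>S. scalar 1 * monomial (W T)) - u \<in> JI (syms m0 m1 n)"
    "finsum (Ugl n) (\<lambda>T. smult_gl n 1 (devirt_mon m0 m1 n (W T))) S = cls (proper_syms n) u"
    using weighted_devirt_sum [OF assms, where c = "\<lambda>_. 1"] .
  have car: "devirt_mon m0 m1 n (W T) \<in> carrier (Ugl n)" if T: "T \<in> S" for T
  proof -
    obtain v where "v \<in> fcar (proper_syms n)" "monomial (W T) - v \<in> JI (syms m0 m1 n)"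
      using devirt_representative assms(2,3) [OF T] by blast
    then show ?thesis using devirt_mon_eq [OF assms(2) [OF T]] by (simp add: UE_simps)
  qed
  have "smult_gl n 1 (devirt_mon m0 m1 n (W T)) = devirt_mon m0 m1 n (W T)" if "T \<in> S" for T
    using UE.l_one [OF car [OF that]] by (simp add: smult_gl_def UE_simps)
  then have "finsum (Ugl n) (\<lambda>T. smult_gl n 1 (devirt_mon m0 m1 n (W T))) S
      = finsum (Ugl n) (\<lambda>T. devirt_mon m0 m1 n (W T)) S"
    using car by (intro UE.finsum_cong') auto
  with u that show ?thesis by simp
qed

lemma zip_Proper:
  "zip (map Proper s) vs = left_word (zip s vs)" "zip vs (map Proper s) = right_word (zip s vs)"
  by (auto simp: left_word_def right_word_def zip_map1 zip_map2 zip_commute [of s vs] comp_def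
      intro!: map_cong)

lemma tab_word_proper:
  "tab_word (proper_tab S) T = left_word (zip (concat S) (concat T))"
  "tab_word T (proper_tab S) = right_word (zip (concat S) (concat T))"
  by (simp_all add: tab_word_def proper_tab_def zip_Proper flip: map_concat)

definition row_alphas :: "nat list \<Rightarrow> gsym list" where
  "row_alphas lam = map (\<lambda>i. Alpha (Suc i)) [0..<length lam]"

definition row_betas :: "'a list \<Rightarrow> gsym list" where
  "row_betas lam = map (\<lambda>i. Beta (Suc i)) [0..<length lam]"

lemma concat_C_star: "concat (C_star lam) = row_syms lam (row_alphas lam)"
  unfolding row_syms_def C_star_def row_alphas_def
  by (intro arg_cong [where f = concat] nth_equalityI) auto

lemma virtual_word_balanced_cells:
  assumes "z \<in> virtual_cells A" "set X \<subseteq> A \<times> A" "balanced X"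
  shows "set (virtual_word X z) \<subseteq> A \<times> A" "balanced (virtual_word X z)"
  using virtual_cells_words [OF assms(1)] assms(2) balanced_virtual_word [OF assms(3)]
  by (auto simp: virtual_word_def)

lemma tab_cells_virtual:
  assumes "T \<in> tableaux n lam" "length vs = length lam" "set vs \<subseteq> A \<inter> Collect virtual" "proper_syms n \<subseteq> A"
  shows "tab_cells T vs \<in> virtual_cells A"
proof -
  have "concat T \<in> fillings n (sum_list lam)"
    using assms(1) bij_betw_concat [of n lam] by (auto simp: bij_betw_def)
  then have "zip (concat T) (row_syms lam vs) \<in> virtual_cells A"
    using assms(3,4) set_row_syms [of lam vs] by (intro zip_virtual_cells) (auto simp: fillings_def)
  then show ?thesis using assms(1,2) by (simp add: tableaux_def zip_concat_row_syms)
qed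

lemma row_strict_tableaux_subset: "row_strict_tableaux n lam \<subseteq> tableaux n lam"
  by (auto simp: row_strict_tableaux_def tableaux_def shape_def)

lemma finite_row_strict_tableaux: "finite (row_strict_tableaux n lam)"
  using row_strict_tableaux_subset by (rule finite_subset) simp

lemma finite_row_weak_tableaux: "finite (row_weak_tableaux n lam)"
  by (simp add: row_weak_tableaux_def)

lemma row_alphas_props:
  assumes "length lam \<le> m0"
  shows "set (row_alphas lam) \<subseteq> syms m0 m1 n \<inter> Collect virtual" "length (row_alphas lam) = length lam"
    "v \<in> set (row_alphas lam) \<Longrightarrow> parity v = 0"
  using assms by (auto simp: row_alphas_def syms_def)

lemma row_betas_props:
  assumes "length lam \<le> m1"
  shows "set (row_betas lam) \<subseteq> syms m0 m1 n \<inter> Collect virtual" "length (row_betas lam) = length lam"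
  using assms by (auto simp: row_betas_def syms_def)

lemma strict_tableaux_representative:
  assumes lam: "length lam \<le> m0"
    and X: "set X \<subseteq> syms m0 m1 n \<times> syms m0 m1 n" "balanced X"
    and W: "\<And>T. T \<in> row_strict_tableaux n lam \<Longrightarrow> W T = virtual_word X (tab_cells T (row_alphas lam))"
  obtains u where "u \<in> fcar (proper_syms n)"
    "scalar (1 / (\<Prod>l\<leftarrow>lam. fact l)) * virtual_sum n X (row_syms lam (row_alphas lam)) - u \<in> JI (syms m0 m1 n)"
    "finsum (Ugl n) (\<lambda>T. devirt_mon m0 m1 n (W T)) (row_strict_tableaux n lam) = cls (proper_syms n) u"
proof -
  let ?A = "syms m0 m1 n"
  have cells: "tab_cells T (row_alphas lam) \<in> virtual_cells ?A" if "T \<in> row_strict_tableaux n lam" for T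
    using that row_strict_tableaux_subset row_alphas_props [OF lam]
    by (intro tab_cells_virtual [OF _ _ _ proper_syms_subset_syms]) auto
  obtain u where u: "u \<in> fcar (proper_syms n)" "(\<Sum>T\<in>row_strict_tableaux n lam. monomial (W T)) - u \<in> JI ?A"
    "finsum (Ugl n) (\<lambda>T. devirt_mon m0 m1 n (W T)) (row_strict_tableaux n lam) = cls (proper_syms n) u"
    by (rule devirt_sum [OF finite_row_strict_tableaux, of n lam W m0 m1 n])
      (use W virtual_word_balanced_cells [OF cells X] in auto)
  have "scalar (1 / (\<Prod>l\<leftarrow>lam. fact l)) * virtual_sum n X (row_syms lam (row_alphas lam))
    - (\<Sum>T\<in>row_strict_tableaux n lam. monomial (W T)) \<in> RI ?A"
    using virtual_sum_strict [OF row_alphas_props(2,1) [OF lam] proper_syms_subset_syms X(1) row_alphas_props(3) [OF lam]] W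
    by simp
  from LG_add [OF LG_rel [OF this] u(2)] u that show ?thesis by simp
qed

section \<open>Transposition of tableaux\<close>

lemma transpose_nth_column: "j < length (List.transpose S) \<Longrightarrow> List.transpose S ! j = column S j"
  by (simp add: nth_transpose column_def)

lemma map_length_transpose:
  assumes "sorted (rev (map length S))"
  shows "map length (List.transpose S) = conj_part (map length S)"
proof (rule nth_equalityI)
  show "length (map length (List.transpose S)) = length (conj_part (map length S))"
    using length_transpose_sorted [OF assms] by (cases S) (auto simp: conj_part_def first_part_def)
next
  fix j assume "j < length (map length (List.transpose S))"
  then have j: "j < length (List.transpose S)" by simp
  moreover have "j < first_part (map length S)"
    using j length_transpose_sorted [OF assms] by (cases S) (auto simp: first_part_def)
  ultimately show "map length (List.transpose S) ! j = conj_part (map length S) ! j"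
    by (simp add: transpose_nth_column column_def conj_part_def filter_map comp_def)
qed

lemma transpose_transpose_partition:
  assumes "is_partition (map length S)" shows "List.transpose (List.transpose S) = S"
proof -
  have "sorted (rev (map length S))"
    using assms by (simp add: is_partition_def sorted_wrt_rev)
  then have "List.transpose (List.transpose S) = takeWhile (\<lambda>x. x \<noteq> []) S" by (rule transpose_transpose)
  also have "\<dots> = S" using assms by (auto simp: is_partition_def takeWhile_eq_all_conv)
  finally show ?thesis .
qed

lemma conj_part_props:
  assumes "is_partition lam"
  shows "conj_part (conj_part lam) = lam" "is_partition (conj_part lam)"
    "first_part (conj_part lam) = length lam"
proof -
  \<comment> \<open>A list of lists with row lengths \<open>lam\<close> and trivial entries, so that
    facts on conjugate partitions follow from transposing lists.\<close>
  define R where "R = map (\<lambda>l. replicate l ()) lam"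
  have lam: "map length R = lam" by (simp add: R_def comp_def)
  have part: "is_partition (map length R)" using assms lam by simp
  then have sorted: "sorted (rev (map length R))" by (simp add: is_partition_def sorted_wrt_rev)
  have conj: "conj_part lam = map length (List.transpose R)"
    using map_length_transpose [OF sorted] by (simp add: lam)
  show "conj_part (conj_part lam) = lam"
    unfolding conj using map_length_transpose [of "List.transpose R"] transpose_transpose_partition [OF part]
    by (simp add: lam)
  have pos: "0 \<notin> set (conj_part lam)"
  proof
    assume "0 \<in> set (conj_part lam)"
    then obtain j where "j < first_part lam" "filter (\<lambda>l. j < l) lam = []"
      by (auto simp: conj_part_def)
    then show False by (cases lam) (auto simp: first_part_def split: if_splits)
  qed
  moreover have "sorted (rev (map length (List.transpose R)))" by simp
  then have "sorted_wrt (\<ge>) (conj_part lam)"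
    unfolding conj by (simp only: sorted_wrt_rev)
  ultimately show "is_partition (conj_part lam)" by (simp add: is_partition_def)
  show "first_part (conj_part lam) = length lam"
  proof (cases lam)
    case (Cons l lam')
    have "filter (\<lambda>l. 0 < l) lam = lam"
      using assms by (intro filter_True) (auto simp: is_partition_def intro: gr0I)
    moreover have "l > 0" using assms Cons by (auto simp: is_partition_def)
    ultimately show ?thesis using Cons by (simp add: first_part_def conj_part_def upt_conv_Cons)
  qed (simp add: first_part_def conj_part_def)
qed

lemma transpose_tableaux:
  assumes lam: "is_partition lam" and S: "S \<in> tableaux n lam"
  shows "List.transpose S \<in> tableaux n (conj_part lam)" "List.transpose (List.transpose S) = S"
    "length (List.transpose S) = first_part lam"
proof -
  have shape: "map length S = lam" and entries: "\<And>r. r \<in> set S \<Longrightarrow> set r \<subseteq> {1..n}"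
    using S by (auto simp: tableaux_def)
  have "sorted (rev (map length S))" using lam shape by (simp add: is_partition_def sorted_wrt_rev)
  then have l: "map length (List.transpose S) = conj_part lam" using map_length_transpose shape by metis
  then show "length (List.transpose S) = first_part lam"
    by (metis conj_part_def diff_zero length_map length_upt)
  have "set c \<subseteq> {1..n}" if c: "c \<in> set (List.transpose S)" for c
  proof -
    obtain j where j: "j < length (List.transpose S)" "c = List.transpose S ! j" using c by (metis in_set_conv_nth)
    then have "c = column S j" by (simp add: transpose_nth_column)
    show ?thesis
    proof
      fix x assume "x \<in> set c"
      then obtain r where "r \<in> set S" "j < length r" "x = r ! j"
        by (auto simp: \<open>c = column S j\<close> column_def)
      then show "x \<in> {1..n}" using entries [of r] nth_mem by blast
    qed
  qed
  with l show "List.transpose S \<in> tableaux n (conj_part lam)" by (auto simp: tableaux_def)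
  show "List.transpose (List.transpose S) = S"
    using transpose_transpose_partition [of S] lam shape by simp
qed

lemma bij_transpose_weak:
  assumes lam: "is_partition lam"
  shows "S \<in> col_weak_tableaux n (conj_part lam) \<Longrightarrow> List.transpose S \<in> row_weak_tableaux n lam"
    "T \<in> row_weak_tableaux n lam \<Longrightarrow> List.transpose T \<in> col_weak_tableaux n (conj_part lam)"
    "S \<in> col_weak_tableaux n (conj_part lam) \<Longrightarrow> S \<in> tableaux n (conj_part lam)"
proof -
  note conj = conj_part_props [OF lam]
  show sub: "S \<in> tableaux n (conj_part lam)" if "S \<in> col_weak_tableaux n (conj_part lam)" for S
    using that by (simp add: col_weak_tableaux_def tableaux_def shape_def)
  show "List.transpose S \<in> row_weak_tableaux n lam" if S: "S \<in> col_weak_tableaux n (conj_part lam)"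
  proof -
    note tr = transpose_tableaux [OF conj(2) sub [OF S]]
    have "sorted r" if r: "r \<in> set (List.transpose S)" for r
    proof -
      obtain j where "j < length (List.transpose S)" "r = List.transpose S ! j" using r by (metis in_set_conv_nth)
      then have "r = column S j" "j < first_part (conj_part lam)"
        using tr(3) by (simp_all add: transpose_nth_column)
      then show ?thesis using S by (simp add: col_weak_tableaux_def)
    qed
    with tr(1) show ?thesis by (simp add: row_weak_tableaux_def conj(1))
  qed
  show "List.transpose T \<in> col_weak_tableaux n (conj_part lam)" if T: "T \<in> row_weak_tableaux n lam"
  proof -
    have T': "T \<in> tableaux n lam" "\<And>r. r \<in> set T \<Longrightarrow> sorted r" using T by (auto simp: row_weak_tableaux_def)
    note tr = transpose_tableaux [OF lam T'(1)]
    have "sorted_wrt (\<le>) (column (List.transpose T) j)" if "j < first_part (conj_part lam)" for j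
    proof -
      have "length T = length lam" using T'(1) by (auto simp: tableaux_def)
      then have j: "j < length T" using that conj(3) by simp
      then have "T ! j = column (List.transpose T) j"
        using transpose_nth_column [of j "List.transpose T"] tr(2) by simp
      then show ?thesis using T'(2) [OF nth_mem [OF j]] by simp
    qed
    with tr(1) show ?thesis by (auto simp: col_weak_tableaux_def tableaux_def shape_def)
  qed
qed

lemma sum_list_sum_swap:
  "(\<Sum>r\<leftarrow>S. \<Sum>j\<in>I. f r j) = (\<Sum>j\<in>I. \<Sum>r\<leftarrow>S. f r j)" for f :: "'a \<Rightarrow> 'b \<Rightarrow> 'c::comm_monoid_add"
  by (induction S) (auto simp: sum.distrib)

lemma mset_as_sum: "mset xs = (\<Sum>j<length xs. {#xs ! j#})"
proof (induction xs)
  case (Cons x xs)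
  then show ?case by (simp add: sum.lessThan_Suc_shift del: sum.lessThan_Suc)
qed simp

text \<open>Column \<open>j\<close> of \<open>D_star\<close> carries the symbol that labels row \<open>j\<close> of the transposed tableau.\<close>

lemma mset_column_cells:
  assumes "\<And>r. r \<in> set S \<Longrightarrow> length r \<le> length (List.transpose S)"
  shows "mset (zip (concat S) (concat (D_star (map length S))))
    = mset (tab_cells (List.transpose S) (row_betas (List.transpose S)))"
proof -
  let ?L = "length (List.transpose S)"
  have "zip (concat S) (concat (D_star (map length S))) = concat (map (\<lambda>r. zip r (map Beta [1..<length r+1])) S)"
    by (induction S) (simp_all add: D_star_def zip_append del: upt_Suc)
  then have "mset (zip (concat S) (concat (D_star (map length S)))) = (\<Sum>r\<leftarrow>S. mset (zip r (map Beta [1..<length r+1])))"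
    by (simp add: mset_concat comp_def del: upt_Suc)
  also have "\<dots> = (\<Sum>r\<leftarrow>S. \<Sum>j<?L. if j < length r then {#(r ! j, Beta (Suc j))#} else {#})"
  proof (intro arg_cong [where f = sum_list] map_cong refl)
    fix r assume r: "r \<in> set S"
    have "mset (zip r (map Beta [1..<length r+1])) = (\<Sum>j<length r. {#(r ! j, Beta (Suc j))#})"
      unfolding mset_as_sum [of "zip _ _"] by (intro sum.cong) (simp_all del: upt_Suc)
    also have "\<dots> = (\<Sum>j<?L. if j < length r then {#(r ! j, Beta (Suc j))#} else {#})"
      using assms [OF r] by (intro sum.mono_neutral_cong_left) auto
    finally show "mset (zip r (map Beta [1..<length r+1])) = (\<Sum>j<?L. if j < length r then {#(r ! j, Beta (Suc j))#} else {#})" .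
  qed
  also have "\<dots> = (\<Sum>j<?L. \<Sum>r\<leftarrow>S. if j < length r then {#(r ! j, Beta (Suc j))#} else {#})"
    by (rule sum_list_sum_swap)
  also have "\<dots> = (\<Sum>j<?L. mset (map (\<lambda>s. (s, Beta (Suc j))) (List.transpose S ! j)))"
  proof (rule sum.cong [OF refl])
    fix j assume "j \<in> {..<?L}"
    then have "List.transpose S ! j = column S j" by (simp add: transpose_nth_column)
    moreover have "(\<Sum>r\<leftarrow>S. if j < length r then {#(r ! j, Beta (Suc j))#} else {#})
        = mset (map (\<lambda>s. (s, Beta (Suc j))) (column S j))" for S :: "nat list list"
      by (induction S) (simp_all add: column_def)
    ultimately show "(\<Sum>r\<leftarrow>S. if j < length r then {#(r ! j, Beta (Suc j))#} else {#})
        = mset (map (\<lambda>s. (s, Beta (Suc j))) (List.transpose S ! j))" by simp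
  qed
  also have "\<dots> = mset (tab_cells (List.transpose S) (row_betas (List.transpose S)))"
  proof -
    have "mset (concat xs) = (\<Sum>j<length xs. mset (xs ! j))" for xs :: "(nat \<times> gsym) list list"
    proof (induction xs)
      case (Cons x xs)
      then show ?case by (simp add: sum.lessThan_Suc_shift del: sum.lessThan_Suc)
    qed simp
    then show ?thesis by (simp add: tab_cells_def row_betas_def)
  qed
  finally show ?thesis .
qed

section \<open>Representatives of the four families\<close>

text \<open>The families \<open>I_elem\<close> and \<open>J_elem\<close> index their sums
  differently; \<open>t\<close> translates their index sets to row-weak tableaux. It is
  transposition for \<open>J_elem\<close> and, for \<open>I_elem\<close>, the row in which
  \<open>i\<close> occurs \<open>h i\<close> times.\<close>

lemma weak_tableaux_representative:
  assumes vs: "length vs = length lam" "set vs \<subseteq> syms m0 m1 n \<inter> Collect virtual"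
    and fin: "finite S" and bij: "bij_betw t S (row_weak_tableaux n lam)"
    and W: "\<And>s. s \<in> S \<Longrightarrow> set (W s) \<subseteq> syms m0 m1 n \<times> syms m0 m1 n" "\<And>s. s \<in> S \<Longrightarrow> balanced (W s)"
      "\<And>s. s \<in> S \<Longrightarrow> monomial (W s) - monomial (virtual_word [] (tab_cells (t s) vs)) \<in> RI (syms m0 m1 n)"
    and c: "\<And>s. s \<in> S \<Longrightarrow> c s = 1 / of_nat (row_mult_fact n (t s))"
  obtains u where "u \<in> fcar (proper_syms n)"
    "scalar (1 / (\<Prod>l\<leftarrow>lam. fact l)) * virtual_sum n [] (row_syms lam vs) - u \<in> JI (syms m0 m1 n)"
    "finsum (Ugl n) (\<lambda>s. smult_gl n (c s) (devirt_mon m0 m1 n (W s))) S = cls (proper_syms n) u"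
proof -
  let ?A = "syms m0 m1 n"
  obtain u where u: "u \<in> fcar (proper_syms n)" "(\<Sum>s\<in>S. scalar (c s) * monomial (W s)) - u \<in> JI ?A"
    "finsum (Ugl n) (\<lambda>s. smult_gl n (c s) (devirt_mon m0 m1 n (W s))) S = cls (proper_syms n) u"
    using weighted_devirt_sum [OF fin W(1,2)] .
  have 1: "scalar (1 / (\<Prod>l\<leftarrow>lam. fact l)) * virtual_sum n [] (row_syms lam vs)
    - (\<Sum>T\<in>row_weak_tableaux n lam. scalar (1 / of_nat (row_mult_fact n T))
        * monomial (virtual_word [] (tab_cells T vs))) \<in> RI ?A"
    by (rule virtual_sum_weak [OF vs proper_syms_subset_syms]) simp
  have sum_eq: "(\<Sum>T\<in>row_weak_tableaux n lam. scalar (1 / of_nat (row_mult_fact n T)) * monomial (virtual_word [] (tab_cells T vs)))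
    = (\<Sum>s\<in>S. scalar (c s) * monomial (virtual_word [] (tab_cells (t s) vs)))"
    using sum.reindex_bij_betw [OF bij, of "\<lambda>T. scalar (1 / of_nat (row_mult_fact n T)) * monomial (virtual_word [] (tab_cells T vs))"] c
    by simp
  have 2: "(\<Sum>s\<in>S. scalar (c s) * (monomial (W s) - monomial (virtual_word [] (tab_cells (t s) vs)))) \<in> RI ?A"
    using W(3) by (intro rel_ideal_sum rel_ideal_lmult) simp_all
  have "scalar (1 / (\<Prod>l\<leftarrow>lam. fact l)) * virtual_sum n [] (row_syms lam vs)
    - (\<Sum>s\<in>S. scalar (c s) * monomial (W s)) \<in> RI ?A"
    using rel_ideal_diff [OF 1 2] by (simp add: sum_eq right_diff_distrib sum_subtractf)
  from LG_add [OF LG_rel [OF this] u(2)] u that show ?thesis by simp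
qed

text \<open>Transposition turns weakly increasing columns of the conjugate shape into weakly
  increasing rows of shape \<open>lam\<close>, with one odd symbol for each row; this is why
  \<open>length lam\<close> such symbols are required.\<close>

lemma J_elem_representative:
  assumes lam: "is_partition lam" "length lam \<le> m1"
  obtains u where "u \<in> fcar (proper_syms n)"
    "scalar (1 / (\<Prod>l\<leftarrow>lam. fact l)) * virtual_sum n [] (row_syms lam (row_betas lam)) - u \<in> JI (syms m0 m1 n)"
    "J_elem m0 m1 n lam = cls (proper_syms n) u"
proof -
  let ?A = "syms m0 m1 n" and ?S = "col_weak_tableaux n (conj_part lam)" and ?D = "D_star (conj_part lam)"
  let ?W = "\<lambda>S. tab_word (proper_tab S) ?D @ tab_word ?D (proper_tab S)"
  note conj = conj_part_props [OF lam(1)] and bij = bij_transpose_weak [OF lam(1)]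
  have cells: "tab_cells (List.transpose S) (row_betas lam) \<in> virtual_cells ?A"
    "mset (zip (concat S) (concat ?D)) = mset (tab_cells (List.transpose S) (row_betas lam))"
    if S: "S \<in> ?S" for S
  proof -
    have T: "List.transpose S \<in> row_weak_tableaux n lam" using bij(1) [OF S] .
    then have T': "List.transpose S \<in> tableaux n lam" by (simp add: row_weak_tableaux_def)
    then show "tab_cells (List.transpose S) (row_betas lam) \<in> virtual_cells ?A"
      using row_betas_props [OF lam(2)] by (intro tab_cells_virtual [OF _ _ _ proper_syms_subset_syms]) auto
    have len: "length (List.transpose S) = length lam" using T' by (auto simp: tableaux_def)
    have shape: "map length S = conj_part lam" using bij(3) [OF S] by (simp add: tableaux_def)
    have "length r \<le> length (List.transpose S)" if "r \<in> set S" for r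
    proof -
      have "length r \<in> set (conj_part lam)" using that by (simp flip: shape)
      then show ?thesis unfolding len by (auto simp: conj_part_def)
    qed
    from mset_column_cells [OF this] show "mset (zip (concat S) (concat ?D)) = mset (tab_cells (List.transpose S) (row_betas lam))"
      using len by (simp add: shape row_betas_def)
  qed
  have W: "?W S = virtual_word [] (zip (concat S) (concat ?D))" for S
    by (simp add: tab_word_proper virtual_word_def)
  have z: "zip (concat S) (concat ?D) \<in> virtual_cells ?A" if "S \<in> ?S" for S
    using cells [OF that] mset_eq_setD [OF cells(2) [OF that]] by (simp only: virtual_cells_def mem_Collect_eq)
  have bb: "bij_betw List.transpose ?S (row_weak_tableaux n lam)"
  proof (rule bij_betw_byWitness [where f' = List.transpose])
    show "\<forall>S\<in>?S. List.transpose (List.transpose S) = S"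
      using transpose_tableaux(2) [OF conj(2)] bij(3) by blast
    show "\<forall>T\<in>row_weak_tableaux n lam. List.transpose (List.transpose T) = T"
      using transpose_tableaux(2) [OF lam(1)] by (auto simp: row_weak_tableaux_def)
  qed (use bij in auto)
  have weight: "1 / of_nat (col_mult_fact n S) = (1 / of_nat (row_mult_fact n (List.transpose S)) :: complex)" if S: "S \<in> ?S" for S
  proof -
    have "length (List.transpose S) = first_part (shape S)"
      using transpose_tableaux(3) [OF conj(2) bij(3) [OF S]] bij(3) [OF S] by (simp add: tableaux_def shape_def)
    then have "col_mult_fact n S = (\<Prod>j<length (List.transpose S). \<Prod>s=1..n. fact (count_list (List.transpose S ! j) s))"
      unfolding col_mult_fact_def by (simp add: transpose_nth_column)
    also have "\<dots> = row_mult_fact n (List.transpose S)"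
      unfolding row_mult_fact_def prod.list_conv_set_nth by (simp add: atLeast0LessThan)
    finally show ?thesis by simp
  qed
  have fin: "finite ?S" using bij_betw_finite [OF bb] finite_row_weak_tableaux by blast
  obtain u where "u \<in> fcar (proper_syms n)"
    "scalar (1 / (\<Prod>l\<leftarrow>lam. fact l)) * virtual_sum n [] (row_syms lam (row_betas lam)) - u \<in> JI ?A"
    "finsum (Ugl n) (\<lambda>S. smult_gl n (1 / of_nat (col_mult_fact n S)) (devirt_mon m0 m1 n (?W S))) ?S = cls (proper_syms n) u"
  proof (rule weak_tableaux_representative [OF row_betas_props(2,1) [OF lam(2)] fin bb, where W = ?W and c = "\<lambda>S. 1 / of_nat (col_mult_fact n S)"])
    fix S assume S: "S \<in> ?S"
    show "set (?W S) \<subseteq> ?A \<times> ?A" "balanced (?W S)"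
      unfolding W using virtual_word_balanced_cells [OF z [OF S], of "[]"] by (auto simp: balanced_def)
    show "monomial (?W S) - monomial (virtual_word [] (tab_cells (List.transpose S) (row_betas lam))) \<in> RI ?A"
      unfolding W by (rule virtual_word_mset [OF cells(2) [OF S] z [OF S]]) simp
  qed (use weight in auto)
  with that show ?thesis by (simp add: J_elem_def)
qed

lemma sum_list_map_mset_cong: "mset xs = mset ys \<Longrightarrow> (\<Sum>x\<leftarrow>xs. g x) = (\<Sum>x\<leftarrow>ys. g x)"
  for g :: "'a \<Rightarrow> 'b::comm_monoid_add"
  by (subst (1 2) sum_mset_sum_list [symmetric]) simp

lemma I_elem_representative:
  assumes b: "b \<in> {1..m1}"
  obtains u where "u \<in> fcar (proper_syms n)"
    "scalar (1 / fact k) * virtual_sum n [] (replicate k (Beta b)) - u \<in> JI (syms m0 m1 n)"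
    "I_elem m0 m1 b n k = cls (proper_syms n) u"
proof -
  let ?A = "syms m0 m1 n" and ?S = "{h \<in> {1..n} \<rightarrow>\<^sub>E UNIV. (\<Sum>i=1..n. h i) = k}"
  let ?r = "\<lambda>h is. concat (map (\<lambda>i. replicate (h i) i) is)"
  let ?t = "\<lambda>h. [?r h [1..<n+1]]"
  let ?W = "\<lambda>h. concat (map (\<lambda>i. replicate (h i) (Proper i, Beta b)) (rev [1..<n+1])) @
              concat (map (\<lambda>i. replicate (h i) (Beta b, Proper i)) [1..<n+1])"
  let ?z = "\<lambda>h is. map (\<lambda>s. (s, Beta b)) (?r h is)"
  have mset_r: "mset (?r h is) = (\<Sum>i\<leftarrow>is. replicate_mset (h i) i)" for h :: "nat \<Rightarrow> nat" and "is" :: "nat list"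
    by (induction "is") auto
  have mset_rn: "mset (?r h [1..<n+1]) = (\<Sum>i=1..n. replicate_mset (h i) i)" for h :: "nat \<Rightarrow> nat"
    unfolding mset_r by (simp add: sum_list_distinct_conv_sum_set atLeastLessThanSuc_atLeastAtMost del: upt_Suc)
  have count_r: "count_list (?r h [1..<n+1]) i = (if i \<in> {1..n} then h i else 0)" for h :: "nat \<Rightarrow> nat" and i
  proof -
    have "count_list (?r h [1..<n+1]) i = count (\<Sum>j=1..n. replicate_mset (h j) j) i"
      by (simp only: mset_rn flip: count_mset)
    also have "\<dots> = (\<Sum>j=1..n. if j = i then h j else 0)"
      by (simp only: count_sum count_replicate_mset) (intro sum.cong, auto)
    finally show ?thesis by simp
  qed
  have set_r: "set (?r h [1..<n+1]) \<subseteq> {1..n}" for h :: "nat \<Rightarrow> nat"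
    by (auto simp del: upt_Suc)
  have sorted_r: "sorted (?r h is)" if "sorted is" for h :: "nat \<Rightarrow> nat" and "is" :: "nat list"
    using that by (induction "is") (auto simp: sorted_append)
  have length_r: "length (?r h [1..<n+1]) = (\<Sum>i=1..n. h i)" for h :: "nat \<Rightarrow> nat"
    using arg_cong [OF mset_rn, of size h] by simp
  have bb: "bij_betw ?t ?S (row_weak_tableaux n [k])"
  proof (rule bij_betw_byWitness [where f' = "\<lambda>T. restrict (count_list (hd T)) {1..n}"])
    show "\<forall>h\<in>?S. restrict (count_list (hd (?t h))) {1..n} = h"
    proof
      fix h assume "h \<in> ?S"
      then have "h \<in> extensional {1..n}" by (auto simp: PiE_def)
      then show "restrict (count_list (hd (?t h))) {1..n} = h"
        by (intro extensionalityI [of _ "{1..n}"]) (simp_all only: list.sel count_r restrict_apply restrict_extensional if_True)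
    qed
    have T: "\<exists>r. T = [r] \<and> length r = k \<and> set r \<subseteq> {1..n} \<and> sorted r" if "T \<in> row_weak_tableaux n [k]" for T
      using that by (auto simp: row_weak_tableaux_def tableaux_def)
    have roundtrip: "?r (restrict (count_list r) {1..n}) [1..<n+1] = r" if "set r \<subseteq> {1..n}" "sorted r" for r
    proof -
      have "mset (?r (restrict (count_list r) {1..n}) [1..<n+1]) = mset r"
      proof (rule multiset_eqI)
        fix i
        have "i \<notin> {1..n} \<Longrightarrow> count_list r i = 0" using that(1) by (auto simp: count_list_0_iff)
        then show "count (mset (?r (restrict (count_list r) {1..n}) [1..<n+1])) i = count (mset r) i"
          unfolding count_mset count_r by simp
      qed
      then show ?thesis
        using sorted_r [of "[1..<n+1]"] that(2) by (metis properties_for_sort sorted_upt)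
    qed
    show "\<forall>T\<in>row_weak_tableaux n [k]. ?t (restrict (count_list (hd T)) {1..n}) = T"
      using T roundtrip by fastforce
    show "?t ` ?S \<subseteq> row_weak_tableaux n [k]"
      using set_r sorted_r [of "[1..<n+1]"] length_r
      by (auto simp: row_weak_tableaux_def tableaux_def simp del: upt_Suc)
    show "(\<lambda>T. restrict (count_list (hd T)) {1..n}) ` row_weak_tableaux n [k] \<subseteq> ?S"
    proof
      fix h assume "h \<in> (\<lambda>T. restrict (count_list (hd T)) {1..n}) ` row_weak_tableaux n [k]"
      then obtain r where r: "h = restrict (count_list r) {1..n}" "length r = k" "set r \<subseteq> {1..n}" "sorted r"
        using T by fastforce
      have "(\<Sum>i=1..n. h i) = length (?r h [1..<n+1])" by (rule length_r [symmetric])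
      also have "\<dots> = k" using roundtrip [OF r(3,4)] r(1,2) by simp
      finally show "h \<in> ?S" using r(1) by auto
    qed
  qed
  have fin: "finite ?S" using bij_betw_finite [OF bb] finite_row_weak_tableaux by blast
  have t: "tab_cells (?t h) [Beta b] = ?z h [1..<n+1]" for h by (simp add: tab_cells_def)
  have zleft: "concat (map (\<lambda>i. replicate (h i) (Proper i, Beta b)) is) = left_word (?z h is)"
    "concat (map (\<lambda>i. replicate (h i) (Beta b, Proper i)) is) = right_word (?z h is)" for h "is"
    by (induction "is") (simp_all add: left_word_def right_word_def)
  \<comment> \<open>Even virtual symbols may be present in the full alphabet; in this odd one,
    letters commute and \<open>left_word_mset_odd\<close> gives the sign 1.\<close>
  define A0 where "A0 = insert (Beta b) (proper_syms n)"
  have A0: "A0 \<subseteq> odd_syms" "A0 \<subseteq> ?A" "Beta b \<in> A0"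
    using proper_syms_odd [of n] b by (auto simp: A0_def odd_syms_def syms_def)
  have zA: "?z h is \<in> virtual_cells A0" if "set is \<subseteq> {1..n}" for h "is"
    using that by (auto simp: virtual_cells_def A0_def proper_syms_def)
  have zr: "?z h (rev [1..<n+1]) \<in> virtual_cells A0" "?z h [1..<n+1] \<in> virtual_cells A0" for h
    by (intro zA; auto simp del: upt_Suc)+
  \<comment> \<open>Reversing the order in which the symbols \<open>1, ..., n\<close> are listed
    does not change the cells as a multiset.\<close>
  have zmset: "mset (?z h (rev [1..<n+1])) = mset (?z h [1..<n+1])" for h
  proof -
    have "mset (?r h (rev [1..<n+1])) = mset (?r h [1..<n+1])"
      unfolding mset_r by (simp add: rev_map [symmetric] sum_list_rev del: upt_Suc)
    then show ?thesis by (simp only: mset_map)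
  qed
  have W: "?W h = left_word (?z h (rev [1..<n+1])) @ right_word (?z h [1..<n+1])" for h
    by (simp only: zleft)
  obtain u where "u \<in> fcar (proper_syms n)"
    "scalar (1 / (\<Prod>l\<leftarrow>[k]. fact l)) * virtual_sum n [] (row_syms [k] [Beta b]) - u \<in> JI ?A"
    "finsum (Ugl n) (\<lambda>h. smult_gl n (1 / (\<Prod>i=1..n. fact (h i))) (devirt_mon m0 m1 n (?W h))) ?S = cls (proper_syms n) u"
  proof (rule weak_tableaux_representative [OF _ _ fin bb, where vs = "[Beta b]" and W = ?W and c = "\<lambda>h. 1 / (\<Prod>i=1..n. fact (h i))"])
    fix h
    let ?l = "left_word (?z h (rev [1..<n+1]))" and ?l' = "left_word (?z h [1..<n+1])" and ?q = "right_word (?z h [1..<n+1])"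
    have sets: "set ?l \<subseteq> A0 \<times> A0" "set ?q \<subseteq> A0 \<times> A0"
      using virtual_cells_words(1) [OF zr(1)] virtual_cells_words(2) [OF zr(2)] .
    then show "set (?W h) \<subseteq> ?A \<times> ?A" unfolding W using A0(2) by auto
    show "balanced (?W h)"
    proof -
      have "balanced (virtual_word [] (?z h [1..<n+1]))"
        by (rule balanced_virtual_word) (simp add: balanced_def)
      moreover have "(\<Sum>l\<leftarrow>?l. g l) = (\<Sum>l\<leftarrow>?l'. g l)" for g :: "gsym \<times> gsym \<Rightarrow> int"
        by (rule sum_list_map_mset_cong) (use zmset [of h] in \<open>simp only: left_word_def mset_map\<close>)
      ultimately show ?thesis unfolding W by (simp add: balanced_iff virtual_word_def del: upt_Suc)
    qed
    have "(monomial ?l - monomial ?l') * monomial ?q \<in> RI A0"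
      using left_word_mset_odd [OF zmset zr(1) A0(1)] sets(2) by (intro rel_ideal_rmult) auto
    then show "monomial (?W h) - monomial (virtual_word [] (tab_cells (?t h) [Beta b])) \<in> RI ?A"
      unfolding W t using rel_ideal_mono [OF A0(2)]
      by (simp add: virtual_word_def monomial_append left_diff_distrib del: upt_Suc)
    have "row_mult_fact n (?t h) = (\<Prod>i=1..n. fact (h i))"
      unfolding row_mult_fact_def by (simp only: list.map prod_list.Cons prod_list.Nil count_r if_True mult_1_right cong: prod.cong)
    then show "1 / (\<Prod>i=1..n. fact (h i)) = (1 / of_nat (row_mult_fact n (?t h)) :: complex)"
      by (simp only: of_nat_prod of_nat_fact)
  qed (use A0 in auto)
  moreover have "row_syms [k] [Beta b] = replicate k (Beta b)" by (simp add: row_syms_def)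
  ultimately show ?thesis using that by (simp add: I_elem_def)
qed

lemma K_elem_representative:
  assumes "length lam \<le> m0"
  obtains u where "u \<in> fcar (proper_syms n)"
    "scalar (1 / (\<Prod>l\<leftarrow>lam. fact l)) * virtual_sum n [] (row_syms lam (row_alphas lam)) - u \<in> JI (syms m0 m1 n)"
    "K_elem m0 m1 n lam = cls (proper_syms n) u"
proof -
  have "tab_word (proper_tab T) (C_star lam) @ tab_word (C_star lam) (proper_tab T)
      = virtual_word [] (tab_cells T (row_alphas lam))" if "T \<in> row_strict_tableaux n lam" for T
    using that by (simp add: tab_word_proper concat_C_star virtual_word_def row_strict_tableaux_def shape_def
        zip_concat_row_syms row_alphas_props(2) [OF order_refl])
  from strict_tableaux_representative [OF assms _ _ this] that show ?thesis
    by (auto simp: K_elem_def balanced_def)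
qed

text \<open>The middle part of the words of \<open>S_elem\<close>, purely virtual and balanced
  because its second half is the first with the indices of each letter exchanged. It plays the role
  of \<open>X\<close> in \<open>virtual_sum\<close>.\<close>

definition inner_word :: "nat list \<Rightarrow> (gsym \<times> gsym) list" where
  "inner_word lam = tab_word (C_star lam) (D_star lam) @ tab_word (D_star lam) (C_star lam)"

lemma inner_word:
  assumes "is_partition lam" "length lam \<le> m0" "first_part lam \<le> m1"
  shows "set (inner_word lam) \<subseteq> syms m0 m1 n \<times> syms m0 m1 n"
    "\<forall>l\<in>set (inner_word lam). virtual (fst l) \<and> virtual (snd l)" "balanced (inner_word lam)"
proof -
  let ?A = "syms m0 m1 n"
  have C: "set (concat (C_star lam)) \<subseteq> ?A \<inter> Collect virtual"
    using assms(2) by (auto simp: C_star_def syms_def)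
  have le: "l \<le> first_part lam" if "l \<in> set lam" for l
    using that assms(1) by (cases lam) (auto simp: first_part_def is_partition_def)
  have D: "set (concat (D_star lam)) \<subseteq> ?A \<inter> Collect virtual"
    using le assms(3) by (fastforce simp: D_star_def syms_def simp del: upt_Suc)
  have "fst l \<in> ?A \<inter> Collect virtual \<and> snd l \<in> ?A \<inter> Collect virtual" if "l \<in> set (inner_word lam)" for l
  proof -
    have "l \<in> set (tab_word (C_star lam) (D_star lam)) \<or> l \<in> set (tab_word (D_star lam) (C_star lam))"
      using that by (simp add: inner_word_def)
    moreover have "fst l \<in> set xs \<and> snd l \<in> set ys" if "l \<in> set (zip xs ys)" for xs ys
      using that set_zip_leftD set_zip_rightD by (metis prod.collapse)
    ultimately show ?thesis using C D unfolding tab_word_def by blast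
  qed
  then show "set (inner_word lam) \<subseteq> ?A \<times> ?A" "\<forall>l\<in>set (inner_word lam). virtual (fst l) \<and> virtual (snd l)"
    by (auto simp: mem_Times_iff)
  have swap: "tab_word (D_star lam) (C_star lam) = map (\<lambda>(x, y). (y, x)) (tab_word (C_star lam) (D_star lam))"
    unfolding tab_word_def by (rule zip_commute)
  show "balanced (inner_word lam)"
    unfolding balanced_iff inner_word_def swap by (simp add: comp_def case_prod_beta add.commute)
qed

lemma S_elem_representative:
  assumes "is_partition lam" "length lam \<le> m0" "first_part lam \<le> m1"
  obtains u where "u \<in> fcar (proper_syms n)"
    "scalar (1 / of_nat (hook_prod lam) * (1 / (\<Prod>l\<leftarrow>lam. fact l)))
      * virtual_sum n (inner_word lam) (row_syms lam (row_alphas lam)) - u \<in> JI (syms m0 m1 n)"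
    "S_elem m0 m1 n lam = cls (proper_syms n) u"
proof -
  let ?h = "1 / of_nat (hook_prod lam)"
  let ?W = "\<lambda>T. tab_word (proper_tab T) (C_star lam) @ tab_word (C_star lam) (D_star lam) @
      tab_word (D_star lam) (C_star lam) @ tab_word (C_star lam) (proper_tab T)"
  have W: "?W T = virtual_word (inner_word lam) (tab_cells T (row_alphas lam))" if "T \<in> row_strict_tableaux n lam" for T
    using that by (simp add: tab_word_proper concat_C_star virtual_word_def row_strict_tableaux_def shape_def
        zip_concat_row_syms row_alphas_props(2) [OF order_refl] inner_word_def)
  obtain u where u: "u \<in> fcar (proper_syms n)"
    "scalar (1 / (\<Prod>l\<leftarrow>lam. fact l)) * virtual_sum n (inner_word lam) (row_syms lam (row_alphas lam)) - u \<in> JI (syms m0 m1 n)"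
    "finsum (Ugl n) (\<lambda>T. devirt_mon m0 m1 n (?W T)) (row_strict_tableaux n lam) = cls (proper_syms n) u"
    by (rule strict_tableaux_representative [OF assms(2) inner_word(1,3) [OF assms] W])
  show ?thesis
  proof
    show "scalar ?h * u \<in> fcar (proper_syms n)" using u(1) by (intro fcar_mult) simp_all
    show "scalar (?h * (1 / (\<Prod>l\<leftarrow>lam. fact l))) * virtual_sum n (inner_word lam) (row_syms lam (row_alphas lam))
      - scalar ?h * u \<in> JI (syms m0 m1 n)"
      using LG_lmult [OF u(2) fcar_scalar [of ?h]] by (simp only: right_diff_distrib mult.assoc flip: scalar_mult)
    show "S_elem m0 m1 n lam = cls (proper_syms n) (scalar ?h * u)"
      unfolding S_elem_def u(3) using u(1) by (simp add: smult_gl_def UE_simps)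
  qed
qed

lemma virtual_sum_decomposition:
  assumes "renaming \<sigma>"
    and "set vs \<subseteq> syms m0 m1 n \<inter> Collect virtual"
    and "set X \<subseteq> syms m0 m1 n \<times> syms m0 m1 n" "\<forall>l\<in>set X. virtual (fst l) \<and> virtual (snd l)" "balanced X"
    and "set (map \<sigma> vs) \<subseteq> syms m0' m1' (n + 1) \<inter> Collect virtual"
    and "set (map (map_prod \<sigma> \<sigma>) X) \<subseteq> syms m0' m1' (n + 1) \<times> syms m0' m1' (n + 1)"
      "\<forall>l\<in>set (map (map_prod \<sigma> \<sigma>) X). virtual (fst l) \<and> virtual (snd l)" "balanced (map (map_prod \<sigma> \<sigma>) X)"
    and "u \<in> fcar (proper_syms n)" "scalar c * virtual_sum n X vs - u \<in> JI (syms m0 m1 n)"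
    and "u' \<in> fcar (proper_syms (n + 1))"
      "scalar c * virtual_sum (n + 1) (map (map_prod \<sigma> \<sigma>) X) (map \<sigma> vs) - u' \<in> JI (syms m0' m1' (n + 1))"
    and x: "x = cls (proper_syms n) u" "x' = cls (proper_syms (n + 1)) u'"
  shows "olshanski n x' x (gl_diff n x' x) \<and> capelli_proj n x' = x"
proof -
  have "olsh n u' u" "central (n + 1) u'" using virtual_sum_olsh [OF assms(1-13)] .
  then show ?thesis unfolding x using olshanski_cls capelli_proj_olsh by blast
qed

lemma map_id_simps: "map id xs = xs" "map (map_prod id id) ys = ys"
  by (simp_all add: map_prod.id)

lemma renaming_id: "renaming id"
  by (simp add: renaming_def)

lemmas virtual_sum_decomposition_id =
  virtual_sum_decomposition [OF renaming_id, unfolded map_id_simps]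

lemma row_syms_subset: "set (row_syms lam vs) \<subseteq> set vs"
  by (auto simp: row_syms_def dest: set_zip_rightD)

text \<open>The elements for n and for n+1 may use different numbers of virtual symbols and
  different symbols \<beta>. The symbols in \<open>K_elem\<close>, \<open>J_elem\<close> and
  \<open>S_elem\<close> depend on \<open>lam\<close> alone and lie in both alphabets, so the
  identity is the renaming there.\<close>

theorem proposition5p10:
  fixes n k :: nat and lam :: "nat list" and m0 m1 m0' m1' b b' :: nat
  assumes n: "n \<ge> 1" and k: "k \<ge> 1" and lam: "is_partition lam"
    and even_syms: "length lam \<le> m0" "length lam \<le> m0'"
    and odd_syms: "max (length lam) (first_part lam) \<le> m1" "max (length lam) (first_part lam) \<le> m1'"
    and beta: "b \<in> {1..m1}" "b' \<in> {1..m1'}"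
  shows
    "(olshanski n (I_elem m0' m1' b' (n + 1) k) (I_elem m0 m1 b n k)
        (gl_diff n (I_elem m0' m1' b' (n + 1) k) (I_elem m0 m1 b n k)) \<and>
      capelli_proj n (I_elem m0' m1' b' (n + 1) k) = I_elem m0 m1 b n k) \<and>
     (first_part lam \<le> n \<longrightarrow>
      olshanski n (K_elem m0' m1' (n + 1) lam) (K_elem m0 m1 n lam)
        (gl_diff n (K_elem m0' m1' (n + 1) lam) (K_elem m0 m1 n lam)) \<and>
      capelli_proj n (K_elem m0' m1' (n + 1) lam) = K_elem m0 m1 n lam) \<and>
     (olshanski n (J_elem m0' m1' (n + 1) lam) (J_elem m0 m1 n lam)
        (gl_diff n (J_elem m0' m1' (n + 1) lam) (J_elem m0 m1 n lam)) \<and>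
      capelli_proj n (J_elem m0' m1' (n + 1) lam) = J_elem m0 m1 n lam) \<and>
     (first_part lam \<le> n \<longrightarrow>
      olshanski n (S_elem m0' m1' (n + 1) lam) (S_elem m0 m1 n lam)
        (gl_diff n (S_elem m0' m1' (n + 1) lam) (S_elem m0 m1 n lam)) \<and>
      capelli_proj n (S_elem m0' m1' (n + 1) lam) = S_elem m0 m1 n lam)"
proof -
  have odd: "length lam \<le> m1" "first_part lam \<le> m1" "length lam \<le> m1'" "first_part lam \<le> m1'"
    using odd_syms by simp_all
  have alphas: "set (row_syms lam (row_alphas lam)) \<subseteq> syms m0 m1 n \<inter> Collect virtual"
    "set (row_syms lam (row_alphas lam)) \<subseteq> syms m0' m1' (n + 1) \<inter> Collect virtual"
    using row_syms_subset row_alphas_props(1) [OF even_syms(1)] row_alphas_props(1) [OF even_syms(2)]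
    by (blast intro: subset_trans)+
  have betas: "set (row_syms lam (row_betas lam)) \<subseteq> syms m0 m1 n \<inter> Collect virtual"
    "set (row_syms lam (row_betas lam)) \<subseteq> syms m0' m1' (n + 1) \<inter> Collect virtual"
    using row_syms_subset row_betas_props(1) [OF odd(1)] row_betas_props(1) [OF odd(3)]
    by (blast intro: subset_trans)+
  have nil: "set [] \<subseteq> A \<times> A" "\<forall>l\<in>set []. virtual (fst l) \<and> virtual (snd l)" "balanced []" for A :: "gsym set"
    by (simp_all add: balanced_def)
  have I: "olshanski n (I_elem m0' m1' b' (n + 1) k) (I_elem m0 m1 b n k)
        (gl_diff n (I_elem m0' m1' b' (n + 1) k) (I_elem m0 m1 b n k)) \<and>
      capelli_proj n (I_elem m0' m1' b' (n + 1) k) = I_elem m0 m1 b n k"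
  proof -
    \<comment> \<open>Exchanging the two odd symbols is injective and parity preserving, and carries
      the words built with \<open>b\<close> to those built with \<open>b'\<close>.\<close>
    let ?\<sigma> = "Transposition.transpose (Beta b) (Beta b')"
    have r: "renaming ?\<sigma>"
      by (auto simp: renaming_def Transposition.transpose_def intro: inj_transpose)
    have \<sigma>: "map ?\<sigma> (replicate k (Beta b)) = replicate k (Beta b')" "map (map_prod ?\<sigma> ?\<sigma>) [] = []" by simp_all
    have v: "set (replicate k (Beta b)) \<subseteq> syms m0 m1 n \<inter> Collect virtual"
      "set (replicate k (Beta b')) \<subseteq> syms m0' m1' (n + 1) \<inter> Collect virtual"
      using beta by (auto simp: syms_def)
    obtain u where u: "u \<in> fcar (proper_syms n)"
      "scalar (1 / fact k) * virtual_sum n [] (replicate k (Beta b)) - u \<in> JI (syms m0 m1 n)"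
      "I_elem m0 m1 b n k = cls (proper_syms n) u"
      by (rule I_elem_representative [OF beta(1)])
    obtain u' where u': "u' \<in> fcar (proper_syms (n + 1))"
      "scalar (1 / fact k) * virtual_sum (n + 1) [] (replicate k (Beta b')) - u' \<in> JI (syms m0' m1' (n + 1))"
      "I_elem m0' m1' b' (n + 1) k = cls (proper_syms (n + 1)) u'"
      by (rule I_elem_representative [OF beta(2)])
    show ?thesis
      by (rule virtual_sum_decomposition [OF r v(1) nil, unfolded \<sigma>, OF v(2) nil u(1,2) u'(1,2) u(3) u'(3)])
  qed
  have K: "olshanski n (K_elem m0' m1' (n + 1) lam) (K_elem m0 m1 n lam)
        (gl_diff n (K_elem m0' m1' (n + 1) lam) (K_elem m0 m1 n lam)) \<and>
      capelli_proj n (K_elem m0' m1' (n + 1) lam) = K_elem m0 m1 n lam"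
    by (rule K_elem_representative [OF even_syms(1)], rule K_elem_representative [OF even_syms(2)],
        rule virtual_sum_decomposition_id [OF alphas(1) nil alphas(2) nil])
  have J: "olshanski n (J_elem m0' m1' (n + 1) lam) (J_elem m0 m1 n lam)
        (gl_diff n (J_elem m0' m1' (n + 1) lam) (J_elem m0 m1 n lam)) \<and>
      capelli_proj n (J_elem m0' m1' (n + 1) lam) = J_elem m0 m1 n lam"
    by (rule J_elem_representative [OF lam odd(1)], rule J_elem_representative [OF lam odd(3)],
        rule virtual_sum_decomposition_id [OF betas(1) nil betas(2) nil])
  have S: "olshanski n (S_elem m0' m1' (n + 1) lam) (S_elem m0 m1 n lam)
        (gl_diff n (S_elem m0' m1' (n + 1) lam) (S_elem m0 m1 n lam)) \<and>
      capelli_proj n (S_elem m0' m1' (n + 1) lam) = S_elem m0 m1 n lam"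
    by (rule S_elem_representative [OF lam even_syms(1) odd(2)], rule S_elem_representative [OF lam even_syms(2) odd(4)],
        rule virtual_sum_decomposition_id [OF alphas(1) inner_word [OF lam even_syms(1) odd(2)]
          alphas(2) inner_word [OF lam even_syms(2) odd(4)]])
  from I K J S show ?thesis by blast
qed

end
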